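(* Let $X$ be a log-correlated field on the domain $U\subset\mathbb{R}^d$ and, for $0<\beta<\sqrt d$, let $\mu_\beta$ be the associated imaginary multiplicative chaos with parameter $\beta$ (see context). Fix $f\in C_c^\infty(U)$. As $\beta\nearrow\sqrt d$, $$\sqrt{\frac{d-\beta^2}{|S^{d-1}|}}\;\mu_\beta(f)\to\int_Uf(x)e^{\frac d2g(x,x)}\,W(dx)$$ in law, where $W$ is the standard complex white noise on $U$ and $|S^{d-1}|$ denotes the surface area of the unit sphere of $\mathbb{R}^d$.
   Context: Setting: $d\ge1$, $U\subset\mathbb{R}^d$ is a bounded simply connected domain, and $C_X(x,y)=\log|x-y|^{-1}+g(x,y)$ for $x,y\in U$, where $g:U\times U\to\mathbb{R}$ belongs to $L^1(U\times U)\cap C(U\times U)$ and is bounded from above. $C_X$ is extended by $0$ outside $U\times U$ and is assumed to be a covariance kernel: symmetric and $\int\int C_X(x,y)f(x)\overline{f(y)}\,dx\,dy\ge0$ for all $f\in C_c^\infty(\mathbb{R}^d)$. The log-correlated field $X$ with covariance $C_X$ is the centered Gaussian random generalized function with $\mathbb{E}X(f)X(h)=\int\int C_X(x,y)f(x)h(y)\,dx\,dy$ for real test functions $f,h$, realized as a random element of the Sobolev space $H^{-\varepsilon}(\mathbb{R}^d)$ for every $\varepsilon>0$. Imaginary chaos: let $\eta\in C_c^\infty(\mathbb{R}^d)$ be non-negative, radially symmetric, with $\int\eta=1$ and support in $B(0,1)$; put $\eta_\varepsilon=\varepsilon^{-d}\eta(\cdot/\varepsilon)$ and $X_\varepsilon=(X*\eta_\varepsilon)\mathbf{1}_U$.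 For $0<\beta<\sqrt d$, $\mu_\beta$ is the limit in probability in the Sobolev space $H^s(\mathbb{R}^d)$, for any $s<-d/2$, along any sequence $\delta_n\searrow0$, of $\mu_n(x)=\exp\big(i\beta X_{\delta_n}(x)+\frac{\beta^2}2\mathbb{E}[X_{\delta_n}(x)^2]\big)\mathbf{1}_U(x)$; the limit exists and does not depend on $\eta$ or on the sequence. $\mu_\beta(f)$ denotes the (bilinear) pairing with $f$, i.e. the limit of $\int\mu_n(x)f(x)\,dx$. White noise: $Z_h:=\int_Uh(x)W(dx)$ denotes a centered complex Gaussian random variable with $\mathbb{E}Z_h^2=0$ and $\mathbb{E}|Z_h|^2=\int_U|h(x)|^2dx$. *)

theory Defs
  imports "HOL-Probability.Probability"
begin

section \<open>Test functions and Schwartz functions\<close>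

fun iter_partial :: "'a::euclidean_space list \<Rightarrow> ('a \<Rightarrow> 'b::real_normed_vector) \<Rightarrow> 'a \<Rightarrow> 'b" where
  "iter_partial [] f = f"
| "iter_partial (b # bs) f = (\<lambda>x. frechet_derivative (iter_partial bs f) (at x) b)"

definition smooth :: "('a::euclidean_space \<Rightarrow> 'b::real_normed_vector) \<Rightarrow> bool" where
  "smooth f \<longleftrightarrow> (\<forall>bs x. set bs \<subseteq> Basis \<longrightarrow> iter_partial bs f differentiable (at x))"

definition support :: "('a::euclidean_space \<Rightarrow> 'b::real_normed_vector) \<Rightarrow> 'a set" where
  "support f = closure {x. f x \<noteq> 0}"

definition test_function ::
  "'a::euclidean_space set \<Rightarrow> ('a \<Rightarrow> 'b::real_normed_vector) \<Rightarrow> bool" where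
  "test_function U f \<longleftrightarrow> smooth f \<and> compact (support f) \<and> support f \<subseteq> U"

definition schwartz :: "('a::euclidean_space \<Rightarrow> complex) \<Rightarrow> bool" where
  "schwartz f \<longleftrightarrow> smooth f \<and>
     (\<forall>bs N. set bs \<subseteq> Basis \<longrightarrow>
        bounded (range (\<lambda>x. (1 + norm x) ^ N *\<^sub>R iter_partial bs f x)))"

definition schwartz_norm :: "nat \<Rightarrow> ('a::euclidean_space \<Rightarrow> complex) \<Rightarrow> real" where
  "schwartz_norm N f =
     (\<Sum>bs | set bs \<subseteq> Basis \<and> length bs \<le> N.
        SUP x. (1 + norm x) ^ N * cmod (iter_partial bs f x))"

section \<open>Sobolev spaces of tempered distributions\<close>

text \<open>A distribution is a functional on complex test functions; its values outside the
  Schwartz space are irrelevant, so the Sobolev norm below is a seminorm on this type.\<close>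

type_synonym 'a distr = "('a \<Rightarrow> complex) \<Rightarrow> complex"

definition tempered :: "'a::euclidean_space distr \<Rightarrow> bool" where
  "tempered u \<longleftrightarrow>
     (\<forall>p q a b. schwartz p \<longrightarrow> schwartz q \<longrightarrow>
        u (\<lambda>x. a * p x + b * q x) = a * u p + b * u q) \<and>
     (\<exists>N K. \<forall>p. schwartz p \<longrightarrow> cmod (u p) \<le> K * schwartz_norm N p)"

definition distr_diff :: "'a distr \<Rightarrow> 'a distr \<Rightarrow> 'a distr" where
  "distr_diff u v = (\<lambda>p. u p - v p)"

definition distr_of_fun :: "('a::euclidean_space \<Rightarrow> complex) \<Rightarrow> 'a distr" where
  "distr_of_fun h = (\<lambda>p. \<integral>x. h x * p x \<partial>lborel)"

definition fourier :: "('a::euclidean_space \<Rightarrow> complex) \<Rightarrow> 'a \<Rightarrow> complex" where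
  "fourier p \<xi> = (\<integral>x. exp (- 2 * pi * \<i> * of_real (x \<bullet> \<xi>)) * p x \<partial>lborel)"

text \<open>\<open>sobolev_transform s u h\<close>: the Fourier transform of the tempered distribution \<open>u\<close>,
  defined by duality, is the function \<open>h\<close>, and \<open>h\<close> has finite weighted \<open>L\<^sup>2\<close> norm.\<close>

definition sobolev_transform ::
  "real \<Rightarrow> 'a::euclidean_space distr \<Rightarrow> ('a \<Rightarrow> complex) \<Rightarrow> bool" where
  "sobolev_transform s u h \<longleftrightarrow>
     h \<in> borel_measurable lborel \<and>
     integrable lborel (\<lambda>\<xi>. (1 + (norm \<xi>)\<^sup>2) powr s * (cmod (h \<xi>))\<^sup>2) \<and>
     (\<forall>p. schwartz p \<longrightarrow> u (fourier p) = (\<integral>\<xi>. h \<xi> * p \<xi> \<partial>lborel))"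

definition sobolev :: "real \<Rightarrow> 'a::euclidean_space distr set" where
  "sobolev s = {u. tempered u \<and> (\<exists>h. sobolev_transform s u h)}"

text \<open>The chosen transform is unique up to a Lebesgue null set.\<close>

definition sobolev_norm :: "real \<Rightarrow> 'a::euclidean_space distr \<Rightarrow> real" where
  "sobolev_norm s u = (let h = (SOME h. sobolev_transform s u h) in
     sqrt (\<integral>\<xi>. (1 + (norm \<xi>)\<^sup>2) powr s * (cmod (h \<xi>))\<^sup>2 \<partial>lborel))"

definition sobolev_borel :: "real \<Rightarrow> 'a::euclidean_space distr measure" where
  "sobolev_borel s = sigma (sobolev s)
     {V. V \<subseteq> sobolev s \<and>
         (\<forall>u\<in>V. \<exists>r>0. \<forall>v\<in>sobolev s. sobolev_norm s (distr_diff v u) < r \<longrightarrow> v \<in> V)}"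

text \<open>The measurability of the norm of the difference is automatic for random elements of
  the separable space \<open>sobolev s\<close>; it is recorded so that the probabilities are meaningful.\<close>

definition sobolev_conv_in_prob ::
  "'w measure \<Rightarrow> real \<Rightarrow> (nat \<Rightarrow> 'w \<Rightarrow> 'a::euclidean_space distr) \<Rightarrow> ('w \<Rightarrow> 'a distr) \<Rightarrow> bool" where
  "sobolev_conv_in_prob M s u v \<longleftrightarrow>
     (\<forall>n. u n \<in> measurable M (sobolev_borel s)) \<and>
     v \<in> measurable M (sobolev_borel s) \<and>
     (\<forall>n. (\<lambda>\<omega>. sobolev_norm s (distr_diff (u n \<omega>) (v \<omega>))) \<in> borel_measurable M) \<and>
     (\<forall>e>0. (\<lambda>n. measure M {\<omega>\<in>space M. sobolev_norm s (distr_diff (u n \<omega>) (v \<omega>)) > e})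
               \<longlonglongrightarrow> 0)"

section \<open>Log-correlated fields\<close>

text \<open>Since \<open>ln 0 = 0\<close>, the diagonal carries an arbitrary value; it is Lebesgue null.\<close>

definition log_kernel ::
  "'a::euclidean_space set \<Rightarrow> ('a \<Rightarrow> 'a \<Rightarrow> real) \<Rightarrow> 'a \<Rightarrow> 'a \<Rightarrow> real" where
  "log_kernel U g x y =
     (if x \<in> U \<and> y \<in> U then ln (inverse (norm (x - y))) + g x y else 0)"

definition covariance_kernel :: "('a::euclidean_space \<Rightarrow> 'a \<Rightarrow> real) \<Rightarrow> bool" where
  "covariance_kernel C \<longleftrightarrow>
     (\<forall>x y. C x y = C y x) \<and>
     (\<forall>f::'a \<Rightarrow> complex. test_function UNIV f \<longrightarrow>
        (\<integral>x. (\<integral>y. of_real (C x y) * f x * cnj (f y) \<partial>lborel) \<partial>lborel) \<in> \<real>\<^sub>\<ge>\<^sub>0)"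

text \<open>Constant \<open>0\<close> counts as a (degenerate) Gaussian variable.\<close>

definition centered_gaussian :: "'w measure \<Rightarrow> ('w \<Rightarrow> real) \<Rightarrow> bool" where
  "centered_gaussian M Y \<longleftrightarrow> Y \<in> borel_measurable M \<and>
     ((\<exists>\<sigma>>0. distributed M lborel Y (normal_density 0 \<sigma>)) \<or> (AE \<omega> in M. Y \<omega> = 0))"

text \<open>Joint Gaussianity of the values of the field follows from its linearity.\<close>

definition log_correlated_field ::
  "'w measure \<Rightarrow> ('a::euclidean_space \<Rightarrow> 'a \<Rightarrow> real) \<Rightarrow> ('w \<Rightarrow> 'a distr) \<Rightarrow> bool" where
  "log_correlated_field M C X \<longleftrightarrow>
     (\<forall>\<epsilon>>0. X \<in> measurable M (sobolev_borel (- \<epsilon>))) \<and>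
     (\<forall>f::'a \<Rightarrow> real. test_function UNIV f \<longrightarrow>
        (\<forall>\<omega>\<in>space M. X \<omega> (\<lambda>x. of_real (f x)) \<in> \<real>) \<and>
        centered_gaussian M (\<lambda>\<omega>. Re (X \<omega> (\<lambda>x. of_real (f x))))) \<and>
     (\<forall>f h::'a \<Rightarrow> real. test_function UNIV f \<longrightarrow> test_function UNIV h \<longrightarrow>
        (\<integral>\<omega>. X \<omega> (\<lambda>x. of_real (f x)) * X \<omega> (\<lambda>x. of_real (h x)) \<partial>M) =
        of_real (\<integral>x. (\<integral>y. C x y * f x * h y \<partial>lborel) \<partial>lborel))"

section \<open>Imaginary multiplicative chaos\<close>

definition mollifier :: "('a::euclidean_space \<Rightarrow> real) \<Rightarrow> bool" where
  "mollifier \<eta> \<longleftrightarrow> test_function UNIV \<eta> \<and> (\<forall>x. \<eta> x \<ge> 0) \<and>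
     (\<forall>x y. norm x = norm y \<longrightarrow> \<eta> x = \<eta> y) \<and>
     (\<integral>x. \<eta> x \<partial>lborel) = 1 \<and> support \<eta> \<subseteq> ball 0 1"

definition rescale :: "('a::euclidean_space \<Rightarrow> real) \<Rightarrow> real \<Rightarrow> 'a \<Rightarrow> real" where
  "rescale \<eta> \<epsilon> x = \<eta> (x /\<^sub>R \<epsilon>) / \<epsilon> ^ DIM('a)"

definition mollified_field ::
  "'a::euclidean_space set \<Rightarrow> ('w \<Rightarrow> 'a distr) \<Rightarrow> ('a \<Rightarrow> real) \<Rightarrow> real \<Rightarrow> 'w \<Rightarrow> 'a \<Rightarrow> complex" where
  "mollified_field U X \<eta> \<epsilon> \<omega> x =
     X \<omega> (\<lambda>y. of_real (rescale \<eta> \<epsilon> (x - y))) * indicator U x"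

definition approx_chaos ::
  "'w measure \<Rightarrow> 'a::euclidean_space set \<Rightarrow> ('w \<Rightarrow> 'a distr) \<Rightarrow> ('a \<Rightarrow> real) \<Rightarrow> real \<Rightarrow> real \<Rightarrow>
     'w \<Rightarrow> 'a \<Rightarrow> complex" where
  "approx_chaos M U X \<eta> \<beta> \<epsilon> \<omega> x =
     exp (\<i> * of_real \<beta> * mollified_field U X \<eta> \<epsilon> \<omega> x +
          of_real (\<beta>\<^sup>2 / 2) * (\<integral>w. (mollified_field U X \<eta> \<epsilon> w x)\<^sup>2 \<partial>M)) * indicator U x"

definition imaginary_chaos ::
  "'w measure \<Rightarrow> 'a::euclidean_space set \<Rightarrow> ('w \<Rightarrow> 'a distr) \<Rightarrow> ('a \<Rightarrow> real) \<Rightarrow> real \<Rightarrow>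
     ('w \<Rightarrow> 'a distr) \<Rightarrow> bool" where
  "imaginary_chaos M U X \<eta> \<beta> \<mu> \<longleftrightarrow>
     (\<forall>s \<delta>. s < - real DIM('a) / 2 \<longrightarrow> decseq \<delta> \<longrightarrow> (\<forall>n. \<delta> n > 0) \<longrightarrow> \<delta> \<longlonglongrightarrow> 0 \<longrightarrow>
        sobolev_conv_in_prob M s
          (\<lambda>n \<omega>. distr_of_fun (approx_chaos M U X \<eta> \<beta> (\<delta> n) \<omega>)) \<mu>)"

section \<open>White noise, surface measure, convergence in law\<close>

text \<open>\<open>Z\<close> is a version of the stochastic integral of \<open>h\<close> over \<open>U\<close> against standard complex
  white noise; the first conjunct says that \<open>(Re Z, Im Z)\<close> is a centred Gaussian vector.\<close>

definition white_noise_integral ::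
  "'z measure \<Rightarrow> 'a::euclidean_space set \<Rightarrow> ('a \<Rightarrow> complex) \<Rightarrow> ('z \<Rightarrow> complex) \<Rightarrow> bool" where
  "white_noise_integral N U h Z \<longleftrightarrow>
     (\<forall>a b. centered_gaussian N (\<lambda>\<omega>. a * Re (Z \<omega>) + b * Im (Z \<omega>))) \<and>
     (\<integral>\<omega>. (Z \<omega>)\<^sup>2 \<partial>N) = 0 \<and>
     (\<integral>\<omega>. (cmod (Z \<omega>))\<^sup>2 \<partial>N) = set_lebesgue_integral lborel U (\<lambda>x. (cmod (h x))\<^sup>2)"

text \<open>Surface measure of a subset of the unit sphere, as in the polar coordinates formula:
  \<open>d\<close> times the volume of the cone over the set (for \<open>d = 1\<close> this is counting measure).\<close>

definition sphere_measure :: "'a::euclidean_space set \<Rightarrow> real" where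
  "sphere_measure A =
     real DIM('a) * measure lborel {r *\<^sub>R x | r x. 0 < r \<and> r \<le> 1 \<and> x \<in> A}"

definition converges_in_law ::
  "'i filter \<Rightarrow> 'w measure \<Rightarrow> ('i \<Rightarrow> 'w \<Rightarrow> complex) \<Rightarrow> 'z measure \<Rightarrow> ('z \<Rightarrow> complex) \<Rightarrow> bool" where
  "converges_in_law F M Y N Z \<longleftrightarrow>
     (\<forall>\<^sub>F b in F. Y b \<in> borel_measurable M) \<and> Z \<in> borel_measurable N \<and>
     (\<forall>G::complex \<Rightarrow> real. continuous_on UNIV G \<longrightarrow> bounded (range G) \<longrightarrow>
        ((\<lambda>b. \<integral>\<omega>. G (Y b \<omega>) \<partial>M) \<longlongrightarrow> (\<integral>\<omega>. G (Z \<omega>) \<partial>N)) F)"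

end

theory Submission
  imports Defs
begin

text \<open>
  The proof is by the method of moments. Write \<open>t = d - \<beta>\<^sup>2\<close>. The mollified chaos is an integral
  of vertex operators \<open>exp (i \<beta> X\<^sub>\<epsilon>(x))\<close>, normalised to have expectation one, and the expectation of a product of
  \<open>k\<close> of them and \<open>l\<close> conjugates is the Boltzmann weight of a Coulomb gas of \<open>k\<close> positive and
  \<open>l\<close> negative charges with interaction \<open>C\<^sub>\<epsilon>\<close> at inverse temperature \<open>\<beta>\<^sup>2\<close>
  (\<open>expectation_vertex_product\<close>). Hence the mixed moments of the mollified chaos paired with \<open>f\<close> are gas integrals
  (\<open>approx_moment\<close>).

  The basic estimate pairs the charges greedily: as \<open>ln |x - y|\<close> satisfies an ultrametric inequality
  up to an additive constant, matching a closest pair of opposite charges and repeating bounds the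
  Boltzmann weight, uniformly in \<open>\<epsilon>\<close>, by a sum over matchings \<open>\<sigma>\<close> of products of Riesz kernels
  \<open>|y\<^sub>j - x\<^sub>\<sigma>\<^sub>j| powr (t - d)\<close> (\<open>greedy_matching_bound\<close>, \<open>cov_log_bound\<close>). These kernels are
  integrable for \<open>t > 0\<close>, so the mollification can be removed under the integral
  (\<open>gas_tendsto\<close>), and each of the \<open>min k l\<close> pairs costs a factor of order \<open>1 / t\<close>.
  A moment with \<open>k \<noteq> l\<close> therefore vanishes after multiplication by \<open>t powr ((k + l) / 2)\<close>.

  For \<open>k = l = n\<close> the Boltzmann weight is a bounded function times a sum of \<open>n!\<close> products of Riesz kernels.
  As \<open>t \<rightarrow> 0\<close>, the measure \<open>t |y - x| powr (t - d) dy\<close> concentrates at \<open>x\<close>, with local mass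
  \<open>|S\<^sup>d\<^sup>-\<^sup>1|\<close>. A substitution makes this a dominated convergence: up to the factor
  \<open>riesz_const d t\<close>, the kernel is the image of a measure that does not depend on \<open>t\<close> under
  \<open>(s, b) \<mapsto> x + s powr (1 / t) b\<close>, where \<open>b\<close> ranges over a shell; the images collapse to \<open>x\<close> for
  \<open>s < 1\<close> and leave every bounded set for \<open>s > 1\<close> (\<open>nn_integral_riesz_polar\<close>). When all
  negative charges collapse onto their partners, the interactions between different pairs cancel and
  each pair leaves the factor \<open>exp (d g(x, x))\<close> (\<open>ratio_tendsto\<close>). The scaled moment thus tends to
  \<open>n! v\<^sup>n\<close> with \<open>v = \<integral> |f(x)|\<^sup>2 exp (d g(x, x)) dx\<close>, the moment of a circular complex Gaussian variable
  of variance \<open>v\<close> (\<open>scaled_gas_limit\<close>).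

  To pass from moments to laws, \<open>\<mu>\<^sub>\<beta>(f)\<close> is approximated by the pairing of a mollified chaos: convergence in the Sobolev
  norm forces convergence of the pairings with \<open>f\<close> (\<open>sobolev_norm_controls_pairing\<close>), and a
  diagonal choice of mollification parameters keeps the limits of all moments. Taylor
  expansion turns moments into characteristic functions, and Gaussian smoothing, which writes the
  expectation of a smoothed compactly supported function as an average of characteristic functions, turns these
  together with tightness into weak convergence (\<open>char_tight_imp_weak_convergence\<close>).
\<close>

section \<open>Smooth functions and test functions\<close>

lemma nn_integral_affine:
  fixes f :: "'a::euclidean_space \<Rightarrow> ennreal"
  assumes [measurable]: "f \<in> borel_measurable borel" and "c \<noteq> 0"
  shows "(\<integral>\<^sup>+x. f x \<partial>lborel) = ennreal (\<bar>c\<bar> ^ DIM('a)) * (\<integral>\<^sup>+x. f (t + c *\<^sub>R x) \<partial>lborel)"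
  by (subst lborel_affine[OF \<open>c \<noteq> 0\<close>, of t])
     (simp add: nn_integral_density nn_integral_distr nn_integral_cmult)

lemma integral_affine:
  fixes f :: "'a::euclidean_space \<Rightarrow> 'b::{banach, second_countable_topology}"
  assumes [measurable]: "f \<in> borel_measurable borel" and "c \<noteq> 0"
  shows "(\<integral>x. f x \<partial>lborel) = \<bar>c\<bar> ^ DIM('a) *\<^sub>R (\<integral>x. f (t + c *\<^sub>R x) \<partial>lborel)"
  by (subst lborel_affine[OF \<open>c \<noteq> 0\<close>, of t])
     (simp add: integral_density integral_distr)

lemma integrable_affine:
  fixes f :: "'a::euclidean_space \<Rightarrow> 'b::{banach, second_countable_topology}"
  assumes f: "integrable lborel f" and "c \<noteq> 0"
  shows "integrable lborel (\<lambda>x. f (t + c *\<^sub>R x))"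
proof -
  have [measurable]: "f \<in> borel_measurable borel" using f by simp
  have "(\<integral>\<^sup>+x. ennreal (norm (f x)) \<partial>lborel) < \<infinity>"
    using f by (simp add: integrable_iff_bounded)
  then show ?thesis
    using \<open>c \<noteq> 0\<close>
    by (subst (asm) nn_integral_affine[OF _ \<open>c \<noteq> 0\<close>, of _ t])
       (auto simp: integrable_iff_bounded ennreal_mult_less_top)
qed

lemma iter_partial_invariant:
  assumes "f \<in> S" "set bs \<subseteq> Basis"
    and "\<And>h b. h \<in> S \<Longrightarrow> b \<in> Basis \<Longrightarrow> (\<lambda>x. frechet_derivative h (at x) b) \<in> S"
  shows "iter_partial bs f \<in> S"
  using assms(2) by (induction bs) (auto simp: assms(1,3))

text \<open>Smoothness by coinduction: every iterated partial derivative of \<open>f\<close> stays in a class of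
  differentiable functions that is closed under partial derivatives. The closure properties of
  smooth functions below exhibit such a class.\<close>

lemma smooth_coinduct:
  assumes "f \<in> S" and diff: "\<And>h x. h \<in> S \<Longrightarrow> h differentiable (at x)"
    and closed: "\<And>h b. h \<in> S \<Longrightarrow> b \<in> Basis \<Longrightarrow> (\<lambda>x. frechet_derivative h (at x) b) \<in> S"
  shows "smooth f"
  unfolding smooth_def using iter_partial_invariant[OF \<open>f \<in> S\<close> _ closed] diff by blast

lemma smooth_differentiable: "smooth f \<Longrightarrow> f differentiable (at x)"
  unfolding smooth_def by (metis empty_subsetI iter_partial.simps(1) list.set(1))

lemma smooth_has_derivative: "smooth f \<Longrightarrow> (f has_derivative frechet_derivative f (at x)) (at x)"
  using smooth_differentiable frechet_derivative_works by blast

lemma iter_partial_append: "iter_partial (as @ bs) f = iter_partial as (iter_partial bs f)"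
  by (induction as) auto

lemma smooth_iter_partial: "smooth f \<Longrightarrow> set bs \<subseteq> Basis \<Longrightarrow> smooth (iter_partial bs f)"
  unfolding smooth_def by (metis Un_least iter_partial_append set_append)

lemma smooth_partial:
  "smooth f \<Longrightarrow> b \<in> Basis \<Longrightarrow> smooth (\<lambda>x. frechet_derivative f (at x) b)"
  using smooth_iter_partial[of f "[b]"] by simp

lemma smooth_continuous: "smooth f \<Longrightarrow> continuous_on S f"
  by (meson continuous_at_imp_continuous_on differentiable_imp_continuous_within smooth_differentiable)

lemma smooth_borel: "smooth f \<Longrightarrow> f \<in> borel_measurable borel"
  by (simp add: borel_measurable_continuous_onI smooth_continuous)

lemma smooth_bounded_linear:
  fixes h :: "'a::euclidean_space \<Rightarrow> 'b::real_normed_vector" and L :: "'b \<Rightarrow> 'c::real_normed_vector"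
  assumes L: "bounded_linear L" and "smooth h"
  shows "smooth (\<lambda>x. L (h x))"
proof (rule smooth_coinduct[where S="{\<lambda>x. L (h x) |h. smooth h}"])
  fix k :: "'a \<Rightarrow> 'c" and x assume "k \<in> {\<lambda>x. L (h x) |h. smooth h}"
  then obtain h where k: "k = (\<lambda>x. L (h x))" and h: "smooth h" by auto
  have der: "(k has_derivative (\<lambda>v. L (frechet_derivative h (at x) v))) (at x)" for x
    unfolding k by (rule bounded_linear.has_derivative[OF L smooth_has_derivative[OF h]])
  show "k differentiable (at x)" using der differentiable_def by blast
  fix b :: 'a assume b: "b \<in> Basis"
  have "(\<lambda>x. frechet_derivative k (at x) b) = (\<lambda>x. L (frechet_derivative h (at x) b))"
    by (simp add: fun_eq_iff frechet_derivative_at[OF der, symmetric])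
  then show "(\<lambda>x. frechet_derivative k (at x) b) \<in> {\<lambda>x. L (h x) |h. smooth h}"
    using smooth_partial[OF h b]
    by (intro CollectI exI[of _ "\<lambda>x. frechet_derivative h (at x) b"]) simp
qed (use assms in auto)

lemma smooth_add:
  fixes f g :: "'a::euclidean_space \<Rightarrow> 'b::real_normed_vector"
  assumes "smooth f" "smooth g"
  shows "smooth (\<lambda>x. f x + g x)"
proof (rule smooth_coinduct[where S="{\<lambda>x. f x + g x |f g. smooth f \<and> smooth g}"])
  fix k :: "'a \<Rightarrow> 'b" and x assume "k \<in> {\<lambda>x. f x + g x |f g. smooth f \<and> smooth g}"
  then obtain f g where k: "k = (\<lambda>x. f x + g x)" and h: "smooth f" "smooth g" by auto
  have der: "(k has_derivative (\<lambda>v. frechet_derivative f (at x) v + frechet_derivative g (at x) v)) (at x)" for x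
    unfolding k by (intro has_derivative_add smooth_has_derivative h)
  show "k differentiable (at x)" using der differentiable_def by blast
  fix b :: 'a assume b: "b \<in> Basis"
  have "(\<lambda>x. frechet_derivative k (at x) b) = (\<lambda>x. frechet_derivative f (at x) b + frechet_derivative g (at x) b)"
    by (simp add: fun_eq_iff frechet_derivative_at[OF der, symmetric])
  then show "(\<lambda>x. frechet_derivative k (at x) b) \<in> {\<lambda>x. f x + g x |f g. smooth f \<and> smooth g}"
    using smooth_partial[OF h(1) b] smooth_partial[OF h(2) b]
    by (intro CollectI exI[of _ "\<lambda>x. frechet_derivative f (at x) b"]
        exI[of _ "\<lambda>x. frechet_derivative g (at x) b"]) simp
qed (use assms in auto)

lemma smooth_affine:
  fixes h :: "'a::euclidean_space \<Rightarrow> 'b::real_normed_vector"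
  assumes "smooth h"
  shows "smooth (\<lambda>x. h (a + r *\<^sub>R x))"
proof (rule smooth_coinduct[where S="{\<lambda>x. c *\<^sub>R h (a + r *\<^sub>R x) |c h. smooth h}"])
  show "(\<lambda>x. h (a + r *\<^sub>R x)) \<in> {\<lambda>x. c *\<^sub>R h (a + r *\<^sub>R x) |c h. smooth h}"
    using assms by (intro CollectI exI[of _ "1::real"] exI[of _ h]) simp
next
  fix k :: "'a \<Rightarrow> 'b" and x assume "k \<in> {\<lambda>x. c *\<^sub>R h (a + r *\<^sub>R x) |c h. smooth h}"
  then obtain c h where k: "k = (\<lambda>x. c *\<^sub>R h (a + r *\<^sub>R x))" and h: "smooth h" by auto
  let ?D = "\<lambda>x. frechet_derivative h (at (a + r *\<^sub>R x))"
  have der: "(k has_derivative (\<lambda>v. c *\<^sub>R ?D x (r *\<^sub>R v))) (at x)" for x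
    unfolding k
    by (intro has_derivative_scaleR_right has_derivative_compose[OF _ smooth_has_derivative[OF h]])
       (auto intro!: derivative_eq_intros)
  show "k differentiable (at x)" using der differentiable_def by blast
  fix b :: 'a assume b: "b \<in> Basis"
  have lin: "?D x (r *\<^sub>R b) = r *\<^sub>R ?D x b" for x
    using smooth_has_derivative[OF h, of "a + r *\<^sub>R x"] linear_cmul has_derivative_linear by blast
  have "(\<lambda>x. frechet_derivative k (at x) b) = (\<lambda>x. (c * r) *\<^sub>R ?D x b)"
    by (simp add: fun_eq_iff frechet_derivative_at[OF der, symmetric] lin)
  then show "(\<lambda>x. frechet_derivative k (at x) b) \<in> {\<lambda>x. c *\<^sub>R h (a + r *\<^sub>R x) |c h. smooth h}"
    using smooth_partial[OF h b]
    by (intro CollectI exI[of _ "c * r"] exI[of _ "\<lambda>x. frechet_derivative h (at x) b"]) simp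
qed

lemma smooth_zero: "smooth (\<lambda>x. 0)"
  by (rule smooth_coinduct[where S="{\<lambda>x. 0}"])
     (auto simp: frechet_derivative_const)

lemma coordinate_multiple_has_derivative:
  assumes a: "smooth a"
  shows "((\<lambda>x. (x \<bullet> c) *\<^sub>R a x) has_derivative
           (\<lambda>v. (x \<bullet> c) *\<^sub>R frechet_derivative a (at x) v + (v \<bullet> c) *\<^sub>R a x)) (at x)"
  by (rule has_derivative_scaleR) (auto intro!: derivative_eq_intros smooth_has_derivative[OF a])

lemma smooth_coordinate_multiple:
  fixes a :: "'a::euclidean_space \<Rightarrow> 'b::real_normed_vector"
  assumes "smooth a"
  shows "smooth (\<lambda>x. (x \<bullet> c) *\<^sub>R a x)"
proof (rule smooth_coinduct[where S="{\<lambda>x. (x \<bullet> c) *\<^sub>R a x + e x |a e. smooth a \<and> smooth e}"])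
  show "(\<lambda>x. (x \<bullet> c) *\<^sub>R a x) \<in> {\<lambda>x. (x \<bullet> c) *\<^sub>R a x + e x |a e. smooth a \<and> smooth e}"
    using assms by (intro CollectI exI[of _ a] exI[of _ "\<lambda>x. 0"]) (simp add: smooth_zero)
next
  fix k :: "'a \<Rightarrow> 'b" and x assume "k \<in> {\<lambda>x. (x \<bullet> c) *\<^sub>R a x + e x |a e. smooth a \<and> smooth e}"
  then obtain a e where k: "k = (\<lambda>x. (x \<bullet> c) *\<^sub>R a x + e x)" and h: "smooth a" "smooth e" by auto
  have der: "(k has_derivative (\<lambda>v. ((x \<bullet> c) *\<^sub>R frechet_derivative a (at x) v + (v \<bullet> c) *\<^sub>R a x)
      + frechet_derivative e (at x) v)) (at x)" for x
    unfolding k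
    by (intro has_derivative_add coordinate_multiple_has_derivative smooth_has_derivative h)
  show "k differentiable (at x)" using der differentiable_def by blast
  fix b :: 'a assume b: "b \<in> Basis"
  have eq: "(\<lambda>x. frechet_derivative k (at x) b) =
      (\<lambda>x. (x \<bullet> c) *\<^sub>R frechet_derivative a (at x) b + ((b \<bullet> c) *\<^sub>R a x + frechet_derivative e (at x) b))"
    by (simp add: fun_eq_iff frechet_derivative_at[OF der, symmetric] add.assoc)
  have "smooth (\<lambda>x. (b \<bullet> c) *\<^sub>R a x + frechet_derivative e (at x) b)"
    by (intro smooth_add smooth_bounded_linear[OF bounded_linear_scaleR_right] h smooth_partial b)
  then show "(\<lambda>x. frechet_derivative k (at x) b) \<in> {\<lambda>x. (x \<bullet> c) *\<^sub>R a x + e x |a e. smooth a \<and> smooth e}"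
    unfolding eq
    by (intro CollectI exI[of _ "\<lambda>x. frechet_derivative a (at x) b"]
        exI[of _ "\<lambda>x. (b \<bullet> c) *\<^sub>R a x + frechet_derivative e (at x) b"])
       (simp add: smooth_partial[OF h(1) b])
qed

lemma test_function_UNIV_iff: "test_function UNIV f \<longleftrightarrow> smooth f \<and> bounded {x. f x \<noteq> 0}"
  unfolding test_function_def support_def
  by (auto simp: compact_closure)

lemma test_function_UNIV: "test_function U f \<Longrightarrow> test_function UNIV f"
  unfolding test_function_def by auto

lemma test_functionI:
  assumes "test_function UNIV f" "smooth h" "\<And>x. f x = 0 \<Longrightarrow> h x = 0"
  shows "test_function UNIV h"
proof -
  have "{x. h x \<noteq> 0} \<subseteq> {x. f x \<noteq> 0}" using assms(3) by auto
  then show ?thesis using assms(1,2) bounded_subset unfolding test_function_UNIV_iff by blast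
qed

lemma test_smooth: "test_function U f \<Longrightarrow> smooth f"
  unfolding test_function_def by simp

lemma test_linear:
  fixes f :: "'a::euclidean_space \<Rightarrow> 'b::real_normed_vector" and L :: "'b \<Rightarrow> 'c::real_normed_vector"
  assumes "bounded_linear L" "test_function UNIV f"
  shows "test_function UNIV (\<lambda>x. L (f x))"
  using linear_0[OF bounded_linear.linear[OF assms(1)]]
  by (intro test_functionI[OF assms(2)] smooth_bounded_linear[OF assms(1)] test_smooth[OF assms(2)]) simp

lemma test_add:
  assumes "test_function UNIV f" "test_function UNIV g"
  shows "test_function UNIV (\<lambda>x. f x + g x)"
proof -
  have "bounded ({x. f x \<noteq> 0} \<union> {x. g x \<noteq> 0})"
    using assms by (simp add: test_function_UNIV_iff)
  then have "bounded {x. f x + g x \<noteq> 0}" by (rule bounded_subset) auto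
  then show ?thesis using assms by (simp add: test_function_UNIV_iff smooth_add)
qed

lemma test_zero: "test_function UNIV (\<lambda>x. 0)"
  by (simp add: test_function_UNIV_iff smooth_zero)

lemma test_sum:
  "finite I \<Longrightarrow> (\<And>i. i \<in> I \<Longrightarrow> test_function UNIV (f i)) \<Longrightarrow> test_function UNIV (\<lambda>x. \<Sum>i\<in>I. f i x)"
  by (induction I rule: finite_induct) (auto intro: test_zero test_add)

lemma test_affine:
  assumes f: "test_function UNIV f" and "r \<noteq> 0"
  shows "test_function UNIV (\<lambda>x. f (a + r *\<^sub>R x))"
proof -
  have "bounded ((\<lambda>y. (y - a) /\<^sub>R r) ` {x. f x \<noteq> 0})"
    using bounded_scaling[OF bounded_translation_minus, of "{x. f x \<noteq> 0}" "inverse r" a] f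
    unfolding test_function_UNIV_iff by (simp add: image_image)
  moreover have "{x. f (a + r *\<^sub>R x) \<noteq> 0} \<subseteq> (\<lambda>y. (y - a) /\<^sub>R r) ` {x. f x \<noteq> 0}"
  proof
    fix x assume "x \<in> {x. f (a + r *\<^sub>R x) \<noteq> 0}"
    then show "x \<in> (\<lambda>y. (y - a) /\<^sub>R r) ` {x. f x \<noteq> 0}"
      using \<open>r \<noteq> 0\<close> by (intro image_eqI[of _ _ "a + r *\<^sub>R x"]) auto
  qed
  ultimately show ?thesis
    using f unfolding test_function_UNIV_iff by (blast intro: smooth_affine bounded_subset)
qed

lemma test_coordinate_multiple:
  "test_function UNIV f \<Longrightarrow> test_function UNIV (\<lambda>x. (x \<bullet> c) *\<^sub>R f x)"
  by (rule test_functionI, assumption) (auto intro: smooth_coordinate_multiple test_smooth)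

lemma test_partial:
  assumes f: "test_function UNIV f" and b: "b \<in> Basis"
  shows "test_function UNIV (\<lambda>x. frechet_derivative f (at x) b)"
proof -
  have "frechet_derivative f (at x) b = 0" if x: "x \<notin> support f" for x
  proof -
    have op: "open (- support f)" unfolding support_def by auto
    have z: "f y = 0" if "y \<in> - support f" for y
      using that closure_subset[of "{x. f x \<noteq> 0}"] unfolding support_def by auto
    have "(f has_derivative (\<lambda>_. 0)) (at x)"
      by (rule has_derivative_transform_within_open[OF _ op, of "\<lambda>_. 0"]) (use x z in auto)
    then show ?thesis using frechet_derivative_at by metis
  qed
  then have "{x. frechet_derivative f (at x) b \<noteq> 0} \<subseteq> support f" by auto
  then show ?thesis
    using f b unfolding test_function_UNIV_iff
    by (metis bounded_closure bounded_subset smooth_partial support_def)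
qed

lemma test_bounded_above:
  assumes "test_function UNIV f"
  obtains B where "B > 0" "\<And>x. norm (f x) \<le> B"
proof -
  have "compact (support f)" using assms test_function_def by blast
  then have "bounded (f ` support f)"
    by (intro compact_imp_bounded compact_continuous_image smooth_continuous[OF test_smooth[OF assms]])
  then obtain B where B: "B > 0" "\<And>x. x \<in> support f \<Longrightarrow> norm (f x) \<le> B"
    unfolding bounded_pos by auto
  have "norm (f x) \<le> B" for x
  proof (cases "x \<in> support f")
    case False then have "f x = 0" using closure_subset[of "{x. f x \<noteq> 0}"] unfolding support_def by auto
    then show ?thesis using B(1) by simp
  qed (use B in auto)
  then show thesis using B(1) that by blast
qed

lemma test_integrable:
  fixes f :: "'a::euclidean_space \<Rightarrow> 'b::euclidean_space"
  assumes f: "test_function UNIV f"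
  shows "integrable lborel f"
proof -
  obtain B where B: "\<And>x. norm (f x) \<le> B" using test_bounded_above[OF f] by blast
  have c: "compact (support f)" using f test_function_def by blast
  have z: "f y = 0" if "y \<notin> support f" for y
    using that closure_subset[of "{x. f x \<noteq> 0}"] unfolding support_def by auto
  show ?thesis
    by (rule integrableI_bounded_set[where A="support f" and B=B])
       (use f c B z in \<open>auto simp: test_smooth smooth_borel borel_compact intro: emeasure_bounded_finite[OF compact_imp_bounded, simplified]\<close>)
qed

section \<open>Gaussian smoothing\<close>

text \<open>The standard Gaussian density on a Euclidean space, written as a product so that its integrals
  factor over the coordinates.\<close>

definition gauss :: "'a::euclidean_space \<Rightarrow> real" where
  "gauss x = (\<Prod>b\<in>Basis. std_normal_density (x \<bullet> b))"

lemma norm_square_coordinates: "(norm x)\<^sup>2 = (\<Sum>b\<in>Basis. (x \<bullet> b)\<^sup>2)"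
  unfolding power2_norm_eq_inner by (subst euclidean_inner) (simp add: power2_eq_square)

lemma gauss_eq:
  "gauss (x::'a::euclidean_space) = (1 / sqrt (2 * pi)) ^ DIM('a) * exp (- (norm x)\<^sup>2 / 2)"
proof -
  have "gauss x = (\<Prod>b\<in>(Basis::'a set). (1 / sqrt (2 * pi)) * exp (- (x \<bullet> b)\<^sup>2 / 2))"
    by (simp add: gauss_def normal_density_def)
  also have "\<dots> = (1 / sqrt (2 * pi)) ^ DIM('a) * exp (\<Sum>b\<in>(Basis::'a set). - (x \<bullet> b)\<^sup>2 / 2)"
    unfolding prod.distrib by (simp add: exp_sum)
  also have "(\<Sum>b\<in>(Basis::'a set). - (x \<bullet> b)\<^sup>2 / 2) = - (norm x)\<^sup>2 / 2"
    by (simp add: norm_square_coordinates sum_negf sum_divide_distrib)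
  finally show ?thesis .
qed

lemma gauss_nonneg: "0 \<le> gauss x"
  by (simp add: gauss_eq)

lemma gauss_borel[measurable]: "gauss \<in> borel_measurable borel"
  unfolding gauss_def[abs_def] by measurable

lemma lborel_product_of_coordinates:
  fixes \<phi> :: "'a::euclidean_space \<Rightarrow> real \<Rightarrow> 'b::{real_normed_field, banach, second_countable_topology}"
  assumes int: "\<And>b. b \<in> Basis \<Longrightarrow> integrable lborel (\<phi> b)"
  shows "integrable lborel (\<lambda>x. \<Prod>b\<in>Basis. \<phi> b (x \<bullet> b))" (is ?I)
    and "(\<integral>x. (\<Prod>b\<in>Basis. \<phi> b (x \<bullet> b)) \<partial>lborel) = (\<Prod>b\<in>Basis. \<integral>y. \<phi> b y \<partial>lborel)" (is ?E)
proof -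
  interpret product_sigma_finite "\<lambda>_::'a. lborel::real measure" ..
  have meas: "(\<lambda>x::'a. \<Prod>b\<in>Basis. \<phi> b (x \<bullet> b)) \<in> borel_measurable borel"
    by (intro borel_measurable_prod measurable_compose[OF _ borel_measurable_integrable[OF int, simplified]])
       auto
  have eq: "(\<Prod>b\<in>Basis. \<phi> b ((\<Sum>c\<in>Basis. f c *\<^sub>R c) \<bullet> b)) = (\<Prod>b\<in>Basis. \<phi> b (f b))" for f
    by (intro prod.cong) (simp_all add: inner_sum_left inner_Basis if_distrib sum.delta cong: if_cong)
  have m2: "(\<lambda>f. \<Sum>b\<in>(Basis::'a set). f b *\<^sub>R b) \<in> (\<Pi>\<^sub>M b\<in>Basis. lborel) \<rightarrow>\<^sub>M borel"
    by measurable
  show ?I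
    by (subst lborel_eq, subst integrable_distr_eq[OF m2 meas], unfold eq)
       (intro product_integrable_prod int, simp_all)
  show ?E
    by (subst lborel_eq, subst integral_distr[OF m2 meas], unfold eq)
       (intro product_integral_prod int, simp_all)
qed

lemma cis_sum: "finite I \<Longrightarrow> cis (\<Sum>i\<in>I. a i) = (\<Prod>i\<in>I. cis (a i))"
  by (induction I rule: finite_induct) (auto simp: cis_mult[symmetric])

lemma cis_borel[measurable]: "cis \<in> borel_measurable borel"
  by (intro borel_measurable_continuous_onI continuous_intros)

lemma gauss_integrable: "integrable lborel (gauss :: 'a::euclidean_space \<Rightarrow> real)"
  and gauss_integral: "(\<integral>x. gauss (x::'a) \<partial>lborel) = 1"
  using lborel_product_of_coordinates[of "\<lambda>_::'a. std_normal_density"]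
  by (simp_all add: gauss_def[abs_def])

lemma gauss_fourier:
  "(\<integral>w. cis (u \<bullet> w) * of_real (gauss w) \<partial>lborel) = of_real (exp (- (norm (u::'a::euclidean_space))\<^sup>2 / 2))"
proof -
  let ?\<phi> = "\<lambda>b y. cis ((u \<bullet> b) * y) * of_real (std_normal_density y)"
  have int: "integrable lborel (?\<phi> b)" for b
    by (rule Bochner_Integration.integrable_bound[where f=std_normal_density])
       (auto simp: norm_mult)
  have char: "(\<integral>y. ?\<phi> b y \<partial>lborel) = of_real (exp (- (u \<bullet> b)\<^sup>2 / 2))" for b
  proof -
    have "(\<integral>y. ?\<phi> b y \<partial>lborel) = char std_normal_distribution (u \<bullet> b)"
      unfolding char_def
      by (subst integral_density)
         (auto simp: cis_conv_exp scaleR_conv_of_real mult.commute intro!: Bochner_Integration.integral_cong)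
    then show ?thesis by (simp add: char_std_normal_distribution)
  qed
  have "cis (u \<bullet> w) * of_real (gauss w) = (\<Prod>b\<in>Basis. ?\<phi> b (w \<bullet> b))" for w
    by (subst euclidean_inner) (simp add: gauss_def cis_sum prod.distrib)
  then have "(\<integral>w. cis (u \<bullet> w) * of_real (gauss w) \<partial>lborel) = (\<integral>w. (\<Prod>b\<in>Basis. ?\<phi> b (w \<bullet> b)) \<partial>lborel)"
    by simp
  also have "\<dots> = (\<Prod>b\<in>Basis. of_real (exp (- (u \<bullet> b)\<^sup>2 / 2)))"
    by (subst lborel_product_of_coordinates(2)[OF int]) (simp add: char)
  also have "\<dots> = of_real (exp (\<Sum>b\<in>Basis. - (u \<bullet> b)\<^sup>2 / 2))"
    by (simp add: exp_sum)
  also have "(\<Sum>b\<in>Basis. - (u \<bullet> b)\<^sup>2 / 2) = - (norm u)\<^sup>2 / 2"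
    by (simp add: norm_square_coordinates sum_negf sum_divide_distrib)
  finally show ?thesis .
qed

text \<open>The integrand is dominated by a multiple of the Gaussian density and converges pointwise.\<close>

lemma gauss_mollification:
  fixes f :: "'a::euclidean_space \<Rightarrow> 'b::{banach, second_countable_topology}"
  assumes f: "continuous_on UNIV f" and B: "\<And>x. norm (f x) \<le> B" and h: "h \<longlonglongrightarrow> 0"
  shows "(\<lambda>n. \<integral>v. gauss v *\<^sub>R f (y + h n *\<^sub>R v) \<partial>lborel) \<longlonglongrightarrow> f y"
proof -
  have [measurable]: "f \<in> borel_measurable borel" using f by (rule borel_measurable_continuous_onI)
  have "(\<lambda>n. \<integral>v. gauss v *\<^sub>R f (y + h n *\<^sub>R v) \<partial>lborel) \<longlonglongrightarrow> (\<integral>v. gauss (v::'a) *\<^sub>R f y \<partial>lborel)"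
  proof (rule integral_dominated_convergence[where w="\<lambda>v. B * gauss v"])
    show "AE v in lborel. (\<lambda>n. gauss v *\<^sub>R f (y + h n *\<^sub>R v)) \<longlonglongrightarrow> gauss v *\<^sub>R f y"
    proof (rule AE_I2)
      fix v
      have "isCont f y" using f by (simp add: continuous_on_eq_continuous_at)
      moreover have "(\<lambda>n. y + h n *\<^sub>R v) \<longlonglongrightarrow> y" using h by (auto intro!: tendsto_eq_intros)
      ultimately have "(\<lambda>n. f (y + h n *\<^sub>R v)) \<longlonglongrightarrow> f y" by (rule isCont_tendsto_compose)
      then show "(\<lambda>n. gauss v *\<^sub>R f (y + h n *\<^sub>R v)) \<longlonglongrightarrow> gauss v *\<^sub>R f y" by (intro tendsto_intros)
    qed
    show "integrable lborel (\<lambda>v::'a. B * gauss v)" by (intro integrable_mult_right gauss_integrable)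
    show "AE v in lborel. norm (gauss v *\<^sub>R f (y + h n *\<^sub>R v)) \<le> B * gauss v" for n
      using B by (intro AE_I2) (simp add: gauss_nonneg mult.commute[of B] mult_left_mono)
  qed measurable
  then show ?thesis by (simp add: gauss_integral gauss_integrable)
qed

text \<open>The Gaussian density is a Fourier transform of itself. Inserting this after the substitution
  \<open>x = y + h v\<close> and exchanging the integrals expresses a smoothed function through the
  Fourier transform of \<open>f\<close>. Both the inversion theorem and the passage from
  characteristic functions to weak convergence rest on this formula.\<close>

lemma gauss_smoothing_fourier:
  fixes f :: "'a::euclidean_space \<Rightarrow> complex"
  assumes f: "integrable lborel f" and h: "h > 0"
  shows "(\<integral>v. gauss v *\<^sub>R f (y + h *\<^sub>R v) \<partial>lborel) =
    of_real ((1 / (sqrt (2 * pi) * h)) ^ DIM('a)) *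
    (\<integral>w. of_real (gauss w) * cis (- (y \<bullet> w) / h) * (\<integral>x. f x * cis ((x \<bullet> w) / h) \<partial>lborel) \<partial>lborel)"
proof -
  have [measurable]: "f \<in> borel_measurable borel" using f by simp
  let ?c = "(1 / sqrt (2 * pi)) ^ DIM('a)"
  define F where "F x = f x * of_real (gauss ((x - y) /\<^sub>R h))" for x
  have [measurable]: "F \<in> borel_measurable borel" unfolding F_def[abs_def] by measurable
  have 1: "(\<integral>x. F x \<partial>lborel) = h ^ DIM('a) *\<^sub>R (\<integral>v. gauss v *\<^sub>R f (y + h *\<^sub>R v) \<partial>lborel)"
    by (subst integral_affine[of F h y]) (use h in \<open>auto simp: F_def scaleR_conv_of_real mult.commute\<close>)
  have 2: "F x = of_real ?c * (\<integral>w. f x * cis (((x - y) \<bullet> w) / h) * of_real (gauss w) \<partial>lborel)" for x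
  proof -
    have "gauss ((x - y) /\<^sub>R h) = ?c * exp (- (norm ((x - y) /\<^sub>R h))\<^sup>2 / 2)"
      by (rule gauss_eq)
    then have "complex_of_real (gauss ((x - y) /\<^sub>R h)) = of_real ?c *
        (\<integral>w. cis (((x - y) /\<^sub>R h) \<bullet> w) * of_real (gauss w) \<partial>lborel)"
      unfolding gauss_fourier by simp
    moreover have "((x - y) /\<^sub>R h) \<bullet> w = ((x - y) \<bullet> w) / h" for w
      by (simp add: divide_inverse mult.commute)
    moreover have "(\<integral>w. f x * cis (((x - y) \<bullet> w) / h) * of_real (gauss w) \<partial>lborel) =
        f x * (\<integral>w. cis (((x - y) \<bullet> w) / h) * of_real (gauss w) \<partial>lborel)"
      by (simp add: mult.assoc)
    ultimately show ?thesis
      unfolding F_def by (simp only: mult.left_commute)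
  qed
  have I: "integrable (lborel \<Otimes>\<^sub>M lborel) (\<lambda>(x, w). f x * cis (((x - y) \<bullet> w) / h) * of_real (gauss w))"
  proof (rule lborel_pair.Fubini_integrable)
    show "integrable lborel (\<lambda>x. \<integral>w. norm (case (x, w) of (x, w) \<Rightarrow> f x * cis (((x - y) \<bullet> w) / h) * of_real (gauss w)) \<partial>lborel)"
      using f by (simp add: norm_mult gauss_nonneg gauss_integral)
    show "AE x in lborel. integrable lborel (\<lambda>w. case (x, w) of (x, w) \<Rightarrow> f x * cis (((x - y) \<bullet> w) / h) * of_real (gauss w))"
    proof (rule AE_I2)
      fix x
      have "integrable lborel (\<lambda>w. norm (f x) * gauss (w::'a))" by (intro integrable_mult_right gauss_integrable)
      then show "integrable lborel (\<lambda>w. case (x, w) of (x, w) \<Rightarrow> f x * cis (((x - y) \<bullet> w) / h) * of_real (gauss w))"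
        by (rule Bochner_Integration.integrable_bound) (auto simp: norm_mult gauss_nonneg)
    qed
  qed measurable
  have 3: "(\<integral>x. F x \<partial>lborel) = of_real ?c *
      (\<integral>w. (\<integral>x. f x * cis (((x - y) \<bullet> w) / h) * of_real (gauss w) \<partial>lborel) \<partial>lborel)"
    unfolding 2 using lborel_pair.Fubini_integral[OF I] by simp
  have 4: "(\<integral>x. f x * cis (((x - y) \<bullet> w) / h) * of_real (gauss w) \<partial>lborel)
      = of_real (gauss w) * cis (- (y \<bullet> w) / h) * (\<integral>x. f x * cis ((x \<bullet> w) / h) \<partial>lborel)" for w
  proof -
    have "cis (((x - y) \<bullet> w) / h) = cis ((x \<bullet> w) / h) * cis (- (y \<bullet> w) / h)" for x
      by (simp add: cis_mult inner_diff_left diff_divide_distrib)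
    then have "(\<integral>x. f x * cis (((x - y) \<bullet> w) / h) * of_real (gauss w) \<partial>lborel) =
        (\<integral>x. (of_real (gauss w) * cis (- (y \<bullet> w) / h)) * (f x * cis ((x \<bullet> w) / h)) \<partial>lborel)"
      by (intro Bochner_Integration.integral_cong) (simp_all only: ac_simps)
    then show ?thesis by simp
  qed
  have "(\<integral>v. gauss v *\<^sub>R f (y + h *\<^sub>R v) \<partial>lborel) = (1 / h ^ DIM('a)) *\<^sub>R (\<integral>x. F x \<partial>lborel)"
    unfolding 1 using h by simp
  also have "\<dots> = of_real ((1 / h ^ DIM('a)) * ?c) *
    (\<integral>w. of_real (gauss w) * cis (- (y \<bullet> w) / h) * (\<integral>x. f x * cis ((x \<bullet> w) / h) \<partial>lborel) \<partial>lborel)"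
    unfolding 3 4 by (simp add: scaleR_conv_of_real)
  also have "(1 / h ^ DIM('a)) * ?c = (1 / (sqrt (2 * pi) * h)) ^ DIM('a)"
    by (simp add: power_divide power_mult_distrib)
  finally show ?thesis .
qed

text \<open>By translation invariance all difference quotients of \<open>F\<close> have integral zero, and they converge
  boundedly, with supports in a common ball.\<close>

lemma integral_directional_derivative:
  fixes F :: "'a::euclidean_space \<Rightarrow> 'b::euclidean_space"
  assumes der: "\<And>x. (F has_derivative F' x) (at x)"
    and cont: "continuous_on UNIV (\<lambda>x. F' x b)" and bd: "bounded {x. F x \<noteq> 0}" and int: "integrable lborel F"
    and B: "\<And>x. norm (F' x b) \<le> B"
  shows "(\<integral>x. F' x b \<partial>lborel) = 0"
proof -
  define D where "D n x = real (Suc n) *\<^sub>R (F (x + (1 / real (Suc n)) *\<^sub>R b) - F x)" for n x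
  have [measurable]: "F \<in> borel_measurable borel" using int by simp
  have [measurable]: "(\<lambda>x. F' x b) \<in> borel_measurable borel" using cont by (rule borel_measurable_continuous_onI)
  have zero: "(\<integral>x. D n x \<partial>lborel) = 0" for n
  proof -
    have "(\<integral>x. F (x + (1 / real (Suc n)) *\<^sub>R b) \<partial>lborel) = (\<integral>x. F x \<partial>lborel)"
      using integral_affine[of F 1 "(1 / real (Suc n)) *\<^sub>R b"] by (simp add: add.commute)
    moreover have "integrable lborel (\<lambda>x. F (x + (1 / real (Suc n)) *\<^sub>R b))"
      using integrable_affine[OF int, of 1 "(1 / real (Suc n)) *\<^sub>R b"] by (simp add: add.commute)
    ultimately show ?thesis using int unfolding D_def by simp
  qed
  obtain r where r: "\<And>x. F x \<noteq> 0 \<Longrightarrow> norm x \<le> r" using bd unfolding bounded_iff by auto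
  have mv: "norm (D n x) \<le> B" for n x
  proof -
    let ?t = "1 / real (Suc n)"
    have "norm (F (x + ?t *\<^sub>R b) - F (x + 0 *\<^sub>R b)) \<le> B * norm (?t - 0)"
    proof (rule differentiable_bound[where S="{0..?t}" and f="\<lambda>s. F (x + s *\<^sub>R b)" and f'="\<lambda>s t. t *\<^sub>R F' (x + s *\<^sub>R b) b"])
      fix s :: real
      have "((\<lambda>s. F (x + s *\<^sub>R b)) has_derivative (\<lambda>t. F' (x + s *\<^sub>R b) (t *\<^sub>R b))) (at s within {0..?t})"
        by (rule has_derivative_compose[OF _ der]) (auto intro!: derivative_eq_intros)
      moreover have "F' (x + s *\<^sub>R b) (t *\<^sub>R b) = t *\<^sub>R F' (x + s *\<^sub>R b) b" for t
        using linear_cmul[OF has_derivative_linear[OF der]] by blast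
      ultimately show "((\<lambda>s. F (x + s *\<^sub>R b)) has_derivative (\<lambda>t. t *\<^sub>R F' (x + s *\<^sub>R b) b)) (at s within {0..?t})"
        by simp
      show "onorm (\<lambda>t. t *\<^sub>R F' (x + s *\<^sub>R b) b) \<le> B"
        by (rule onorm_le) (use B[of "x + s *\<^sub>R b"] in \<open>auto simp: mult.commute[of B] intro!: mult_left_mono\<close>)
    qed auto
    then show ?thesis unfolding D_def by (simp add: pos_le_divide_eq mult.commute del: of_nat_Suc)
  qed
  have supp: "D n x = 0" if "norm x > r + norm b" for n x
  proof -
    have "norm x \<le> norm (x + (1 / real (Suc n)) *\<^sub>R b) + norm ((1 / real (Suc n)) *\<^sub>R b)"
      using norm_triangle_ineq4[of "x + (1 / real (Suc n)) *\<^sub>R b" "(1 / real (Suc n)) *\<^sub>R b"] by simp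
    moreover have "norm ((1 / real (Suc n)) *\<^sub>R b) \<le> norm b"
      using divide_left_mono[of 1 "1 + real n" "norm b"] by simp
    ultimately have "norm (x + (1 / real (Suc n)) *\<^sub>R b) > r" "norm x > r"
      using that norm_ge_zero[of b] by linarith+
    then show ?thesis unfolding D_def using r by (metis not_less diff_zero scaleR_zero_right)
  qed
  have "(\<lambda>n. \<integral>x. D n x \<partial>lborel) \<longlonglongrightarrow> (\<integral>x. F' x b \<partial>lborel)"
  proof (rule integral_dominated_convergence[where w="\<lambda>x. B * indicator (cball 0 (r + norm b)) x"])
    show "integrable lborel (\<lambda>x::'a. B * indicator (cball 0 (r + norm b)) x)"
      by (intro integrable_mult_right integrable_real_indicator)
         (auto intro: emeasure_bounded_finite[simplified])
    show "AE x in lborel. norm (D n x) \<le> B * indicator (cball 0 (r + norm b)) x" for n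
      using mv supp by (intro AE_I2) (auto simp: indicator_def not_le)
    show "AE x in lborel. (\<lambda>n. D n x) \<longlonglongrightarrow> F' x b"
    proof (rule AE_I2)
      fix x
interpret D: bounded_linear "F' x" using der by (rule has_derivative_bounded_linear)
      show "(\<lambda>n. D n x) \<longlonglongrightarrow> F' x b"
      proof (cases "b = 0")
        case False
        let ?h = "\<lambda>n. (1 / real (Suc n)) *\<^sub>R b"
        have "?h \<longlonglongrightarrow> 0 *\<^sub>R b" by (intro tendsto_intros LIMSEQ_Suc[OF lim_1_over_n])
        then have "filterlim ?h (at 0) sequentially"
          using False by (simp add: filterlim_at)
        moreover have "((\<lambda>h. norm (F (x + h) - F x - F' x h) / norm h) \<longlongrightarrow> 0) (at 0)"
          using der[of x] by (simp add: has_derivative_at)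
        ultimately have "(\<lambda>n. norm (F (x + ?h n) - F x - F' x (?h n)) / norm (?h n)) \<longlonglongrightarrow> 0"
          by (rule filterlim_compose[rotated])
        then have "(\<lambda>n. norm (F (x + ?h n) - F x - F' x (?h n)) / norm (?h n) * norm b) \<longlonglongrightarrow> 0"
          by (rule tendsto_mult_left_zero)
        moreover have "norm (F (x + ?h n) - F x - F' x (?h n)) / norm (?h n) * norm b = norm (D n x - F' x b)" for n
        proof -
          have "D n x - F' x b = real (Suc n) *\<^sub>R (F (x + ?h n) - F x - F' x (?h n))"
            by (simp add: D_def D.scaleR algebra_simps del: of_nat_Suc)
          then show ?thesis using False by (simp del: of_nat_Suc)
        qed
        ultimately have "(\<lambda>n. norm (D n x - F' x b)) \<longlonglongrightarrow> 0" by simp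
        then show ?thesis by (simp add: LIM_zero_cancel tendsto_norm_zero_iff)
      qed (simp add: D_def D.zero)
    qed
  qed (auto simp: D_def[abs_def])
  then show ?thesis unfolding zero using LIMSEQ_const_iff by metis
qed

section \<open>Fourier inversion for test functions\<close>

text \<open>The inverse Fourier transform: pairings with elements of the Sobolev space are known on Fourier transforms of
  Schwartz functions, so a test function has to be written as the Fourier transform of its inverse transform.\<close>

definition ifourier :: "('a::euclidean_space \<Rightarrow> complex) \<Rightarrow> 'a \<Rightarrow> complex" where
  "ifourier f \<xi> = (\<integral>x. cis (2 * pi * (x \<bullet> \<xi>)) * f x \<partial>lborel)"

lemma fourier_eq: "fourier p \<xi> = (\<integral>x. cis (- 2 * pi * (x \<bullet> \<xi>)) * p x \<partial>lborel)"
  unfolding fourier_def cis_conv_exp by (simp add: mult_ac)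

lemma integrable_cis_mult:
  assumes "integrable M f" "a \<in> borel_measurable M"
  shows "integrable M (\<lambda>x. cis (a x) * f x)"
  using assms by (intro Bochner_Integration.integrable_bound[OF assms(1)]) (auto simp: norm_mult)

lemma test_times_const: "test_function UNIV f \<Longrightarrow> test_function UNIV (\<lambda>x. c * (f x :: complex))"
  by (rule test_linear[OF bounded_linear_mult_right])

lemma cis_remainder: "cmod (cis x - 1 - \<i> * of_real x) \<le> x\<^sup>2 / 2"
  using iexp_approx1[of x 1] by (simp add: cis_conv_exp power2_eq_square diff_diff_eq)

text \<open>Differentiation under the integral sign; the second order remainder of the exponential is
  integrable against a compactly supported function.\<close>

lemma ifourier_has_derivative:
  fixes f :: "'a::euclidean_space \<Rightarrow> complex"
  assumes f: "test_function UNIV f"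
  shows "(ifourier f has_derivative
     (\<lambda>v. ifourier (\<lambda>x. (2 * pi * \<i>) * ((x \<bullet> v) *\<^sub>R f x)) \<xi>)) (at \<xi>)"
proof -
  have int1: "integrable lborel (\<lambda>x. (2 * pi * \<i>) * ((x \<bullet> v) *\<^sub>R f x))" for v
    by (intro test_integrable test_times_const test_coordinate_multiple f)
  have intc: "integrable lborel (\<lambda>x. cis (2 * pi * (x \<bullet> \<xi>)) * ((2 * pi * \<i>) * ((x \<bullet> v) *\<^sub>R f x)))" for v
    by (rule integrable_cis_mult[OF int1]) auto
  have int0: "integrable lborel (\<lambda>x. cis (2 * pi * (x \<bullet> \<zeta>)) * f x)" for \<zeta>
    by (rule integrable_cis_mult[OF test_integrable[OF f]]) auto
  have lin: "linear (\<lambda>v. ifourier (\<lambda>x. (2 * pi * \<i>) * ((x \<bullet> v) *\<^sub>R f x)) \<xi>)"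
  proof
    fix a b r
    show "ifourier (\<lambda>x. 2 * pi * \<i> * ((x \<bullet> (a + b)) *\<^sub>R f x)) \<xi> =
       ifourier (\<lambda>x. 2 * pi * \<i> * ((x \<bullet> a) *\<^sub>R f x)) \<xi> + ifourier (\<lambda>x. 2 * pi * \<i> * ((x \<bullet> b) *\<^sub>R f x)) \<xi>"
      unfolding ifourier_def Bochner_Integration.integral_add[OF intc intc, symmetric]
      by (simp add: inner_add_right algebra_simps)
    show "ifourier (\<lambda>x. 2 * pi * \<i> * ((x \<bullet> r *\<^sub>R b) *\<^sub>R f x)) \<xi> =
       r *\<^sub>R ifourier (\<lambda>x. 2 * pi * \<i> * ((x \<bullet> b) *\<^sub>R f x)) \<xi>"
      unfolding ifourier_def integral_scaleR_right[symmetric]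
      by (simp add: scaleR_conv_of_real mult_ac)
  qed
  define C where "C = (\<integral>x. (2 * pi * norm x)\<^sup>2 / 2 * norm (f x) \<partial>lborel)"
  obtain r where r: "\<And>x. f x \<noteq> 0 \<Longrightarrow> norm x \<le> r"
    using f unfolding test_function_UNIV_iff bounded_iff by auto
  have [measurable]: "f \<in> borel_measurable borel" using f test_smooth smooth_borel by blast
  have intC: "integrable lborel (\<lambda>x. (2 * pi * norm x)\<^sup>2 / 2 * norm (f x))"
  proof (rule Bochner_Integration.integrable_bound)
    show "integrable lborel (\<lambda>x. (2 * pi * r)\<^sup>2 / 2 * norm (f x))"
      using test_integrable[OF f] by (intro integrable_mult_right integrable_norm)
    show "AE x in lborel. norm ((2 * pi * norm x)\<^sup>2 / 2 * norm (f x)) \<le> norm ((2 * pi * r)\<^sup>2 / 2 * norm (f x))"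
    proof (rule AE_I2)
      fix x
      have "(2 * pi * norm x)\<^sup>2 \<le> (2 * pi * r)\<^sup>2" if "f x \<noteq> 0"
        using r[OF that] by (intro power_mono mult_left_mono) auto
      then show "norm ((2 * pi * norm x)\<^sup>2 / 2 * norm (f x)) \<le> norm ((2 * pi * r)\<^sup>2 / 2 * norm (f x))"
        by (cases "f x = 0") (auto intro!: mult_right_mono simp: abs_mult)
    qed
  qed measurable
  have C0: "C \<ge> 0" unfolding C_def by (intro integral_nonneg_AE) auto
  have rem: "norm (ifourier f \<zeta> - ifourier f \<xi> - ifourier (\<lambda>x. (2 * pi * \<i>) * ((x \<bullet> (\<zeta> - \<xi>)) *\<^sub>R f x)) \<xi>)
      \<le> C * (norm (\<zeta> - \<xi>))\<^sup>2" for \<zeta>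
  proof -
    let ?G = "\<lambda>x. cis (2 * pi * (x \<bullet> \<zeta>)) * f x - cis (2 * pi * (x \<bullet> \<xi>)) * f x
      - cis (2 * pi * (x \<bullet> \<xi>)) * ((2 * pi * \<i>) * ((x \<bullet> (\<zeta> - \<xi>)) *\<^sub>R f x))"
    have eq: "ifourier f \<zeta> - ifourier f \<xi> - ifourier (\<lambda>x. (2 * pi * \<i>) * ((x \<bullet> (\<zeta> - \<xi>)) *\<^sub>R f x)) \<xi> = (\<integral>x. ?G x \<partial>lborel)"
      unfolding ifourier_def
      by (subst Bochner_Integration.integral_diff[OF Bochner_Integration.integrable_diff[OF int0 int0] intc], subst Bochner_Integration.integral_diff[OF int0 int0]) (rule refl)
    have "norm (\<integral>x. ?G x \<partial>lborel) \<le> (\<integral>x. ((2 * pi * norm x)\<^sup>2 / 2 * norm (f x)) * (norm (\<zeta> - \<xi>))\<^sup>2 \<partial>lborel)"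
    proof (rule Bochner_Integration.integral_norm_bound_integral)
      show "integrable lborel ?G" by (intro Bochner_Integration.integrable_diff int0 intc)
      show "integrable lborel (\<lambda>x. (2 * pi * norm x)\<^sup>2 / 2 * norm (f x) * (norm (\<zeta> - \<xi>))\<^sup>2)"
        using intC by (rule integrable_mult_left)
      fix x
      let ?\<delta> = "2 * pi * (x \<bullet> (\<zeta> - \<xi>))"
      have "cis (2 * pi * (x \<bullet> \<zeta>)) = cis (2 * pi * (x \<bullet> \<xi>)) * cis ?\<delta>"
        by (simp add: cis_mult inner_diff_right algebra_simps)
      then have "?G x = cis (2 * pi * (x \<bullet> \<xi>)) * (cis ?\<delta> - 1 - \<i> * of_real ?\<delta>) * f x"
        by (simp add: scaleR_conv_of_real algebra_simps)
      then have "norm (?G x) \<le> ?\<delta>\<^sup>2 / 2 * norm (f x)"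
        using mult_right_mono[OF cis_remainder[of ?\<delta>] norm_ge_zero[of "f x"]] by (simp add: norm_mult)
      also have "?\<delta>\<^sup>2 / 2 * norm (f x) \<le> (2 * pi * (norm x * norm (\<zeta> - \<xi>)))\<^sup>2 / 2 * norm (f x)"
      proof (intro mult_right_mono divide_right_mono)
        have "\<bar>?\<delta>\<bar> \<le> \<bar>2 * pi * (norm x * norm (\<zeta> - \<xi>))\<bar>"
          using Cauchy_Schwarz_ineq2[of x "\<zeta> - \<xi>"] by (simp add: abs_mult)
        then show "?\<delta>\<^sup>2 \<le> (2 * pi * (norm x * norm (\<zeta> - \<xi>)))\<^sup>2" by (rule abs_le_square_iff[THEN iffD1])
      qed auto
      finally show "norm (?G x) \<le> (2 * pi * norm x)\<^sup>2 / 2 * norm (f x) * (norm (\<zeta> - \<xi>))\<^sup>2"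
        unfolding power2_eq_square by (simp only: mult_ac times_divide_eq_left times_divide_eq_right)
    qed
    also have "\<dots> = C * (norm (\<zeta> - \<xi>))\<^sup>2" unfolding C_def by (rule integral_mult_left_zero)
    finally show ?thesis unfolding eq .
  qed
  show ?thesis
  proof (rule has_derivativeI_sandwich[of 1])
    show "bounded_linear (\<lambda>v. ifourier (\<lambda>x. (2 * pi * \<i>) * ((x \<bullet> v) *\<^sub>R f x)) \<xi>)"
      using lin linear_conv_bounded_linear by blast
    fix \<zeta> assume "\<zeta> \<noteq> \<xi>"
    then show "norm (ifourier f \<zeta> - ifourier f \<xi> - ifourier (\<lambda>x. (2 * pi * \<i>) * ((x \<bullet> (\<zeta> - \<xi>)) *\<^sub>R f x)) \<xi>)
         / norm (\<zeta> - \<xi>) \<le> C * norm (\<zeta> - \<xi>)"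
      using rem[of \<zeta>] by (simp add: pos_divide_le_eq power2_eq_square mult_ac)
  next
    have "((\<lambda>y. C * norm (y - \<xi>)) \<longlongrightarrow> C * norm (\<xi> - \<xi>)) (at \<xi>)" by (intro tendsto_intros)
    then show "((\<lambda>y. C * norm (y - \<xi>)) \<longlongrightarrow> 0) (at \<xi>)" by simp
  qed simp
qed

lemma ifourier_partial:
  assumes "test_function UNIV f"
  shows "(\<lambda>\<xi>. frechet_derivative (ifourier f) (at \<xi>) b) = ifourier (\<lambda>x. (2 * pi * \<i>) * ((x \<bullet> b) *\<^sub>R f x))"
  by (simp add: fun_eq_iff frechet_derivative_at[OF ifourier_has_derivative[OF assms], symmetric])

text \<open>A partial derivative of an inverse transform is the inverse transform of another test function,
  so bounds for inverse transforms of test functions apply to all derivatives as well.\<close>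

lemma ifourier_iter_partial:
  assumes f: "test_function UNIV f" and "set bs \<subseteq> Basis"
  obtains h where "test_function UNIV h" "iter_partial bs (ifourier f) = ifourier h"
proof -
  have "iter_partial bs (ifourier f) \<in> {ifourier h |h. test_function UNIV h}"
  proof (rule iter_partial_invariant)
    fix k b assume "k \<in> {ifourier h |h. test_function UNIV h}"
    then obtain h where h: "k = ifourier h" "test_function UNIV h" by auto
    show "(\<lambda>x. frechet_derivative k (at x) b) \<in> {ifourier h |h. test_function UNIV h}"
      unfolding h(1) ifourier_partial[OF h(2)]
      by (intro CollectI exI[of _ "\<lambda>x. (2 * pi * \<i>) * ((x \<bullet> b) *\<^sub>R h x)"] conjI refl
          test_times_const test_coordinate_multiple h(2))
  qed (use assms in auto)
  then show thesis using that by auto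
qed

lemma ifourier_smooth:
  assumes f: "test_function UNIV f"
  shows "smooth (ifourier f)"
  unfolding smooth_def
  by (metis (no_types) f differentiable_def ifourier_has_derivative ifourier_iter_partial)

lemma ifourier_bounded:
  assumes f: "test_function UNIV f"
  shows "cmod (ifourier f \<xi>) \<le> (\<integral>x. cmod (f x) \<partial>lborel)"
  unfolding ifourier_def
  by (rule order_trans[OF integral_norm_bound]) (simp add: norm_mult)

lemma ifourier_by_parts:
  assumes f: "test_function UNIV f" and b: "b \<in> Basis"
  shows "cmod (ifourier (\<lambda>x. frechet_derivative f (at x) b) \<xi>) = 2 * pi * \<bar>\<xi> \<bullet> b\<bar> * cmod (ifourier f \<xi>)"
proof -
  define D where "D x = frechet_derivative f (at x)" for x
  have D: "(f has_derivative D x) (at x)" for x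
    unfolding D_def using f test_smooth smooth_has_derivative by blast
  have tD: "test_function UNIV (\<lambda>x. D x b)" unfolding D_def by (rule test_partial[OF f b])
  let ?e = "\<lambda>x. cis (2 * pi * (x \<bullet> \<xi>))"
  define F' where "F' x v = ?e x * D x v + (of_real (2 * pi * (v \<bullet> \<xi>)) * \<i> * ?e x) * f x" for x v
  have der: "((\<lambda>x. ?e x * f x) has_derivative F' x) (at x)" for x
  proof -
    have "((\<lambda>x. cis (2 * pi * (x \<bullet> \<xi>))) has_derivative (\<lambda>v. of_real (2 * pi * (v \<bullet> \<xi>)) * \<i> * ?e x)) (at x)"
    proof -
      have "((\<lambda>x. \<i> * complex_of_real (2 * pi * (x \<bullet> \<xi>))) has_derivative (\<lambda>v. \<i> * of_real (2 * pi * (v \<bullet> \<xi>)))) (at x)"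
        by (intro derivative_intros)
      from has_derivative_compose[OF this DERIV_exp[unfolded has_field_derivative_def]]
      show ?thesis unfolding cis_conv_exp by (simp only: mult_ac)
    qed
    from has_derivative_mult[OF this D[of x]] show ?thesis unfolding F'_def .
  qed
  obtain B1 where B1: "\<And>x. norm (D x b) \<le> B1" using test_bounded_above[OF tD] by blast
  obtain B2 where B2: "\<And>x. norm (f x) \<le> B2" using test_bounded_above[OF f] by blast
  have int: "integrable lborel (\<lambda>x. ?e x * f x)"
    by (rule integrable_cis_mult[OF test_integrable[OF f]]) simp
  have intD: "integrable lborel (\<lambda>x. ?e x * D x b)"
    by (rule integrable_cis_mult[OF test_integrable[OF tD]]) simp
  have "(\<integral>x. F' x b \<partial>lborel) = 0"
  proof (rule integral_directional_derivative[OF der _ _ int])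
    show "continuous_on UNIV (\<lambda>x. F' x b)"
      unfolding F'_def
      by (intro continuous_intros smooth_continuous test_smooth[OF f] test_smooth[OF tD])
    show "bounded {x. ?e x * f x \<noteq> 0}"
      using f unfolding test_function_UNIV_iff by (auto elim: bounded_subset)
    fix x
    have "norm (F' x b) \<le> norm (D x b) + \<bar>2 * pi * (b \<bullet> \<xi>)\<bar> * norm (f x)"
      unfolding F'_def by (rule order_trans[OF norm_triangle_ineq]) (simp add: norm_mult abs_mult)
    also have "\<dots> \<le> B1 + \<bar>2 * pi * (b \<bullet> \<xi>)\<bar> * B2"
      by (intro add_mono mult_left_mono B1 B2) auto
    finally show "norm (F' x b) \<le> B1 + \<bar>2 * pi * (b \<bullet> \<xi>)\<bar> * B2" .
  qed
  moreover have "(\<integral>x. F' x b \<partial>lborel) = ifourier (\<lambda>x. D x b) \<xi> + of_real (2 * pi * (b \<bullet> \<xi>)) * \<i> * ifourier f \<xi>"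
  proof -
    have "F' x b = ?e x * D x b + (of_real (2 * pi * (b \<bullet> \<xi>)) * \<i>) * (?e x * f x)" for x
      unfolding F'_def by (simp only: mult.assoc)
    then show ?thesis
      unfolding ifourier_def
      using Bochner_Integration.integral_add[OF intD integrable_mult_right[OF int, of "of_real (2 * pi * (b \<bullet> \<xi>)) * \<i>"]]
      by (simp only: integral_mult_right_zero)
  qed
  ultimately have "ifourier (\<lambda>x. D x b) \<xi> = - (of_real (2 * pi * (b \<bullet> \<xi>)) * \<i> * ifourier f \<xi>)"
    by (simp add: eq_neg_iff_add_eq_0)
  then show ?thesis unfolding D_def by (simp add: norm_mult abs_mult inner_commute)
qed

text \<open>Induction on \<open>N\<close>: integration by parts trades a factor \<open>\<xi> \<bullet> b\<close> for a derivative of \<open>f\<close>.\<close>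

lemma ifourier_decay:
  fixes f :: "'a::euclidean_space \<Rightarrow> complex"
  assumes "test_function UNIV f"
  shows "\<exists>B. \<forall>\<xi>. (1 + norm \<xi>) ^ N * cmod (ifourier f \<xi>) \<le> B"
  using assms
proof (induction N arbitrary: f)
  case 0
  then show ?case using ifourier_bounded by auto
next
  case (Suc N)
  obtain B where B: "\<And>\<xi>. (1 + norm \<xi>) ^ N * cmod (ifourier f \<xi>) \<le> B" using Suc by blast
  have "\<forall>b\<in>Basis. \<exists>B. \<forall>\<xi>. (1 + norm \<xi>) ^ N * cmod (ifourier (\<lambda>x. frechet_derivative f (at x) b) \<xi>) \<le> B"
    using Suc test_partial by blast
  then obtain B' where B': "\<And>b \<xi>. b \<in> Basis \<Longrightarrow>
      (1 + norm \<xi>) ^ N * cmod (ifourier (\<lambda>x. frechet_derivative f (at x) b) \<xi>) \<le> B' b" by metis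
  show ?case
  proof (intro exI allI)
    fix \<xi> :: 'a
    let ?p = "(1 + norm \<xi>) ^ N * cmod (ifourier f \<xi>)"
    have p: "?p \<ge> 0" by simp
    have "(1 + norm \<xi>) * ?p \<le> (1 + (\<Sum>b\<in>Basis. \<bar>\<xi> \<bullet> b\<bar>)) * ?p"
      using norm_le_l1[of \<xi>] p by (intro mult_right_mono) auto
    also have "\<dots> = ?p + (\<Sum>b\<in>Basis. \<bar>\<xi> \<bullet> b\<bar> * ?p)" by (simp add: distrib_right sum_distrib_right)
    also have "\<dots> \<le> B + (\<Sum>b\<in>Basis. B' b)"
    proof (intro add_mono B sum_mono)
      fix b :: 'a assume b: "b \<in> Basis"
      have "\<bar>\<xi> \<bullet> b\<bar> * ?p \<le> 2 * pi * \<bar>\<xi> \<bullet> b\<bar> * ?p"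
        using pi_ge_two p by (intro mult_right_mono) (auto intro: mult_right_mono[of 1 "2 * pi", simplified])
      also have "\<dots> = (1 + norm \<xi>) ^ N * cmod (ifourier (\<lambda>x. frechet_derivative f (at x) b) \<xi>)"
        unfolding ifourier_by_parts[OF Suc.prems b] by simp
      also have "\<dots> \<le> B' b" by (rule B'[OF b])
      finally show "\<bar>\<xi> \<bullet> b\<bar> * ?p \<le> B' b" .
    qed
    finally show "(1 + norm \<xi>) ^ Suc N * cmod (ifourier f \<xi>) \<le> B + (\<Sum>b\<in>Basis. B' b)"
      by (simp add: mult_ac)
  qed
qed

lemma ifourier_schwartz:
  assumes f: "test_function UNIV f"
  shows "schwartz (ifourier f)"
  unfolding schwartz_def
proof (intro conjI allI impI)
  show "smooth (ifourier f)" by (rule ifourier_smooth[OF f])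
  fix bs :: "'a list" and N assume "set bs \<subseteq> Basis"
  then obtain h where h: "test_function UNIV h" "iter_partial bs (ifourier f) = ifourier h"
    using ifourier_iter_partial[OF f] by blast
  obtain B where "\<And>\<xi>. (1 + norm \<xi>) ^ N * cmod (ifourier h \<xi>) \<le> B" using ifourier_decay[OF h(1)] by blast
  then show "bounded (range (\<lambda>x. (1 + norm x) ^ N *\<^sub>R iter_partial bs (ifourier f) x))"
    unfolding h(2) bounded_iff by (intro exI[of _ B]) auto
qed

text \<open>The integrand is bounded by a product of one-dimensional Cauchy densities, up to a constant.\<close>

lemma integrable_rapid_decay:
  "integrable lborel (\<lambda>\<xi>::'a::euclidean_space. inverse ((1 + norm \<xi>) ^ (2 * DIM('a))))"
proof (rule Bochner_Integration.integrable_bound)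
  have "integrable lborel (\<lambda>x::real. inverse (1 + x\<^sup>2))"
    using integrable_inverse_1_plus_square by (simp add: set_integrable_def)
  then show "integrable lborel (\<lambda>\<xi>::'a. \<Prod>b\<in>Basis. inverse (1 + (\<xi> \<bullet> b)\<^sup>2))"
    by (rule lborel_product_of_coordinates(1))
  show "AE \<xi>::'a in lborel. norm (inverse ((1 + norm \<xi>) ^ (2 * DIM('a)))) \<le> norm (\<Prod>b\<in>Basis. inverse (1 + (\<xi> \<bullet> b)\<^sup>2))"
  proof (rule AE_I2)
    fix \<xi> :: 'a
    have "(\<Prod>b\<in>(Basis::'a set). 1 + (\<xi> \<bullet> b)\<^sup>2) \<le> (\<Prod>b\<in>(Basis::'a set). (1 + norm \<xi>)\<^sup>2)"
    proof (intro prod_mono conjI)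
      fix b :: 'a assume "b \<in> Basis"
      then have "(\<xi> \<bullet> b)\<^sup>2 \<le> (norm \<xi>)\<^sup>2" using Basis_le_norm[of b \<xi>] abs_le_square_iff[of "\<xi> \<bullet> b" "norm \<xi>"] by simp
      then show "1 + (\<xi> \<bullet> b)\<^sup>2 \<le> (1 + norm \<xi>)\<^sup>2"
        by (simp add: power2_sum add_increasing2)
    qed simp
    also have "\<dots> = (1 + norm \<xi>) ^ (2 * DIM('a))" by (simp add: power_mult)
    finally have "inverse ((1 + norm \<xi>) ^ (2 * DIM('a))) \<le> inverse (\<Prod>b\<in>(Basis::'a set). 1 + (\<xi> \<bullet> b)\<^sup>2)"
      by (intro le_imp_inverse_le prod_pos) (auto intro: add_pos_nonneg)
    then show "norm (inverse ((1 + norm \<xi>) ^ (2 * DIM('a)))) \<le> norm (\<Prod>b\<in>Basis. inverse (1 + (\<xi> \<bullet> b)\<^sup>2))"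
      by (simp add: prod_inversef[symmetric] o_def abs_prod)
  qed
qed simp

lemma schwartz_borel: "schwartz p \<Longrightarrow> p \<in> borel_measurable borel"
  unfolding schwartz_def using smooth_borel by blast

lemma schwartz_decay:
  assumes "schwartz p"
  obtains B where "B \<ge> 0" "\<And>x. cmod (p x) \<le> B * inverse ((1 + norm x) ^ N)"
proof -
  have "bounded (range (\<lambda>x. (1 + norm x) ^ N *\<^sub>R iter_partial [] p x))"
    using assms unfolding schwartz_def by (metis empty_subsetI list.set(1))
  then obtain B where B: "\<And>x. cmod ((1 + norm x) ^ N *\<^sub>R p x) \<le> B" unfolding bounded_iff by auto
  have "cmod (p x) \<le> B * inverse ((1 + norm x) ^ N)" for x
    using B[of x] by (simp add: field_simps add_pos_nonneg abs_mult)
  moreover have "B \<ge> 0" using B[of 0] norm_ge_zero order_trans by blast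
  ultimately show thesis using that by blast
qed

lemma schwartz_integrable:
  fixes p :: "'a::euclidean_space \<Rightarrow> complex"
  assumes p: "schwartz p"
  shows "integrable lborel p"
proof -
  obtain B where B: "B \<ge> 0" "\<And>x. cmod (p x) \<le> B * inverse ((1 + norm x) ^ (2 * DIM('a)))"
    using schwartz_decay[OF p] by blast
  show ?thesis
    by (rule Bochner_Integration.integrable_bound[OF integrable_mult_right[OF integrable_rapid_decay, of B]])
       (use B p schwartz_borel in \<open>auto simp: abs_mult\<close>)
qed

lemma integrable_weighted_schwartz:
  fixes p :: "'a::euclidean_space \<Rightarrow> complex"
  assumes p: "schwartz p"
  shows "integrable lborel (\<lambda>\<xi>. (1 + (norm \<xi>)\<^sup>2) powr r * (cmod (p \<xi>))\<^sup>2)"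
proof -
  obtain n :: nat where n: "\<bar>r\<bar> \<le> real n" using real_arch_simple by blast
  have [measurable]: "p \<in> borel_measurable borel" using p by (rule schwartz_borel)
  obtain B where B: "B \<ge> 0" "\<And>x. cmod (p x) \<le> B * inverse ((1 + norm x) ^ (DIM('a) + n))"
    using schwartz_decay[OF p] by blast
  show ?thesis
  proof (rule Bochner_Integration.integrable_bound[OF integrable_mult_right[OF integrable_rapid_decay, of "B\<^sup>2"]])
    show "AE \<xi> in lborel. norm ((1 + (norm \<xi>)\<^sup>2) powr r * (cmod (p \<xi>))\<^sup>2)
       \<le> norm (B\<^sup>2 * inverse ((1 + norm \<xi>) ^ (2 * DIM('a))))"
    proof (rule AE_I2)
      fix \<xi> :: 'a
      have pos: "0 < 1 + norm \<xi>" by (simp add: add_pos_nonneg)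
      have "(1 + (norm \<xi>)\<^sup>2) powr r \<le> (1 + (norm \<xi>)\<^sup>2) powr real n"
        using n by (intro powr_mono) auto
      also have "\<dots> = (1 + (norm \<xi>)\<^sup>2) ^ n" by (intro powr_realpow) (simp add: add_pos_nonneg)
      also have "\<dots> \<le> ((1 + norm \<xi>)\<^sup>2) ^ n" by (intro power_mono) (auto simp: power2_sum)
      finally have 1: "(1 + (norm \<xi>)\<^sup>2) powr r \<le> (1 + norm \<xi>) ^ (2 * n)" by (simp add: power_mult)
      have 2: "(cmod (p \<xi>))\<^sup>2 \<le> (B * inverse ((1 + norm \<xi>) ^ (DIM('a) + n)))\<^sup>2"
        by (intro power_mono B) auto
      have "(1 + (norm \<xi>)\<^sup>2) powr r * (cmod (p \<xi>))\<^sup>2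
          \<le> (1 + norm \<xi>) ^ (2 * n) * (B * inverse ((1 + norm \<xi>) ^ (DIM('a) + n)))\<^sup>2"
        using pos by (intro mult_mono 1 2) auto
      also have "\<dots> = B\<^sup>2 * inverse ((1 + norm \<xi>) ^ (2 * DIM('a)))"
        using pos by (simp add: power_mult_distrib power_add power_mult field_simps flip: power_mult)
      finally show "norm ((1 + (norm \<xi>)\<^sup>2) powr r * (cmod (p \<xi>))\<^sup>2)
       \<le> norm (B\<^sup>2 * inverse ((1 + norm \<xi>) ^ (2 * DIM('a))))" by simp
    qed
  qed measurable
qed

text \<open>Damp the integral for \<open>fourier (ifourier f)\<close> by the factor \<open>exp (- (2 * pi * h * |\<xi>|)\<^sup>2 / 2)\<close>.
  It becomes a Gaussian smoothing of \<open>f\<close>, which converges to \<open>f\<close> as \<open>h \<rightarrow> 0\<close>,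
  while the damping disappears by dominated convergence.\<close>

theorem fourier_ifourier:
  fixes f :: "'a::euclidean_space \<Rightarrow> complex"
  assumes f: "test_function UNIV f"
  shows "fourier (ifourier f) = f"
proof
  fix y
  define p where "p = ifourier f"
  have p: "schwartz p" unfolding p_def by (rule ifourier_schwartz[OF f])
  have [measurable]: "p \<in> borel_measurable borel" using p by (rule schwartz_borel)
  have ip: "integrable lborel p" by (rule schwartz_integrable[OF p])
  define h where "h n = 1 / real (Suc n)" for n
  have h: "h n > 0" "h \<longlonglongrightarrow> 0" for n
    unfolding h_def by (simp, intro LIMSEQ_Suc[OF lim_1_over_n])
  obtain B where B: "\<And>x. norm (f x) \<le> B" using test_bounded_above[OF f] by blast
  let ?I = "\<lambda>n. \<integral>v. gauss v *\<^sub>R f (y + h n *\<^sub>R v) \<partial>lborel"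
  let ?J = "\<lambda>n \<xi>. of_real (exp (- (norm ((2 * pi * h n) *\<^sub>R \<xi>))\<^sup>2 / 2)) * (cis (- 2 * pi * (\<xi> \<bullet> y)) * p \<xi>)"
  have 1: "?I \<longlonglongrightarrow> f y"
    by (rule gauss_mollification[OF smooth_continuous[OF test_smooth[OF f]] B h(2)])
  have 2: "?I n = (\<integral>\<xi>. ?J n \<xi> \<partial>lborel)" for n
  proof -
    define F where "F w = of_real (gauss w) * cis (- (y \<bullet> w) / h n) * (\<integral>x. f x * cis ((x \<bullet> w) / h n) \<partial>lborel)" for w
    have F: "F w = of_real (gauss w) * cis (- (y \<bullet> w) / h n) * p (w /\<^sub>R (2 * pi * h n))" for w
      unfolding F_def p_def ifourier_def by (simp add: field_simps)
    have Fm: "F \<in> borel_measurable borel" unfolding F[abs_def] by measurable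
    let ?c = "2 * pi * h n"
    have c: "?c > 0" using h(1) by simp
    have "?I n = of_real ((1 / (sqrt (2 * pi) * h n)) ^ DIM('a)) * (\<integral>w. F w \<partial>lborel)"
      unfolding F_def by (rule gauss_smoothing_fourier[OF test_integrable[OF f] h(1)])
    also have "(\<integral>w. F w \<partial>lborel) = ?c ^ DIM('a) *\<^sub>R (\<integral>\<xi>. F (0 + ?c *\<^sub>R \<xi>) \<partial>lborel)"
      using integral_affine[OF Fm less_imp_neq[OF c, symmetric], of 0] unfolding abs_of_pos[OF c] .
    also have "of_real ((1 / (sqrt (2 * pi) * h n)) ^ DIM('a)) * \<dots> =
        (\<integral>\<xi>. of_real (((1 / (sqrt (2 * pi) * h n)) * ?c) ^ DIM('a)) * F (?c *\<^sub>R \<xi>) \<partial>lborel)"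
      by (simp only: scaleR_conv_of_real power_mult_distrib of_real_mult
          mult.assoc integral_mult_right_zero add_0_left)
    also have "(1 / (sqrt (2 * pi) * h n)) * ?c = sqrt (2 * pi)"
      using h(1)[of n] by (simp add: field_simps)
    also have "(\<lambda>\<xi>. of_real (sqrt (2 * pi) ^ DIM('a)) * F (?c *\<^sub>R \<xi>)) = ?J n"
    proof
      fix \<xi> :: 'a
      have "of_real (sqrt (2 * pi) ^ DIM('a)) * complex_of_real (gauss (?c *\<^sub>R \<xi>)) =
          of_real (exp (- (norm (?c *\<^sub>R \<xi>))\<^sup>2 / 2))"
        unfolding gauss_eq of_real_mult[symmetric] by (simp add: power_divide)
      moreover have "(?c *\<^sub>R \<xi>) /\<^sub>R ?c = \<xi>" unfolding scaleR_scaleR left_inverse[OF less_imp_neq[OF c, symmetric]] by simp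
      moreover have "- (y \<bullet> (?c *\<^sub>R \<xi>)) / h n = - 2 * pi * (\<xi> \<bullet> y)"
        using h(1)[of n] by (simp add: inner_commute)
      ultimately show "of_real (sqrt (2 * pi) ^ DIM('a)) * F (?c *\<^sub>R \<xi>) = ?J n \<xi>"
        unfolding F by (simp only: mult.assoc[symmetric])
    qed
    finally show ?thesis .
  qed
  have 3: "(\<lambda>n. \<integral>\<xi>. ?J n \<xi> \<partial>lborel) \<longlonglongrightarrow> (\<integral>\<xi>. cis (- 2 * pi * (\<xi> \<bullet> y)) * p \<xi> \<partial>lborel)"
  proof (rule integral_dominated_convergence[where w="\<lambda>\<xi>. cmod (p \<xi>)"])
    show "integrable lborel (\<lambda>\<xi>. cmod (p \<xi>))" using ip by (rule integrable_norm)
    show "AE \<xi> in lborel. (\<lambda>n. ?J n \<xi>) \<longlonglongrightarrow> cis (- 2 * pi * (\<xi> \<bullet> y)) * p \<xi>"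
    proof (rule AE_I2)
      fix \<xi>
      have "(\<lambda>n. ?J n \<xi>) \<longlonglongrightarrow> of_real (exp (- (norm ((2 * pi * 0) *\<^sub>R \<xi>))\<^sup>2 / 2)) * (cis (- 2 * pi * (\<xi> \<bullet> y)) * p \<xi>)"
        by (intro tendsto_intros h(2)) simp
      then show "(\<lambda>n. ?J n \<xi>) \<longlonglongrightarrow> cis (- 2 * pi * (\<xi> \<bullet> y)) * p \<xi>" by simp
    qed
    show "AE \<xi> in lborel. norm (?J n \<xi>) \<le> cmod (p \<xi>)" for n
      by (intro AE_I2) (simp add: norm_mult mult_left_le_one_le)
  qed measurable
  show "fourier (ifourier f) y = f y"
    using LIMSEQ_unique[OF 3] 1 unfolding 2 fourier_eq p_def by blast
qed

section \<open>Pairing Sobolev distributions with test functions\<close>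

text \<open>The weighted Cauchy-Schwarz inequality in its additive form, with a free parameter \<open>r\<close>: this avoids square
  roots of integrals, and a suitable \<open>r\<close> recovers the product form.\<close>

lemma sobolev_transform_pairing:
  fixes u :: "'a::euclidean_space distr"
  assumes h: "sobolev_transform s u h" and p: "schwartz p" and r: "r > 0"
  shows "integrable lborel (\<lambda>\<xi>. h \<xi> * p \<xi>)" (is ?I)
    and "cmod (\<integral>\<xi>. h \<xi> * p \<xi> \<partial>lborel) \<le>
      (r * (\<integral>\<xi>. (1 + (norm \<xi>)\<^sup>2) powr s * (cmod (h \<xi>))\<^sup>2 \<partial>lborel)
       + (\<integral>\<xi>. (1 + (norm \<xi>)\<^sup>2) powr (- s) * (cmod (p \<xi>))\<^sup>2 \<partial>lborel) / r) / 2" (is ?E)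
proof -
  have [measurable]: "h \<in> borel_measurable borel" "p \<in> borel_measurable borel"
    using h schwartz_borel[OF p] unfolding sobolev_transform_def by auto
  let ?A = "\<lambda>\<xi>. (1 + (norm \<xi>)\<^sup>2) powr s * (cmod (h \<xi>))\<^sup>2"
  let ?B = "\<lambda>\<xi>. (1 + (norm \<xi>)\<^sup>2) powr (- s) * (cmod (p \<xi>))\<^sup>2"
  let ?G = "\<lambda>\<xi>. (r * ?A \<xi> + ?B \<xi> / r) / 2"
  have iA: "integrable lborel ?A" using h unfolding sobolev_transform_def by blast
  have iB: "integrable lborel ?B" by (rule integrable_weighted_schwartz[OF p])
  have iG: "integrable lborel ?G" using iA iB by simp
  have bound: "cmod (h \<xi> * p \<xi>) \<le> ?G \<xi>" for \<xi>
  proof -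
    have pos: "(1 + (norm \<xi>)\<^sup>2) > 0" by (simp add: add_pos_nonneg)
    have "(r * ?A \<xi>) * (?B \<xi> / r) = (cmod (h \<xi>) * cmod (p \<xi>))\<^sup>2"
      using r pos by (simp add: powr_minus field_simps power_mult_distrib)
    then have "cmod (h \<xi>) * cmod (p \<xi>) = sqrt ((r * ?A \<xi>) * (?B \<xi> / r))"
      by (simp add: real_sqrt_unique)
    also have "\<dots> \<le> ?G \<xi>" using r by (intro arith_geo_mean_sqrt) auto
    finally show ?thesis by (simp add: norm_mult)
  qed
  show ?I
    by (rule Bochner_Integration.integrable_bound[OF iG]) (use bound in \<open>auto intro: order_trans[OF _ abs_ge_self]\<close>)
  then have "cmod (\<integral>\<xi>. h \<xi> * p \<xi> \<partial>lborel) \<le> (\<integral>\<xi>. ?G \<xi> \<partial>lborel)"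
    by (rule Bochner_Integration.integral_norm_bound_integral[OF _ iG]) (rule bound)
  also have "\<dots> = (r * (\<integral>\<xi>. ?A \<xi> \<partial>lborel) + (\<integral>\<xi>. ?B \<xi> \<partial>lborel) / r) / 2"
    using iA iB by simp
  finally show ?E .
qed

lemma sobolev_transform_apply:
  assumes "sobolev_transform s u h" and f: "test_function UNIV f"
  shows "u f = (\<integral>\<xi>. h \<xi> * ifourier f \<xi> \<partial>lborel)"
  using assms(1) ifourier_schwartz[OF f] fourier_ifourier[OF f] unfolding sobolev_transform_def by metis

lemma sobolev_transform_diff:
  fixes u v :: "'a::euclidean_space distr"
  assumes h: "sobolev_transform s u h" and k: "sobolev_transform s v k"
  shows "sobolev_transform s (distr_diff u v) (\<lambda>\<xi>. h \<xi> - k \<xi>)"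
  unfolding sobolev_transform_def
proof (intro conjI allI impI)
  have [measurable]: "h \<in> borel_measurable borel" "k \<in> borel_measurable borel"
    using h k unfolding sobolev_transform_def by auto
  show "(\<lambda>\<xi>. h \<xi> - k \<xi>) \<in> borel_measurable lborel" by measurable
  let ?A = "\<lambda>h \<xi>. (1 + (norm \<xi>)\<^sup>2) powr s * (cmod (h \<xi>))\<^sup>2"
  have "integrable lborel (\<lambda>\<xi>. 2 * ?A h \<xi> + 2 * ?A k \<xi>)"
    using h k unfolding sobolev_transform_def by simp
  then show "integrable lborel (\<lambda>\<xi>. ?A (\<lambda>\<xi>. h \<xi> - k \<xi>) \<xi>)"
  proof (rule Bochner_Integration.integrable_bound)
    show "AE \<xi> in lborel. norm (?A (\<lambda>\<xi>. h \<xi> - k \<xi>) \<xi>) \<le> norm (2 * ?A h \<xi> + 2 * ?A k \<xi>)"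
    proof (rule AE_I2)
      fix \<xi>
      have "(cmod (h \<xi> - k \<xi>))\<^sup>2 \<le> (cmod (h \<xi>) + cmod (k \<xi>))\<^sup>2"
        by (intro power_mono norm_triangle_ineq4) auto
      also have "\<dots> \<le> 2 * (cmod (h \<xi>))\<^sup>2 + 2 * (cmod (k \<xi>))\<^sup>2"
        using sum_squares_bound[of "cmod (h \<xi>)" "cmod (k \<xi>)"] by (simp add: power2_sum)
      finally have "?A (\<lambda>\<xi>. h \<xi> - k \<xi>) \<xi> \<le> (1 + (norm \<xi>)\<^sup>2) powr s * (2 * (cmod (h \<xi>))\<^sup>2 + 2 * (cmod (k \<xi>))\<^sup>2)"
        by (intro mult_left_mono) auto
      then show "norm (?A (\<lambda>\<xi>. h \<xi> - k \<xi>) \<xi>) \<le> norm (2 * ?A h \<xi> + 2 * ?A k \<xi>)"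
        by (simp add: algebra_simps)
    qed
  qed measurable
  fix p :: "'a \<Rightarrow> complex" assume p: "schwartz p"
  show "distr_diff u v (fourier p) = (\<integral>\<xi>. (h \<xi> - k \<xi>) * p \<xi> \<partial>lborel)"
    using h k p sobolev_transform_pairing(1)[OF h p zero_less_one] sobolev_transform_pairing(1)[OF k p zero_less_one]
    by (simp add: distr_diff_def sobolev_transform_def left_diff_distrib)
qed

text \<open>The norm is defined through a chosen transform of the difference, which may differ from the
  difference of transforms of the two distributions. Both represent the same functional, so the pairing can
  be estimated with the chosen one.\<close>

lemma sobolev_norm_controls_pairing:
  fixes f :: "'a::euclidean_space \<Rightarrow> complex"
  assumes f: "test_function UNIV f"
  obtains c where "c > 0"
    "\<And>u v. u \<in> sobolev s \<Longrightarrow> v \<in> sobolev s \<Longrightarrow> cmod (u f - v f) \<le> c * sobolev_norm s (distr_diff u v)"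
proof -
  let ?p = "ifourier f"
  define B where "B = (\<integral>\<xi>. (1 + (norm \<xi>)\<^sup>2) powr (- s) * (cmod (?p \<xi>))\<^sup>2 \<partial>lborel)"
  have B: "B \<ge> 0" unfolding B_def by (intro integral_nonneg_AE) auto
  have main: "cmod (w f) \<le> (1 + B) / 2 * sobolev_norm s w" if "sobolev_transform s w h0" for w :: "'a distr" and h0
  proof -
    define h where "h = (SOME h. sobolev_transform s w h)"
    have h: "sobolev_transform s w h" unfolding h_def using that by (rule someI[of "sobolev_transform s w"])
    define A where "A = (\<integral>\<xi>. (1 + (norm \<xi>)\<^sup>2) powr s * (cmod (h \<xi>))\<^sup>2 \<partial>lborel)"
    have A: "A \<ge> 0" unfolding A_def by (intro integral_nonneg_AE) auto
    have nrm: "sobolev_norm s w = sqrt A" unfolding sobolev_norm_def Let_def A_def h_def ..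
    \<comment> \<open>Optimal is \<open>r = sqrt (B / A)\<close>; \<open>r = 1 / sqrt A\<close> suffices when \<open>A > 0\<close>, and \<open>r\<close> tends to infinity
      when \<open>A = 0\<close>.\<close>
    have bd: "cmod (w f) \<le> (r * A + B / r) / 2" if "r > 0" for r
      using sobolev_transform_pairing(2)[OF h ifourier_schwartz[OF f] that]
      unfolding sobolev_transform_apply[OF h f] A_def B_def .
    show ?thesis
    proof (cases "A = 0")
      case True
      have "cmod (w f) \<le> e" if "e > 0" for e
      proof -
        have "cmod (w f) \<le> B / ((B + 1) / e) / 2" using bd[of "(B + 1) / e"] True that B by simp
        also have "\<dots> \<le> e" using B that by (simp add: field_simps)
        finally show ?thesis .
      qed
      then have "cmod (w f) \<le> 0" by (rule field_le_epsilon) simp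
      then show ?thesis using nrm True by simp
    next
      case False
      then have pos: "sqrt A > 0" using A by simp
      have "(1 / q * (q * q) + B / (1 / q)) / 2 = (1 + B) / 2 * q" if "q > 0" for q :: real
        using that by (simp add: field_simps)
      from this[OF pos] have eq: "(1 / sqrt A * A + B / (1 / sqrt A)) / 2 = (1 + B) / 2 * sqrt A"
        using A by simp
      have "1 / sqrt A > 0" using pos by simp
      from bd[OF this] show ?thesis unfolding nrm eq .
    qed
  qed
  show thesis
  proof (rule that[of "(1 + B) / 2"])
    show "(1 + B) / 2 > 0" using B by simp
    fix u v :: "'a distr" assume "u \<in> sobolev s" "v \<in> sobolev s"
    then obtain h k where "sobolev_transform s u h" "sobolev_transform s v k" unfolding sobolev_def by auto
    from main[OF sobolev_transform_diff[OF this]]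
    show "cmod (u f - v f) \<le> (1 + B) / 2 * sobolev_norm s (distr_diff u v)" by (simp add: distr_diff_def)
  qed
qed

lemma space_sobolev_borel: "space (sobolev_borel s) = sobolev s"
  unfolding sobolev_borel_def by (rule space_measure_of) auto

text \<open>Evaluation at a test function is continuous for the Sobolev seminorm, and the sigma algebra
  is generated by the sets that are open for this seminorm.\<close>

lemma sobolev_pairing_measurable:
  assumes f: "test_function UNIV f"
  shows "(\<lambda>u. u f) \<in> borel_measurable (sobolev_borel s)"
proof (rule borel_measurableI)
  fix S :: "complex set" assume S: "open S"
  obtain c where c: "c > 0" and bd: "\<And>u v. u \<in> sobolev s \<Longrightarrow> v \<in> sobolev s \<Longrightarrow>
      cmod (u f - v f) \<le> c * sobolev_norm s (distr_diff u v)"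
    using sobolev_norm_controls_pairing[OF f] by blast
  let ?V = "{u \<in> sobolev s. u f \<in> S}"
  have "\<exists>r>0. \<forall>v\<in>sobolev s. sobolev_norm s (distr_diff v u) < r \<longrightarrow> v \<in> ?V" if u: "u \<in> ?V" for u
  proof -
    obtain e where e: "e > 0" "\<And>z. dist z (u f) < e \<Longrightarrow> z \<in> S"
      using S u unfolding open_dist by blast
    have "v \<in> ?V" if v: "v \<in> sobolev s" "sobolev_norm s (distr_diff v u) < e / c" for v
    proof -
      have "cmod (v f - u f) \<le> c * sobolev_norm s (distr_diff v u)" using bd v u by blast
      also have "\<dots> < e" using v(2) c by (simp add: field_simps)
      finally show ?thesis using v e(2) by (simp add: dist_norm)
    qed
    then show ?thesis using e(1) c by (intro exI[of _ "e / c"]) auto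
  qed
  then have "?V \<in> sets (sobolev_borel s)"
    unfolding sobolev_borel_def by (subst sets_measure_of) (auto intro!: sigma_sets.Basic)
  also have "?V = (\<lambda>u. u f) -` S \<inter> space (sobolev_borel s)" unfolding space_sobolev_borel by auto
  finally show "(\<lambda>u. u f) -` S \<inter> space (sobolev_borel s) \<in> sets (sobolev_borel s)" .
qed

text \<open>Linearity is read off from the integral representation of the pairing.\<close>

lemma sobolev_linear:
  assumes u: "u \<in> sobolev s" and f: "test_function UNIV f" and g: "test_function UNIV g"
  shows "u (\<lambda>x. a * f x + b * g x) = a * u f + b * u g"
proof -
  obtain h where h: "sobolev_transform s u h" using u unfolding sobolev_def by auto
  have int: "integrable lborel (\<lambda>\<xi>. h \<xi> * ifourier f \<xi>)" if "test_function UNIV f" for f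
    by (rule sobolev_transform_pairing(1)[OF h ifourier_schwartz[OF that] zero_less_one])
  have t: "test_function UNIV (\<lambda>x. a * f x + b * g x)"
    by (intro test_add test_times_const f g)
  have "ifourier (\<lambda>x. a * f x + b * g x) \<xi> = a * ifourier f \<xi> + b * ifourier g \<xi>" for \<xi>
  proof -
    have i: "integrable lborel (\<lambda>x. cis (2 * pi * (x \<bullet> \<xi>)) * f x)" if "test_function UNIV f" for f :: "'a \<Rightarrow> complex"
      by (rule integrable_cis_mult[OF test_integrable[OF that]]) simp
    have "cis (2 * pi * (x \<bullet> \<xi>)) * (a * f x + b * g x) =
        a * (cis (2 * pi * (x \<bullet> \<xi>)) * f x) + b * (cis (2 * pi * (x \<bullet> \<xi>)) * g x)" for x
      by (simp add: algebra_simps)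
    then show ?thesis unfolding ifourier_def using i[OF f] i[OF g] by simp
  qed
  then have "h \<xi> * ifourier (\<lambda>x. a * f x + b * g x) \<xi> = a * (h \<xi> * ifourier f \<xi>) + b * (h \<xi> * ifourier g \<xi>)" for \<xi>
    by (simp add: algebra_simps)
  then show ?thesis
    unfolding sobolev_transform_apply[OF h f] sobolev_transform_apply[OF h g] sobolev_transform_apply[OF h t]
    using int[OF f] int[OF g] by simp
qed

lemma sobolev_linear_sum:
  fixes f :: "'i \<Rightarrow> 'a::euclidean_space \<Rightarrow> complex"
  assumes u: "u \<in> sobolev s" and "finite I" and f: "\<And>i. i \<in> I \<Longrightarrow> test_function UNIV (f i)"
  shows "u (\<lambda>x. \<Sum>i\<in>I. c i * f i x) = (\<Sum>i\<in>I. c i * u (f i))"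
  using assms(2,3)
proof (induction I rule: finite_induct)
  case empty
  show ?case using sobolev_linear[OF u test_zero test_zero, of 0 0] by simp
next
  case (insert i I)
  have "test_function UNIV (\<lambda>x. \<Sum>i\<in>I. c i * f i x)"
    using insert by (intro test_sum test_times_const) auto
  from sobolev_linear[OF u insert.prems[of i] this, of "c i" 1] insert show ?case by simp
qed

lemma ifourier_translate:
  fixes k :: "'a::euclidean_space \<Rightarrow> complex"
  assumes k: "test_function UNIV k"
  shows "ifourier (\<lambda>y. k (x - y)) \<xi> = cis (2 * pi * (x \<bullet> \<xi>)) * ifourier (\<lambda>y. k (- y)) \<xi>"
proof -
  have [measurable]: "k \<in> borel_measurable borel" using k test_smooth smooth_borel by blast
  have "ifourier (\<lambda>y. k (x - y)) \<xi> = (\<integral>z. cis (2 * pi * ((x + z) \<bullet> \<xi>)) * k (- z) \<partial>lborel)"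
    unfolding ifourier_def
    using integral_affine[of "\<lambda>y. cis (2 * pi * (y \<bullet> \<xi>)) * k (x - y)" 1 x] by simp
  also have "\<dots> = (\<integral>z. cis (2 * pi * (x \<bullet> \<xi>)) * (cis (2 * pi * (z \<bullet> \<xi>)) * k (- z)) \<partial>lborel)"
    by (simp add: inner_add_left distrib_left cis_mult[symmetric] mult.assoc)
  also have "\<dots> = cis (2 * pi * (x \<bullet> \<xi>)) * ifourier (\<lambda>y. k (- y)) \<xi>"
    unfolding ifourier_def by (rule integral_mult_right_zero)
  finally show ?thesis .
qed

lemma test_reflect: "test_function UNIV k \<Longrightarrow> test_function UNIV (\<lambda>y. k (x - y))"
  using test_affine[of k "-1" x] by simp

text \<open>Translating the test function multiplies its inverse transform by a phase, so continuity follows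
  by dominated convergence. This gives the mollified field continuous sample paths.\<close>

lemma sobolev_translate_continuous:
  fixes k :: "'a::euclidean_space \<Rightarrow> complex"
  assumes u: "u \<in> sobolev s" and k: "test_function UNIV k"
  shows "continuous_on UNIV (\<lambda>x. u (\<lambda>y. k (x - y)))"
proof -
  obtain h where h: "sobolev_transform s u h" using u unfolding sobolev_def by auto
  let ?K = "ifourier (\<lambda>y. k (- y))"
  have tK: "test_function UNIV (\<lambda>y. k (- y))" using test_reflect[OF k, of 0] by simp
  have int: "integrable lborel (\<lambda>\<xi>. h \<xi> * ?K \<xi>)"
    by (rule sobolev_transform_pairing(1)[OF h ifourier_schwartz[OF tK] zero_less_one])
  have [measurable]: "(\<lambda>\<xi>. h \<xi> * ?K \<xi>) \<in> borel_measurable borel" using int by simp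
  have eq: "u (\<lambda>y. k (x - y)) = (\<integral>\<xi>. cis (2 * pi * (x \<bullet> \<xi>)) * (h \<xi> * ?K \<xi>) \<partial>lborel)" for x
    unfolding sobolev_transform_apply[OF h test_reflect[OF k]] ifourier_translate[OF k]
    by (simp add: mult_ac)
  show ?thesis
    unfolding continuous_on_sequentially comp_def eq
  proof (intro allI ballI impI)
    fix X and x :: 'a assume X: "(\<forall>n. X n \<in> UNIV) \<and> X \<longlonglongrightarrow> x"
    show "(\<lambda>n. \<integral>\<xi>. cis (2 * pi * (X n \<bullet> \<xi>)) * (h \<xi> * ?K \<xi>) \<partial>lborel) \<longlonglongrightarrow>
        (\<integral>\<xi>. cis (2 * pi * (x \<bullet> \<xi>)) * (h \<xi> * ?K \<xi>) \<partial>lborel)"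
    proof (rule integral_dominated_convergence[where w="\<lambda>\<xi>. norm (h \<xi> * ?K \<xi>)"])
      have c: "continuous_on UNIV cis" by (intro continuous_intros)
      show "AE \<xi> in lborel. (\<lambda>n. cis (2 * pi * (X n \<bullet> \<xi>)) * (h \<xi> * ?K \<xi>))
          \<longlonglongrightarrow> cis (2 * pi * (x \<bullet> \<xi>)) * (h \<xi> * ?K \<xi>)"
        by (intro AE_I2 tendsto_intros continuous_on_tendsto_compose[OF c]) (use X in auto)
      show "integrable lborel (\<lambda>\<xi>. norm (h \<xi> * ?K \<xi>))" using int by (rule integrable_norm)
    qed (auto simp: norm_mult)
  qed
qed

text \<open>Joint measurability of a Caratheodory function: approximate the second variable by
  a lattice point, so that only countably many sections occur.\<close>

lemma borel_measurable_caratheodory: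
  fixes F :: "'w \<Rightarrow> 'a::euclidean_space \<Rightarrow> 'b::metric_space"
  assumes meas: "\<And>x. (\<lambda>\<omega>. F \<omega> x) \<in> borel_measurable M"
    and cont: "\<And>\<omega>. \<omega> \<in> space M \<Longrightarrow> continuous_on UNIV (F \<omega>)"
  shows "(\<lambda>(\<omega>, x). F \<omega> x) \<in> borel_measurable (M \<Otimes>\<^sub>M borel)"
proof -
  define q where "q n x = (\<lambda>b\<in>Basis. \<lfloor>real (Suc n) * (x \<bullet> b)\<rfloor>)" for n and x :: 'a
  define z where "z n a = (\<Sum>b\<in>Basis. (of_int (a b) / real (Suc n)) *\<^sub>R b)" for n and a :: "'a \<Rightarrow> int"
  let ?I = "(\<Pi>\<^sub>E b\<in>(Basis::'a set). (UNIV :: int set))"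
  have cI: "countable ?I" by (intro countable_PiE) auto
  have qm: "q n \<in> measurable borel (count_space ?I)" for n
  proof (subst measurable_count_space_eq_countable[OF cI], intro conjI ballI)
    show "q n \<in> space borel \<rightarrow> ?I" unfolding q_def by auto
    fix a assume a: "a \<in> ?I"
    have "q n -` {a} \<inter> space borel = {x. \<forall>b\<in>Basis. \<lfloor>real (Suc n) * (x \<bullet> b)\<rfloor> = a b}"
      using a unfolding q_def by (auto simp: fun_eq_iff restrict_def PiE_def extensional_def)
    also have "\<dots> \<in> sets borel" by measurable
    finally show "q n -` {a} \<inter> space borel \<in> sets borel" .
  qed
  have lim: "(\<lambda>n. z n (q n x)) \<longlonglongrightarrow> x" for x
  proof (rule Lim_null_comparison[where g="\<lambda>n. 1 / real (Suc n) * DIM('a)", THEN LIM_zero_cancel], rule always_eventually, rule allI)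
    fix n
    have "z n (q n x) - x = (\<Sum>b\<in>Basis. (of_int \<lfloor>real (Suc n) * (x \<bullet> b)\<rfloor> / real (Suc n) - x \<bullet> b) *\<^sub>R b)"
      unfolding z_def q_def by (simp add: scaleR_diff_left sum_subtractf euclidean_representation)
    also have "norm \<dots> \<le> (\<Sum>b\<in>(Basis::'a set). 1 / real (Suc n))"
    proof (rule sum_norm_le)
      fix b :: 'a assume b: "b \<in> Basis"
      have "\<bar>of_int \<lfloor>real (Suc n) * (x \<bullet> b)\<rfloor> - real (Suc n) * (x \<bullet> b)\<bar> \<le> 1" by linarith
      then have "\<bar>(of_int \<lfloor>real (Suc n) * (x \<bullet> b)\<rfloor> - real (Suc n) * (x \<bullet> b)) / real (Suc n)\<bar> \<le> 1 / real (Suc n)"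
        unfolding abs_divide by (intro frac_le) auto
      then have "\<bar>of_int \<lfloor>real (Suc n) * (x \<bullet> b)\<rfloor> / real (Suc n) - x \<bullet> b\<bar> \<le> 1 / real (Suc n)"
        by (simp add: diff_divide_distrib del: of_nat_Suc)
      then show "norm ((of_int \<lfloor>real (Suc n) * (x \<bullet> b)\<rfloor> / real (Suc n) - x \<bullet> b) *\<^sub>R b) \<le> 1 / real (Suc n)"
        using b by simp
    qed
    finally show "norm (z n (q n x) - x) \<le> 1 / real (Suc n) * DIM('a)" by simp
  next
    show "(\<lambda>n. 1 / real (Suc n) * DIM('a)) \<longlonglongrightarrow> 0"
      by (rule tendsto_mult_left_zero) (rule LIMSEQ_Suc[OF lim_1_over_n])
  qed
  have m: "(\<lambda>(\<omega>, x). F \<omega> (z n (q n x))) \<in> borel_measurable (M \<Otimes>\<^sub>M borel)" for n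
    unfolding case_prod_beta
    by (rule measurable_compose_countable'[where f="\<lambda>a p. F (fst p) (z n a)" and g="\<lambda>p. q n (snd p)", OF _ _ cI])
       (auto intro: measurable_compose[OF measurable_fst meas] measurable_compose[OF measurable_snd qm])
  show ?thesis
  proof (rule borel_measurable_LIMSEQ_metric[OF m])
    fix p :: "'w \<times> 'a" assume p: "p \<in> space (M \<Otimes>\<^sub>M borel)"
    then have "continuous_on UNIV (F (fst p))" using cont by (auto simp: space_pair_measure)
    then show "(\<lambda>n. case p of (\<omega>, x) \<Rightarrow> F \<omega> (z n (q n x))) \<longlonglongrightarrow> (case p of (\<omega>, x) \<Rightarrow> F \<omega> x)"
      unfolding case_prod_beta by (intro continuous_on_tendsto_compose[OF _ lim]) auto
  qed
qed

section \<open>Coulomb energies and greedy matchings\<close>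

text \<open>The energy, without self interactions, of positive charges at the points \<open>x i\<close> and negative charges at the points
  \<open>y j\<close> when equal charges repel each other through the kernel \<open>C\<close>.\<close>

definition coulomb_energy ::
  "('p \<Rightarrow> 'p \<Rightarrow> real) \<Rightarrow> ('i \<Rightarrow> 'p) \<Rightarrow> ('j \<Rightarrow> 'p) \<Rightarrow> 'i set \<Rightarrow> 'j set \<Rightarrow> real" where
  "coulomb_energy C x y I J =
     (\<Sum>i\<in>I. \<Sum>i'\<in>I - {i}. C (x i) (x i')) / 2 + (\<Sum>j\<in>J. \<Sum>j'\<in>J - {j}. C (y j) (y j')) / 2
     - (\<Sum>i\<in>I. \<Sum>j\<in>J. C (x i) (y j))"

lemma sum_ordered_pairs_remove:
  fixes c :: "'i \<Rightarrow> 'i \<Rightarrow> real"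
  assumes I: "finite I" "k \<in> I" and sym: "\<And>i. i \<in> I \<Longrightarrow> c i k = c k i"
  shows "(\<Sum>i\<in>I. \<Sum>i'\<in>I - {i}. c i i') =
    (\<Sum>i\<in>I - {k}. \<Sum>i'\<in>I - {k} - {i}. c i i') + 2 * (\<Sum>i\<in>I - {k}. c k i)"
proof -
  have "(\<Sum>i'\<in>I - {i}. c i i') = c i k + (\<Sum>i'\<in>I - {k} - {i}. c i i')" if "i \<in> I - {k}" for i
  proof -
    have "I - {i} - {k} = I - {k} - {i}" by auto
    then show ?thesis using that I sum.remove[of "I - {i}" k "c i"] by auto
  qed
  then have "(\<Sum>i\<in>I - {k}. \<Sum>i'\<in>I - {i}. c i i') =
      (\<Sum>i\<in>I - {k}. c i k) + (\<Sum>i\<in>I - {k}. \<Sum>i'\<in>I - {k} - {i}. c i i')"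
    by (simp add: sum.distrib)
  moreover have "(\<Sum>i\<in>I - {k}. c i k) = (\<Sum>i\<in>I - {k}. c k i)" using sym by (intro sum.cong) auto
  ultimately show ?thesis using sum.remove[OF I, of "\<lambda>i. \<Sum>i'\<in>I - {i}. c i i'"] by simp
qed

text \<open>Match a pair of opposite charges with the strongest interaction and remove it. By the approximate
  ultrametric inequality for \<open>- C\<close>, the attraction of any other charge to one member of this pair exceeds its
  repulsion from the other member by at most \<open>\<kappa>\<close>: apart from its own interaction, the pair contributes at most \<open>\<kappa>\<close> to \<open>- coulomb_energy\<close>
  for each remaining charge. Once the negative charges are exhausted, the repulsion of the
  others is bounded below by \<open>low\<close>.\<close>

lemma greedy_matching_bound:
  fixes C :: "'p \<Rightarrow> 'p \<Rightarrow> real" and x :: "'i \<Rightarrow> 'p" and y :: "'j \<Rightarrow> 'p"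
  assumes sym: "\<And>a b. a \<in> A \<Longrightarrow> b \<in> A \<Longrightarrow> C a b = C b a"
    and tri: "\<And>a b c. a \<in> A \<Longrightarrow> b \<in> A \<Longrightarrow> c \<in> A \<Longrightarrow> - C a c \<le> \<kappa> + max (- C a b) (- C b c)"
    and low: "\<And>a b. a \<in> A \<Longrightarrow> b \<in> A \<Longrightarrow> - \<kappa>' \<le> C a b"
    and \<kappa>: "\<kappa> \<ge> 0" "\<kappa>' \<ge> 0"
    and fin: "finite I" "finite J" and card: "card J \<le> card I" and A: "x ` I \<subseteq> A" "y ` J \<subseteq> A"
  shows "\<exists>\<sigma>. inj_on \<sigma> J \<and> \<sigma> ` J \<subseteq> I \<and>
    - coulomb_energy C x y I J \<le> (2 * \<kappa> + \<kappa>') * (real (card I))\<^sup>2 + (\<Sum>j\<in>J. C (x (\<sigma> j)) (y j))"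
  using fin card A
proof (induction "card J" arbitrary: I J)
  case 0
  then have J: "J = {}" by simp
  have "- (\<Sum>i\<in>I. \<Sum>i'\<in>I - {i}. C (x i) (x i')) \<le> (\<Sum>i\<in>I. \<Sum>i'\<in>I - {i}. \<kappa>')"
    unfolding sum_negf[symmetric] using 0(5) by (intro sum_mono) (auto intro!: low[THEN minus_le_iff[THEN iffD1]])
  also have "\<dots> \<le> (\<Sum>i\<in>I. \<Sum>i'\<in>I. \<kappa>')"
    using 0(2) \<kappa> by (intro sum_mono sum_mono2) auto
  also have "\<dots> = \<kappa>' * (real (card I))\<^sup>2" by (simp add: power2_eq_square)
  finally have "- coulomb_energy C x y I J \<le> \<kappa>' * (real (card I))\<^sup>2 / 2"
    unfolding coulomb_energy_def J by simp
  also have "\<dots> \<le> (2 * \<kappa> + \<kappa>') * (real (card I))\<^sup>2"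
    using \<kappa> by (simp add: distrib_right)
  finally show ?case unfolding J by (intro exI[of _ undefined]) simp
next
  case (Suc n)
  have JI: "J \<noteq> {}" "I \<noteq> {}" using Suc(2,5) by auto
  \<comment> \<open>\<open>(i0, j0)\<close> is the pair with the strongest interaction.\<close>
  let ?F = "\<lambda>(i, j). C (x i) (y j)"
  have "finite (?F ` (I \<times> J))" "?F ` (I \<times> J) \<noteq> {}" using JI Suc(3,4) by auto
  then have "Max (?F ` (I \<times> J)) \<in> ?F ` (I \<times> J)" by (rule Max_in)
  then obtain q where q: "Max (?F ` (I \<times> J)) = ?F q" "q \<in> I \<times> J" by (rule imageE)
  obtain i0 j0 where "q = (i0, j0)" by (cases q)
  with q have ij: "i0 \<in> I" "j0 \<in> J" and mx': "?F (i0, j0) = Max (?F ` (I \<times> J))" by auto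
  have mx: "C (x i) (y j) \<le> C (x i0) (y j0)" if "i \<in> I" "j \<in> J" for i j
  proof -
    have "?F (i, j) \<in> ?F ` (I \<times> J)" using that by (intro imageI) simp
    from Max_ge[OF _ this] Suc(3,4) show ?thesis unfolding mx'[symmetric] by simp
  qed
  let ?I = "I - {i0}" and ?J = "J - {j0}"
  have cards: "card ?J = n" "card ?I = card I - 1" "card ?J \<le> card ?I"
    using Suc ij by auto
  have "\<exists>\<sigma>. inj_on \<sigma> ?J \<and> \<sigma> ` ?J \<subseteq> ?I \<and>
    - coulomb_energy C x y ?I ?J \<le> (2 * \<kappa> + \<kappa>') * (real (card ?I))\<^sup>2 + (\<Sum>j\<in>?J. C (x (\<sigma> j)) (y j))"
    by (rule Suc(1)) (use Suc(3-) cards in auto)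
  then obtain \<sigma> where \<sigma>: "inj_on \<sigma> ?J" "\<sigma> ` ?J \<subseteq> ?I"
    "- coulomb_energy C x y ?I ?J \<le> (2 * \<kappa> + \<kappa>') * (real (card ?I))\<^sup>2 + (\<Sum>j\<in>?J. C (x (\<sigma> j)) (y j))"
    by blast
  have inA: "x i \<in> A" "y j \<in> A" if "i \<in> I" "j \<in> J" for i j using Suc(6,7) that by auto
  have xs: "C (x i) (x k) = C (x k) (x i)" if "i \<in> I" "k \<in> I" for i k
    using sym inA that ij by blast
  have ys: "C (y i) (y k) = C (y k) (y i)" if "i \<in> J" "k \<in> J" for i k
    using sym inA that ij by blast
  have cross: "(\<Sum>i\<in>I. \<Sum>j\<in>J. C (x i) (y j)) = (\<Sum>i\<in>?I. \<Sum>j\<in>?J. C (x i) (y j))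
      + (\<Sum>i\<in>?I. C (x i) (y j0)) + (\<Sum>j\<in>?J. C (x i0) (y j)) + C (x i0) (y j0)"
    using Suc(3,4) ij by (simp add: sum.remove[of J j0] sum.remove[of I i0] sum.distrib)
  have ex: "(\<Sum>i\<in>I. \<Sum>i'\<in>I - {i}. C (x i) (x i')) =
      (\<Sum>i\<in>?I. \<Sum>i'\<in>?I - {i}. C (x i) (x i')) + 2 * (\<Sum>i\<in>?I. C (x i0) (x i))"
    by (rule sum_ordered_pairs_remove[OF \<open>finite I\<close> ij(1)]) (use xs ij in blast)
  have ey: "(\<Sum>j\<in>J. \<Sum>j'\<in>J - {j}. C (y j) (y j')) =
      (\<Sum>j\<in>?J. \<Sum>j'\<in>?J - {j}. C (y j) (y j')) + 2 * (\<Sum>j\<in>?J. C (y j0) (y j))"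
    by (rule sum_ordered_pairs_remove[OF \<open>finite J\<close> ij(2)]) (use ys ij in blast)
  \<comment> \<open>The two sums pair each remaining charge with both members of the removed pair.\<close>
  have split: "- coulomb_energy C x y I J = - coulomb_energy C x y ?I ?J + C (x i0) (y j0)
      + (\<Sum>i\<in>?I. C (x i) (y j0) - C (x i0) (x i)) + (\<Sum>j\<in>?J. C (x i0) (y j) - C (y j0) (y j))"
    unfolding coulomb_energy_def cross ex ey
    by (simp add: sum_subtractf field_simps)
  have "(\<Sum>i\<in>?I. C (x i) (y j0) - C (x i0) (x i)) \<le> (\<Sum>i\<in>?I. \<kappa>)"
  proof (rule sum_mono)
    fix i assume i: "i \<in> ?I"
    have "- C (x i0) (x i) \<le> \<kappa> + max (- C (x i0) (y j0)) (- C (y j0) (x i))"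
      using i ij by (intro tri inA) auto
    moreover have "C (y j0) (x i) = C (x i) (y j0)" using i ij by (intro sym inA) auto
    moreover have "C (x i) (y j0) \<le> C (x i0) (y j0)" using i ij by (intro mx) auto
    ultimately show "C (x i) (y j0) - C (x i0) (x i) \<le> \<kappa>" by simp
  qed
  moreover have "(\<Sum>j\<in>?J. C (x i0) (y j) - C (y j0) (y j)) \<le> (\<Sum>j\<in>?J. \<kappa>)"
  proof (rule sum_mono)
    fix j assume j: "j \<in> ?J"
    have "- C (y j0) (y j) \<le> \<kappa> + max (- C (y j0) (x i0)) (- C (x i0) (y j))"
      using j ij by (intro tri inA) auto
    moreover have "C (y j0) (x i0) = C (x i0) (y j0)" using ij by (intro sym inA) auto
    moreover have "C (x i0) (y j) \<le> C (x i0) (y j0)" using j ij by (intro mx) auto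
    ultimately show "C (x i0) (y j) - C (y j0) (y j) \<le> \<kappa>" by simp
  qed
  moreover have "(\<Sum>j\<in>?J. \<kappa>) \<le> (\<Sum>i\<in>?I. \<kappa>)"
    using cards(3) \<kappa> by (simp add: mult_right_mono)
  ultimately have "- coulomb_energy C x y I J \<le> (2 * \<kappa> + \<kappa>') * (real (card ?I))\<^sup>2
      + (\<Sum>j\<in>?J. C (x (\<sigma> j)) (y j)) + C (x i0) (y j0) + 2 * \<kappa> * real (card ?I)"
    using \<sigma>(3) unfolding split sum_constant by (simp only: mult.commute[of _ \<kappa>] mult.assoc)
  also have "\<dots> \<le> (2 * \<kappa> + \<kappa>') * (real (card I))\<^sup>2 + ((\<Sum>j\<in>?J. C (x (\<sigma> j)) (y j)) + C (x i0) (y j0))"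
  proof -
    have I: "real (card I) = real (card ?I) + 1" using cards(2) JI(2) Suc(3) by (simp add: card_gt_0_iff of_nat_diff Suc_leI)
    have "2 * \<kappa> * real (card ?I) \<le> (2 * \<kappa> + \<kappa>') * (2 * real (card ?I) + 1)"
      using \<kappa> by (intro mult_mono) auto
    then show ?thesis unfolding I by (simp add: power2_eq_square algebra_simps)
  qed
  also have "(\<Sum>j\<in>?J. C (x (\<sigma> j)) (y j)) + C (x i0) (y j0) = (\<Sum>j\<in>J. C (x ((\<sigma>(j0 := i0)) j)) (y j))"
    using Suc(4) ij by (simp add: sum.remove[of J j0])
  finally show ?case
    using \<sigma>(1,2) ij by (intro exI[of _ "\<sigma>(j0 := i0)"]) (auto simp: inj_on_def)
qed

section \<open>Riesz kernels in expanding polar coordinates\<close>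

definition shell :: "'a::euclidean_space set" where "shell = {b. 1 \<le> norm b \<and> norm b \<le> 2}"

text \<open>Lebesgue measure on \<open>{0<..} \<times> shell\<close>. A shell of positive thickness replaces the unit sphere,
  so that only Lebesgue measure is needed for polar coordinates.\<close>

definition polar_measure :: "(real \<times> 'a::euclidean_space) measure" where
  "polar_measure = density lborel (indicator ({0<..} \<times> shell))"

text \<open>The exponent \<open>1 / t\<close> is chosen so that the radial variable \<open>s\<close> measures mass: the kernel
  \<open>|y - x| powr (t - d)\<close> gives the ball of radius \<open>r\<close> a mass proportional to \<open>r powr t\<close>.\<close>

definition polar_point :: "real \<Rightarrow> 'a::euclidean_space \<Rightarrow> real \<times> 'a \<Rightarrow> 'a" where
  "polar_point t x p = x + (fst p powr (1 / t)) *\<^sub>R snd p"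

text \<open>The normalisation that turns the Riesz kernel of order \<open>t\<close> into the image of the polar measure
  (\<open>nn_integral_riesz_polar\<close>).\<close>

definition riesz_const :: "real \<Rightarrow> real \<Rightarrow> real" where
  "riesz_const d t = (2 powr (d - t) - 1) * t / (d - t)"

lemma riesz_const_pos: "0 < t \<Longrightarrow> t < d \<Longrightarrow> riesz_const d t > 0"
  unfolding riesz_const_def using powr_less_mono[of 0 "d - t" 2] by simp

lemma shell_borel[measurable]: "shell \<in> sets borel"
  unfolding shell_def by measurable

lemma polar_point_measurable[measurable]: "polar_point t x \<in> borel_measurable borel"
proof -
  have "polar_point t x \<in> borel_measurable (borel \<Otimes>\<^sub>M borel)"
    unfolding polar_point_def[abs_def] by measurable
  then show ?thesis unfolding borel_prod .
qed

lemma polar_region_borel[measurable]: "{0<..} \<times> shell \<in> sets (borel :: (real \<times> 'a::euclidean_space) measure)"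
  by (intro borel_Times) auto

lemma product_sigma_finite_lborel: "product_sigma_finite (\<lambda>_. lborel)"
  by standard

lemma distr_PiM_componentwise:
  assumes J: "finite J" and N: "\<And>j. sigma_finite_measure (N j)" and T: "\<And>j. T j \<in> measurable (N j) (L j)"
    and D: "\<And>j. sigma_finite_measure (distr (N j) (L j) (T j))"
  shows "distr (PiM J N) (PiM J L) (\<lambda>\<omega>. \<lambda>j\<in>J. T j (\<omega> j)) = PiM J (\<lambda>j. distr (N j) (L j) (T j))"
proof -
  interpret N: product_sigma_finite N using N by (simp add: product_sigma_finite_def)
  interpret D: product_sigma_finite "\<lambda>j. distr (N j) (L j) (T j)" using D by (simp add: product_sigma_finite_def)
  note T[measurable]
  have m: "(\<lambda>\<omega>. \<lambda>j\<in>J. T j (\<omega> j)) \<in> measurable (PiM J N) (PiM J L)" by measurable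
  show ?thesis
  proof (rule D.PiM_eqI[OF J])
    show "sets (distr (PiM J N) (PiM J L) (\<lambda>\<omega>. \<lambda>j\<in>J. T j (\<omega> j))) = sets (PiM J (\<lambda>j. distr (N j) (L j) (T j)))"
      by (simp cong: sets_PiM_cong)
    fix A assume A: "\<And>i. i \<in> J \<Longrightarrow> A i \<in> sets (distr (N i) (L i) (T i))"
    then have A': "\<And>i. i \<in> J \<Longrightarrow> A i \<in> sets (L i)" by simp
    have pre: "(\<lambda>\<omega>. \<lambda>j\<in>J. T j (\<omega> j)) -` Pi\<^sub>E J A \<inter> space (PiM J N) = Pi\<^sub>E J (\<lambda>j. T j -` A j \<inter> space (N j))"
      by (auto simp: space_PiM PiE_iff)
    have "emeasure (distr (PiM J N) (PiM J L) (\<lambda>\<omega>. \<lambda>j\<in>J. T j (\<omega> j))) (Pi\<^sub>E J A) =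
        emeasure (PiM J N) (Pi\<^sub>E J (\<lambda>j. T j -` A j \<inter> space (N j)))"
      unfolding pre[symmetric] by (rule emeasure_distr[OF m]) (intro sets_PiM_I_finite J A')
    also have "\<dots> = (\<Prod>j\<in>J. emeasure (N j) (T j -` A j \<inter> space (N j)))"
      using T A' by (intro N.emeasure_PiM J) (auto intro: measurable_sets)
    also have "\<dots> = (\<Prod>j\<in>J. emeasure (distr (N j) (L j) (T j)) (A j))"
      using A' by (intro prod.cong) (auto simp: emeasure_distr[OF T])
    finally show "emeasure (distr (PiM J N) (PiM J L) (\<lambda>\<omega>. \<lambda>j\<in>J. T j (\<omega> j))) (Pi\<^sub>E J A) =
        (\<Prod>j\<in>J. emeasure (distr (N j) (L j) (T j)) (A j))" .
  qed
qed

lemma PiM_density_componentwise: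
  fixes w :: "'i \<Rightarrow> 'a \<Rightarrow> ennreal"
  assumes J: "finite J" and M: "\<And>j. sigma_finite_measure (M j)" and w[measurable]: "\<And>j. w j \<in> borel_measurable (M j)"
    and D: "\<And>j. sigma_finite_measure (density (M j) (w j))"
  shows "PiM J (\<lambda>j. density (M j) (w j)) = density (PiM J M) (\<lambda>x. \<Prod>j\<in>J. w j (x j))"
proof -
  interpret M: product_sigma_finite M using M by (simp add: product_sigma_finite_def)
  interpret D: product_sigma_finite "\<lambda>j. density (M j) (w j)" using D by (simp add: product_sigma_finite_def)
  show ?thesis
  proof (rule D.PiM_eqI[OF J, symmetric])
    show "sets (density (PiM J M) (\<lambda>x. \<Prod>j\<in>J. w j (x j))) = sets (PiM J (\<lambda>j. density (M j) (w j)))"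
      by (simp cong: sets_PiM_cong)
    fix A assume "\<And>i. i \<in> J \<Longrightarrow> A i \<in> sets (density (M i) (w i))"
    then have A[measurable]: "\<And>i. i \<in> J \<Longrightarrow> A i \<in> sets (M i)" by simp
    have "emeasure (density (PiM J M) (\<lambda>x. \<Prod>j\<in>J. w j (x j))) (Pi\<^sub>E J A) =
        (\<integral>\<^sup>+x. (\<Prod>j\<in>J. w j (x j)) * indicator (Pi\<^sub>E J A) x \<partial>PiM J M)"
      using A J by (intro emeasure_density sets_PiM_I_finite borel_measurable_prod_ennreal) auto
    also have "\<dots> = (\<integral>\<^sup>+x. (\<Prod>j\<in>J. w j (x j) * indicator (A j) (x j)) \<partial>PiM J M)"
    proof (rule nn_integral_cong)
      fix x assume "x \<in> space (PiM J M)"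
      then have "indicator (Pi\<^sub>E J A) x = (\<Prod>j\<in>J. indicator (A j) (x j) :: ennreal)"
        using J by (auto simp: indicator_def PiE_iff space_PiM)
      then show "(\<Prod>j\<in>J. w j (x j)) * indicator (Pi\<^sub>E J A) x = (\<Prod>j\<in>J. w j (x j) * indicator (A j) (x j))"
        by (simp add: prod.distrib)
    qed
    also have "\<dots> = (\<Prod>j\<in>J. \<integral>\<^sup>+x. w j x * indicator (A j) x \<partial>M j)"
      by (intro M.product_nn_integral_prod J) measurable
    also have "\<dots> = (\<Prod>j\<in>J. emeasure (density (M j) (w j)) (A j))"
      using A by (intro prod.cong) (auto simp: emeasure_density)
    finally show "emeasure (density (PiM J M) (\<lambda>x. \<Prod>j\<in>J. w j (x j))) (Pi\<^sub>E J A) =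
        (\<Prod>j\<in>J. emeasure (density (M j) (w j)) (A j))" .
  qed
qed

lemma powr_le_powr_iff:
  fixes a b t :: real
  assumes "0 < t" "0 < a" "0 < b"
  shows "a \<le> b \<longleftrightarrow> a powr t \<le> b powr t"
  using assms powr_mono2[of t a b] powr_less_mono2[of t b a] by force

text \<open>The interval consists of the radial variables \<open>s\<close> for which a point at distance \<open>r\<close> from
  the centre is reached from the shell, that is \<open>s powr (1 / t) \<le> r \<le> 2 * s powr (1 / t)\<close>; the
  power of \<open>s\<close> is the Jacobian of the scaling.\<close>

lemma nn_integral_riesz_interval:
  assumes t: "0 < t" "t < d" and r: "r > 0"
  shows "(\<integral>\<^sup>+s. ennreal (s powr (- d / t)) * indicator {(r / 2) powr t..r powr t} s \<partial>lborel)
    = ennreal (riesz_const d t * r powr (t - d))"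
proof -
  let ?F = "\<lambda>s. - (t / (d - t)) * s powr (1 - d / t)"
  have ne: "1 - d / t \<noteq> 0" using t by (simp add: field_simps)
  have le: "(r / 2) powr t \<le> r powr t" using r t by (intro powr_mono2) auto
  have pos: "(r / 2) powr t > 0" using r by simp
  have "(\<integral>\<^sup>+s. ennreal (s powr (- d / t)) * indicator {(r / 2) powr t..r powr t} s \<partial>lborel)
     = ennreal (?F (r powr t) - ?F ((r / 2) powr t))"
  proof (rule nn_integral_FTC_Icc[OF _ _ _ le])
    fix s assume s: "s \<in> {(r / 2) powr t..r powr t}"
    then have "s > 0" using pos by (meson atLeastAtMost_iff less_le_trans)
    then have "(?F has_real_derivative - (t / (d - t)) * ((1 - d / t) * s powr (1 - d / t - 1))) (at s)"
      using t by (auto intro!: derivative_eq_intros)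
    moreover have "- (t / (d - t)) * ((1 - d / t) * s powr (1 - d / t - 1)) = s powr (- d / t)"
      using t by (simp add: field_simps)
    ultimately show "(?F has_real_derivative s powr (- d / t)) (at s)" by simp
  qed auto
  also have "?F (r powr t) - ?F ((r / 2) powr t) = riesz_const d t * r powr (t - d)"
  proof -
    have e: "t * (1 - d / t) = t - d" using t by (simp add: field_simps)
    have "(r / 2) powr (t - d) = r powr (t - d) * 2 powr (d - t)"
    proof -
      have "2 powr (d - t) = inverse (2 powr (t - d))" by (metis minus_diff_eq powr_minus)
      moreover have "(r / 2) powr (t - d) = r powr (t - d) / 2 powr (t - d)"
        using r by (intro powr_divide)
      ultimately show ?thesis by (simp only: divide_inverse)
    qed
    moreover have "- (t / (d - t)) * p - - (t / (d - t)) * (p * q) = (q - 1) * t / (d - t) * p" for p q :: real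
      by (simp add: algebra_simps diff_divide_distrib)
    ultimately show ?thesis unfolding powr_powr e riesz_const_def by (simp only:)
  qed
  finally show ?thesis .
qed

lemma nn_integral_polar_measure:
  fixes \<phi> :: "real \<times> 'a::euclidean_space \<Rightarrow> ennreal"
  assumes [measurable]: "\<phi> \<in> borel_measurable borel"
  shows "(\<integral>\<^sup>+p. \<phi> p \<partial>polar_measure) =
    (\<integral>\<^sup>+s. indicator {0<..} s * (\<integral>\<^sup>+b. indicator shell b * \<phi> (s, b) \<partial>lborel) \<partial>lborel)"
proof -
  have "(\<integral>\<^sup>+p. \<phi> p \<partial>polar_measure) = (\<integral>\<^sup>+p. indicator ({0<..} \<times> shell) p * \<phi> p \<partial>(lborel \<Otimes>\<^sub>M lborel))"
    unfolding polar_measure_def lborel_prod by (subst nn_integral_density) auto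
  also have "\<dots> = (\<integral>\<^sup>+s. (\<integral>\<^sup>+b. indicator ({0<..} \<times> shell) (s, b) * \<phi> (s, b) \<partial>lborel) \<partial>lborel)"
  proof (rule lborel.nn_integral_fst[symmetric])
    show "(\<lambda>p. indicator ({0<..} \<times> shell) p * \<phi> p) \<in> borel_measurable (lborel \<Otimes>\<^sub>M lborel)"
      unfolding lborel_prod by measurable
  qed
  also have "\<dots> = (\<integral>\<^sup>+s. indicator {0<..} s * (\<integral>\<^sup>+b. indicator shell b * \<phi> (s, b) \<partial>lborel) \<partial>lborel)"
    by (intro nn_integral_cong) (auto simp: indicator_times nn_integral_cmult[symmetric] mult.assoc)
  finally show ?thesis .
qed

text \<open>For fixed \<open>s\<close> the substitution \<open>y = x + s powr (1 / t) b\<close> is affine in \<open>b\<close>; exchanging the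
  integrals leaves the integral over \<open>s\<close> that is computed in \<open>nn_integral_riesz_interval\<close>. The measure on
  the left does not depend on \<open>t\<close>, which is what makes the limit \<open>t \<rightarrow> 0\<close> accessible to
  dominated convergence.\<close>

lemma nn_integral_riesz_polar:
  fixes \<phi> :: "'a::euclidean_space \<Rightarrow> ennreal"
  assumes [measurable]: "\<phi> \<in> borel_measurable borel" and t: "0 < t" "t < real DIM('a)"
  shows "(\<integral>\<^sup>+p. \<phi> (polar_point t x p) \<partial>polar_measure) =
    (\<integral>\<^sup>+y. ennreal (riesz_const (real DIM('a)) t * norm (y - x) powr (t - real DIM('a))) * \<phi> y \<partial>lborel)"
proof -
  let ?d = "real DIM('a)"
  have inner: "indicator {0<..} s * (\<integral>\<^sup>+b. indicator shell b * \<phi> (x + (s powr (1 / t)) *\<^sub>R b) \<partial>lborel) =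
     (\<integral>\<^sup>+y. indicator {0<..} s * (ennreal (s powr (- ?d / t)) * indicator {s powr (1 / t)..2 * s powr (1 / t)} (norm (y - x)) * \<phi> y) \<partial>lborel)"
    for s
  proof (cases "s > 0")
    case True
    define c where "c = s powr (1 / t)"
    have c: "c > 0" using True unfolding c_def by simp
    have cd: "ennreal (s powr (- ?d / t)) * ennreal (c ^ DIM('a)) = 1"
    proof -
      have "c ^ DIM('a) = s powr (?d / t)" unfolding c_def using True by (simp add: powr_powr flip: powr_realpow)
      then have "s powr (- ?d / t) * c ^ DIM('a) = 1" using True by (simp flip: powr_add)
      then show ?thesis by (subst ennreal_mult[symmetric]) (use c in auto)
    qed
    have "(\<integral>\<^sup>+y. ennreal (s powr (- ?d / t)) * indicator {c..2 * c} (norm (y - x)) * \<phi> y \<partial>lborel) =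
      ennreal (c ^ DIM('a)) * (\<integral>\<^sup>+b. ennreal (s powr (- ?d / t)) * indicator {c..2 * c} (norm (x + c *\<^sub>R b - x)) * \<phi> (x + c *\<^sub>R b) \<partial>lborel)"
      using c by (subst nn_integral_affine[of _ c x]) auto
    also have "\<dots> = (\<integral>\<^sup>+b. (ennreal (s powr (- ?d / t)) * ennreal (c ^ DIM('a))) * (indicator {c..2 * c} (norm (x + c *\<^sub>R b - x)) * \<phi> (x + c *\<^sub>R b)) \<partial>lborel)"
      by (subst nn_integral_cmult[symmetric]) (auto intro!: nn_integral_cong simp: mult_ac)
    also have "\<dots> = (\<integral>\<^sup>+b. indicator shell b * \<phi> (x + c *\<^sub>R b) \<partial>lborel)"
      unfolding cd using c by (intro nn_integral_cong) (auto simp: indicator_def shell_def)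
    finally show ?thesis using True unfolding c_def by simp
  qed simp
  have swap: "(\<integral>\<^sup>+s. indicator {0<..} s * (ennreal (s powr (- ?d / t)) * indicator {s powr (1 / t)..2 * s powr (1 / t)} (norm (y - x)) * \<phi> y) \<partial>lborel)
     = ennreal (riesz_const ?d t * norm (y - x) powr (t - ?d)) * \<phi> y" for y
  proof (cases "y = x")
    case True
    have z: "indicator {0<..} s * (ennreal (s powr (- ?d / t)) * indicator {s powr (1 / t)..2 * s powr (1 / t)} (norm (y - x)) * \<phi> y) = 0" for s :: real
      unfolding True by (auto simp: indicator_def)
    show ?thesis unfolding z using True by simp
  next
    case False
    define r where "r = norm (y - x)"
    have r: "r > 0" using False unfolding r_def by simp
    have iff: "s > 0 \<and> s powr (1 / t) \<le> r \<and> r \<le> 2 * s powr (1 / t) \<longleftrightarrow> (r / 2) powr t \<le> s \<and> s \<le> r powr t" for s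
    proof (cases "s > 0")
      case True
      have "s powr (1 / t) \<le> r \<longleftrightarrow> s \<le> r powr t"
      proof -
        have "s powr (1 / t) \<le> r \<longleftrightarrow> (s powr (1 / t)) powr t \<le> r powr t"
          using r t True by (intro powr_le_powr_iff) auto
        then show ?thesis using True t by (simp add: powr_powr)
      qed
      moreover have "r / 2 \<le> s powr (1 / t) \<longleftrightarrow> (r / 2) powr t \<le> s"
      proof -
        have "r / 2 \<le> s powr (1 / t) \<longleftrightarrow> (r / 2) powr t \<le> (s powr (1 / t)) powr t"
          using r t True by (intro powr_le_powr_iff) auto
        then show ?thesis using True t by (simp add: powr_powr)
      qed
      ultimately show ?thesis using True by auto
    next
      case False
      moreover have "(r / 2) powr t > 0" using r by simp
      ultimately show ?thesis by linarith
    qed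
    have "(\<integral>\<^sup>+s. indicator {0<..} s * (ennreal (s powr (- ?d / t)) * indicator {s powr (1 / t)..2 * s powr (1 / t)} r * \<phi> y) \<partial>lborel)
      = (\<integral>\<^sup>+s. ennreal (s powr (- ?d / t)) * indicator {(r / 2) powr t..r powr t} s * \<phi> y \<partial>lborel)"
      using iff by (intro nn_integral_cong) (auto simp: indicator_def)
    also have "\<dots> = ennreal (riesz_const ?d t * r powr (t - ?d)) * \<phi> y"
      by (subst nn_integral_multc) (simp, simp only: nn_integral_riesz_interval[OF t r])
    finally show ?thesis unfolding r_def .
  qed
  have "(\<integral>\<^sup>+p. \<phi> (polar_point t x p) \<partial>polar_measure) =
    (\<integral>\<^sup>+s. indicator {0<..} s * (\<integral>\<^sup>+b. indicator shell b * \<phi> (x + (s powr (1 / t)) *\<^sub>R b) \<partial>lborel) \<partial>lborel)"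
  proof -
    have m: "(\<lambda>p. \<phi> (polar_point t x p)) \<in> borel_measurable borel" by measurable
    show ?thesis unfolding nn_integral_polar_measure[OF m] by (simp add: polar_point_def)
  qed
  also have "\<dots> = (\<integral>\<^sup>+y. (\<integral>\<^sup>+s. indicator {0<..} s * (ennreal (s powr (- ?d / t)) * indicator {s powr (1 / t)..2 * s powr (1 / t)} (norm (y - x)) * \<phi> y) \<partial>lborel) \<partial>lborel)"
    unfolding inner by (rule lborel_pair.Fubini') (simp add: indicator_def cong: if_cong)
  finally show ?thesis unfolding swap .
qed


lemma sigma_finite_density_ennreal:
  assumes "f \<in> borel_measurable borel"
  shows "sigma_finite_measure (density lborel (\<lambda>x. ennreal (f x)))"
  using assms by (subst sigma_finite_measure.sigma_finite_iff_density_finite[OF sigma_finite_lborel]) auto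

lemma sigma_finite_polar_measure: "sigma_finite_measure (polar_measure :: (real \<times> 'a::euclidean_space) measure)"
  unfolding polar_measure_def
  by (subst sigma_finite_measure.sigma_finite_iff_density_finite[OF sigma_finite_lborel]) (auto simp: indicator_def)

lemma distr_polar_point:
  fixes x :: "'a::euclidean_space"
  assumes t: "0 < t" "t < real DIM('a)"
  shows "distr polar_measure lborel (polar_point t x) =
    density lborel (\<lambda>y. ennreal (riesz_const (real DIM('a)) t * norm (y - x) powr (t - real DIM('a))))"
proof (rule measure_eqI)
  fix A :: "'a set" assume "A \<in> sets (distr polar_measure lborel (polar_point t x))"
  then have A[measurable]: "A \<in> sets borel" by simp
  have m: "polar_point t x \<in> measurable polar_measure lborel"
    unfolding polar_measure_def by simp
  have "emeasure (distr polar_measure lborel (polar_point t x)) A = (\<integral>\<^sup>+p. indicator A (polar_point t x p) \<partial>polar_measure)"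
    using nn_integral_distr[OF m, of "indicator A"] by simp
  also have "\<dots> = emeasure (density lborel (\<lambda>y. ennreal (riesz_const (real DIM('a)) t * norm (y - x) powr (t - real DIM('a))))) A"
    by (subst nn_integral_riesz_polar[OF _ t]) (auto simp: emeasure_density)
  finally show "emeasure (distr polar_measure lborel (polar_point t x)) A =
    emeasure (density lborel (\<lambda>y. ennreal (riesz_const (real DIM('a)) t * norm (y - x) powr (t - real DIM('a))))) A" .
qed simp

text \<open>Componentwise transport of the polar measure: the form in which the change of variables is
  applied to all negative charges at once.\<close>

lemma PiM_polar_points:
  fixes x :: "'i \<Rightarrow> 'a::euclidean_space"
  assumes J: "finite J" and t: "0 < t" "t < real DIM('a)"
  shows "distr (PiM J (\<lambda>_. polar_measure)) (PiM J (\<lambda>_. lborel)) (\<lambda>\<omega>. \<lambda>j\<in>J. polar_point t (x j) (\<omega> j)) =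
    density (PiM J (\<lambda>_. lborel))
      (\<lambda>y. \<Prod>j\<in>J. ennreal (riesz_const (real DIM('a)) t * norm (y j - x j) powr (t - real DIM('a))))"
proof -
  have m: "polar_point t z \<in> measurable polar_measure lborel" for z :: 'a
    unfolding polar_measure_def by simp
  let ?w = "\<lambda>j y. ennreal (riesz_const (real DIM('a)) t * norm (y - x j) powr (t - real DIM('a)))"
  have sf: "sigma_finite_measure (density lborel (?w j))" for j
    by (rule sigma_finite_density_ennreal) measurable
  have "distr (PiM J (\<lambda>_. polar_measure)) (PiM J (\<lambda>_. lborel)) (\<lambda>\<omega>. \<lambda>j\<in>J. polar_point t (x j) (\<omega> j)) =
      PiM J (\<lambda>j. distr polar_measure lborel (polar_point t (x j)))"
    by (rule distr_PiM_componentwise[OF J sigma_finite_polar_measure m])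
       (simp add: distr_polar_point[OF t] sf)
  also have "\<dots> = PiM J (\<lambda>j. density lborel (?w j))" by (simp add: distr_polar_point[OF t])
  also have "\<dots> = density (PiM J (\<lambda>_. lborel)) (\<lambda>y. \<Prod>j\<in>J. ?w j (y j))"
    by (rule PiM_density_componentwise[OF J sigma_finite_lborel _ sf]) measurable
  finally show ?thesis .
qed

text \<open>A point of the ball is only reached from radial variables \<open>s \<le> D powr t\<close>, as shell points have norm at
  least one.\<close>

lemma riesz_potential_bound:
  fixes x :: "'a::euclidean_space"
  assumes t: "0 < t" "t < real DIM('a)" and D: "D > 0"
  shows "(\<integral>\<^sup>+y. ennreal (norm (y - x) powr (t - real DIM('a))) * indicator (cball x D) y \<partial>lborel)
    \<le> ennreal (D powr t / riesz_const (real DIM('a)) t * measure lborel (shell :: 'a set))"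
proof -
  let ?c = "riesz_const (real DIM('a)) t"
  have c: "?c > 0" by (rule riesz_const_pos[OF t])
  have [measurable]: "cball x D \<in> sets borel" by simp
  have fin: "emeasure lborel (shell :: 'a set) = ennreal (measure lborel (shell :: 'a set))"
  proof (rule emeasure_eq_ennreal_measure)
    have "bounded (shell :: 'a set)" unfolding shell_def bounded_iff by auto
    then show "emeasure lborel (shell :: 'a set) \<noteq> top" using emeasure_bounded_finite by fastforce
  qed
  have le: "indicator {0<..} s * (indicator shell b * indicator (cball x D) (polar_point t x (s, b)))
      \<le> (indicator {0..D powr t} s * indicator shell b :: ennreal)" for s and b :: 'a
  proof (cases "s > 0 \<and> b \<in> shell \<and> norm ((s powr (1 / t)) *\<^sub>R b) \<le> D")
    case True
    then have "s powr (1 / t) * 1 \<le> s powr (1 / t) * norm b" unfolding shell_def by (intro mult_left_mono) auto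
    also have "\<dots> \<le> D" using True by simp
    finally have "s powr (1 / t) \<le> D" by simp
    then have "(s powr (1 / t)) powr t \<le> D powr t" using t by (intro powr_mono2) auto
    then show ?thesis using True t by (auto simp: powr_powr indicator_def)
  next
    case False
    then show ?thesis by (auto simp: indicator_def polar_point_def dist_norm)
  qed
  have "ennreal ?c * (\<integral>\<^sup>+y. ennreal (norm (y - x) powr (t - real DIM('a))) * indicator (cball x D) y \<partial>lborel)
     = (\<integral>\<^sup>+y. ennreal (?c * norm (y - x) powr (t - real DIM('a))) * indicator (cball x D) y \<partial>lborel)"
  proof -
    have m: "(\<lambda>y. ennreal (norm (y - x) powr (t - real DIM('a))) * indicator (cball x D) y) \<in> borel_measurable lborel"
      by measurable
    show ?thesis
      unfolding nn_integral_cmult[OF m, symmetric] using c by (simp add: ennreal_mult mult.assoc)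
  qed
  also have "\<dots> = (\<integral>\<^sup>+p. indicator (cball x D) (polar_point t x p) \<partial>polar_measure)"
    by (rule nn_integral_riesz_polar[OF _ t, symmetric]) simp
  also have "\<dots> = (\<integral>\<^sup>+s. (\<integral>\<^sup>+b. indicator {0<..} s * (indicator shell b * indicator (cball x D) (polar_point t x (s, b))) \<partial>lborel) \<partial>lborel)"
    by (subst nn_integral_polar_measure) (auto simp: nn_integral_cmult)
  also have "\<dots> \<le> (\<integral>\<^sup>+s. (\<integral>\<^sup>+b. indicator {0..D powr t} s * indicator (shell :: 'a set) b \<partial>lborel) \<partial>lborel)"
    by (intro nn_integral_mono le)
  also have "\<dots> = ennreal (D powr t) * emeasure lborel (shell :: 'a set)"
    by (simp add: nn_integral_cmult nn_integral_multc)
  also have "\<dots> = ennreal ?c * ennreal (D powr t / ?c * measure lborel (shell :: 'a set))"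
    unfolding fin using c by (simp add: ennreal_mult[symmetric])
  finally show ?thesis
    using c by (simp add: ennreal_mult_le_mult_iff)
qed

section \<open>The mollified field and its covariance\<close>

text \<open>An integrable power majorises the logarithmic singularity, so that the estimates for Riesz
  kernels apply to it.\<close>

lemma abs_ln_le: "(u::real) \<ge> 0 \<Longrightarrow> \<bar>ln u\<bar> \<le> u + 2 * u powr (- (1/2))"
proof (cases "u = 0")
  case False
  assume "u \<ge> 0"
  then have u: "u > 0" using False by simp
  have 1: "ln u \<le> u" using ln_le_minus_one[OF u] by simp
  have "ln (u powr (- (1/2))) \<le> u powr (- (1/2)) - 1" using u by (intro ln_le_minus_one) simp
  then have "- ln u \<le> 2 * u powr (- (1/2))" using u by (simp add: ln_powr)
  moreover have "u powr (- (1/2)) \<ge> 0" by simp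
  ultimately show ?thesis using 1 u by linarith
qed simp

text \<open>A log-correlated field together with a compact subset \<open>K\<close> of the domain that is to contain the
  support of the test function. Near \<open>K\<close> the function \<open>g\<close> is bounded and
  mollification does not see the boundary of \<open>U\<close>.\<close>

locale log_field =
  fixes U :: "'a::euclidean_space set" and g :: "'a \<Rightarrow> 'a \<Rightarrow> real"
    and M :: "'w measure" and X :: "'w \<Rightarrow> 'a distr" and \<eta> :: "'a \<Rightarrow> real" and K :: "'a set"
  assumes U_open: "open U" and g_cont: "continuous_on (U \<times> U) (\<lambda>(x, y). g x y)"
    and prob: "prob_space M" and field: "log_correlated_field M (log_kernel U g) X"
    and moll: "mollifier \<eta>" and K: "compact K" "K \<subseteq> U"
begin

abbreviation "C \<equiv> log_kernel U g"

sublocale prob_space M by (rule prob)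

lemma eta: "test_function UNIV \<eta>" "\<eta> x \<ge> 0" "(\<integral>x. \<eta> x \<partial>lborel) = 1" "integrable lborel \<eta>"
  "\<eta> x \<noteq> 0 \<Longrightarrow> norm x < 1" "\<eta> \<in> borel_measurable borel"
proof -
  show "test_function UNIV \<eta>" using moll unfolding mollifier_def by simp
  then show "integrable lborel \<eta>" "\<eta> \<in> borel_measurable borel"
    using test_integrable test_smooth smooth_borel by blast+
  have "{x. \<eta> x \<noteq> 0} \<subseteq> ball 0 1"
    using moll closure_subset[of "{x. \<eta> x \<noteq> 0}"] unfolding mollifier_def support_def by (meson order_trans)
  then show "\<eta> x \<noteq> 0 \<Longrightarrow> norm x < 1" by (simp add: subset_iff)
  show "\<eta> x \<ge> 0" "(\<integral>x. \<eta> x \<partial>lborel) = 1" using moll unfolding mollifier_def by blast+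
qed

lemma eta_borel[measurable]: "\<eta> \<in> borel_measurable borel" by (rule eta(6))

definition bump :: "real \<Rightarrow> 'a \<Rightarrow> 'a \<Rightarrow> real" where
  "bump \<epsilon> x y = rescale \<eta> \<epsilon> (x - y)"

text \<open>The mollified field as a real random function; it is also defined off \<open>U\<close>.\<close>

definition fld :: "real \<Rightarrow> 'w \<Rightarrow> 'a \<Rightarrow> real" where
  "fld \<epsilon> \<omega> x = Re (X \<omega> (\<lambda>y. of_real (bump \<epsilon> x y)))"

definition cov :: "real \<Rightarrow> 'a \<Rightarrow> 'a \<Rightarrow> real" where
  "cov \<epsilon> x y = (\<integral>\<omega>. fld \<epsilon> \<omega> x * fld \<epsilon> \<omega> y \<partial>M)"

lemma rescale_test:
  assumes "\<epsilon> > 0"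
  shows "test_function UNIV (rescale \<eta> \<epsilon>)"
proof -
  have "test_function UNIV (\<lambda>x. \<eta> (0 + inverse \<epsilon> *\<^sub>R x))"
    using assms by (intro test_affine eta(1)) simp
  then have "test_function UNIV (\<lambda>x. inverse (\<epsilon> ^ DIM('a)) *\<^sub>R \<eta> (0 + inverse \<epsilon> *\<^sub>R x))"
    by (rule test_linear[OF bounded_linear_scaleR_right])
  then show ?thesis unfolding rescale_def[abs_def] by (simp add: field_simps)
qed

lemma bump_test: "\<epsilon> > 0 \<Longrightarrow> test_function UNIV (bump \<epsilon> x)"
  unfolding bump_def[abs_def] by (intro test_reflect rescale_test)

lemma of_real_test: "test_function UNIV f \<Longrightarrow> test_function UNIV (\<lambda>x. complex_of_real (f x))"
  by (rule test_linear[OF bounded_linear_of_real])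

lemma X_sobolev: "\<omega> \<in> space M \<Longrightarrow> X \<omega> \<in> sobolev (- 1)"
proof -
  assume "\<omega> \<in> space M"
  moreover have "X \<in> measurable M (sobolev_borel (- 1))"
    using field unfolding log_correlated_field_def by (metis zero_less_one)
  ultimately have "X \<omega> \<in> space (sobolev_borel (- 1))" by (rule measurable_space[rotated])
  then show ?thesis unfolding space_sobolev_borel .
qed

lemma X_real: "\<omega> \<in> space M \<Longrightarrow> test_function UNIV f \<Longrightarrow>
    X \<omega> (\<lambda>x. of_real (f x)) = of_real (Re (X \<omega> (\<lambda>x. of_real (f x))))"
  using field unfolding log_correlated_field_def by (metis of_real_Re)

lemma X_gaussian: "test_function UNIV f \<Longrightarrow> centered_gaussian M (\<lambda>\<omega>. Re (X \<omega> (\<lambda>x. of_real (f x))))"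
  using field unfolding log_correlated_field_def by blast

lemma X_fld: "\<omega> \<in> space M \<Longrightarrow> \<epsilon> > 0 \<Longrightarrow> X \<omega> (\<lambda>y. of_real (bump \<epsilon> x y)) = of_real (fld \<epsilon> \<omega> x)"
  unfolding fld_def by (rule X_real[OF _ bump_test])

lemma log_kernel_measurable[measurable]: "(\<lambda>p. C (fst p) (snd p)) \<in> borel_measurable (borel \<Otimes>\<^sub>M borel)"
proof -
  have o: "open (U \<times> U)" using U_open by (simp add: open_Times)
  have [measurable]: "(\<lambda>p. if p \<in> U \<times> U then (\<lambda>(x, y). g x y) p else 0) \<in> borel_measurable (borel :: ('a \<times> 'a) measure)"
    using o by (intro borel_measurable_continuous_on_if g_cont continuous_on_const) auto
  have [measurable]: "(\<lambda>p. norm (fst p - snd p)) \<in> borel_measurable (borel :: ('a \<times> 'a) measure)"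
    by (intro borel_measurable_continuous_onI continuous_intros)
  have [measurable]: "U \<times> U \<in> sets (borel :: ('a \<times> 'a) measure)" using o by simp
  have "(\<lambda>p. C (fst p) (snd p)) = (\<lambda>p. indicator (U \<times> U) p * ln (inverse (norm (fst p - snd p)))
      + (if p \<in> U \<times> U then (\<lambda>(x, y). g x y) p else 0))"
    by (auto simp: log_kernel_def indicator_def fun_eq_iff)
  also have "\<dots> \<in> borel_measurable borel" by measurable
  finally show ?thesis unfolding borel_prod .
qed

lemma log_kernel_measurable1[measurable]: "C x \<in> borel_measurable borel"
  using measurable_compose[OF measurable_Pair1' log_kernel_measurable, of x] by simp

lemma log_kernel_measurable2[measurable (raw)]:
  assumes [measurable]: "a \<in> borel_measurable N" "b \<in> borel_measurable N"
  shows "(\<lambda>x. C (a x) (b x)) \<in> borel_measurable N"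
  using measurable_compose[OF measurable_Pair[OF assms] log_kernel_measurable] by simp

text \<open>The variables are rescaled to the support of \<open>\<eta>\<close>, so that the domain of averaging is independent
  of \<open>\<epsilon>\<close>.\<close>

lemma cov_eq_integral:
  assumes \<epsilon>: "\<epsilon> > 0"
  shows "cov \<epsilon> x y = (\<integral>a. (\<integral>b. C (x - \<epsilon> *\<^sub>R a) (y - \<epsilon> *\<^sub>R b) * \<eta> b \<partial>lborel) * \<eta> a \<partial>lborel)"
proof -
  have [measurable]: "bump \<epsilon> z \<in> borel_measurable borel" for z
    using bump_test[OF \<epsilon>] test_smooth smooth_borel by blast
  have scal: "bump \<epsilon> z (z - \<epsilon> *\<^sub>R a) = \<eta> a / \<epsilon> ^ DIM('a)" for z a
    using \<epsilon> unfolding bump_def rescale_def by simp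
  have "complex_of_real (cov \<epsilon> x y) = (\<integral>\<omega>. X \<omega> (\<lambda>z. of_real (bump \<epsilon> x z)) * X \<omega> (\<lambda>z. of_real (bump \<epsilon> y z)) \<partial>M)"
    unfolding cov_def integral_complex_of_real[symmetric]
    by (intro Bochner_Integration.integral_cong) (auto simp: X_fld[OF _ \<epsilon>])
  also have "\<dots> = of_real (\<integral>u. (\<integral>v. C u v * bump \<epsilon> x u * bump \<epsilon> y v \<partial>lborel) \<partial>lborel)"
    using field bump_test[OF \<epsilon>] unfolding log_correlated_field_def by blast
  finally have "cov \<epsilon> x y = (\<integral>u. (\<integral>v. C u v * bump \<epsilon> x u * bump \<epsilon> y v \<partial>lborel) \<partial>lborel)"
    unfolding of_real_eq_iff .
  also have "\<dots> = (\<integral>u. bump \<epsilon> x u * (\<integral>b. C u (y - \<epsilon> *\<^sub>R b) * \<eta> b \<partial>lborel) \<partial>lborel)"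
  proof (rule Bochner_Integration.integral_cong[OF refl])
    fix u
    have "(\<integral>v. C u v * bump \<epsilon> x u * bump \<epsilon> y v \<partial>lborel) =
      \<bar>- \<epsilon>\<bar> ^ DIM('a) *\<^sub>R (\<integral>b. C u (y + (- \<epsilon>) *\<^sub>R b) * bump \<epsilon> x u * bump \<epsilon> y (y + (- \<epsilon>) *\<^sub>R b) \<partial>lborel)"
      using \<epsilon> by (intro integral_affine) auto
    also have "(\<lambda>b. C u (y + (- \<epsilon>) *\<^sub>R b) * bump \<epsilon> x u * bump \<epsilon> y (y + (- \<epsilon>) *\<^sub>R b)) =
      (\<lambda>b. (bump \<epsilon> x u / \<epsilon> ^ DIM('a)) * (C u (y - \<epsilon> *\<^sub>R b) * \<eta> b))"
      by (simp add: scal field_simps)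
    finally show "(\<integral>v. C u v * bump \<epsilon> x u * bump \<epsilon> y v \<partial>lborel) = bump \<epsilon> x u * (\<integral>b. C u (y - \<epsilon> *\<^sub>R b) * \<eta> b \<partial>lborel)"
      using \<epsilon> by simp
  qed
  also have "\<dots> = \<bar>- \<epsilon>\<bar> ^ DIM('a) *\<^sub>R (\<integral>a. bump \<epsilon> x (x + (- \<epsilon>) *\<^sub>R a) * (\<integral>b. C (x + (- \<epsilon>) *\<^sub>R a) (y - \<epsilon> *\<^sub>R b) * \<eta> b \<partial>lborel) \<partial>lborel)"
    using \<epsilon> by (intro integral_affine) auto
  also have "(\<lambda>a. bump \<epsilon> x (x + (- \<epsilon>) *\<^sub>R a) * (\<integral>b. C (x + (- \<epsilon>) *\<^sub>R a) (y - \<epsilon> *\<^sub>R b) * \<eta> b \<partial>lborel)) =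
     (\<lambda>a. (1 / \<epsilon> ^ DIM('a)) * ((\<integral>b. C (x - \<epsilon> *\<^sub>R a) (y - \<epsilon> *\<^sub>R b) * \<eta> b \<partial>lborel) * \<eta> a))"
    by (simp add: scal mult.commute)
  finally show ?thesis using \<epsilon> by simp
qed

text \<open>Used to average first in one and then in the other variable, so that integrability is only
  needed for one-variable averages.\<close>

lemma double_average_close:
  fixes h :: "'a \<Rightarrow> 'a \<Rightarrow> real"
  assumes meas[measurable]: "(\<lambda>p. h (fst p) (snd p)) \<in> borel_measurable (borel \<Otimes>\<^sub>M borel)"
    and close: "\<And>a. \<eta> a \<noteq> 0 \<Longrightarrow> \<bar>(\<integral>b. h a b * \<eta> b \<partial>lborel) - c\<bar> \<le> e"
  shows "\<bar>(\<integral>a. (\<integral>b. h a b * \<eta> b \<partial>lborel) * \<eta> a \<partial>lborel) - c\<bar> \<le> e"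
proof -
  define q where "q a = (\<integral>b. h a b * \<eta> b \<partial>lborel)" for a
  have [measurable]: "q \<in> borel_measurable borel" unfolding q_def by measurable
  have bd: "\<bar>(q a - c) * \<eta> a\<bar> \<le> e * \<eta> a" for a
    using close[of a] eta(2)[of a] unfolding q_def by (cases "\<eta> a = 0") (auto simp: abs_mult mult_right_mono)
  have ie: "integrable lborel (\<lambda>a. e * \<eta> a)" using eta(4) by simp
  have int: "integrable lborel (\<lambda>a. (q a - c) * \<eta> a)"
    by (rule Bochner_Integration.integrable_bound[OF ie]) (use bd in \<open>auto intro: order_trans[OF _ abs_ge_self]\<close>)
  have ic: "integrable lborel (\<lambda>a. c * \<eta> a)" using eta(4) by simp
  have "(\<integral>a. q a * \<eta> a \<partial>lborel) = (\<integral>a. (q a - c) * \<eta> a + c * \<eta> a \<partial>lborel)"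
    by (intro Bochner_Integration.integral_cong) (auto simp: algebra_simps)
  also have "\<dots> = (\<integral>a. (q a - c) * \<eta> a \<partial>lborel) + c"
    using Bochner_Integration.integral_add[OF int ic] eta(3) by simp
  finally have "(\<integral>a. q a * \<eta> a \<partial>lborel) - c = (\<integral>a. (q a - c) * \<eta> a \<partial>lborel)" by simp
  also have "\<bar>\<dots>\<bar> \<le> (\<integral>a. e * \<eta> a \<partial>lborel)"
    using Bochner_Integration.integral_norm_bound_integral[OF int ie] bd by simp
  also have "\<dots> = e" using eta(3) by simp
  finally show ?thesis unfolding q_def .
qed

lemma average_close:
  assumes [measurable]: "h \<in> borel_measurable borel" and int: "integrable lborel (\<lambda>b. w b * \<eta> b)"
    and close: "AE b in lborel. \<eta> b \<noteq> 0 \<longrightarrow> \<bar>h b - c\<bar> \<le> w b"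
  shows "\<bar>(\<integral>b. h b * \<eta> b \<partial>lborel) - c\<bar> \<le> (\<integral>b. w b * \<eta> b \<partial>lborel)"
proof -
  have bd: "AE a in lborel. \<bar>(h a - c) * \<eta> a\<bar> \<le> w a * \<eta> a"
    using close
  proof eventually_elim
    case (elim a)
    then show ?case using eta(2)[of a] by (cases "\<eta> a = 0") (auto simp: abs_mult mult_right_mono)
  qed
  have int1: "integrable lborel (\<lambda>a. (h a - c) * \<eta> a)"
  proof (rule Bochner_Integration.integrable_bound[OF int])
    show "AE a in lborel. norm ((h a - c) * \<eta> a) \<le> norm (w a * \<eta> a)"
      using bd by eventually_elim (simp add: order_trans[OF _ abs_ge_self])
  qed measurable
  have ic: "integrable lborel (\<lambda>a. c * \<eta> a)" using eta(4) by simp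
  have "(\<integral>a. h a * \<eta> a \<partial>lborel) = (\<integral>a. (h a - c) * \<eta> a + c * \<eta> a \<partial>lborel)"
    by (intro Bochner_Integration.integral_cong) (auto simp: algebra_simps)
  also have "\<dots> = (\<integral>a. (h a - c) * \<eta> a \<partial>lborel) + c"
    using Bochner_Integration.integral_add[OF int1 ic] eta(3) by simp
  finally have "(\<integral>a. h a * \<eta> a \<partial>lborel) - c = (\<integral>a. (h a - c) * \<eta> a \<partial>lborel)" by simp
  also have "\<bar>\<dots>\<bar> \<le> (\<integral>a. \<bar>(h a - c) * \<eta> a\<bar> \<partial>lborel)"
    by (rule integral_abs_bound)
  also have "\<dots> \<le> (\<integral>b. w b * \<eta> b \<partial>lborel)"
    by (rule integral_mono_AE[OF integrable_abs[OF int1] int bd])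
  finally show ?thesis .
qed

lemma neighbourhood:
  obtains \<epsilon>0 G where "\<epsilon>0 > 0" "G \<ge> 0"
    "\<And>x y a b. x \<in> K \<Longrightarrow> y \<in> K \<Longrightarrow> norm a \<le> \<epsilon>0 \<Longrightarrow> norm b \<le> \<epsilon>0 \<Longrightarrow>
       x + a \<in> U \<and> y + b \<in> U \<and> \<bar>g (x + a) (y + b)\<bar> \<le> G"
proof -
  have "K \<inter> - U = {}" using K(2) by auto
  then obtain d where d: "d > 0" "\<forall>x\<in>K. \<forall>y\<in>- U. d \<le> dist x y"
    using separate_compact_closed[OF K(1), of "- U"] U_open by auto
  define K' where "K' = {x + y |x y. x \<in> K \<and> y \<in> cball (0::'a) (d / 2)}"
  have cK: "compact K'" unfolding K'_def by (rule compact_sums[OF K(1) compact_cball])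
  have sub: "K' \<subseteq> U"
  proof
    fix z assume "z \<in> K'"
    then obtain x v where z: "z = x + v" "x \<in> K" "norm v \<le> d / 2" unfolding K'_def by auto
    show "z \<in> U"
    proof (rule ccontr)
      assume "z \<notin> U"
      then have "d \<le> dist x z" using d(2) z(2) by auto
      also have "dist x z = norm v" unfolding z(1) by (simp add: dist_norm)
      finally show False using z(3) d(1) by simp
    qed
  qed
  have "compact ((\<lambda>(x, y). g x y) ` (K' \<times> K'))"
    using cK sub by (intro compact_continuous_image continuous_on_subset[OF g_cont] compact_Times) auto
  then have "bounded ((\<lambda>(x, y). g x y) ` (K' \<times> K'))" by (rule compact_imp_bounded)
  then obtain G where G: "G > 0" "\<And>v. v \<in> (\<lambda>(x, y). g x y) ` (K' \<times> K') \<Longrightarrow> norm v \<le> G"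
    unfolding bounded_pos by blast
  have gG: "\<bar>g x y\<bar> \<le> G" if "x \<in> K'" "y \<in> K'" for x y
  proof -
    have "(\<lambda>(x, y). g x y) (x, y) \<in> (\<lambda>(x, y). g x y) ` (K' \<times> K')" using that by (intro imageI) simp
    from G(2)[OF this] show ?thesis by simp
  qed
  show thesis
  proof (rule that[of "d / 2" G])
    fix x y a b :: 'a assume "x \<in> K" "y \<in> K" "norm a \<le> d / 2" "norm b \<le> d / 2"
    then have "x + a \<in> K'" "y + b \<in> K'" unfolding K'_def by auto
    then show "x + a \<in> U \<and> y + b \<in> U \<and> \<bar>g (x + a) (y + b)\<bar> \<le> G" using sub gG by blast
  qed (use d G in auto)
qed

text \<open>If the scale \<open>m\<close> is large compared with \<open>\<epsilon>\<close>, the argument of the singular power stays of order \<open>m\<close>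
  on the support of \<open>\<eta>\<close>. Otherwise \<open>m\<close> and \<open>\<epsilon>\<close> are comparable, and after rescaling the
  integral is a Riesz potential of exponent \<open>-1/2\<close>, bounded uniformly in its centre.\<close>

lemma mollified_singularity_bound:
  obtains L where "L \<ge> 0" "\<And>w \<epsilon> m. \<epsilon> > 0 \<Longrightarrow> \<epsilon> \<le> m \<Longrightarrow> norm w \<le> 2 * m \<Longrightarrow> (4 * \<epsilon> < m \<longrightarrow> m - \<epsilon> \<le> norm w) \<Longrightarrow>
     integrable lborel (\<lambda>b. (norm (w + \<epsilon> *\<^sub>R b) / m) powr (- (1/2)) * \<eta> b) \<and>
     (\<integral>b. (norm (w + \<epsilon> *\<^sub>R b) / m) powr (- (1/2)) * \<eta> b \<partial>lborel) \<le> L"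
proof -
  obtain H where H: "H > 0" "\<And>x. \<bar>\<eta> x\<bar> \<le> H" using test_bounded_above[OF eta(1)] by auto
  \<comment> \<open>The exponent \<open>- 1/2\<close> is \<open>?t - d\<close>.\<close>
  let ?t = "real DIM('a) - 1/2"
  have t: "0 < ?t" "?t < real DIM('a)" 
  proof -
    have "real DIM('a) \<ge> 1" by (simp add: Suc_leI)
    then show "0 < ?t" "?t < real DIM('a)" by linarith+
  qed
  define R where "R = 9 powr ?t / riesz_const (real DIM('a)) ?t * measure lborel (shell :: 'a set)"
  have R: "R \<ge> 0" unfolding R_def using riesz_const_pos[OF t] by simp
  have main: "integrable lborel (\<lambda>b. (norm (w + \<epsilon> *\<^sub>R b) / m) powr (- (1/2)) * \<eta> b) \<and>
     (\<integral>b. (norm (w + \<epsilon> *\<^sub>R b) / m) powr (- (1/2)) * \<eta> b \<partial>lborel) \<le> 2 + 2 * H * R"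
    if e: "\<epsilon> > 0" "\<epsilon> \<le> m" and w: "norm w \<le> 2 * m" "4 * \<epsilon> < m \<longrightarrow> m - \<epsilon> \<le> norm w" for w \<epsilon> m
  proof -
    have m: "m > 0" using e by simp
    let ?u = "\<lambda>b. (norm (w + \<epsilon> *\<^sub>R b) / m) powr (- (1/2)) * \<eta> b"
    have nn: "(\<integral>\<^sup>+b. ennreal (?u b) \<partial>lborel) \<le> ennreal (2 + 2 * H * R)"
    proof (cases "4 * \<epsilon> < m")
      case True
      have "?u b \<le> 2 * \<eta> b" for b
      proof (cases "\<eta> b = 0")
        case False
        then have b: "norm b < 1" by (rule eta(5))
        have "norm w \<le> norm (w + \<epsilon> *\<^sub>R b) + norm (\<epsilon> *\<^sub>R b)" using norm_triangle_ineq4[of "w + \<epsilon> *\<^sub>R b" "\<epsilon> *\<^sub>R b"] by simp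
        moreover have "norm (\<epsilon> *\<^sub>R b) \<le> \<epsilon>" using b e(1) by simp
        ultimately have "m / 2 \<le> norm (w + \<epsilon> *\<^sub>R b)" using w(2) True by linarith
        then have "1 / 2 \<le> norm (w + \<epsilon> *\<^sub>R b) / m" using m by (simp add: field_simps)
        then have "(norm (w + \<epsilon> *\<^sub>R b) / m) powr (- (1/2)) \<le> (1 / 2) powr (- (1/2))"
          by (intro powr_mono2') auto
        also have "\<dots> = sqrt 2" by (simp add: powr_minus powr_half_sqrt real_sqrt_divide)
        also have "\<dots> \<le> 2" by (simp add: real_le_lsqrt)
        finally show ?thesis using eta(2)[of b] by (intro mult_right_mono)
      qed simp
      then have "(\<integral>\<^sup>+b. ennreal (?u b) \<partial>lborel) \<le> (\<integral>\<^sup>+b. ennreal (2 * \<eta> b) \<partial>lborel)"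
        by (intro nn_integral_mono ennreal_leI)
      also have "\<dots> = ennreal 2" using eta(2,3,4) by (subst nn_integral_eq_integral) auto
      also have "\<dots> \<le> ennreal (2 + 2 * H * R)" using H R by (intro ennreal_leI) simp
      finally show ?thesis .
    next
      case False
      let ?z = "- (inverse \<epsilon> *\<^sub>R w)"
      have "?u b \<le> 2 * H * (norm (b - ?z) powr (?t - real DIM('a)) * indicator (cball ?z 9) b)" for b
      proof (cases "\<eta> b = 0")
        case False
        then have b: "norm b < 1" by (rule eta(5))
        have "w + \<epsilon> *\<^sub>R b = \<epsilon> *\<^sub>R (b - ?z)" using e(1) by (simp add: algebra_simps)
        then have eq: "norm (w + \<epsilon> *\<^sub>R b) / m = norm (b - ?z) * (\<epsilon> / m)" using e(1) by simp
        have "(\<epsilon> / m) powr (- (1/2)) \<le> (1 / 4) powr (- (1/2))"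
          using \<open>\<not> 4 * \<epsilon> < m\<close> m by (intro powr_mono2') (auto simp: field_simps)
        also have "(1 / 4 :: real) powr (- (1/2)) = 2"
          by (simp add: powr_minus powr_half_sqrt real_sqrt_divide)
        finally have 1: "(\<epsilon> / m) powr (- (1/2)) \<le> 2" .
        have "norm (inverse \<epsilon> *\<^sub>R w) \<le> 8"
        proof -
          have "norm w \<le> 8 * \<epsilon>" using w(1) \<open>\<not> 4 * \<epsilon> < m\<close> by linarith
          then show ?thesis using e(1) by (simp add: field_simps)
        qed
        then have "b \<in> cball ?z 9"
          using b norm_triangle_ineq4[of ?z b] by (simp add: dist_norm)
        moreover have "norm (b - ?z) powr (- (1/2)) * (\<epsilon> / m) powr (- (1/2)) * \<eta> b \<le> norm (b - ?z) powr (- (1/2)) * 2 * H"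
          using 1 H(2)[of b] eta(2)[of b] by (intro mult_mono) auto
        moreover have "(norm (b - ?z) * (\<epsilon> / m)) powr (- (1/2)) = norm (b - ?z) powr (- (1/2)) * (\<epsilon> / m) powr (- (1/2))"
          by (rule powr_mult)
        ultimately show ?thesis unfolding eq by (simp add: mult_ac)
      qed (use H in simp)
      then have "(\<integral>\<^sup>+b. ennreal (?u b) \<partial>lborel) \<le>
          (\<integral>\<^sup>+b. ennreal (2 * H * (norm (b - ?z) powr (?t - real DIM('a)) * indicator (cball ?z 9) b)) \<partial>lborel)"
        by (intro nn_integral_mono ennreal_leI)
      also have "\<dots> = (\<integral>\<^sup>+b. ennreal (2 * H) * (ennreal (norm (b - ?z) powr (?t - real DIM('a))) * indicator (cball ?z 9) b) \<partial>lborel)"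
        using H by (intro nn_integral_cong) (auto simp: ennreal_mult indicator_def)
      also have "\<dots> = ennreal (2 * H) * (\<integral>\<^sup>+b. ennreal (norm (b - ?z) powr (?t - real DIM('a))) * indicator (cball ?z 9) b \<partial>lborel)"
      proof (rule nn_integral_cmult)
        have [measurable]: "cball ?z 9 \<in> sets borel" by simp
        show "(\<lambda>b. ennreal (norm (b - ?z) powr (?t - real DIM('a))) * indicator (cball ?z 9) b) \<in> borel_measurable lborel"
          by measurable
      qed
      also have "\<dots> \<le> ennreal (2 * H) * ennreal R"
        unfolding R_def by (intro mult_left_mono riesz_potential_bound t) auto
      also have "\<dots> = ennreal (2 * H * R)" using H R by (simp add: ennreal_mult)
      also have "\<dots> \<le> ennreal (2 + 2 * H * R)" using H R by (intro ennreal_leI) simp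
      finally show ?thesis .
    qed
    have u0: "?u b \<ge> 0" for b using eta(2) by simp
    have int: "integrable lborel ?u"
      by (intro integrableI_bounded) (use nn u0 in \<open>auto intro: le_less_trans\<close>)
    then have "ennreal (\<integral>b. ?u b \<partial>lborel) \<le> ennreal (2 + 2 * H * R)"
      using nn u0 by (subst nn_integral_eq_integral[symmetric]) auto
    then have "(\<integral>b. ?u b \<partial>lborel) \<le> 2 + 2 * H * R"
      using H R by (subst (asm) ennreal_le_iff) auto
    with int show ?thesis by blast
  qed
  show thesis by (rule that[OF _ main]) (use H R in auto)
qed

text \<open>Mollification at scale \<open>\<epsilon>\<close> cuts the logarithm off at distance \<open>\<epsilon>\<close>, up to a bounded error that is
  uniform in \<open>\<epsilon>\<close> and in the two points. With \<open>m = max |x - y| \<epsilon>\<close>, the difference of the kernel and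
  \<open>- ln m\<close> is the logarithm of a distance divided by \<open>m\<close> plus a value of \<open>g\<close>, and the average of
  its singularity is bounded by \<open>mollified_singularity_bound\<close>.\<close>

lemma cov_log_bound:
  obtains \<epsilon>0 c where "\<epsilon>0 > 0" "c \<ge> 0"
    "\<And>x y \<epsilon>. x \<in> K \<Longrightarrow> y \<in> K \<Longrightarrow> 0 < \<epsilon> \<Longrightarrow> \<epsilon> \<le> \<epsilon>0 \<Longrightarrow> \<bar>cov \<epsilon> x y + ln (max (norm (x - y)) \<epsilon>)\<bar> \<le> c"
proof -
  obtain \<epsilon>0 G where e0: "\<epsilon>0 > 0" and G: "G \<ge> 0"
    and near: "\<And>x y a b. x \<in> K \<Longrightarrow> y \<in> K \<Longrightarrow> norm a \<le> \<epsilon>0 \<Longrightarrow> norm b \<le> \<epsilon>0 \<Longrightarrow>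
       x + a \<in> U \<and> y + b \<in> U \<and> \<bar>g (x + a) (y + b)\<bar> \<le> G"
    using neighbourhood by blast
  obtain L where L: "L \<ge> 0" "\<And>w \<epsilon> m. \<epsilon> > 0 \<Longrightarrow> \<epsilon> \<le> m \<Longrightarrow> norm w \<le> 2 * m \<Longrightarrow> (4 * \<epsilon> < m \<longrightarrow> m - \<epsilon> \<le> norm w) \<Longrightarrow>
     integrable lborel (\<lambda>b. (norm (w + \<epsilon> *\<^sub>R b) / m) powr (- (1/2)) * \<eta> b) \<and>
     (\<integral>b. (norm (w + \<epsilon> *\<^sub>R b) / m) powr (- (1/2)) * \<eta> b \<partial>lborel) \<le> L"
    using mollified_singularity_bound by blast
  show thesis
  proof (rule that[OF e0, of "3 + G + 2 * L"])
    show "0 \<le> 3 + G + 2 * L" using L G by simp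
    fix x y \<epsilon> assume K': "x \<in> K" "y \<in> K" and e: "0 < \<epsilon>" "\<epsilon> \<le> \<epsilon>0"
    define m where "m = max (norm (x - y)) \<epsilon>"
    have m: "m > 0" "\<epsilon> \<le> m" "norm (x - y) \<le> m" using e unfolding m_def by auto
    have "\<bar>(\<integral>a. (\<integral>b. C (x - \<epsilon> *\<^sub>R a) (y - \<epsilon> *\<^sub>R b) * \<eta> b \<partial>lborel) * \<eta> a \<partial>lborel) - (- ln m)\<bar> \<le> 3 + G + 2 * L"
    proof (rule double_average_close)
      show "(\<lambda>p. C (x - \<epsilon> *\<^sub>R fst p) (y - \<epsilon> *\<^sub>R snd p)) \<in> borel_measurable (borel \<Otimes>\<^sub>M borel)" by measurable
      fix a assume "\<eta> a \<noteq> 0"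
      then have a: "norm a < 1" by (rule eta(5))
      then have ea: "norm (\<epsilon> *\<^sub>R a) \<le> \<epsilon>" using e by simp
      define w where "w = x - y - \<epsilon> *\<^sub>R a"
      let ?u = "\<lambda>b. norm (w + \<epsilon> *\<^sub>R b) / m"
      have w1: "norm w \<le> 2 * m" unfolding w_def
        using norm_triangle_ineq4[of "x - y" "\<epsilon> *\<^sub>R a"] ea m by linarith
      have w2: "4 * \<epsilon> < m \<longrightarrow> m - \<epsilon> \<le> norm w"
      proof
        assume "4 * \<epsilon> < m"
        then have "m = norm (x - y)" using e unfolding m_def by auto
        then show "m - \<epsilon> \<le> norm w" unfolding w_def
          using norm_triangle_ineq2[of "x - y" "\<epsilon> *\<^sub>R a"] ea by linarith
      qed
      note Lw = L(2)[OF e(1) m(2) w1 w2]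
      have i1: "integrable lborel (\<lambda>b. (3 + G) * \<eta> b)" using eta(4) by simp
      have i2: "integrable lborel (\<lambda>b. 2 * (?u b powr (- (1/2)) * \<eta> b))" using Lw by (intro integrable_mult_right) blast
      have weq: "(\<lambda>b. ((3 + G) + 2 * ?u b powr (- (1/2))) * \<eta> b) = (\<lambda>b. (3 + G) * \<eta> b + 2 * (?u b powr (- (1/2)) * \<eta> b))"
        by (simp add: fun_eq_iff algebra_simps)
      have "\<bar>(\<integral>b. C (x - \<epsilon> *\<^sub>R a) (y - \<epsilon> *\<^sub>R b) * \<eta> b \<partial>lborel) - (- ln m)\<bar>
          \<le> (\<integral>b. ((3 + G) + 2 * ?u b powr (- (1/2))) * \<eta> b \<partial>lborel)"
      proof (rule average_close)
        show "integrable lborel (\<lambda>b. ((3 + G) + 2 * ?u b powr (- (1/2))) * \<eta> b)"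
          unfolding weq by (rule Bochner_Integration.integrable_add[OF i1 i2])
        have "\<bar>C (x - \<epsilon> *\<^sub>R a) (y - \<epsilon> *\<^sub>R b) - (- ln m)\<bar> \<le> (3 + G) + 2 * ?u b powr (- (1/2))"
          if b0: "\<eta> b \<noteq> 0" "b \<noteq> - (inverse \<epsilon> *\<^sub>R w)" for b
        proof -
          have b: "norm b < 1" using b0(1) by (rule eta(5))
          then have eb: "norm (\<epsilon> *\<^sub>R b) \<le> \<epsilon>" using e by simp
          have nr: "x - \<epsilon> *\<^sub>R a \<in> U" "y - \<epsilon> *\<^sub>R b \<in> U" "\<bar>g (x - \<epsilon> *\<^sub>R a) (y - \<epsilon> *\<^sub>R b)\<bar> \<le> G"
            using near[OF K', of "- (\<epsilon> *\<^sub>R a)" "- (\<epsilon> *\<^sub>R b)"] ea eb e(2) by auto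
          have diff: "x - \<epsilon> *\<^sub>R a - (y - \<epsilon> *\<^sub>R b) = w + \<epsilon> *\<^sub>R b" unfolding w_def by simp
          have u3: "?u b \<le> 3"
          proof -
            have "norm (w + \<epsilon> *\<^sub>R b) \<le> 3 * m" using norm_triangle_ineq[of w "\<epsilon> *\<^sub>R b"] w1 eb m(2) by linarith
            then show ?thesis using m(1) by (simp add: field_simps)
          qed
          have u0: "?u b \<ge> 0" using m by simp
          have nz: "w + \<epsilon> *\<^sub>R b \<noteq> 0"
          proof
            assume "w + \<epsilon> *\<^sub>R b = 0"
            then have "w = - (\<epsilon> *\<^sub>R b)" by (simp add: add_eq_0_iff2)
            then have "b = - (inverse \<epsilon> *\<^sub>R w)" using e(1) by simp
            then show False using b0(2) by simp
          qed
          have "C (x - \<epsilon> *\<^sub>R a) (y - \<epsilon> *\<^sub>R b) - (- ln m) = - ln (?u b) + g (x - \<epsilon> *\<^sub>R a) (y - \<epsilon> *\<^sub>R b)"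
            using nr nz m(1) unfolding log_kernel_def diff by (simp add: ln_inverse ln_div)
          then show ?thesis using abs_ln_le[OF u0] u3 nr(3) by linarith
        qed
        then show "AE b in lborel. \<eta> b \<noteq> 0 \<longrightarrow> \<bar>C (x - \<epsilon> *\<^sub>R a) (y - \<epsilon> *\<^sub>R b) - (- ln m)\<bar> \<le> (3 + G) + 2 * ?u b powr (- (1/2))"
          using AE_lborel_singleton[of "- (inverse \<epsilon> *\<^sub>R w)"] by (auto elim: eventually_mono)
      qed measurable
      also have "\<dots> = (3 + G) + 2 * (\<integral>b. ?u b powr (- (1/2)) * \<eta> b \<partial>lborel)"
        unfolding weq using Bochner_Integration.integral_add[OF i1 i2] eta(3) by simp
      also have "\<dots> \<le> 3 + G + 2 * L" using Lw by simp
      finally show "\<bar>(\<integral>b. C (x - \<epsilon> *\<^sub>R a) (y - \<epsilon> *\<^sub>R b) * \<eta> b \<partial>lborel) - (- ln m)\<bar> \<le> 3 + G + 2 * L" .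
    qed
    then show "\<bar>cov \<epsilon> x y + ln (max (norm (x - y)) \<epsilon>)\<bar> \<le> 3 + G + 2 * L"
      unfolding cov_eq_integral[OF e(1)] m_def by simp
  qed
qed

end

section \<open>Vertex operators\<close>

lemma scaled_normal_fourier:
  assumes s: "\<sigma> > 0"
  shows "(\<integral>y. normal_density 0 \<sigma> y *\<^sub>R cis y \<partial>lborel) = of_real (exp (- \<sigma>\<^sup>2 / 2))"
proof -
  have "(\<integral>y. normal_density 0 \<sigma> y *\<^sub>R cis y \<partial>lborel) = \<sigma> *\<^sub>R (\<integral>z. normal_density 0 \<sigma> (\<sigma> * z) *\<^sub>R cis (\<sigma> * z) \<partial>lborel)"
    using integral_affine[of "\<lambda>y. normal_density 0 \<sigma> y *\<^sub>R cis y" \<sigma> 0] s by simp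
  also have "\<dots> = (\<integral>z. cis (\<sigma> * z) * of_real (std_normal_density z) \<partial>lborel)"
  proof -
    have "\<sigma> * normal_density 0 \<sigma> (\<sigma> * z) = std_normal_density z" for z
      using s by (simp add: normal_density_def power_mult_distrib real_sqrt_mult field_simps)
    then show ?thesis
      unfolding integral_scaleR_right[symmetric] scaleR_scaleR by (simp add: scaleR_conv_of_real mult.commute)
  qed
  also have "\<dots> = char std_normal_distribution \<sigma>"
    unfolding char_def
    by (subst integral_density)
       (auto simp: cis_conv_exp scaleR_conv_of_real mult.commute intro!: Bochner_Integration.integral_cong)
  finally show ?thesis by (simp add: char_std_normal_distribution)
qed

lemma centered_gaussian_char:
  assumes M: "prob_space M" and G: "centered_gaussian M Y"
  shows "integrable M (\<lambda>\<omega>. (Y \<omega>)\<^sup>2)"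
    and "(\<integral>\<omega>. cis (Y \<omega>) \<partial>M) = of_real (exp (- (\<integral>\<omega>. (Y \<omega>)\<^sup>2 \<partial>M) / 2))"
proof -
  interpret prob_space M by fact
  have [measurable]: "Y \<in> borel_measurable M" using G unfolding centered_gaussian_def by blast
  consider \<sigma> where "\<sigma> > 0" "distributed M lborel Y (normal_density 0 \<sigma>)" | "AE \<omega> in M. Y \<omega> = 0"
    using G unfolding centered_gaussian_def by blast
  then have "integrable M (\<lambda>\<omega>. (Y \<omega>)\<^sup>2) \<and>
    (\<integral>\<omega>. cis (Y \<omega>) \<partial>M) = of_real (exp (- (\<integral>\<omega>. (Y \<omega>)\<^sup>2 \<partial>M) / 2))"
  proof cases
    case 1
    have var: "(\<integral>\<omega>. (Y \<omega>)\<^sup>2 \<partial>M) = \<sigma>\<^sup>2"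
      using normal_distributed_variance[OF 1] normal_distributed_expectation[OF 1] by simp
    have int: "integrable M (\<lambda>\<omega>. (Y \<omega>)\<^sup>2)"
      using integrable_normal_moment[OF 1(1), of 0 2]
        distributed_integrable[OF 1(2), of "\<lambda>y. y\<^sup>2"] by simp
    have "(\<integral>\<omega>. cis (Y \<omega>) \<partial>M) = (\<integral>y. cis y \<partial>distr M lborel Y)"
      by (subst integral_distr) auto
    also have "\<dots> = (\<integral>y. normal_density 0 \<sigma> y *\<^sub>R cis y \<partial>lborel)"
      unfolding distributed_distr_eq_density[OF 1(2)] by (subst integral_density) auto
    also have "\<dots> = of_real (exp (- \<sigma>\<^sup>2 / 2))" by (rule scaled_normal_fourier[OF 1(1)])
    finally show ?thesis using int var by simp
  next
    case 2
    have "(\<integral>\<omega>. (Y \<omega>)\<^sup>2 \<partial>M) = (\<integral>\<omega>. 0 \<partial>M)" by (intro integral_cong_AE) (use 2 in auto)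
    moreover have "(\<integral>\<omega>. cis (Y \<omega>) \<partial>M) = (\<integral>\<omega>. 1 \<partial>M)" by (intro integral_cong_AE) (use 2 in auto)
    moreover have "integrable M (\<lambda>\<omega>. (Y \<omega>)\<^sup>2) \<longleftrightarrow> integrable M (\<lambda>\<omega>. 0::real)"
      by (intro integrable_cong_AE) (use 2 in auto)
    ultimately show ?thesis by (simp add: prob_space)
  qed
  then show "integrable M (\<lambda>\<omega>. (Y \<omega>)\<^sup>2)"
    "(\<integral>\<omega>. cis (Y \<omega>) \<partial>M) = of_real (exp (- (\<integral>\<omega>. (Y \<omega>)\<^sup>2 \<partial>M) / 2))" by auto
qed

context log_field
begin

text \<open>Off the diagonal \<open>C\<close> is continuous, so its averages over shrinking neighbourhoods converge.\<close>

lemma cov_tendsto: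
  assumes xy: "x \<in> K" "y \<in> K" "x \<noteq> y" and \<delta>: "\<And>n. \<delta> n > 0" "\<delta> \<longlonglongrightarrow> 0"
  shows "(\<lambda>n. cov (\<delta> n) x y) \<longlonglongrightarrow> C x y"
proof -
  have U: "(x, y) \<in> U \<times> U" "open (U \<times> U)" using xy K(2) U_open by (auto simp: open_Times)
  have "isCont (\<lambda>(x, y). g x y) (x, y)" using g_cont U continuous_on_eq_continuous_at by blast
  then have "((\<lambda>(x, y). g x y) \<longlongrightarrow> (\<lambda>(x, y). g x y) (x, y)) (nhds (x, y))"
    unfolding isCont_def tendsto_at_iff_tendsto_nhds .
  then have g: "((\<lambda>p. g (fst p) (snd p)) \<longlongrightarrow> g x y) (nhds (x, y))"
    by (simp add: case_prod_beta')
  have 1: "((\<lambda>p. ln (inverse (norm (fst p - snd p))) + g (fst p) (snd p)) \<longlongrightarrow> ln (inverse (norm (fst (x, y) - snd (x, y)))) + g x y) (nhds (x, y))"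
    by (intro tendsto_intros g) (use xy in \<open>auto intro: filterlim_ident\<close>)
  have "((\<lambda>p. C (fst p) (snd p)) \<longlongrightarrow> C x y) (nhds (x, y))"
  proof (rule Lim_transform_eventually[of "\<lambda>p. ln (inverse (norm (fst p - snd p))) + g (fst p) (snd p)"])
    show "\<forall>\<^sub>F p in nhds (x, y). ln (inverse (norm (fst p - snd p))) + g (fst p) (snd p) = C (fst p) (snd p)"
      using eventually_nhds_in_open[OF U(2,1)] by eventually_elim (auto simp: log_kernel_def)
  qed (use 1 U in \<open>simp add: log_kernel_def\<close>)
  then have lim: "\<forall>e>0. \<exists>d>0. \<forall>p. dist p (x, y) < d \<longrightarrow> dist (C (fst p) (snd p)) (C x y) < e"
    unfolding tendsto_iff eventually_nhds_metric by blast
  show ?thesis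
  proof (rule LIMSEQ_I)
    fix e :: real assume e: "e > 0"
    obtain d where d: "d > 0" "\<And>p. dist p (x, y) < d \<Longrightarrow> dist (C (fst p) (snd p)) (C x y) < e / 2"
      using lim e by (meson half_gt_zero)
    obtain N where N: "\<And>n. n \<ge> N \<Longrightarrow> \<bar>\<delta> n\<bar> < d / 2"
      using LIMSEQ_D[OF \<delta>(2), of "d / 2"] d(1) by auto
    show "\<exists>N. \<forall>n\<ge>N. norm (cov (\<delta> n) x y - C x y) < e"
    proof (intro exI allI impI)
      fix n assume n: "n \<ge> N"
      have "\<bar>(\<integral>a. (\<integral>b. C (x - \<delta> n *\<^sub>R a) (y - \<delta> n *\<^sub>R b) * \<eta> b \<partial>lborel) * \<eta> a \<partial>lborel) - C x y\<bar> \<le> e / 2"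
      proof (rule double_average_close)
        show "(\<lambda>p. C (x - \<delta> n *\<^sub>R fst p) (y - \<delta> n *\<^sub>R snd p)) \<in> borel_measurable (borel \<Otimes>\<^sub>M borel)" by measurable
        fix a assume "\<eta> a \<noteq> 0"
        then have a: "norm a < 1" by (rule eta(5))
        have "\<bar>(\<integral>b. C (x - \<delta> n *\<^sub>R a) (y - \<delta> n *\<^sub>R b) * \<eta> b \<partial>lborel) - C x y\<bar> \<le> (\<integral>b. e / 2 * \<eta> b \<partial>lborel)"
        proof (rule average_close)
          show "integrable lborel (\<lambda>b. e / 2 * \<eta> b)" using eta(4) by simp
          show "AE b in lborel. \<eta> b \<noteq> 0 \<longrightarrow> \<bar>C (x - \<delta> n *\<^sub>R a) (y - \<delta> n *\<^sub>R b) - C x y\<bar> \<le> e / 2"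
          proof (intro AE_I2 impI)
            fix b assume "\<eta> b \<noteq> 0"
            then have b: "norm b < 1" by (rule eta(5))
            let ?p = "(x - \<delta> n *\<^sub>R a, y - \<delta> n *\<^sub>R b)"
            have "dist ?p (x, y) \<le> norm (\<delta> n *\<^sub>R a) + norm (\<delta> n *\<^sub>R b)"
              unfolding dist_Pair_Pair using sqrt_sum_squares_le_sum_abs[of "dist (x - \<delta> n *\<^sub>R a) x" "dist (y - \<delta> n *\<^sub>R b) y"]
              by (simp add: dist_norm)
            also have "\<dots> \<le> \<bar>\<delta> n\<bar> + \<bar>\<delta> n\<bar>"
              using a b by (intro add_mono) (auto simp: mult_left_le)
            also have "\<dots> < d" using N[OF n] by simp
            finally have "dist (C (fst ?p) (snd ?p)) (C x y) < e / 2" by (rule d(2))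
            then show "\<bar>C (x - \<delta> n *\<^sub>R a) (y - \<delta> n *\<^sub>R b) - C x y\<bar> \<le> e / 2" by (simp add: dist_real_def)
          qed
        qed measurable
        then show "\<bar>(\<integral>b. C (x - \<delta> n *\<^sub>R a) (y - \<delta> n *\<^sub>R b) * \<eta> b \<partial>lborel) - C x y\<bar> \<le> e / 2" using eta(3) by simp
      qed
      then show "norm (cov (\<delta> n) x y - C x y) < e" unfolding cov_eq_integral[OF \<delta>(1)] using e by simp
    qed
  qed
qed

lemma fld_measurable: "\<epsilon> > 0 \<Longrightarrow> (\<lambda>\<omega>. fld \<epsilon> \<omega> x) \<in> borel_measurable M"
  using X_gaussian[OF bump_test] unfolding fld_def centered_gaussian_def by blast

lemma fld_continuous:
  assumes "\<epsilon> > 0" "\<omega> \<in> space M"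
  shows "continuous_on UNIV (fld \<epsilon> \<omega>)"
  unfolding fld_def[abs_def] bump_def
  by (intro continuous_on_Re sobolev_translate_continuous[OF X_sobolev[OF assms(2)]] of_real_test rescale_test assms(1))

lemma fld_jointly_measurable:
  "\<epsilon> > 0 \<Longrightarrow> (\<lambda>p. fld \<epsilon> (fst p) (snd p)) \<in> borel_measurable (M \<Otimes>\<^sub>M borel)"
  using borel_measurable_caratheodory[of "fld \<epsilon>" M] fld_measurable fld_continuous
  by (simp add: case_prod_beta)

lemma fld_square_integrable: "\<epsilon> > 0 \<Longrightarrow> integrable M (\<lambda>\<omega>. (fld \<epsilon> \<omega> x)\<^sup>2)"
  unfolding fld_def by (rule centered_gaussian_char(1)[OF prob X_gaussian[OF bump_test]])

lemma fld_product_integrable: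
  assumes e: "\<epsilon> > 0"
  shows "integrable M (\<lambda>\<omega>. fld \<epsilon> \<omega> x * fld \<epsilon> \<omega> y)"
proof (rule Bochner_Integration.integrable_bound)
  show "integrable M (\<lambda>\<omega>. (fld \<epsilon> \<omega> x)\<^sup>2 + (fld \<epsilon> \<omega> y)\<^sup>2)"
    by (intro Bochner_Integration.integrable_add fld_square_integrable e)
  note [measurable] = fld_measurable[OF e]
  show "(\<lambda>\<omega>. fld \<epsilon> \<omega> x * fld \<epsilon> \<omega> y) \<in> borel_measurable M" by measurable
  show "AE \<omega> in M. norm (fld \<epsilon> \<omega> x * fld \<epsilon> \<omega> y) \<le> norm ((fld \<epsilon> \<omega> x)\<^sup>2 + (fld \<epsilon> \<omega> y)\<^sup>2)"
  proof (rule AE_I2)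
    fix \<omega>
    have "2 * \<bar>fld \<epsilon> \<omega> x\<bar> * \<bar>fld \<epsilon> \<omega> y\<bar> \<le> \<bar>fld \<epsilon> \<omega> x\<bar>\<^sup>2 + \<bar>fld \<epsilon> \<omega> y\<bar>\<^sup>2" by (rule sum_squares_bound)
    moreover have "0 \<le> \<bar>fld \<epsilon> \<omega> x\<bar> * \<bar>fld \<epsilon> \<omega> y\<bar>" by simp
    ultimately have "\<bar>fld \<epsilon> \<omega> x\<bar> * \<bar>fld \<epsilon> \<omega> y\<bar> \<le> (fld \<epsilon> \<omega> x)\<^sup>2 + (fld \<epsilon> \<omega> y)\<^sup>2"
      unfolding mult.assoc power2_abs by linarith
    then show "norm (fld \<epsilon> \<omega> x * fld \<epsilon> \<omega> y) \<le> norm ((fld \<epsilon> \<omega> x)\<^sup>2 + (fld \<epsilon> \<omega> y)\<^sup>2)"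
      by (simp add: abs_mult)
  qed
qed

lemma cov_sym: "cov \<epsilon> x y = cov \<epsilon> y x"
  unfolding cov_def by (simp add: mult.commute)

text \<open>The linear combination of field values is the value of the field at a test function, hence
  a centred Gaussian variable; its variance is expanded into covariances.\<close>

lemma expectation_cis_sum:
  fixes z :: "'i \<Rightarrow> 'a"
  assumes e: "\<epsilon> > 0" and I: "finite I"
  shows "(\<integral>\<omega>. cis (\<Sum>i\<in>I. s i * fld \<epsilon> \<omega> (z i)) \<partial>M) =
    of_real (exp (- (\<Sum>i\<in>I. \<Sum>j\<in>I. s i * s j * cov \<epsilon> (z i) (z j)) / 2))"
proof -
  define h where "h y = (\<Sum>i\<in>I. s i * bump \<epsilon> (z i) y)" for y
  have th: "test_function UNIV h"
    unfolding h_def[abs_def] by (intro test_sum I test_linear[OF bounded_linear_mult_right] bump_test e)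
  have eq: "Re (X \<omega> (\<lambda>y. of_real (h y))) = (\<Sum>i\<in>I. s i * fld \<epsilon> \<omega> (z i))" if w: "\<omega> \<in> space M" for \<omega>
  proof -
    have "X \<omega> (\<lambda>y. of_real (h y)) = X \<omega> (\<lambda>y. \<Sum>i\<in>I. of_real (s i) * of_real (bump \<epsilon> (z i) y))"
      unfolding h_def by simp
    also have "\<dots> = (\<Sum>i\<in>I. of_real (s i) * X \<omega> (\<lambda>y. of_real (bump \<epsilon> (z i) y)))"
      by (intro sobolev_linear_sum[OF X_sobolev[OF w] I] of_real_test bump_test e)
    also have "\<dots> = of_real (\<Sum>i\<in>I. s i * fld \<epsilon> \<omega> (z i))"
      by (simp add: X_fld[OF w e])
    finally show ?thesis by simp
  qed
  have sq: "(\<integral>\<omega>. (\<Sum>i\<in>I. s i * fld \<epsilon> \<omega> (z i))\<^sup>2 \<partial>M) = (\<Sum>i\<in>I. \<Sum>j\<in>I. s i * s j * cov \<epsilon> (z i) (z j))"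
  proof -
    have "(\<Sum>i\<in>I. s i * fld \<epsilon> \<omega> (z i))\<^sup>2 = (\<Sum>i\<in>I. \<Sum>j\<in>I. s i * s j * (fld \<epsilon> \<omega> (z i) * fld \<epsilon> \<omega> (z j)))" for \<omega>
      unfolding power2_eq_square sum_product by (intro sum.cong) auto
    then show ?thesis
      unfolding cov_def using fld_product_integrable[OF e] by (simp add: Bochner_Integration.integral_sum)
  qed
  have "(\<integral>\<omega>. cis (\<Sum>i\<in>I. s i * fld \<epsilon> \<omega> (z i)) \<partial>M) = (\<integral>\<omega>. cis (Re (X \<omega> (\<lambda>y. of_real (h y)))) \<partial>M)"
    by (intro Bochner_Integration.integral_cong) (auto simp: eq)
  also have "\<dots> = of_real (exp (- (\<integral>\<omega>. (Re (X \<omega> (\<lambda>y. of_real (h y))))\<^sup>2 \<partial>M) / 2))"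
    by (rule centered_gaussian_char(2)[OF prob X_gaussian[OF th]])
  also have "(\<integral>\<omega>. (Re (X \<omega> (\<lambda>y. of_real (h y))))\<^sup>2 \<partial>M) = (\<integral>\<omega>. (\<Sum>i\<in>I. s i * fld \<epsilon> \<omega> (z i))\<^sup>2 \<partial>M)"
    by (intro Bochner_Integration.integral_cong) (auto simp: eq)
  finally show ?thesis unfolding sq .
qed

text \<open>The vertex operator, normalised to have expectation one.\<close>

definition vertex :: "real \<Rightarrow> real \<Rightarrow> 'w \<Rightarrow> 'a \<Rightarrow> complex" where
  "vertex \<beta> \<epsilon> \<omega> x = cis (\<beta> * fld \<epsilon> \<omega> x) * of_real (exp (\<beta>\<^sup>2 / 2 * cov \<epsilon> x x))"

lemma approx_chaos_eq_vertex:
  assumes e: "\<epsilon> > 0" and w: "\<omega> \<in> space M" and x: "x \<in> U"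
  shows "approx_chaos M U X \<eta> \<beta> \<epsilon> \<omega> x = vertex \<beta> \<epsilon> \<omega> x"
proof -
  have m: "mollified_field U X \<eta> \<epsilon> \<omega>' x = of_real (fld \<epsilon> \<omega>' x)" if "\<omega>' \<in> space M" for \<omega>'
    using X_fld[OF that e] x unfolding mollified_field_def bump_def by simp
  have "(\<integral>\<omega>. (mollified_field U X \<eta> \<epsilon> \<omega> x)\<^sup>2 \<partial>M) = (\<integral>\<omega>. complex_of_real (fld \<epsilon> \<omega> x * fld \<epsilon> \<omega> x) \<partial>M)"
    by (intro Bochner_Integration.integral_cong) (auto simp: m power2_eq_square)
  also have "\<dots> = of_real (cov \<epsilon> x x)" unfolding cov_def by (rule integral_complex_of_real)
  finally have v: "(\<integral>\<omega>. (mollified_field U X \<eta> \<epsilon> \<omega> x)\<^sup>2 \<partial>M) = of_real (cov \<epsilon> x x)" .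
  show ?thesis
    unfolding approx_chaos_def vertex_def m[OF w] v cis_conv_exp exp_add
    using x by (simp add: mult.assoc flip: exp_of_real)
qed

lemma cov_measurable:
  assumes e: "\<epsilon> > 0" and [measurable]: "a \<in> borel_measurable N" "b \<in> borel_measurable N"
  shows "(\<lambda>x. cov \<epsilon> (a x) (b x)) \<in> borel_measurable N"
proof -
  have [measurable]: "(\<lambda>p. fld \<epsilon> (snd p) (a (fst p))) \<in> borel_measurable (N \<Otimes>\<^sub>M M)" if "a \<in> borel_measurable N" for a
    using measurable_compose[OF measurable_Pair[OF measurable_snd measurable_compose[OF measurable_fst that]] fld_jointly_measurable[OF e]]
    by simp
  show ?thesis unfolding cov_def by (rule borel_measurable_lebesgue_integral) (simp add: case_prod_beta)
qed

text \<open>The expectation of a product of vertex operators is a Coulomb gas weight: the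
  normalisation removes the self energies.\<close>

lemma expectation_vertex_product:
  fixes x y :: "nat \<Rightarrow> 'a"
  assumes e: "\<epsilon> > 0"
  shows "(\<integral>\<omega>. (\<Prod>i<k. vertex \<beta> \<epsilon> \<omega> (x i)) * (\<Prod>j<l. cnj (vertex \<beta> \<epsilon> \<omega> (y j))) \<partial>M) =
    of_real (exp (- \<beta>\<^sup>2 * coulomb_energy (cov \<epsilon>) x y {..<k} {..<l}))"
proof -
  let ?I = "{..<k} <+> {..<l}"
  define z where "z p = (case p of Inl i \<Rightarrow> x i | Inr j \<Rightarrow> y j)" for p :: "nat + nat"
  define s where "s p = (case p of Inl i \<Rightarrow> \<beta> | Inr j \<Rightarrow> - \<beta>)" for p :: "nat + nat"
  let ?D = "(\<Sum>i<k. cov \<epsilon> (x i) (x i)) + (\<Sum>j<l. cov \<epsilon> (y j) (y j))"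
  have 1: "(\<Prod>i<k. vertex \<beta> \<epsilon> \<omega> (x i)) * (\<Prod>j<l. cnj (vertex \<beta> \<epsilon> \<omega> (y j))) =
      of_real (exp (\<beta>\<^sup>2 / 2 * ?D)) * cis (\<Sum>p\<in>?I. s p * fld \<epsilon> \<omega> (z p))" for \<omega>
  proof -
    have "(\<Sum>p\<in>?I. s p * fld \<epsilon> \<omega> (z p)) = (\<Sum>i<k. \<beta> * fld \<epsilon> \<omega> (x i)) + (\<Sum>j<l. - (\<beta> * fld \<epsilon> \<omega> (y j)))"
      by (subst sum.Plus) (auto simp: z_def s_def)
    then show ?thesis
      by (simp add: vertex_def prod.distrib cis_cnj cis_sum cis_mult[symmetric] exp_sum exp_add distrib_left sum_distrib_left mult_ac del: of_real_exp)
  qed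
  have diag: "(\<Sum>i\<in>S. \<Sum>i'\<in>S. c i i') = (\<Sum>i\<in>S. c i i) + (\<Sum>i\<in>S. \<Sum>i'\<in>S - {i}. c i i')" if "finite S"
    for S :: "nat set" and c :: "nat \<Rightarrow> nat \<Rightarrow> real"
    unfolding sum.distrib[symmetric] by (intro sum.cong refl) (simp add: sum.remove[OF that])
  have 2: "(\<Sum>p\<in>?I. \<Sum>q\<in>?I. s p * s q * cov \<epsilon> (z p) (z q)) =
      \<beta>\<^sup>2 * (?D + 2 * coulomb_energy (cov \<epsilon>) x y {..<k} {..<l})"
  proof -
    have "(\<Sum>p\<in>?I. \<Sum>q\<in>?I. s p * s q * cov \<epsilon> (z p) (z q)) =
       \<beta>\<^sup>2 * (\<Sum>i<k. \<Sum>i'<k. cov \<epsilon> (x i) (x i')) - \<beta>\<^sup>2 * (\<Sum>i<k. \<Sum>j<l. cov \<epsilon> (x i) (y j))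
       + (\<beta>\<^sup>2 * (\<Sum>j<l. \<Sum>j'<l. cov \<epsilon> (y j) (y j')) - \<beta>\<^sup>2 * (\<Sum>j<l. \<Sum>i<k. cov \<epsilon> (y j) (x i)))"
      by (subst sum.Plus, simp, simp, subst (1 2) sum.Plus)
         (simp_all add: z_def s_def sum.distrib sum_subtractf sum_negf sum_distrib_left power2_eq_square mult.assoc)
    also have "(\<Sum>j<l. \<Sum>i<k. cov \<epsilon> (y j) (x i)) = (\<Sum>i<k. \<Sum>j<l. cov \<epsilon> (x i) (y j))"
      by (subst sum.swap) (simp add: cov_sym)
    finally show ?thesis
      unfolding diag[of "{..<k}" "\<lambda>i i'. cov \<epsilon> (x i) (x i')", simplified] diag[of "{..<l}" "\<lambda>i i'. cov \<epsilon> (y i) (y i')", simplified]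
        coulomb_energy_def by (simp add: algebra_simps)
  qed
  have "(\<integral>\<omega>. (\<Prod>i<k. vertex \<beta> \<epsilon> \<omega> (x i)) * (\<Prod>j<l. cnj (vertex \<beta> \<epsilon> \<omega> (y j))) \<partial>M) =
     of_real (exp (\<beta>\<^sup>2 / 2 * ?D)) * of_real (exp (- (\<beta>\<^sup>2 * (?D + 2 * coulomb_energy (cov \<epsilon>) x y {..<k} {..<l})) / 2))"
    unfolding 1 integral_mult_right_zero by (subst expectation_cis_sum[OF e]) (simp_all add: 2)
  also have "\<dots> = of_real (exp (- \<beta>\<^sup>2 * coulomb_energy (cov \<epsilon>) x y {..<k} {..<l}))"
    unfolding of_real_mult[symmetric] exp_add[symmetric] by (simp add: field_simps)
  finally show ?thesis .
qed

end

section \<open>Moments as integrals over configurations\<close>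

abbreviation config :: "nat \<Rightarrow> (nat \<Rightarrow> 'a::euclidean_space) measure" where
  "config k \<equiv> PiM {..<k} (\<lambda>_. lborel)"

abbreviation configs :: "nat \<Rightarrow> nat \<Rightarrow> ((nat \<Rightarrow> 'a::euclidean_space) \<times> (nat \<Rightarrow> 'a)) measure" where
  "configs k l \<equiv> config k \<Otimes>\<^sub>M config l"

lemma sigma_finite_config: "sigma_finite_measure (config k)"
  by (rule product_sigma_finite.sigma_finite[OF product_sigma_finite_lborel]) simp

lemma pair_sigma_finite_configs: "pair_sigma_finite (config k) (config l)"
  by (intro pair_sigma_finite.intro sigma_finite_config)

lemma sigma_finite_configs: "sigma_finite_measure (configs k l)"
proof -
  interpret pair_sigma_finite "config k :: (nat \<Rightarrow> 'a) measure" "config l" by (rule pair_sigma_finite_configs)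
  show ?thesis by (rule P.sigma_finite_measure_axioms)
qed

definition box :: "'a::euclidean_space set \<Rightarrow> nat \<Rightarrow> nat \<Rightarrow> ((nat \<Rightarrow> 'a) \<times> (nat \<Rightarrow> 'a)) set" where
  "box K k l = Pi\<^sub>E {..<k} (\<lambda>_. K) \<times> Pi\<^sub>E {..<l} (\<lambda>_. K)"

lemma box_sets: "K \<in> sets borel \<Longrightarrow> box K k l \<in> sets (configs k l)"
  unfolding box_def by (intro pair_measureI sets_PiM_I_finite) auto

lemma emeasure_box:
  assumes K: "K \<in> sets borel" "bounded K"
  shows "emeasure (configs k l) (box K k l) < \<infinity>"
proof -
  interpret product_sigma_finite "\<lambda>_::nat. lborel :: 'a measure" by (rule product_sigma_finite_lborel)
  have fin: "emeasure (config k) (Pi\<^sub>E {..<k} (\<lambda>_. K)) < \<infinity>" for k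
    using K emeasure_bounded_finite[OF K(2)] by (subst emeasure_PiM) (auto simp: ennreal_prod_eq_top less_top power_less_top_ennreal)
  interpret sigma_finite_measure "config l :: (nat \<Rightarrow> 'a) measure" by (rule sigma_finite_config)
  show ?thesis
    unfolding box_def using fin[of k] fin[of l] K
    by (subst emeasure_pair_measure_Times) (auto intro!: sets_PiM_I_finite simp: ennreal_mult_less_top)
qed

lemma not_in_box:
  assumes "p \<in> space (configs k l)" "p \<notin> box K k l"
  shows "(\<exists>i<k. fst p i \<notin> K) \<or> (\<exists>j<l. snd p j \<notin> K)"
  using assms unfolding box_def by (cases p) (auto simp: space_pair_measure space_PiM PiE_iff)

lemma component_fst[measurable (raw)]: "i < k \<Longrightarrow> (\<lambda>p. fst p i) \<in> borel_measurable (configs k l)"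
  by (rule measurable_compose[OF measurable_fst measurable_component_singleton[of i "{..<k}" "\<lambda>_. lborel", simplified measurable_lborel1]]) simp

lemma component_snd[measurable (raw)]: "j < l \<Longrightarrow> (\<lambda>p. snd p j) \<in> borel_measurable (configs k l)"
  by (rule measurable_compose[OF measurable_snd measurable_component_singleton[of j "{..<l}" "\<lambda>_. lborel", simplified measurable_lborel1]]) simp

text \<open>A power of an integral is an integral over configurations of points. Boundedness and the
  compactly supported integrand make all exchanges of integrals legitimate.\<close>

lemma moment_fubini:
  fixes a :: "'w \<Rightarrow> 'a::euclidean_space \<Rightarrow> complex"
  assumes M: "prob_space M" and a[measurable]: "(\<lambda>p. a (fst p) (snd p)) \<in> borel_measurable (M \<Otimes>\<^sub>M borel)"
    and K: "K \<in> sets borel" "bounded K" and B: "\<And>\<omega> x. \<omega> \<in> space M \<Longrightarrow> cmod (a \<omega> x) \<le> B"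
    and z: "\<And>\<omega> x. x \<notin> K \<Longrightarrow> a \<omega> x = 0"
  shows "(\<integral>\<omega>. (\<integral>x. a \<omega> x \<partial>lborel) ^ k * cnj (\<integral>x. a \<omega> x \<partial>lborel) ^ l \<partial>M) =
    (\<integral>p. (\<integral>\<omega>. (\<Prod>i<k. a \<omega> (fst p i)) * (\<Prod>j<l. cnj (a \<omega> (snd p j))) \<partial>M) \<partial>configs k l)"
proof -
  interpret prob_space M by (rule M)
  interpret PS: product_sigma_finite "\<lambda>_::nat. lborel :: 'a measure" by (rule product_sigma_finite_lborel)
  interpret L: pair_sigma_finite "config k :: (nat \<Rightarrow> 'a) measure" "config l :: (nat \<Rightarrow> 'a) measure"
    by (rule pair_sigma_finite_configs)
  interpret Q: pair_sigma_finite M "configs k l :: ((nat \<Rightarrow> 'a) \<times> (nat \<Rightarrow> 'a)) measure"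
    by (intro pair_sigma_finite.intro sigma_finite_configs) unfold_locales
  define \<Psi> where "\<Psi> \<omega> p = (\<Prod>i<k. a \<omega> (fst p i)) * (\<Prod>j<l. cnj (a \<omega> (snd p j)))" for \<omega> p
  have a2[measurable (raw)]: "(\<lambda>x. a (u x) (v x)) \<in> borel_measurable N"
    if "u \<in> measurable N M" "v \<in> borel_measurable N" for u v and N :: "'z measure"
    using measurable_compose[OF measurable_Pair[OF that] a] by simp
  have am: "a \<omega> \<in> borel_measurable borel" if "\<omega> \<in> space M" for \<omega>
    using measurable_compose[OF measurable_Pair1'[OF that] a] by simp
  have B0: "B \<ge> 0" using B not_empty norm_ge_zero order_trans by blast
  have bd: "cmod (\<Psi> \<omega> p) \<le> B ^ k * B ^ l" if "\<omega> \<in> space M" for \<omega> p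
  proof -
    have "(\<Prod>i<k. cmod (a \<omega> (fst p i))) \<le> (\<Prod>i<k. B)" by (intro prod_mono conjI B that) auto
    moreover have "(\<Prod>j<l. cmod (a \<omega> (snd p j))) \<le> (\<Prod>i<l. B)" by (intro prod_mono conjI B that) auto
    ultimately show ?thesis
      unfolding \<Psi>_def norm_mult prod_norm[symmetric] complex_mod_cnj
      using B0 by (intro mult_mono) (auto intro: prod_nonneg)
  qed
  have zero: "\<Psi> \<omega> p = 0" if p: "p \<in> space (configs k l)" "p \<notin> box K k l" for \<omega> p
    using not_in_box[OF p]
  proof
    assume "\<exists>i<k. fst p i \<notin> K"
    then obtain i where "i < k" "a \<omega> (fst p i) = 0" using z by blast
    then have "(\<Prod>i<k. a \<omega> (fst p i)) = 0" by (intro prod_zero) auto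
    then show ?thesis unfolding \<Psi>_def by simp
  next
    assume "\<exists>j<l. snd p j \<notin> K"
    then obtain i where "i < l" "a \<omega> (snd p i) = 0" using z by blast
    then have "(\<Prod>i<l. cnj (a \<omega> (snd p i))) = 0" by (intro prod_zero) auto
    then show ?thesis unfolding \<Psi>_def by simp
  qed
  have cnj_m: "cnj \<in> borel_measurable borel" by (intro borel_measurable_continuous_onI continuous_intros)
  have \<Psi>m: "(\<lambda>q. \<Psi> (fst q) (snd q)) \<in> borel_measurable (M \<Otimes>\<^sub>M configs k l)"
    unfolding \<Psi>_def
    by (intro borel_measurable_times borel_measurable_prod a2 measurable_fst
        measurable_compose[OF a2 cnj_m]
        measurable_compose[OF measurable_snd component_fst] measurable_compose[OF measurable_snd component_snd]) auto
  have int: "integrable (M \<Otimes>\<^sub>M configs k l) (\<lambda>(\<omega>, p). \<Psi> \<omega> p)"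
  proof (rule integrableI_bounded_set[where A="space M \<times> box K k l" and B="B ^ k * B ^ l"])
    show "space M \<times> box K k l \<in> sets (M \<Otimes>\<^sub>M configs k l)" using box_sets[OF K(1)] by auto
    show "emeasure (M \<Otimes>\<^sub>M configs k l) (space M \<times> box K k l) < \<infinity>"
      using emeasure_box[OF K, of k l] box_sets[OF K(1), of k l]
      by (subst sigma_finite_measure.emeasure_pair_measure_Times[OF sigma_finite_configs]) (auto simp: emeasure_space_1)
    show "AE x in M \<Otimes>\<^sub>M configs k l. x \<in> space M \<times> box K k l \<longrightarrow> norm (case x of (\<omega>, p) \<Rightarrow> \<Psi> \<omega> p) \<le> B ^ k * B ^ l"
      using bd by (intro AE_I2) auto
    show "AE x in M \<Otimes>\<^sub>M configs k l. x \<notin> space M \<times> box K k l \<longrightarrow> (case x of (\<omega>, p) \<Rightarrow> \<Psi> \<omega> p) = 0"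
      using zero by (intro AE_I2) (auto simp: space_pair_measure)
  qed (use \<Psi>m in \<open>simp add: case_prod_beta\<close>)
  have inner: "(\<integral>p. \<Psi> \<omega> p \<partial>configs k l) = (\<integral>x. a \<omega> x \<partial>lborel) ^ k * cnj (\<integral>x. a \<omega> x \<partial>lborel) ^ l"
    if w: "\<omega> \<in> space M" for \<omega>
  proof -
    note [measurable] = am[OF w]
    have ia: "integrable lborel (a \<omega>)"
      by (rule integrableI_bounded_set[where A=K and B=B])
        (use K emeasure_bounded_finite[OF K(2)] B[OF w] z in \<open>auto intro!: AE_I2\<close>)
    have ic: "integrable lborel (\<lambda>x. cnj (a \<omega> x))" using ia by simp
    have i2: "integrable (configs k l) (\<Psi> \<omega>)"
    proof (rule integrableI_bounded_set[where A="box K k l" and B="B ^ k * B ^ l"])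
      show "\<Psi> \<omega> \<in> borel_measurable (configs k l)"
        using measurable_compose[OF measurable_Pair1'[OF w] \<Psi>m] by simp
    qed (use box_sets[OF K(1)] emeasure_box[OF K] bd[OF w] zero in \<open>auto intro!: AE_I2\<close>)
    have "(\<integral>p. \<Psi> \<omega> p \<partial>configs k l) = (\<integral>x. (\<integral>y. \<Psi> \<omega> (x, y) \<partial>config l) \<partial>config k)"
      by (rule L.integral_fst'[OF i2, symmetric])
    also have "\<dots> = (\<integral>x. (\<Prod>i<k. a \<omega> (x i)) \<partial>config k) * (\<integral>y. (\<Prod>j<l. cnj (a \<omega> (y j))) \<partial>config l)"
      unfolding \<Psi>_def by simp
    also have "\<dots> = (\<integral>x. a \<omega> x \<partial>lborel) ^ k * cnj (\<integral>x. a \<omega> x \<partial>lborel) ^ l"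
      by (subst (1 2) PS.product_integral_prod) (use ia ic in auto)
    finally show ?thesis .
  qed
  have "(\<integral>\<omega>. (\<integral>x. a \<omega> x \<partial>lborel) ^ k * cnj (\<integral>x. a \<omega> x \<partial>lborel) ^ l \<partial>M) = (\<integral>\<omega>. (\<integral>p. \<Psi> \<omega> p \<partial>configs k l) \<partial>M)"
    by (intro Bochner_Integration.integral_cong) (auto simp: inner)
  also have "\<dots> = (\<integral>p. (\<integral>\<omega>. \<Psi> \<omega> p \<partial>M) \<partial>configs k l)"
    using Q.Fubini_integral[OF int] by simp
  finally show ?thesis unfolding \<Psi>_def .
qed

lemma integral_norm_bound_integral_AE:
  fixes f :: "'x \<Rightarrow> 'b::{banach, second_countable_topology}"
  assumes g: "integrable M g" and le: "AE x in M. norm (f x) \<le> g x"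
  shows "norm (\<integral>x. f x \<partial>M) \<le> (\<integral>x. g x \<partial>M)"
proof -
  have "norm (\<integral>x. f x \<partial>M) \<le> (\<integral>x. norm (f x) \<partial>M)" by (rule integral_norm_bound)
  also have "\<dots> \<le> (\<integral>x. g x \<partial>M)"
  proof (rule integral_mono_AE'[OF g le])
    show "AE x in M. 0 \<le> g x" using le by eventually_elim (rule order_trans[OF norm_ge_zero])
  qed
  finally show ?thesis .
qed

lemma AE_config_neq: "j < l \<Longrightarrow> AE y in config l. y j \<noteq> (c :: 'a::euclidean_space)"
proof -
  assume j: "j < l"
  interpret product_sigma_finite "\<lambda>_::nat. lborel :: 'a measure" by (rule product_sigma_finite_lborel)
  let ?A = "\<lambda>i. if i = j then {c} else (UNIV :: 'a set)"
  have "emeasure (config l) (Pi\<^sub>E {..<l} ?A) = (\<Prod>i<l. emeasure lborel (?A i))"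
    by (intro emeasure_PiM) auto
  also have "\<dots> = 0" using j by (intro prod_zero) auto
  finally have "Pi\<^sub>E {..<l} ?A \<in> null_sets (config l)" by (auto intro!: sets_PiM_I_finite)
  then show ?thesis
    by (rule AE_I') (use j in \<open>auto simp: space_PiM PiE_iff extensional_def\<close>)
qed

lemma AE_config_distinct:
  assumes i: "i < k" "i' < k" "i \<noteq> i'"
  shows "AE x in (config k :: (nat \<Rightarrow> 'a::euclidean_space) measure). x i \<noteq> x i'"
proof -
  interpret product_sigma_finite "\<lambda>_::nat. lborel :: 'a measure" by (rule product_sigma_finite_lborel)
  let ?I = "{..<k} - {i}"
  have I: "insert i ?I = {..<k}" using i by auto
  let ?N = "{x \<in> space (config k). x i = (x i' :: 'a)}"
  have [measurable]: "(\<lambda>x. x i) \<in> borel_measurable (config k :: (nat \<Rightarrow> 'a) measure)" "(\<lambda>x. x i') \<in> borel_measurable (config k :: (nat \<Rightarrow> 'a) measure)"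
    using i measurable_component_singleton[of _ "{..<k}" "\<lambda>_. lborel :: 'a measure"] by auto
  have N: "?N \<in> sets (config k)" by measurable
  have "emeasure (config k) ?N = (\<integral>\<^sup>+x. indicator ?N x \<partial>PiM (insert i ?I) (\<lambda>_. lborel))"
    unfolding I using N by simp
  also have "\<dots> = (\<integral>\<^sup>+x. (\<integral>\<^sup>+y. indicator ?N (x(i := y)) \<partial>lborel) \<partial>PiM ?I (\<lambda>_. lborel))"
  proof (rule product_nn_integral_insert)
    show "indicator ?N \<in> borel_measurable (PiM (insert i ?I) (\<lambda>_. lborel))" unfolding I using N by simp
  qed auto
  also have "\<dots> = (\<integral>\<^sup>+x. 0 \<partial>PiM ?I (\<lambda>_. lborel :: 'a measure))"
  proof (rule nn_integral_cong)
    fix x :: "nat \<Rightarrow> 'a"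
    have "(\<integral>\<^sup>+y. indicator ?N (x(i := y)) \<partial>lborel) \<le> (\<integral>\<^sup>+y. indicator {x i'} y \<partial>lborel)"
      using i by (intro nn_integral_mono) (auto simp: indicator_def)
    then show "(\<integral>\<^sup>+y. indicator ?N (x(i := y)) \<partial>lborel) = 0" by simp
  qed
  finally have "?N \<in> null_sets (config k)" using N by auto
  then show ?thesis by (rule AE_I') auto
qed

definition distinct_points :: "nat \<Rightarrow> nat \<Rightarrow> (nat \<Rightarrow> 'a) \<Rightarrow> (nat \<Rightarrow> 'a) \<Rightarrow> bool" where
  "distinct_points k l x y \<longleftrightarrow> inj_on x {..<k} \<and> inj_on y {..<l} \<and> (\<forall>i<k. \<forall>j<l. x i \<noteq> y j)"

lemma AE_distinct_points:
  "AE p in (configs k l :: ((nat \<Rightarrow> 'a::euclidean_space) \<times> (nat \<Rightarrow> 'a)) measure). distinct_points k l (fst p) (snd p)"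
proof -
  interpret L: pair_sigma_finite "config k :: (nat \<Rightarrow> 'a) measure" "config l :: (nat \<Rightarrow> 'a) measure"
    by (rule pair_sigma_finite_configs)
  have xx: "AE p in configs k l. fst p i \<noteq> (fst p i' :: 'a)" if "i < k" "i' < k" "i \<noteq> i'" for i i'
    by (rule L.AE_pair_measure) (use that AE_config_distinct[OF that, where 'a='a] in \<open>auto intro!: measurable_sets_Collect pred_intros_logic\<close>)
  have yy: "AE p in configs k l. snd p i \<noteq> (snd p i' :: 'a)" if "i < l" "i' < l" "i \<noteq> i'" for i i'
    by (rule L.AE_pair_measure) (use that AE_config_distinct[OF that, where 'a='a] in auto)
  have xy: "AE p in configs k l. fst p i \<noteq> (snd p j :: 'a)" if "i < k" "j < l" for i j
  proof (rule L.AE_pair_measure)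
    show "AE x in config k. AE y in config l. fst (x, y) i \<noteq> (snd (x, y) j :: 'a)"
    proof (rule AE_I2)
      fix x :: "nat \<Rightarrow> 'a"
      have "AE y in config l. y j \<noteq> x i" by (rule AE_config_neq[OF that(2)])
      then show "AE y in config l. fst (x, y) i \<noteq> snd (x, y) j" by eventually_elim auto
    qed
  qed (use that in auto)
  have "AE p in configs k l. \<forall>i\<in>{..<k}. \<forall>i'\<in>{..<k} - {i}. fst p i \<noteq> (fst p i' :: 'a)"
    by (intro AE_finite_allI) (auto intro: xx)
  moreover have "AE p in configs k l. \<forall>i\<in>{..<l}. \<forall>i'\<in>{..<l} - {i}. snd p i \<noteq> (snd p i' :: 'a)"
    by (intro AE_finite_allI) (auto intro: yy)
  moreover have "AE p in configs k l. \<forall>i\<in>{..<k}. \<forall>j\<in>{..<l}. fst p i \<noteq> (snd p j :: 'a)"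
    by (intro AE_finite_allI) (auto intro: xy)
  ultimately show ?thesis
    by eventually_elim (auto simp: distinct_points_def inj_on_def)
qed

text \<open>Matchings of all negative charges with distinct positive ones; they are restricted to the index
  set so that there are finitely many.\<close>

definition matchings :: "nat \<Rightarrow> nat \<Rightarrow> (nat \<Rightarrow> nat) set" where
  "matchings k l = {\<sigma> \<in> {..<l} \<rightarrow>\<^sub>E {..<k}. inj_on \<sigma> {..<l}}"

lemma finite_matchings: "finite (matchings k l)"
  unfolding matchings_def by (simp add: finite_PiE)

definition riesz_sum :: "real \<Rightarrow> nat \<Rightarrow> nat \<Rightarrow> (nat \<Rightarrow> 'a::euclidean_space) \<Rightarrow> (nat \<Rightarrow> 'a) \<Rightarrow> real" where
  "riesz_sum \<alpha> k l x y = (\<Sum>\<sigma>\<in>matchings k l. \<Prod>j<l. norm (y j - x (\<sigma> j)) powr (- \<alpha>))"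

lemma riesz_sum_nonneg: "riesz_sum \<alpha> k l x y \<ge> 0"
  unfolding riesz_sum_def by (intro sum_nonneg prod_nonneg) auto

lemma riesz_sum_measurable[measurable]:
  "(\<lambda>p. riesz_sum \<alpha> k l (fst p) (snd p)) \<in> borel_measurable (configs k l :: ((nat \<Rightarrow> 'a::euclidean_space) \<times> (nat \<Rightarrow> 'a)) measure)"
  unfolding riesz_sum_def
proof (intro borel_measurable_sum borel_measurable_prod)
  fix \<sigma> j assume "\<sigma> \<in> matchings k l" "j \<in> {..<l}"
  then have [simp]: "\<sigma> j < k" "j < l" by (auto simp: matchings_def PiE_iff)
  show "(\<lambda>p. norm (snd p j - fst p (\<sigma> j) :: 'a) powr (- \<alpha>)) \<in> borel_measurable (configs k l)"
    by measurable
qed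

lemma exp_sum_ln:
  fixes x y :: "nat \<Rightarrow> 'a::real_normed_vector"
  assumes "\<And>j. j < l \<Longrightarrow> y j \<noteq> x (\<sigma> j)"
  shows "exp (\<alpha> * (\<Sum>j<l. - ln (norm (y j - x (\<sigma> j))))) = (\<Prod>j<l. norm (y j - x (\<sigma> j)) powr (- \<alpha>))"
proof -
  have "exp (\<alpha> * (\<Sum>j<l. - ln (norm (y j - x (\<sigma> j))))) = (\<Prod>j<l. exp (\<alpha> * - ln (norm (y j - x (\<sigma> j)))))"
    by (simp only: sum_distrib_left exp_sum finite_lessThan)
  also have "\<dots> = (\<Prod>j<l. norm (y j - x (\<sigma> j)) powr (- \<alpha>))"
    using assms by (intro prod.cong) (auto simp: powr_def)
  finally show ?thesis .
qed

lemma ennreal_prod_mono: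
  fixes u v :: "'i \<Rightarrow> ennreal"
  shows "(\<And>i. i \<in> I \<Longrightarrow> u i \<le> v i) \<Longrightarrow> (\<Prod>i\<in>I. u i) \<le> (\<Prod>i\<in>I. v i)"
  by (induction I rule: infinite_finite_induct) (auto intro: mult_mono)

text \<open>The second family of points is integrated
  first, and every singularity is integrated with respect to its own variable.\<close>

lemma riesz_product_integral_le:
  assumes K: "compact K" and \<sigma>: "\<sigma> \<in> matchings k l" and D: "D > 0" "\<And>x y. x \<in> K \<Longrightarrow> y \<in> K \<Longrightarrow> norm (y - x) \<le> D"
    and t: "0 < t" "t < real DIM('a)"
  shows "(\<integral>\<^sup>+p. indicator (box K k l) p * ennreal (\<Prod>j<l. norm (snd p j - fst p (\<sigma> j)) powr (t - real DIM('a)))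
       \<partial>(configs k l :: ((nat \<Rightarrow> 'a::euclidean_space) \<times> (nat \<Rightarrow> 'a)) measure))
    \<le> ennreal (measure lborel K ^ k * (D powr t / riesz_const (real DIM('a)) t * measure lborel (shell :: 'a set)) ^ l)"
proof -
  interpret PS: product_sigma_finite "\<lambda>_::nat. lborel :: 'a measure" by (rule product_sigma_finite_lborel)
  interpret Pl: sigma_finite_measure "config l :: (nat \<Rightarrow> 'a) measure" by (rule sigma_finite_config)
  let ?r = "\<lambda>x y. norm (y - x) powr (t - real DIM('a))"
  let ?R = "D powr t / riesz_const (real DIM('a)) t * measure lborel (shell :: 'a set)"
  have R0: "?R \<ge> 0" using riesz_const_pos[OF t] by simp
  have Kb[measurable]: "K \<in> sets borel" using K by (rule borel_compact)
  have \<sigma>k: "\<sigma> j < k" if "j < l" for j using \<sigma> that by (auto simp: matchings_def PiE_iff)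
  have eK: "emeasure lborel K = ennreal (measure lborel K)"
    using emeasure_bounded_finite[OF compact_imp_bounded[OF K]] by (intro emeasure_eq_ennreal_measure) auto
  have bK: "(\<integral>\<^sup>+y. indicator K y * ennreal (?r x y) \<partial>lborel) \<le> ennreal ?R" if "x \<in> K" for x
  proof -
    have "(\<integral>\<^sup>+y. indicator K y * ennreal (?r x y) \<partial>lborel) \<le> (\<integral>\<^sup>+y. ennreal (?r x y) * indicator (cball x D) y \<partial>lborel)"
      using D(2)[OF that] by (intro nn_integral_mono) (auto simp: indicator_def dist_norm norm_minus_commute)
    also have "\<dots> \<le> ennreal ?R" by (rule riesz_potential_bound[OF t D(1)])
    finally show ?thesis .
  qed
  have meas: "(\<lambda>p. indicator (box K k l) p * ennreal (\<Prod>j<l. ?r (fst p (\<sigma> j)) (snd p j))) \<in> borel_measurable (configs k l)"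
  proof -
    note [measurable] = box_sets[OF Kb, of k l]
    have "(\<lambda>p. \<Prod>j<l. ?r (fst p (\<sigma> j)) (snd p j)) \<in> borel_measurable (configs k l)"
    proof (rule borel_measurable_prod)
      fix j assume "j \<in> {..<l}"
      then have [simp]: "\<sigma> j < k" "j < l" using \<sigma>k by auto
      show "(\<lambda>p. ?r (fst p (\<sigma> j)) (snd p j)) \<in> borel_measurable (configs k l)" by measurable
    qed
    note [measurable] = this
    show ?thesis by measurable
  qed
  have inner: "(\<integral>\<^sup>+y. indicator (box K k l) (x, y) * ennreal (\<Prod>j<l. ?r (x (\<sigma> j)) (y j)) \<partial>config l)
      \<le> indicator (Pi\<^sub>E {..<k} (\<lambda>_. K)) x * ennreal (?R ^ l)" for x
  proof (cases "x \<in> Pi\<^sub>E {..<k} (\<lambda>_. K)")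
    case True
    have "(\<integral>\<^sup>+y. indicator (box K k l) (x, y) * ennreal (\<Prod>j<l. ?r (x (\<sigma> j)) (y j)) \<partial>config l)
        = (\<integral>\<^sup>+y. (\<Prod>j<l. indicator K (y j) * ennreal (?r (x (\<sigma> j)) (y j))) \<partial>config l)"
    proof (rule nn_integral_cong)
      fix y assume "y \<in> space (config l :: (nat \<Rightarrow> 'a) measure)"
      then have "indicator (box K k l) (x, y) = (\<Prod>j<l. indicator K (y j) :: ennreal)"
        using True by (auto simp: box_def indicator_def space_PiM PiE_iff)
      then show "indicator (box K k l) (x, y) * ennreal (\<Prod>j<l. ?r (x (\<sigma> j)) (y j)) =
          (\<Prod>j<l. indicator K (y j) * ennreal (?r (x (\<sigma> j)) (y j)))"
        by (simp add: prod.distrib prod_ennreal)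
    qed
    also have "\<dots> = (\<Prod>j<l. \<integral>\<^sup>+y. indicator K y * ennreal (?r (x (\<sigma> j)) y) \<partial>lborel)"
      by (intro PS.product_nn_integral_prod) auto
    also have "\<dots> \<le> (\<Prod>j<l. ennreal ?R)"
      by (intro ennreal_prod_mono bK) (use True \<sigma>k in auto)
    also have "\<dots> = ennreal (?R ^ l)" using R0 by (simp add: ennreal_power)
    finally show ?thesis using True by simp
  qed (simp add: box_def indicator_def)
  have "(\<integral>\<^sup>+p. indicator (box K k l) p * ennreal (\<Prod>j<l. ?r (fst p (\<sigma> j)) (snd p j)) \<partial>configs k l)
      = (\<integral>\<^sup>+x. (\<integral>\<^sup>+y. indicator (box K k l) (x, y) * ennreal (\<Prod>j<l. ?r (x (\<sigma> j)) (y j)) \<partial>config l) \<partial>config k)"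
    using Pl.nn_integral_fst[OF meas] by simp
  also have "\<dots> \<le> (\<integral>\<^sup>+x. indicator (Pi\<^sub>E {..<k} (\<lambda>_. K)) x * ennreal (?R ^ l) \<partial>config k)"
    by (intro nn_integral_mono inner)
  also have "\<dots> = emeasure (config k) (Pi\<^sub>E {..<k} (\<lambda>_. K)) * ennreal (?R ^ l)"
    by (subst nn_integral_multc) (auto intro!: borel_measurable_indicator sets_PiM_I_finite)
  also have "emeasure (config k) (Pi\<^sub>E {..<k} (\<lambda>_. K)) = ennreal (measure lborel K ^ k)"
    by (subst PS.emeasure_PiM) (auto simp: eK ennreal_power)
  also have "\<dots> * ennreal (?R ^ l) = ennreal (measure lborel K ^ k * ?R ^ l)"
    by (rule ennreal_mult[symmetric]) (intro zero_le_power R0 measure_nonneg)+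
  finally show ?thesis .
qed

lemma riesz_sum_integrable:
  fixes K :: "'a::euclidean_space set"
  assumes K: "compact K" and D: "D > 0" "\<And>x y. x \<in> K \<Longrightarrow> y \<in> K \<Longrightarrow> norm (y - x) \<le> D"
    and t: "0 < t" "t < real DIM('a)"
  shows "integrable (configs k l) (\<lambda>p. indicator (box K k l) p * riesz_sum (real DIM('a) - t) k l (fst p) (snd p))" (is ?I)
    and "(\<integral>p. indicator (box K k l) p * riesz_sum (real DIM('a) - t) k l (fst p) (snd p) \<partial>configs k l) \<le>
      real (card (matchings k l)) *
      (measure lborel K ^ k * (D powr t / riesz_const (real DIM('a)) t * measure lborel (shell :: 'a set)) ^ l)" (is "?J \<le> ?B")
proof -
  note [measurable] = box_sets[OF borel_compact[OF K], of k l]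
  let ?q = "\<lambda>\<sigma> p. \<Prod>j<l. norm (snd p j - fst p (\<sigma> j) :: 'a) powr (t - real DIM('a))"
  let ?Q = "measure lborel K ^ k * (D powr t / riesz_const (real DIM('a)) t * measure lborel (shell :: 'a set)) ^ l"
  have Q0: "?Q \<ge> 0" using riesz_const_pos[OF t] by simp
  have qm: "?q \<sigma> \<in> borel_measurable (configs k l)" if "\<sigma> \<in> matchings k l" for \<sigma>
  proof (rule borel_measurable_prod)
    fix j assume "j \<in> {..<l}"
    then have [simp]: "\<sigma> j < k" "j < l" using that by (auto simp: matchings_def PiE_iff)
    show "(\<lambda>p. norm (snd p j - fst p (\<sigma> j) :: 'a) powr (t - real DIM('a))) \<in> borel_measurable (configs k l)" by measurable
  qed
  let ?w = "\<lambda>p. indicator (box K k l) p * riesz_sum (real DIM('a) - t) k l (fst p) (snd p)"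
  have w0: "?w p \<ge> 0" for p by (simp add: riesz_sum_nonneg)
  have wm: "?w \<in> borel_measurable (configs k l)" by measurable
  have "(\<integral>\<^sup>+p. ennreal (?w p) \<partial>configs k l) = (\<integral>\<^sup>+p. (\<Sum>\<sigma>\<in>matchings k l. indicator (box K k l) p * ennreal (?q \<sigma> p)) \<partial>configs k l)"
  proof (rule nn_integral_cong)
    fix p :: "(nat \<Rightarrow> 'a) \<times> (nat \<Rightarrow> 'a)"
    have "(\<Sum>\<sigma>\<in>matchings k l. ennreal (?q \<sigma> p)) = ennreal (\<Sum>\<sigma>\<in>matchings k l. ?q \<sigma> p)"
      by (rule sum_ennreal) (simp add: prod_nonneg)
    then have "ennreal (riesz_sum (real DIM('a) - t) k l (fst p) (snd p)) = (\<Sum>\<sigma>\<in>matchings k l. ennreal (?q \<sigma> p))"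
      unfolding riesz_sum_def minus_diff_eq by (rule sym)
    then show "ennreal (?w p) = (\<Sum>\<sigma>\<in>matchings k l. indicator (box K k l) p * ennreal (?q \<sigma> p))"
      by (cases "p \<in> box K k l") simp_all
  qed
  also have "\<dots> = (\<Sum>\<sigma>\<in>matchings k l. \<integral>\<^sup>+p. indicator (box K k l) p * ennreal (?q \<sigma> p) \<partial>configs k l)"
  proof (rule nn_integral_sum)
    fix \<sigma> assume "\<sigma> \<in> matchings k l"
    note [measurable] = qm[OF this]
    show "(\<lambda>p. indicator (box K k l) p * ennreal (?q \<sigma> p)) \<in> borel_measurable (configs k l)" by measurable
  qed
  also have "\<dots> \<le> (\<Sum>\<sigma>\<in>matchings k l. ennreal ?Q)"
    by (intro sum_mono riesz_product_integral_le[OF K _ D t])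
  also have "\<dots> = ennreal ?B" using Q0 by (simp add: ennreal_of_nat_eq_real_of_nat ennreal_mult)
  finally have le: "(\<integral>\<^sup>+p. ennreal (?w p) \<partial>configs k l) \<le> ennreal ?B" .
  show ?I
    by (rule integrableI_nonneg) (use wm w0 le in \<open>auto intro: le_less_trans\<close>)
  then have "ennreal ?J \<le> ennreal ?B" using le w0 by (subst nn_integral_eq_integral[symmetric]) auto
  then show "?J \<le> ?B" using Q0 by (subst (asm) ennreal_le_iff) auto
qed

section \<open>Coulomb gas integrals\<close>

locale log_field_test = log_field +
  fixes f :: "'a \<Rightarrow> complex"
  assumes f: "test_function UNIV f" and f_supp: "\<And>x. x \<notin> K \<Longrightarrow> f x = 0"
begin

lemma f_borel[measurable]: "f \<in> borel_measurable borel"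
  using f test_smooth smooth_borel by blast

definition F where "F = (SOME B. B > 0 \<and> (\<forall>x. cmod (f x) \<le> B))"

lemma F: "F > 0" "cmod (f x) \<le> F"
proof -
  have "\<exists>B. B > 0 \<and> (\<forall>x. cmod (f x) \<le> B)" using test_bounded_above[OF f] by metis
  then have "F > 0 \<and> (\<forall>x. cmod (f x) \<le> F)" unfolding F_def by (rule someI_ex)
  then show "F > 0" "cmod (f x) \<le> F" by auto
qed

lemma K_diameter: obtains D where "D \<ge> 1" "\<And>x y. x \<in> K \<Longrightarrow> y \<in> K \<Longrightarrow> norm (y - x) \<le> D"
proof -
  obtain r where r: "\<And>x. x \<in> K \<Longrightarrow> norm x \<le> r" using compact_imp_bounded[OF K(1)] unfolding bounded_iff by blast
  show thesis
  proof (rule that[of "max 1 (2 * r)"])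
    fix x y assume "x \<in> K" "y \<in> K"
    then show "norm (y - x) \<le> max 1 (2 * r)" using r[of x] r[of y] norm_triangle_ineq4[of y x] by linarith
  qed simp
qed

text \<open>By \<open>cov_log_bound\<close> the mollified covariance satisfies the hypotheses of \<open>greedy_matching_bound\<close>, with
  constants that do not depend on \<open>\<epsilon>\<close>, since the truncated distance \<open>max |x - y| \<epsilon>\<close> satisfies a triangle
  inequality up to a factor two. The matched interactions become Riesz kernels.\<close>

lemma mollified_weight_bound:
  assumes lk: "l \<le> k"
  obtains \<epsilon>0 c where "\<epsilon>0 > 0" "c \<ge> 0"
    "\<And>x y \<epsilon> \<alpha>. (\<And>i. i < k \<Longrightarrow> x i \<in> K) \<Longrightarrow> (\<And>j. j < l \<Longrightarrow> y j \<in> K) \<Longrightarrow> (\<And>i j. i < k \<Longrightarrow> j < l \<Longrightarrow> x i \<noteq> y j) \<Longrightarrow>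
      0 < \<epsilon> \<Longrightarrow> \<epsilon> \<le> \<epsilon>0 \<Longrightarrow> 0 \<le> \<alpha> \<Longrightarrow>
      exp (- \<alpha> * coulomb_energy (cov \<epsilon>) x y {..<k} {..<l}) \<le> exp (\<alpha> * c) * riesz_sum \<alpha> k l x y"
proof -
  obtain \<epsilon>1 c1 where e1: "\<epsilon>1 > 0" and c1: "c1 \<ge> 0" and cb: "\<And>x y \<epsilon>. x \<in> K \<Longrightarrow> y \<in> K \<Longrightarrow> 0 < \<epsilon> \<Longrightarrow> \<epsilon> \<le> \<epsilon>1 \<Longrightarrow>
      \<bar>cov \<epsilon> x y + ln (max (norm (x - y)) \<epsilon>)\<bar> \<le> c1"
    using cov_log_bound by blast
  obtain D where D: "D \<ge> 1" "\<And>x y. x \<in> K \<Longrightarrow> y \<in> K \<Longrightarrow> norm (y - x) \<le> D" using K_diameter by blast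
  \<comment> \<open>In \<open>\<kappa>\<close>, the one bounds \<open>ln 2\<close>, and \<open>c1\<close> is lost on each side of the triangle inequality. In \<open>\<kappa>'\<close>,
    \<open>D \<ge> 1\<close> bounds the truncated distances within \<open>K\<close>.\<close>
  define \<kappa> where "\<kappa> = 1 + 2 * c1"
  define \<kappa>' where "\<kappa>' = c1 + ln D"
  have k0: "\<kappa> \<ge> 0" "\<kappa>' \<ge> 0" unfolding \<kappa>_def \<kappa>'_def using c1 D by auto
  define c4 where "c4 = (2 * \<kappa> + \<kappa>') * (real k)\<^sup>2 + real l * c1"
  show thesis
  proof (rule that[of "min \<epsilon>1 1" c4])
    show "min \<epsilon>1 1 > 0" using e1 by simp
    show "c4 \<ge> 0" unfolding c4_def using k0 c1 by simp
    fix x y :: "nat \<Rightarrow> 'a" and \<epsilon> \<alpha> :: real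
    assume xK: "\<And>i. i < k \<Longrightarrow> x i \<in> K" and yK: "\<And>j. j < l \<Longrightarrow> y j \<in> K"
      and ne: "\<And>i j. i < k \<Longrightarrow> j < l \<Longrightarrow> x i \<noteq> y j" and e: "0 < \<epsilon>" "\<epsilon> \<le> min \<epsilon>1 1" and \<alpha>: "0 \<le> \<alpha>"
    let ?m = "\<lambda>a b. max (norm (a - b)) \<epsilon>"
    have mpos: "?m a b > 0" for a b :: 'a using e by simp
    have cb': "\<bar>cov \<epsilon> a b + ln (?m a b)\<bar> \<le> c1" if "a \<in> K" "b \<in> K" for a b using cb that e by simp
    have tri: "- cov \<epsilon> a c \<le> \<kappa> + max (- cov \<epsilon> a b) (- cov \<epsilon> b c)" if abc: "a \<in> K" "b \<in> K" "c \<in> K" for a b c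
    proof -
      have "norm (a - c) \<le> norm (a - b) + norm (b - c)" using norm_triangle_ineq[of "a - b" "b - c"] by simp
      then have "?m a c \<le> 2 * max (?m a b) (?m b c)" using e(1) by (auto simp: max_def)
      then have "ln (?m a c) \<le> ln (2 * max (?m a b) (?m b c))" using mpos[of a c] by (intro ln_mono) auto
      also have "\<dots> = ln 2 + ln (max (?m a b) (?m b c))" using mpos[of a b] by (intro ln_mult_pos) auto
      also have "\<dots> \<le> 1 + max (ln (?m a b)) (ln (?m b c))" using ln_2_less_1 by (auto simp: max_def)
      finally have 1: "ln (?m a c) \<le> 1 + max (ln (?m a b)) (ln (?m b c))" .
      have "ln (?m a b) \<le> c1 + - cov \<epsilon> a b" "ln (?m b c) \<le> c1 + - cov \<epsilon> b c"
        using abs_le_D1[OF cb'[OF abc(1,2)]] abs_le_D1[OF cb'[OF abc(2,3)]] by simp_all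
      then have "max (ln (?m a b)) (ln (?m b c)) \<le> max (c1 + - cov \<epsilon> a b) (c1 + - cov \<epsilon> b c)"
        by (rule max.mono)
      also have "\<dots> = c1 + max (- cov \<epsilon> a b) (- cov \<epsilon> b c)" by (rule max_add_distrib_right[symmetric])
      finally have 2: "max (ln (?m a b)) (ln (?m b c)) \<le> c1 + max (- cov \<epsilon> a b) (- cov \<epsilon> b c)" .
      have 3: "- cov \<epsilon> a c \<le> c1 + ln (?m a c)" using abs_le_D2[OF cb'[OF abc(1,3)]] by simp
      have comb: "w \<le> c1 + z \<Longrightarrow> z \<le> 1 + s \<Longrightarrow> s \<le> c1 + q \<Longrightarrow> w \<le> (1 + 2 * c1) + q" for w z s q by linarith
      show ?thesis unfolding \<kappa>_def by (rule comb[OF 3 1 2])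
    qed
    have low: "- \<kappa>' \<le> cov \<epsilon> a b" if ab: "a \<in> K" "b \<in> K" for a b
    proof -
      have "?m a b \<le> D" using D(1) D(2)[OF ab(2,1)] e by simp
      then have "ln (?m a b) \<le> ln D" using mpos[of a b] by (intro ln_mono) auto
      then show ?thesis using cb'[OF ab] unfolding \<kappa>'_def by linarith
    qed
    have "\<exists>\<sigma>. inj_on \<sigma> {..<l} \<and> \<sigma> ` {..<l} \<subseteq> {..<k} \<and> - coulomb_energy (cov \<epsilon>) x y {..<k} {..<l} \<le>
        (2 * \<kappa> + \<kappa>') * (real (card {..<k}))\<^sup>2 + (\<Sum>j<l. cov \<epsilon> (x (\<sigma> j)) (y j))"
      by (rule greedy_matching_bound[where A=K, OF cov_sym tri low k0]) (use lk xK yK in auto)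
    then obtain \<sigma>' where \<sigma>': "inj_on \<sigma>' {..<l}" "\<sigma>' ` {..<l} \<subseteq> {..<k}"
      and E: "- coulomb_energy (cov \<epsilon>) x y {..<k} {..<l} \<le> (2 * \<kappa> + \<kappa>') * (real k)\<^sup>2 + (\<Sum>j<l. cov \<epsilon> (x (\<sigma>' j)) (y j))"
      by auto
    define \<sigma> where "\<sigma> = restrict \<sigma>' {..<l}"
    have \<sigma>: "\<sigma> \<in> matchings k l" using \<sigma>' unfolding \<sigma>_def matchings_def by (auto simp: inj_on_def)
    have \<sigma>eq: "\<sigma>' j = \<sigma> j" if "j < l" for j using that unfolding \<sigma>_def by simp
    have \<sigma>k: "\<sigma> j < k" if "j < l" for j using \<sigma> that by (auto simp: matchings_def PiE_iff)
    have "(\<Sum>j<l. cov \<epsilon> (x (\<sigma>' j)) (y j)) \<le> (\<Sum>j<l. c1 + - ln (norm (y j - x (\<sigma> j))))"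
    proof (rule sum_mono)
      fix j assume "j \<in> {..<l}"
      then have j: "j < l" by simp
      have "norm (y j - x (\<sigma> j)) > 0" using ne[OF \<sigma>k[OF j] j] by simp
      then have "ln (norm (y j - x (\<sigma> j))) \<le> ln (?m (x (\<sigma> j)) (y j))"
        by (intro ln_mono) (auto simp: norm_minus_commute)
      then show "cov \<epsilon> (x (\<sigma>' j)) (y j) \<le> c1 + - ln (norm (y j - x (\<sigma> j)))"
        using cb'[OF xK[OF \<sigma>k[OF j]] yK[OF j]] unfolding \<sigma>eq[OF j] by linarith
    qed
    then have "- coulomb_energy (cov \<epsilon>) x y {..<k} {..<l} \<le> c4 + (\<Sum>j<l. - ln (norm (y j - x (\<sigma> j))))"
      using E unfolding c4_def sum.distrib by simp
    then have "\<alpha> * (- coulomb_energy (cov \<epsilon>) x y {..<k} {..<l}) \<le> \<alpha> * (c4 + (\<Sum>j<l. - ln (norm (y j - x (\<sigma> j)))))"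
      using \<alpha> by (rule mult_left_mono)
    then have "exp (- \<alpha> * coulomb_energy (cov \<epsilon>) x y {..<k} {..<l}) \<le> exp (\<alpha> * c4 + \<alpha> * (\<Sum>j<l. - ln (norm (y j - x (\<sigma> j)))))"
      by (simp add: distrib_left)
    also have "\<dots> = exp (\<alpha> * c4) * (\<Prod>j<l. norm (y j - x (\<sigma> j)) powr (- \<alpha>))"
    proof -
      have ne': "y j \<noteq> x (\<sigma> j)" if "j < l" for j using ne[OF \<sigma>k[OF that] that] by simp
      show ?thesis unfolding exp_add by (simp only: exp_sum_ln[where l=l and y=y and x=x and \<sigma>=\<sigma>, OF ne'])
    qed
    also have "\<dots> \<le> exp (\<alpha> * c4) * riesz_sum \<alpha> k l x y"
      unfolding riesz_sum_def
      by (intro mult_left_mono member_le_sum[OF \<sigma>] finite_matchings prod_nonneg) auto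
    finally show "exp (- \<alpha> * coulomb_energy (cov \<epsilon>) x y {..<k} {..<l}) \<le> exp (\<alpha> * c4) * riesz_sum \<alpha> k l x y" .
  qed
qed

lemma energy_tendsto:
  assumes xK: "\<And>i. i < k \<Longrightarrow> x i \<in> K" and yK: "\<And>j. j < l \<Longrightarrow> y j \<in> K" and dp: "distinct_points k l x y"
    and \<delta>: "\<And>n. \<delta> n > 0" "\<delta> \<longlonglongrightarrow> 0"
  shows "(\<lambda>n. coulomb_energy (cov (\<delta> n)) x y {..<k} {..<l}) \<longlonglongrightarrow> coulomb_energy C x y {..<k} {..<l}"
  unfolding coulomb_energy_def
  by (intro tendsto_diff tendsto_add tendsto_divide tendsto_const tendsto_sum cov_tendsto \<delta>)
     (use dp xK yK in \<open>auto simp: distinct_points_def inj_on_def\<close>)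

text \<open>The limit \<open>\<epsilon> \<rightarrow> 0\<close> of \<open>mollified_weight_bound\<close>.\<close>

lemma weight_bound:
  assumes lk: "l \<le> k"
  obtains c where "c \<ge> 0"
    "\<And>x y \<alpha>. (\<And>i. i < k \<Longrightarrow> x i \<in> K) \<Longrightarrow> (\<And>j. j < l \<Longrightarrow> y j \<in> K) \<Longrightarrow> distinct_points k l x y \<Longrightarrow> 0 \<le> \<alpha> \<Longrightarrow>
      exp (- \<alpha> * coulomb_energy C x y {..<k} {..<l}) \<le> exp (\<alpha> * c) * riesz_sum \<alpha> k l x y"
proof -
  obtain \<epsilon>0 c where e0: "\<epsilon>0 > 0" "c \<ge> 0" and bd:
    "\<And>x y \<epsilon> \<alpha>. (\<And>i. i < k \<Longrightarrow> x i \<in> K) \<Longrightarrow> (\<And>j. j < l \<Longrightarrow> y j \<in> K) \<Longrightarrow> (\<And>i j. i < k \<Longrightarrow> j < l \<Longrightarrow> x i \<noteq> y j) \<Longrightarrow>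
      0 < \<epsilon> \<Longrightarrow> \<epsilon> \<le> \<epsilon>0 \<Longrightarrow> 0 \<le> \<alpha> \<Longrightarrow>
      exp (- \<alpha> * coulomb_energy (cov \<epsilon>) x y {..<k} {..<l}) \<le> exp (\<alpha> * c) * riesz_sum \<alpha> k l x y"
    using mollified_weight_bound[OF lk] by blast
  show thesis
  proof (rule that[OF e0(2)])
    fix x y :: "nat \<Rightarrow> 'a" and \<alpha> :: real
    assume a: "\<And>i. i < k \<Longrightarrow> x i \<in> K" "\<And>j. j < l \<Longrightarrow> y j \<in> K" "distinct_points k l x y" "0 \<le> \<alpha>"
    define \<delta> where "\<delta> n = \<epsilon>0 * (1 / real (Suc n))" for n
    have \<delta>: "\<delta> n > 0" "\<delta> n \<le> \<epsilon>0" for n unfolding \<delta>_def using e0 divide_left_mono[of 1 "1 + real n" \<epsilon>0] by auto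
    have "\<delta> \<longlonglongrightarrow> \<epsilon>0 * 0" unfolding \<delta>_def by (intro tendsto_intros LIMSEQ_Suc[OF lim_1_over_n])
    then have \<delta>0: "\<delta> \<longlonglongrightarrow> 0" by simp
    have "(\<lambda>n. exp (- \<alpha> * coulomb_energy (cov (\<delta> n)) x y {..<k} {..<l})) \<longlonglongrightarrow> exp (- \<alpha> * coulomb_energy C x y {..<k} {..<l})"
      by (intro tendsto_intros energy_tendsto a(1,2,3) \<delta>(1) \<delta>0)
    moreover have "exp (- \<alpha> * coulomb_energy (cov (\<delta> n)) x y {..<k} {..<l}) \<le> exp (\<alpha> * c) * riesz_sum \<alpha> k l x y" for n
      using a \<delta> by (intro bd) (auto simp: distinct_points_def)
    ultimately show "exp (- \<alpha> * coulomb_energy C x y {..<k} {..<l}) \<le> exp (\<alpha> * c) * riesz_sum \<alpha> k l x y"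
      by (intro LIMSEQ_le_const2) auto
  qed
qed

definition wt :: "nat \<Rightarrow> nat \<Rightarrow> (nat \<Rightarrow> 'a) \<Rightarrow> (nat \<Rightarrow> 'a) \<Rightarrow> complex" where
  "wt k l x y = (\<Prod>i<k. f (x i)) * (\<Prod>j<l. cnj (f (y j)))"

lemma wt_bound: "cmod (wt k l x y) \<le> F ^ k * F ^ l"
proof -
  have "(\<Prod>i<k. cmod (f (x i))) \<le> (\<Prod>i<k. F)" by (intro prod_mono conjI F) auto
  moreover have "(\<Prod>j<l. cmod (f (y j))) \<le> (\<Prod>i<l. F)" by (intro prod_mono conjI F) auto
  ultimately show ?thesis
    unfolding wt_def norm_mult prod_norm[symmetric] complex_mod_cnj
    using F(1) by (intro mult_mono) (auto intro: prod_nonneg)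
qed

lemma wt_support:
  assumes "wt k l x y \<noteq> 0"
  shows "i < k \<Longrightarrow> x i \<in> K" "j < l \<Longrightarrow> y j \<in> K"
proof -
  have *: "f (x i) \<noteq> 0" if "i < k" for i using assms that unfolding wt_def by auto
  have **: "f (y i) \<noteq> 0" if "i < l" for i using assms that unfolding wt_def by auto
  show "i < k \<Longrightarrow> x i \<in> K" "j < l \<Longrightarrow> y j \<in> K" using * ** f_supp by blast+
qed

lemma cnj_borel[measurable]: "cnj \<in> borel_measurable borel"
  by (intro borel_measurable_continuous_onI continuous_intros)

lemma wt_measurable[measurable]: "(\<lambda>p. wt k l (fst p) (snd p)) \<in> borel_measurable (configs k l)"
  unfolding wt_def
  by (intro borel_measurable_times borel_measurable_prod measurable_compose[OF _ f_borel]
      measurable_compose[OF measurable_compose[OF _ f_borel] cnj_borel] component_fst component_snd) auto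

lemma coulomb_energy_measurable:
  fixes c :: "'a \<Rightarrow> 'a \<Rightarrow> real"
  assumes m: "\<And>a b :: (nat \<Rightarrow> 'a) \<times> (nat \<Rightarrow> 'a) \<Rightarrow> 'a. a \<in> borel_measurable (configs k l) \<Longrightarrow> b \<in> borel_measurable (configs k l) \<Longrightarrow>
    (\<lambda>p. c (a p) (b p)) \<in> borel_measurable (configs k l)"
  shows "(\<lambda>p. coulomb_energy c (fst p) (snd p) {..<k} {..<l}) \<in> borel_measurable (configs k l)"
  unfolding coulomb_energy_def
  by (intro borel_measurable_diff borel_measurable_add borel_measurable_divide borel_measurable_sum
      borel_measurable_const m[OF component_fst component_fst] m[OF component_fst component_snd]
      m[OF component_snd component_snd]) auto

text \<open>The partition function of the two-component Coulomb gas in the external weight \<open>f\<close>.\<close>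

definition gas :: "real \<Rightarrow> ('a \<Rightarrow> 'a \<Rightarrow> real) \<Rightarrow> nat \<Rightarrow> nat \<Rightarrow> complex" where
  "gas \<alpha> c k l = (\<integral>p. wt k l (fst p) (snd p) *
     of_real (exp (- \<alpha> * coulomb_energy c (fst p) (snd p) {..<k} {..<l})) \<partial>configs k l)"

lemma energy_cov_measurable[measurable]:
  "\<epsilon> > 0 \<Longrightarrow> (\<lambda>p. coulomb_energy (cov \<epsilon>) (fst p) (snd p) {..<k} {..<l}) \<in> borel_measurable (configs k l)"
  by (intro coulomb_energy_measurable cov_measurable)

lemma energy_C_measurable[measurable]:
  "(\<lambda>p. coulomb_energy C (fst p) (snd p) {..<k} {..<l}) \<in> borel_measurable (configs k l)"
  by (intro coulomb_energy_measurable log_kernel_measurable2)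

text \<open>Dominated convergence with the integrable sum of Riesz kernels from
  \<open>mollified_weight_bound\<close>.\<close>

lemma gas_tendsto:
  assumes lk: "l \<le> k" and t: "0 < t" "t < real DIM('a)" and \<delta>: "\<And>n. \<delta> n > 0" "\<delta> \<longlonglongrightarrow> 0"
  shows "(\<lambda>n. gas (real DIM('a) - t) (cov (\<delta> n)) k l) \<longlonglongrightarrow> gas (real DIM('a) - t) C k l"
proof -
  let ?\<alpha> = "real DIM('a) - t"
  obtain \<epsilon>0 c where e0: "\<epsilon>0 > 0" "c \<ge> 0" and bd:
    "\<And>x y \<epsilon> \<alpha>. (\<And>i. i < k \<Longrightarrow> x i \<in> K) \<Longrightarrow> (\<And>j. j < l \<Longrightarrow> y j \<in> K) \<Longrightarrow> (\<And>i j. i < k \<Longrightarrow> j < l \<Longrightarrow> x i \<noteq> y j) \<Longrightarrow>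
      0 < \<epsilon> \<Longrightarrow> \<epsilon> \<le> \<epsilon>0 \<Longrightarrow> 0 \<le> \<alpha> \<Longrightarrow>
      exp (- \<alpha> * coulomb_energy (cov \<epsilon>) x y {..<k} {..<l}) \<le> exp (\<alpha> * c) * riesz_sum \<alpha> k l x y"
    using mollified_weight_bound[OF lk] by blast
  obtain D where D: "D \<ge> 1" "\<And>x y. x \<in> K \<Longrightarrow> y \<in> K \<Longrightarrow> norm (y - x) \<le> D" using K_diameter by blast
  have D0: "D > 0" using D(1) by simp
  obtain N where N: "\<And>n. n \<ge> N \<Longrightarrow> \<delta> n \<le> \<epsilon>0"
    using LIMSEQ_D[OF \<delta>(2) e0(1)] by force
  let ?w = "\<lambda>p. (F ^ k * F ^ l * exp (?\<alpha> * c)) * (indicator (box K k l) p * riesz_sum ?\<alpha> k l (fst p) (snd p))"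
  have "(\<lambda>n. gas ?\<alpha> (cov (\<delta> (n + N))) k l) \<longlonglongrightarrow> gas ?\<alpha> C k l"
    unfolding gas_def
  proof (rule integral_dominated_convergence[where w="?w"])
    note [measurable] = energy_cov_measurable[OF \<delta>(1)]
    show "(\<lambda>p. wt k l (fst p) (snd p) * complex_of_real (exp (- ?\<alpha> * coulomb_energy (cov (\<delta> (n + N))) (fst p) (snd p) {..<k} {..<l})))
        \<in> borel_measurable (configs k l)" for n by measurable
    show "integrable (configs k l) ?w"
      by (rule integrable_mult_right[OF riesz_sum_integrable(1)[OF K(1) D0 D(2) t]])
    show "AE p in configs k l. (\<lambda>n. wt k l (fst p) (snd p) * complex_of_real (exp (- ?\<alpha> * coulomb_energy (cov (\<delta> (n + N))) (fst p) (snd p) {..<k} {..<l})))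
        \<longlonglongrightarrow> wt k l (fst p) (snd p) * complex_of_real (exp (- ?\<alpha> * coulomb_energy C (fst p) (snd p) {..<k} {..<l}))"
      using AE_distinct_points
    proof eventually_elim
      case (elim p)
      show ?case
      proof (cases "wt k l (fst p) (snd p) = 0")
        case False
        show ?thesis
          by (intro tendsto_intros energy_tendsto elim wt_support[OF False] \<delta>(1) LIMSEQ_ignore_initial_segment[OF \<delta>(2)])
      qed simp
    qed
    show "AE p in configs k l. norm (wt k l (fst p) (snd p) * complex_of_real (exp (- ?\<alpha> * coulomb_energy (cov (\<delta> (n + N))) (fst p) (snd p) {..<k} {..<l})))
        \<le> ?w p" for n
      using AE_distinct_points AE_space
    proof eventually_elim
      case (elim p)
      show ?case
      proof (cases "wt k l (fst p) (snd p) = 0")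
        case True
        then show ?thesis using F(1) by (simp add: riesz_sum_nonneg)
      next
        case False
        have "exp (- ?\<alpha> * coulomb_energy (cov (\<delta> (n + N))) (fst p) (snd p) {..<k} {..<l}) \<le> exp (?\<alpha> * c) * riesz_sum ?\<alpha> k l (fst p) (snd p)"
          using wt_support[OF False] elim(1) \<delta>(1) N[of "n + N"] t by (intro bd) (auto simp: distinct_points_def)
        then have "norm (wt k l (fst p) (snd p) * complex_of_real (exp (- ?\<alpha> * coulomb_energy (cov (\<delta> (n + N))) (fst p) (snd p) {..<k} {..<l})))
            \<le> (F ^ k * F ^ l) * (exp (?\<alpha> * c) * riesz_sum ?\<alpha> k l (fst p) (snd p))"
          unfolding norm_mult norm_of_real abs_exp_cancel using wt_bound F(1) by (intro mult_mono) auto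
        moreover have "p \<in> box K k l"
          using not_in_box[OF elim(2), of K] wt_support[OF False] by blast
        ultimately show ?thesis by (simp add: mult.assoc)
      qed
    qed
  qed measurable
  then show ?thesis by (rule LIMSEQ_offset)
qed

text \<open>Each of the \<open>l\<close> matched pairs contributes a Riesz potential, which is of order
  \<open>1 / riesz_const d t\<close>, that is \<open>1 / t\<close> as \<open>t \<rightarrow> 0\<close>.\<close>

lemma gas_bound:
  assumes lk: "l \<le> k"
  obtains B where "\<And>t. 0 < t \<Longrightarrow> t < real DIM('a) \<Longrightarrow> t \<le> 1 \<Longrightarrow>
    cmod (gas (real DIM('a) - t) C k l) \<le> B * (1 / riesz_const (real DIM('a)) t) ^ l"
proof -
  obtain c where c: "c \<ge> 0" and bd:
    "\<And>x y \<alpha>. (\<And>i. i < k \<Longrightarrow> x i \<in> K) \<Longrightarrow> (\<And>j. j < l \<Longrightarrow> y j \<in> K) \<Longrightarrow> distinct_points k l x y \<Longrightarrow> 0 \<le> \<alpha> \<Longrightarrow>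
      exp (- \<alpha> * coulomb_energy C x y {..<k} {..<l}) \<le> exp (\<alpha> * c) * riesz_sum \<alpha> k l x y"
    using weight_bound[OF lk] by blast
  obtain D where D: "D \<ge> 1" "\<And>x y. x \<in> K \<Longrightarrow> y \<in> K \<Longrightarrow> norm (y - x) \<le> D" using K_diameter by blast
  have D0: "D > 0" using D(1) by simp
  let ?S = "measure lborel (shell :: 'a set)"
  let ?B = "(F ^ k * F ^ l * exp (real DIM('a) * c)) * (real (card (matchings k l)) * (measure lborel K ^ k * (D * ?S) ^ l))"
  show thesis
  proof (rule that[of ?B])
    fix t assume t: "0 < t" "t < real DIM('a)" "t \<le> 1"
    let ?\<alpha> = "real DIM('a) - t"
    let ?r = "riesz_const (real DIM('a)) t"
    have r: "?r > 0" by (rule riesz_const_pos[OF t(1,2)])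
    let ?w = "\<lambda>p. (F ^ k * F ^ l * exp (real DIM('a) * c)) * (indicator (box K k l) p * riesz_sum ?\<alpha> k l (fst p) (snd p))"
    have iw: "integrable (configs k l) ?w"
      by (rule integrable_mult_right[OF riesz_sum_integrable(1)[OF K(1) D0 D(2) t(1,2)]])
    have "AE p in configs k l. norm (wt k l (fst p) (snd p) * complex_of_real (exp (- ?\<alpha> * coulomb_energy C (fst p) (snd p) {..<k} {..<l}))) \<le> ?w p"
      using AE_distinct_points AE_space
    proof eventually_elim
      case (elim p)
      show ?case
      proof (cases "wt k l (fst p) (snd p) = 0")
        case True
        then show ?thesis using F(1) by (simp add: riesz_sum_nonneg)
      next
        case False
        have "exp (- ?\<alpha> * coulomb_energy C (fst p) (snd p) {..<k} {..<l}) \<le> exp (?\<alpha> * c) * riesz_sum ?\<alpha> k l (fst p) (snd p)"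
          using wt_support[OF False] elim(1) t by (intro bd) auto
        also have "\<dots> \<le> exp (real DIM('a) * c) * riesz_sum ?\<alpha> k l (fst p) (snd p)"
          using t c by (intro mult_right_mono riesz_sum_nonneg) (simp add: mult_right_mono)
        finally have "norm (wt k l (fst p) (snd p) * complex_of_real (exp (- ?\<alpha> * coulomb_energy C (fst p) (snd p) {..<k} {..<l})))
            \<le> (F ^ k * F ^ l) * (exp (real DIM('a) * c) * riesz_sum ?\<alpha> k l (fst p) (snd p))"
          unfolding norm_mult norm_of_real abs_exp_cancel using wt_bound F(1) by (intro mult_mono) auto
        moreover have "p \<in> box K k l"
          using not_in_box[OF elim(2), of K] wt_support[OF False] by blast
        ultimately show ?thesis by (simp add: mult.assoc)
      qed
    qed
    then have "cmod (gas ?\<alpha> C k l) \<le> (\<integral>p. ?w p \<partial>configs k l)"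
      unfolding gas_def by (intro integral_norm_bound_integral_AE iw)
    also have "\<dots> \<le> (F ^ k * F ^ l * exp (real DIM('a) * c)) *
        (real (card (matchings k l)) * (measure lborel K ^ k * (D powr t / ?r * ?S) ^ l))"
      unfolding integral_mult_right_zero
      using F(1) by (intro mult_left_mono riesz_sum_integrable(2)[OF K(1) D0 D(2) t(1,2)]) auto
    also have "\<dots> \<le> (F ^ k * F ^ l * exp (real DIM('a) * c)) *
        (real (card (matchings k l)) * (measure lborel K ^ k * (D / ?r * ?S) ^ l))"
    proof -
      have "D powr t \<le> D powr 1" using D(1) t by (intro powr_mono) auto
      then have "D powr t / ?r * ?S \<le> D / ?r * ?S" using r D0 by (intro mult_right_mono divide_right_mono) auto
      then show ?thesis
        using F(1) r by (intro mult_left_mono power_mono mult_nonneg_nonneg) auto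
    qed
    also have "\<dots> = ?B * (1 / ?r) ^ l" by (simp add: power_mult_distrib power_divide)
    finally show "cmod (gas ?\<alpha> C k l) \<le> ?B * (1 / ?r) ^ l" .
  qed
qed

text \<open>The approximants are bounded random variables, because the normalisation of the vertex operators is bounded
  on \<open>K\<close> for fixed \<open>\<epsilon>\<close>; so all their moments are finite, and no integrability of the limit has to be known.\<close>

lemma approx_moment:
  obtains \<epsilon>0 where "\<epsilon>0 > 0"
    "\<And>\<epsilon> \<beta>. 0 < \<epsilon> \<Longrightarrow> \<epsilon> \<le> \<epsilon>0 \<Longrightarrow> \<exists>B. \<forall>\<omega>\<in>space M. cmod (distr_of_fun (approx_chaos M U X \<eta> \<beta> \<epsilon> \<omega>) f) \<le> B"
    "\<And>\<epsilon> \<beta> k l. 0 < \<epsilon> \<Longrightarrow> \<epsilon> \<le> \<epsilon>0 \<Longrightarrow>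
      (\<integral>\<omega>. distr_of_fun (approx_chaos M U X \<eta> \<beta> \<epsilon> \<omega>) f ^ k * cnj (distr_of_fun (approx_chaos M U X \<eta> \<beta> \<epsilon> \<omega>) f) ^ l \<partial>M) =
      gas (\<beta>\<^sup>2) (cov \<epsilon>) k l"
proof -
  obtain \<epsilon>1 c1 where e1: "\<epsilon>1 > 0" and c1: "c1 \<ge> 0" and cb: "\<And>x y \<epsilon>. x \<in> K \<Longrightarrow> y \<in> K \<Longrightarrow> 0 < \<epsilon> \<Longrightarrow> \<epsilon> \<le> \<epsilon>1 \<Longrightarrow>
      \<bar>cov \<epsilon> x y + ln (max (norm (x - y)) \<epsilon>)\<bar> \<le> c1"
    using cov_log_bound by blast
  have Kb: "K \<in> sets borel" "bounded K" using K(1) borel_compact compact_imp_bounded by auto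
  have Ke: "emeasure lborel K < \<infinity>" by (rule emeasure_bounded_finite[OF Kb(2)])
  have dist: "distr_of_fun (approx_chaos M U X \<eta> \<beta> \<epsilon> \<omega>) f = (\<integral>x. vertex \<beta> \<epsilon> \<omega> x * f x \<partial>lborel)"
    if "0 < \<epsilon>" "\<omega> \<in> space M" for \<beta> \<epsilon> \<omega>
    unfolding distr_of_fun_def
  proof (intro Bochner_Integration.integral_cong refl)
    fix x
    show "approx_chaos M U X \<eta> \<beta> \<epsilon> \<omega> x * f x = vertex \<beta> \<epsilon> \<omega> x * f x"
      using approx_chaos_eq_vertex[OF that, of x \<beta>] f_supp[of x] K(2) by (cases "x \<in> K") auto
  qed
  define B where "B \<beta> \<epsilon> = exp (\<beta>\<^sup>2 / 2 * (c1 - ln \<epsilon>)) * F" for \<beta> \<epsilon>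
  have bd: "cmod (vertex \<beta> \<epsilon> \<omega> x * f x) \<le> B \<beta> \<epsilon>" if e: "0 < \<epsilon>" "\<epsilon> \<le> \<epsilon>1" for \<beta> \<epsilon> \<omega> x
  proof (cases "x \<in> K")
    case True
    have "cov \<epsilon> x x \<le> c1 - ln \<epsilon>" using cb[OF True True e] e by simp
    then have "exp (\<beta>\<^sup>2 / 2 * cov \<epsilon> x x) \<le> exp (\<beta>\<^sup>2 / 2 * (c1 - ln \<epsilon>))" by (simp add: mult_left_mono divide_right_mono)
    then show ?thesis
      unfolding B_def vertex_def norm_mult norm_of_real norm_cis using F(1) F(2)[of x] by (intro mult_mono) auto
  next
    case False
    then show ?thesis using f_supp[of x] F(1) unfolding B_def by simp
  qed
  show thesis
  proof (rule that[OF e1])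
    fix \<epsilon> \<beta> assume e: "0 < \<epsilon>" "\<epsilon> \<le> \<epsilon>1"
    show "\<exists>B. \<forall>\<omega>\<in>space M. cmod (distr_of_fun (approx_chaos M U X \<eta> \<beta> \<epsilon> \<omega>) f) \<le> B"
    proof (intro exI ballI)
      fix \<omega> assume w: "\<omega> \<in> space M"
      have "cmod (\<integral>x. vertex \<beta> \<epsilon> \<omega> x * f x \<partial>lborel) \<le> (\<integral>x. B \<beta> \<epsilon> * indicator K x \<partial>lborel)"
        proof (rule integral_norm_bound_integral_AE)
        show "integrable lborel (\<lambda>x. B \<beta> \<epsilon> * indicator K x)"
          using Kb Ke by (intro integrable_mult_right integrable_real_indicator) auto
        show "AE x in lborel. cmod (vertex \<beta> \<epsilon> \<omega> x * f x) \<le> B \<beta> \<epsilon> * indicator K x"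
          using bd[OF e] f_supp by (intro AE_I2) (auto simp: indicator_def)
      qed
      then show "cmod (distr_of_fun (approx_chaos M U X \<eta> \<beta> \<epsilon> \<omega>) f) \<le> (\<integral>x. B \<beta> \<epsilon> * indicator K x \<partial>lborel)"
        unfolding dist[OF e(1) w] .
    qed
    fix k l
    have vm: "(\<lambda>p. vertex \<beta> \<epsilon> (fst p) (snd p) * f (snd p)) \<in> borel_measurable (M \<Otimes>\<^sub>M borel)"
    proof -
      note [measurable] = fld_jointly_measurable[OF e(1)] cov_measurable[OF e(1) measurable_snd measurable_snd]
      show ?thesis unfolding vertex_def by measurable
    qed
    have "(\<integral>\<omega>. distr_of_fun (approx_chaos M U X \<eta> \<beta> \<epsilon> \<omega>) f ^ k * cnj (distr_of_fun (approx_chaos M U X \<eta> \<beta> \<epsilon> \<omega>) f) ^ l \<partial>M) =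
        (\<integral>\<omega>. (\<integral>x. vertex \<beta> \<epsilon> \<omega> x * f x \<partial>lborel) ^ k * cnj (\<integral>x. vertex \<beta> \<epsilon> \<omega> x * f x \<partial>lborel) ^ l \<partial>M)"
      by (intro Bochner_Integration.integral_cong refl) (simp add: dist[OF e(1)])
    also have "\<dots> = (\<integral>p. (\<integral>\<omega>. (\<Prod>i<k. vertex \<beta> \<epsilon> \<omega> (fst p i) * f (fst p i)) * (\<Prod>j<l. cnj (vertex \<beta> \<epsilon> \<omega> (snd p j) * f (snd p j))) \<partial>M) \<partial>configs k l)"
      by (rule moment_fubini[OF prob vm Kb bd[OF e]]) (simp add: f_supp)
    also have "\<dots> = gas (\<beta>\<^sup>2) (cov \<epsilon>) k l"
      unfolding gas_def
    proof (intro Bochner_Integration.integral_cong refl)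
      fix p :: "(nat \<Rightarrow> 'a) \<times> (nat \<Rightarrow> 'a)"
      have "(\<Prod>i<k. vertex \<beta> \<epsilon> \<omega> (fst p i) * f (fst p i)) * (\<Prod>j<l. cnj (vertex \<beta> \<epsilon> \<omega> (snd p j) * f (snd p j))) =
          wt k l (fst p) (snd p) * ((\<Prod>i<k. vertex \<beta> \<epsilon> \<omega> (fst p i)) * (\<Prod>j<l. cnj (vertex \<beta> \<epsilon> \<omega> (snd p j))))" for \<omega>
        by (simp add: wt_def prod.distrib)
      then show "(\<integral>\<omega>. (\<Prod>i<k. vertex \<beta> \<epsilon> \<omega> (fst p i) * f (fst p i)) * (\<Prod>j<l. cnj (vertex \<beta> \<epsilon> \<omega> (snd p j) * f (snd p j))) \<partial>M) =
          wt k l (fst p) (snd p) * of_real (exp (- \<beta>\<^sup>2 * coulomb_energy (cov \<epsilon>) (fst p) (snd p) {..<k} {..<l}))"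
        by (simp only: integral_mult_right_zero expectation_vertex_product[OF e(1)])
    qed
    finally show "(\<integral>\<omega>. distr_of_fun (approx_chaos M U X \<eta> \<beta> \<epsilon> \<omega>) f ^ k * cnj (distr_of_fun (approx_chaos M U X \<eta> \<beta> \<epsilon> \<omega>) f) ^ l \<partial>M) =
      gas (\<beta>\<^sup>2) (cov \<epsilon>) k l" .
  qed
qed

end

section \<open>Merging pairs of opposite charges\<close>

lemma matchings_bij: "\<sigma> \<in> matchings n n \<Longrightarrow> bij_betw \<sigma> {..<n} {..<n}"
proof -
  assume "\<sigma> \<in> matchings n n"
  then have "inj_on \<sigma> {..<n}" "\<sigma> ` {..<n} \<subseteq> {..<n}" unfolding matchings_def by auto
  then show ?thesis unfolding bij_betw_def by (simp add: endo_inj_surj)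
qed

lemma card_matchings: "card (matchings n n) = fact n"
proof -
  have "bij_betw (\<lambda>p. restrict p {..<n}) {p. p permutes {..<n}} (matchings n n)"
    unfolding bij_betw_def
  proof (intro conjI)
    show "inj_on (\<lambda>p. restrict p {..<n}) {p. p permutes {..<n}}"
    proof (rule inj_onI)
      fix p q assume pq: "p \<in> {p. p permutes {..<n}}" "q \<in> {p. p permutes {..<n}}" "restrict p {..<n} = restrict q {..<n}"
      show "p = q"
      proof
        fix i show "p i = q i"
        proof (cases "i < n")
          case True
          then show ?thesis using fun_cong[OF pq(3), of i] by simp
        next
          case False
          then show ?thesis using pq(1,2) by (simp add: permutes_def)
        qed
      qed
    qed
    show "(\<lambda>p. restrict p {..<n}) ` {p. p permutes {..<n}} = matchings n n"
    proof (intro equalityI subsetI)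
      fix \<sigma> assume "\<sigma> \<in> (\<lambda>p. restrict p {..<n}) ` {p. p permutes {..<n}}"
      then obtain p where p: "p permutes {..<n}" "\<sigma> = restrict p {..<n}" by auto
      then show "\<sigma> \<in> matchings n n"
        using permutes_in_image[OF p(1)] permutes_inj_on[OF p(1), of "{..<n}"]
        by (auto simp: matchings_def inj_on_def)
    next
      fix \<sigma> assume \<sigma>: "\<sigma> \<in> matchings n n"
      let ?p = "\<lambda>i. if i < n then \<sigma> i else i"
      have "bij_betw ?p {..<n} {..<n}"
        using matchings_bij[OF \<sigma>] by (subst bij_betw_cong[of _ _ \<sigma>]) auto
      then have "?p permutes {..<n}" by (rule bij_imp_permutes) auto
      moreover have "\<sigma> = restrict ?p {..<n}"
        using \<sigma> by (auto simp: matchings_def PiE_iff extensional_def fun_eq_iff)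
      ultimately show "\<sigma> \<in> (\<lambda>p. restrict p {..<n}) ` {p. p permutes {..<n}}" by blast
    qed
  qed
  then show ?thesis using bij_betw_same_card card_permutations[of "{..<n}" n] by fastforce
qed

definition riesz_prod :: "real \<Rightarrow> (nat \<Rightarrow> nat) \<Rightarrow> nat \<Rightarrow> (nat \<Rightarrow> 'a::euclidean_space) \<Rightarrow> (nat \<Rightarrow> 'a) \<Rightarrow> real" where
  "riesz_prod \<alpha> \<sigma> l x y = (\<Prod>j<l. norm (y j - x (\<sigma> j)) powr (- \<alpha>))"

lemma riesz_sum_eq: "riesz_sum \<alpha> k l x y = (\<Sum>\<sigma>\<in>matchings k l. riesz_prod \<alpha> \<sigma> l x y)"
  unfolding riesz_sum_def riesz_prod_def ..

lemma riesz_prod_measurable: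
  assumes "\<sigma> \<in> matchings k l"
  shows "(\<lambda>p. riesz_prod \<alpha> \<sigma> l (fst p) (snd p)) \<in> borel_measurable (configs k l :: ((nat \<Rightarrow> 'a::euclidean_space) \<times> (nat \<Rightarrow> 'a)) measure)"
  unfolding riesz_prod_def
proof (rule borel_measurable_prod)
  fix j assume "j \<in> {..<l}"
  then have [simp]: "\<sigma> j < k" "j < l" using assms by (auto simp: matchings_def PiE_iff)
  show "(\<lambda>p. norm (snd p j - fst p (\<sigma> j) :: 'a) powr (- \<alpha>)) \<in> borel_measurable (configs k l)" by measurable
qed

lemma riesz_prod_pos:
  assumes "distinct_points k l x y" "\<sigma> \<in> matchings k l"
  shows "riesz_prod \<alpha> \<sigma> l x y > 0"
  unfolding riesz_prod_def
proof (rule prod_pos)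
  fix j assume "j \<in> {..<l}"
  then have "\<sigma> j < k" "j < l" using assms(2) by (auto simp: matchings_def PiE_iff)
  then have "x (\<sigma> j) \<noteq> y j" using assms(1) unfolding distinct_points_def by blast
  then show "0 < norm (y j - x (\<sigma> j)) powr - \<alpha>" by auto
qed

text \<open>The kernels of a wrong partner stay bounded while that of the right partner blows up, so the term
  of \<open>\<sigma>\<close> outweighs those of all other matchings.\<close>

lemma riesz_prod_dominates:
  fixes x :: "nat \<Rightarrow> 'a::euclidean_space"
  assumes \<sigma>: "\<sigma> \<in> matchings n n" and inj: "inj_on x {..<n}"
    and y: "\<And>j. j < n \<Longrightarrow> (\<lambda>m. y m j) \<longlonglongrightarrow> x (\<sigma> j)" and ne: "\<And>m j. j < n \<Longrightarrow> y m j \<noteq> x (\<sigma> j)"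
    and \<alpha>: "\<alpha> \<longlonglongrightarrow> d" "d > 0"
  shows "(\<lambda>m. riesz_prod (\<alpha> m) \<sigma> n x (y m) / riesz_sum (\<alpha> m) n n x (y m)) \<longlonglongrightarrow> 1"
proof -
  have \<sigma>n: "\<tau> j < n" if "\<tau> \<in> matchings n n" "j < n" for \<tau> j using that by (auto simp: matchings_def PiE_iff)
  have ratio: "(\<lambda>m. riesz_prod (\<alpha> m) \<tau> n x (y m) / riesz_prod (\<alpha> m) \<sigma> n x (y m)) \<longlonglongrightarrow> (if \<tau> = \<sigma> then 1 else 0)"
    if \<tau>: "\<tau> \<in> matchings n n" for \<tau>
  proof -
    have f: "(\<lambda>m. norm (y m j - x (\<tau> j)) powr (- \<alpha> m) / norm (y m j - x (\<sigma> j)) powr (- \<alpha> m))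
        \<longlonglongrightarrow> (if \<tau> j = \<sigma> j then 1 else 0)" if j: "j < n" for j
    proof (cases "\<tau> j = \<sigma> j")
      case True
      have "norm (y m j - x (\<tau> j)) powr (- \<alpha> m) / norm (y m j - x (\<sigma> j)) powr (- \<alpha> m) = 1" for m
        unfolding True using ne[OF j, of m] by simp
      then show ?thesis using True by simp
    next
      case False
      then have x: "x (\<sigma> j) - x (\<tau> j) \<noteq> 0"
        using inj \<sigma>n[OF \<sigma> j] \<sigma>n[OF \<tau> j] by (auto simp: inj_on_def)
      have 1: "(\<lambda>m. norm (y m j - x (\<tau> j)) powr (- \<alpha> m)) \<longlonglongrightarrow> norm (x (\<sigma> j) - x (\<tau> j)) powr (- d)"
        by (intro tendsto_intros y j \<alpha>(1)) (use x in simp)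
      have "(\<lambda>m. norm (y m j - x (\<sigma> j))) \<longlonglongrightarrow> norm (x (\<sigma> j) - x (\<sigma> j))"
        by (intro tendsto_intros y j)
      then have 2: "(\<lambda>m. norm (y m j - x (\<sigma> j)) powr \<alpha> m) \<longlonglongrightarrow> 0"
        by (intro tendsto_zero_powrI[OF _ \<alpha>(1) _ \<alpha>(2)]) auto
      have "(\<lambda>m. norm (y m j - x (\<tau> j)) powr (- \<alpha> m) * norm (y m j - x (\<sigma> j)) powr \<alpha> m) \<longlonglongrightarrow> 0"
        using tendsto_mult[OF 1 2] by simp
      then show ?thesis using False by (simp add: powr_minus divide_inverse)
    qed
    have "(\<lambda>m. \<Prod>j<n. norm (y m j - x (\<tau> j)) powr (- \<alpha> m) / norm (y m j - x (\<sigma> j)) powr (- \<alpha> m))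
        \<longlonglongrightarrow> (\<Prod>j<n. if \<tau> j = \<sigma> j then 1 else 0)"
      by (intro tendsto_prod f) auto
    also have "(\<Prod>j<n. if \<tau> j = \<sigma> j then 1 else 0) = (if \<tau> = \<sigma> then 1 else (0::real))"
    proof (cases "\<tau> = \<sigma>")
      case False
      then obtain j where "\<tau> j \<noteq> \<sigma> j" by blast
      moreover from this have "j < n"
        using \<tau> \<sigma> by (auto simp: matchings_def PiE_iff extensional_def) (metis lessThan_iff)
      ultimately show ?thesis using False by (auto intro!: prod_zero)
    qed simp
    finally show ?thesis unfolding riesz_prod_def prod_dividef .
  qed
  have "(\<lambda>m. \<Sum>\<tau>\<in>matchings n n. riesz_prod (\<alpha> m) \<tau> n x (y m) / riesz_prod (\<alpha> m) \<sigma> n x (y m))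
      \<longlonglongrightarrow> (\<Sum>\<tau>\<in>matchings n n. if \<tau> = \<sigma> then 1 else 0)"
    by (intro tendsto_sum ratio)
  also have "(\<Sum>\<tau>\<in>matchings n n. if \<tau> = \<sigma> then 1 else (0::real)) = 1"
    using \<sigma> finite_matchings[of n n] by simp
  finally have "(\<lambda>m. riesz_sum (\<alpha> m) n n x (y m) / riesz_prod (\<alpha> m) \<sigma> n x (y m)) \<longlonglongrightarrow> 1"
    unfolding riesz_sum_eq sum_divide_distrib .
  from tendsto_inverse[OF this] show ?thesis by (simp add: inverse_eq_divide)
qed

lemma sum_offdiag_reindex:
  fixes c :: "nat \<Rightarrow> nat \<Rightarrow> real"
  assumes b: "bij_betw \<sigma> {..<n} {..<n}"
  shows "(\<Sum>j<n. \<Sum>j'\<in>{..<n} - {j}. c (\<sigma> j) (\<sigma> j')) = (\<Sum>i<n. \<Sum>i'\<in>{..<n} - {i}. c i i')"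
    and "(\<Sum>j<n. \<Sum>i\<in>{..<n} - {\<sigma> j}. c i (\<sigma> j)) = (\<Sum>i<n. \<Sum>i'\<in>{..<n} - {i}. c i i')"
proof -
  have off: "(\<Sum>i'\<in>{..<n} - {i}. h i') = (\<Sum>i'<n. h i') - h i" if "i < n" for i and h :: "nat \<Rightarrow> real"
    using that by (simp add: sum_diff1)
  have r: "(\<Sum>j<n. h (\<sigma> j)) = (\<Sum>i<n. h i)" for h :: "nat \<Rightarrow> real"
    by (rule sum.reindex_bij_betw[OF b])
  have \<sigma>: "\<sigma> j < n" if "j < n" for j using b that by (auto simp: bij_betw_def)
  have base: "(\<Sum>i<n. \<Sum>i'\<in>{..<n} - {i}. c i i') = (\<Sum>i<n. \<Sum>i'<n. c i i') - (\<Sum>i<n. c i i)"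
    by (simp add: off sum_subtractf)
  have "(\<Sum>j<n. \<Sum>j'\<in>{..<n} - {j}. c (\<sigma> j) (\<sigma> j')) = (\<Sum>j<n. \<Sum>j'<n. c (\<sigma> j) (\<sigma> j')) - (\<Sum>j<n. c (\<sigma> j) (\<sigma> j))"
    by (simp add: off sum_subtractf)
  also have "\<dots> = (\<Sum>i<n. \<Sum>i'<n. c i i') - (\<Sum>i<n. c i i)"
    using r[of "\<lambda>i. \<Sum>j'<n. c i (\<sigma> j')"] r[of "\<lambda>i. c i i"] r[of "c i" for i] by simp
  finally show "(\<Sum>j<n. \<Sum>j'\<in>{..<n} - {j}. c (\<sigma> j) (\<sigma> j')) = (\<Sum>i<n. \<Sum>i'\<in>{..<n} - {i}. c i i')"
    using base by simp
  have "(\<Sum>j<n. \<Sum>i\<in>{..<n} - {\<sigma> j}. c i (\<sigma> j)) = (\<Sum>j<n. (\<Sum>i<n. c i (\<sigma> j)) - c (\<sigma> j) (\<sigma> j))"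
    by (intro sum.cong refl off) (simp add: \<sigma>)
  also have "\<dots> = (\<Sum>j<n. \<Sum>i<n. c i j) - (\<Sum>i<n. c i i)"
    using r[of "\<lambda>j. (\<Sum>i<n. c i j) - c j j"] by (simp add: sum_subtractf)
  also have "(\<Sum>j<n. \<Sum>i<n. c i j) = (\<Sum>i<n. \<Sum>j<n. c i j)" by (rule sum.swap)
  finally show "(\<Sum>j<n. \<Sum>i\<in>{..<n} - {\<sigma> j}. c i (\<sigma> j)) = (\<Sum>i<n. \<Sum>i'\<in>{..<n} - {i}. c i i')"
    using base by simp
qed

context log_field_test
begin

lemma g_tendsto:
  assumes xy: "x \<in> U" "y \<in> U" and lim: "u \<longlonglongrightarrow> x" "v \<longlonglongrightarrow> y"
  shows "(\<lambda>m. g (u m) (v m)) \<longlonglongrightarrow> g x y"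
proof -
  have o: "(x, y) \<in> U \<times> U" "open (U \<times> U)" using xy U_open by (auto simp: open_Times)
  have "isCont (\<lambda>(x, y). g x y) (x, y)" using g_cont o continuous_on_eq_continuous_at by blast
  from isCont_tendsto_compose[OF this tendsto_Pair[OF lim]] show ?thesis by simp
qed

lemma C_continuous:
  assumes xy: "x \<in> U" "y \<in> U" "x \<noteq> y" and lim: "u \<longlonglongrightarrow> x" "v \<longlonglongrightarrow> y"
  shows "(\<lambda>m. C (u m) (v m)) \<longlonglongrightarrow> C x y"
proof -
  have ev: "\<forall>\<^sub>F m in sequentially. u m \<in> U" "\<forall>\<^sub>F m in sequentially. v m \<in> U"
    using topological_tendstoD[OF lim(1) U_open xy(1)] topological_tendstoD[OF lim(2) U_open xy(2)] by auto
  have g: "(\<lambda>m. g (u m) (v m)) \<longlonglongrightarrow> g x y" by (rule g_tendsto[OF xy(1,2) lim])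
  have "(\<lambda>m. ln (inverse (norm (u m - v m))) + g (u m) (v m)) \<longlonglongrightarrow> ln (inverse (norm (x - y))) + g x y"
    by (intro tendsto_intros g lim) (use xy in auto)
  moreover have "\<forall>\<^sub>F m in sequentially. ln (inverse (norm (u m - v m))) + g (u m) (v m) = C (u m) (v m)"
    using ev by eventually_elim (simp add: log_kernel_def)
  ultimately have "(\<lambda>m. C (u m) (v m)) \<longlonglongrightarrow> ln (inverse (norm (x - y))) + g x y"
    by (rule Lim_transform_eventually)
  then show ?thesis using xy by (simp add: log_kernel_def)
qed

text \<open>The quotient of the Boltzmann weight by its majorant. It is bounded, and it converges when the
  charges collapse along a matching, so that all singular behaviour is left to explicit Riesz kernels.\<close>

definition ratio :: "real \<Rightarrow> nat \<Rightarrow> (nat \<Rightarrow> 'a) \<Rightarrow> (nat \<Rightarrow> 'a) \<Rightarrow> real" where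
  "ratio \<alpha> n x y = exp (- \<alpha> * coulomb_energy C x y {..<n} {..<n}) / riesz_sum \<alpha> n n x y"

text \<open>Because opposite charges sit at the same limit points, the interactions between different pairs cancel.
  The interaction within a pair is the logarithm that the matching product divides
  out, plus \<open>g\<close> at the common limit.\<close>

lemma ratio_tendsto:
  assumes \<sigma>: "\<sigma> \<in> matchings n n" and xU: "\<And>i. i < n \<Longrightarrow> x i \<in> U" and inj: "inj_on x {..<n}"
    and y: "\<And>j. j < n \<Longrightarrow> (\<lambda>m. y m j) \<longlonglongrightarrow> x (\<sigma> j)" and ne: "\<And>m j. j < n \<Longrightarrow> y m j \<noteq> x (\<sigma> j)"
    and \<alpha>: "\<alpha> \<longlonglongrightarrow> d" "d > 0"
  shows "(\<lambda>m. ratio (\<alpha> m) n x (y m)) \<longlonglongrightarrow> exp (d * (\<Sum>i<n. g (x i) (x i)))"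
proof -
  note b = matchings_bij[OF \<sigma>]
  have \<sigma>n: "\<sigma> j < n" if "j < n" for j using b that by (auto simp: bij_betw_def)
  have \<sigma>i: "\<sigma> j \<noteq> \<sigma> j'" if "j < n" "j' < n" "j \<noteq> j'" for j j'
    using b that by (auto simp: bij_betw_def inj_on_def)
  have xne: "x i \<noteq> x i'" if "i < n" "i' < n" "i \<noteq> i'" for i i' using inj that by (auto simp: inj_on_def)
  let ?A = "\<Sum>i<n. \<Sum>i'\<in>{..<n} - {i}. C (x i) (x i')"
  \<comment> \<open>The energy between different pairs, to be separated from the interaction within the pairs.\<close>
  define R where "R m = - (?A / 2) - (\<Sum>j<n. \<Sum>j'\<in>{..<n} - {j}. C (y m j) (y m j')) / 2
      + (\<Sum>j<n. \<Sum>i\<in>{..<n} - {\<sigma> j}. C (x i) (y m j))" for m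
  have "R \<longlonglongrightarrow> - (?A / 2) - (\<Sum>j<n. \<Sum>j'\<in>{..<n} - {j}. C (x (\<sigma> j)) (x (\<sigma> j'))) / 2
      + (\<Sum>j<n. \<Sum>i\<in>{..<n} - {\<sigma> j}. C (x i) (x (\<sigma> j)))"
    unfolding R_def
    by (intro tendsto_add tendsto_diff tendsto_divide tendsto_sum tendsto_const C_continuous y xU xne \<sigma>n)
       (auto intro: \<sigma>n simp: \<sigma>i)
  also have "- (?A / 2) - (\<Sum>j<n. \<Sum>j'\<in>{..<n} - {j}. C (x (\<sigma> j)) (x (\<sigma> j'))) / 2
      + (\<Sum>j<n. \<Sum>i\<in>{..<n} - {\<sigma> j}. C (x i) (x (\<sigma> j))) = 0"
    unfolding sum_offdiag_reindex(1)[OF b, of "\<lambda>i i'. C (x i) (x i')"]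
      sum_offdiag_reindex(2)[OF b, of "\<lambda>i i'. C (x i) (x i')"] by simp
  finally have R: "R \<longlonglongrightarrow> 0" .
  define G where "G m = (\<Sum>j<n. g (x (\<sigma> j)) (y m j))" for m
  have "G \<longlonglongrightarrow> (\<Sum>j<n. g (x (\<sigma> j)) (x (\<sigma> j)))"
    unfolding G_def by (intro tendsto_sum g_tendsto tendsto_const y xU) (auto intro: \<sigma>n)
  also have "(\<Sum>j<n. g (x (\<sigma> j)) (x (\<sigma> j))) = (\<Sum>i<n. g (x i) (x i))"
    by (rule sum.reindex_bij_betw[OF b])
  finally have G: "G \<longlonglongrightarrow> (\<Sum>i<n. g (x i) (x i))" .
  have energy: "- coulomb_energy C x (y m) {..<n} {..<n} = R m + (\<Sum>j<n. C (x (\<sigma> j)) (y m j))" for m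
  proof -
    have "(\<Sum>i<n. C (x i) (y m j)) = C (x (\<sigma> j)) (y m j) + (\<Sum>i\<in>{..<n} - {\<sigma> j}. C (x i) (y m j))" if "j < n" for j
      using \<sigma>n[OF that] by (simp add: sum.remove)
    then have "(\<Sum>i<n. \<Sum>j<n. C (x i) (y m j)) = (\<Sum>j<n. C (x (\<sigma> j)) (y m j)) + (\<Sum>j<n. \<Sum>i\<in>{..<n} - {\<sigma> j}. C (x i) (y m j))"
      by (subst sum.swap) (simp add: sum.distrib)
    then show ?thesis unfolding coulomb_energy_def R_def by simp
  qed
  have ev: "\<forall>\<^sub>F m in sequentially. \<forall>j\<in>{..<n}. y m j \<in> U"
  proof (rule eventually_ball_finite)
    show "\<forall>j\<in>{..<n}. \<forall>\<^sub>F m in sequentially. y m j \<in> U"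
      using topological_tendstoD[OF y U_open] xU \<sigma>n by blast
  qed simp
  have "\<forall>\<^sub>F m in sequentially. exp (\<alpha> m * R m) * exp (\<alpha> m * G m) *
      (riesz_prod (\<alpha> m) \<sigma> n x (y m) / riesz_sum (\<alpha> m) n n x (y m)) = ratio (\<alpha> m) n x (y m)"
    using ev
  proof eventually_elim
    case (elim m)
    have "(\<Sum>j<n. C (x (\<sigma> j)) (y m j)) = (\<Sum>j<n. - ln (norm (y m j - x (\<sigma> j))) + g (x (\<sigma> j)) (y m j))"
      using elim xU \<sigma>n by (intro sum.cong) (auto simp: log_kernel_def ln_inverse norm_minus_commute)
    then have e: "(\<Sum>j<n. C (x (\<sigma> j)) (y m j)) = (\<Sum>j<n. - ln (norm (y m j - x (\<sigma> j)))) + G m"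
      unfolding G_def sum.distrib .
    have "- \<alpha> m * coulomb_energy C x (y m) {..<n} {..<n} = \<alpha> m * (- coulomb_energy C x (y m) {..<n} {..<n})"
      by simp
    also have "\<dots> = \<alpha> m * R m + \<alpha> m * G m + \<alpha> m * (\<Sum>j<n. - ln (norm (y m j - x (\<sigma> j))))"
      unfolding energy e by (simp only: distrib_left ac_simps)
    finally have "- \<alpha> m * coulomb_energy C x (y m) {..<n} {..<n} =
        \<alpha> m * R m + \<alpha> m * G m + \<alpha> m * (\<Sum>j<n. - ln (norm (y m j - x (\<sigma> j))))" .
    then have "exp (- \<alpha> m * coulomb_energy C x (y m) {..<n} {..<n}) =
        exp (\<alpha> m * R m) * exp (\<alpha> m * G m) * riesz_prod (\<alpha> m) \<sigma> n x (y m)"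
      unfolding riesz_prod_def
      using exp_sum_ln[where l=n and y="y m" and x=x and \<sigma>=\<sigma> and \<alpha>="\<alpha> m"] ne by (simp add: exp_add)
    then show ?case unfolding ratio_def by simp
  qed
  moreover have "(\<lambda>m. exp (\<alpha> m * R m) * exp (\<alpha> m * G m) *
      (riesz_prod (\<alpha> m) \<sigma> n x (y m) / riesz_sum (\<alpha> m) n n x (y m)))
      \<longlonglongrightarrow> exp (d * 0) * exp (d * (\<Sum>i<n. g (x i) (x i))) * 1"
    by (intro tendsto_mult tendsto_exp R G \<alpha>(1) riesz_prod_dominates[OF \<sigma> inj y ne \<alpha>])
  ultimately have "(\<lambda>m. ratio (\<alpha> m) n x (y m)) \<longlonglongrightarrow> exp (d * 0) * exp (d * (\<Sum>i<n. g (x i) (x i))) * 1"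
    by (rule Lim_transform_eventually[rotated])
  then show ?thesis by simp
qed

end

section \<open>The collapse of the Riesz kernels\<close>

lemma AE_PiM_component_sigma_finite:
  assumes M: "\<And>i. sigma_finite_measure (M i)" and J: "finite J" "j \<in> J" and ae: "AE z in M j. Q z"
  shows "AE \<omega> in PiM J M. Q (\<omega> j)"
proof -
  interpret product_sigma_finite M using M by (simp add: product_sigma_finite_def)
  obtain N where N: "{z \<in> space (M j). \<not> Q z} \<subseteq> N" "N \<in> sets (M j)" "emeasure (M j) N = 0"
    using ae by (rule AE_E)
  let ?A = "\<lambda>i. if i = j then N else space (M i)"
  have A: "?A i \<in> sets (M i)" for i using N(2) by auto
  have "emeasure (PiM J M) (Pi\<^sub>E J ?A) = (\<Prod>i\<in>J. emeasure (M i) (?A i))"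
    using J A by (intro emeasure_PiM) auto
  also have "\<dots> = 0" using J N(3) by (intro prod_zero) auto
  finally have "Pi\<^sub>E J ?A \<in> null_sets (PiM J M)" using J A by (auto intro!: sets_PiM_I_finite)
  then show ?thesis
  proof (rule AE_I')
    show "{\<omega> \<in> space (PiM J M). \<not> Q (\<omega> j)} \<subseteq> Pi\<^sub>E J ?A"
      using N(1) J(2) by (auto simp: space_PiM PiE_iff extensional_def)
  qed
qed

lemma not_in_PiE:
  "x \<in> space (config n) \<Longrightarrow> x \<notin> Pi\<^sub>E {..<n} (\<lambda>_. K) \<Longrightarrow> \<exists>i<n. x i \<notin> K"
  by (auto simp: space_PiM PiE_iff)

lemma emeasure_shell_finite: "emeasure lborel (shell :: 'a::euclidean_space set) = ennreal (measure lborel (shell :: 'a set))"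
proof (rule emeasure_eq_ennreal_measure)
  have "bounded (shell :: 'a set)" unfolding shell_def bounded_iff by auto
  then show "emeasure lborel (shell :: 'a set) \<noteq> top" using emeasure_bounded_finite by fastforce
qed

lemma emeasure_polar_measure:
  assumes A[measurable]: "A \<in> sets borel"
  shows "emeasure polar_measure (A \<times> (UNIV :: 'a::euclidean_space set)) =
    emeasure lborel (A \<inter> {0<..}) * ennreal (measure lborel (shell :: 'a set))"
proof -
  have [measurable]: "A \<times> (UNIV :: 'a set) \<in> sets borel" by (intro borel_Times) auto
  have "emeasure polar_measure (A \<times> (UNIV :: 'a set)) = (\<integral>\<^sup>+p. indicator (A \<times> UNIV) p \<partial>(polar_measure :: (real \<times> 'a) measure))"
    by (rule nn_integral_indicator[symmetric]) (simp add: polar_measure_def)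
  also have "\<dots> = (\<integral>\<^sup>+s. indicator {0<..} s * (\<integral>\<^sup>+b. indicator shell b * indicator (A \<times> (UNIV :: 'a set)) (s, b) \<partial>lborel) \<partial>lborel)"
    by (rule nn_integral_polar_measure) simp
  also have "\<dots> = (\<integral>\<^sup>+s. indicator (A \<inter> {0<..}) s * emeasure lborel (shell :: 'a set) \<partial>lborel)"
  proof (rule nn_integral_cong)
    fix s :: real
    have "(\<integral>\<^sup>+b. indicator shell b * indicator (A \<times> (UNIV :: 'a set)) (s, b) \<partial>lborel) =
        indicator A s * emeasure lborel (shell :: 'a set)"
      by (cases "s \<in> A") (simp_all add: indicator_times)
    then show "indicator {0<..} s * (\<integral>\<^sup>+b. indicator shell b * indicator (A \<times> (UNIV :: 'a set)) (s, b) \<partial>lborel) =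
        indicator (A \<inter> {0<..}) s * emeasure lborel (shell :: 'a set)"
      by (simp add: indicator_inter_arith mult_ac)
  qed
  also have "\<dots> = emeasure lborel (A \<inter> {0<..}) * ennreal (measure lborel (shell :: 'a set))"
    by (subst nn_integral_multc) (auto simp: emeasure_shell_finite)
  finally show ?thesis .
qed

lemma AE_polar_measure:
  "AE p in (polar_measure :: (real \<times> 'a::euclidean_space) measure). 0 < fst p \<and> fst p \<noteq> 1 \<and> snd p \<in> shell"
proof -
  have "AE p in (polar_measure :: (real \<times> 'a) measure). p \<in> {0<..} \<times> shell"
    unfolding polar_measure_def by (subst AE_density) (auto simp: indicator_def)
  moreover have "AE p in (polar_measure :: (real \<times> 'a) measure). p \<notin> {1} \<times> UNIV"
  proof (rule AE_not_in)
    have "emeasure polar_measure ({1} \<times> (UNIV :: 'a set)) = 0"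
      by (subst emeasure_polar_measure) (auto intro!: emeasure_eq_0[of "{1::real}"])
    moreover have "{1} \<times> (UNIV :: 'a set) \<in> sets polar_measure"
      unfolding polar_measure_def by (simp add: borel_Times)
    ultimately show "{1} \<times> (UNIV :: 'a set) \<in> null_sets polar_measure" by auto
  qed
  ultimately show ?thesis by eventually_elim auto
qed

lemma powr_reciprocal_tendsto_0:
  assumes s: "0 < s" "s < (1::real)" and t: "\<And>m. t m > 0" "t \<longlonglongrightarrow> 0"
  shows "(\<lambda>m. s powr (1 / t m)) \<longlonglongrightarrow> 0"
proof -
  have "filterlim (\<lambda>m. inverse (t m)) at_top sequentially"
    using t by (intro filterlim_inverse_at_top) auto
  then have "filterlim (\<lambda>m. ln s * inverse (t m)) at_bot sequentially"
    using s by (intro filterlim_tendsto_neg_mult_at_bot[OF tendsto_const]) auto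
  then have "(\<lambda>m. exp (ln s * inverse (t m))) \<longlonglongrightarrow> 0"
    by (rule filterlim_compose[OF exp_at_bot])
  then show ?thesis using s by (simp add: powr_def divide_inverse mult.commute)
qed

lemma powr_reciprocal_at_top:
  assumes s: "(1::real) < s" and t: "\<And>m. t m > 0" "t \<longlonglongrightarrow> 0"
  shows "filterlim (\<lambda>m. s powr (1 / t m)) at_top sequentially"
proof -
  have "filterlim (\<lambda>m. inverse (t m)) at_top sequentially"
    using t by (intro filterlim_inverse_at_top) auto
  then have "filterlim (\<lambda>m. ln s * inverse (t m)) at_top sequentially"
    using s by (intro filterlim_tendsto_pos_mult_at_top[OF tendsto_const]) auto
  then have "filterlim (\<lambda>m. exp (ln s * inverse (t m))) at_top sequentially"
    by (rule filterlim_compose[OF exp_at_top])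
  then show ?thesis using s by (simp add: powr_def divide_inverse mult.commute)
qed

context log_field_test
begin

text \<open>The density of the limiting variance.\<close>

definition \<rho> :: "'a \<Rightarrow> real" where
  "\<rho> x = (cmod (f x))\<^sup>2 * exp (real DIM('a) * g x x)"

lemma rho_integrable: "integrable lborel \<rho>"
proof -
  obtain \<epsilon>0 G where e0: "\<epsilon>0 > 0" and G: "G \<ge> 0"
    and near: "\<And>x y a b. x \<in> K \<Longrightarrow> y \<in> K \<Longrightarrow> norm a \<le> \<epsilon>0 \<Longrightarrow> norm b \<le> \<epsilon>0 \<Longrightarrow>
       x + a \<in> U \<and> y + b \<in> U \<and> \<bar>g (x + a) (y + b)\<bar> \<le> G"
    using neighbourhood by blast
  have gK: "g x x \<le> G" if "x \<in> K" for x using near[OF that that, of 0 0] e0 by auto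
  have [measurable]: "U \<in> sets borel" using U_open by simp
  have "continuous_on U ((\<lambda>(x, y). g x y) \<circ> (\<lambda>x. (x, x)))"
    by (intro continuous_on_compose continuous_intros continuous_on_subset[OF g_cont]) auto
  then have "continuous_on U (\<lambda>x. g x x)" by (simp add: o_def)
  then have [measurable]: "(\<lambda>x. if x \<in> U then g x x else 0) \<in> borel_measurable borel"
    by (intro borel_measurable_continuous_on_if continuous_on_const) auto
  have eq: "\<rho> = (\<lambda>x. (cmod (f x))\<^sup>2 * exp (real DIM('a) * (if x \<in> U then g x x else 0)))"
    using f_supp K(2) unfolding \<rho>_def by (auto simp: fun_eq_iff)
  have m: "\<rho> \<in> borel_measurable borel" unfolding eq by measurable
  show ?thesis
  proof (rule integrableI_bounded_set[where A=K and B="F\<^sup>2 * exp (real DIM('a) * G)"])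
    show "AE x in lborel. x \<in> K \<longrightarrow> norm (\<rho> x) \<le> F\<^sup>2 * exp (real DIM('a) * G)"
    proof (intro AE_I2 impI)
      fix x assume x: "x \<in> K"
      have "(cmod (f x))\<^sup>2 \<le> F\<^sup>2" using F(2) by (intro power_mono) auto
      moreover have "exp (real DIM('a) * g x x) \<le> exp (real DIM('a) * G)"
        using gK[OF x] by (simp add: mult_left_mono)
      ultimately have "(cmod (f x))\<^sup>2 * exp (real DIM('a) * g x x) \<le> F\<^sup>2 * exp (real DIM('a) * G)"
        by (rule mult_mono) simp_all
      then show "norm (\<rho> x) \<le> F\<^sup>2 * exp (real DIM('a) * G)"
        unfolding \<rho>_def by simp
    qed
    show "AE x in lborel. x \<notin> K \<longrightarrow> \<rho> x = 0" using f_supp by (intro AE_I2) (simp add: \<rho>_def)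
  qed (use m K(1) emeasure_bounded_finite[OF compact_imp_bounded[OF K(1)]] borel_compact in auto)
qed

lemma ratio_measurable[measurable]:
  "(\<lambda>p. ratio \<alpha> n (fst p) (snd p)) \<in> borel_measurable (configs n n)"
  unfolding ratio_def by measurable

text \<open>The bounded factor that multiplies the Riesz kernels in the gas integral.\<close>

definition dipole :: "real \<Rightarrow> nat \<Rightarrow> (nat \<Rightarrow> 'a) \<Rightarrow> (nat \<Rightarrow> 'a) \<Rightarrow> complex" where
  "dipole \<alpha> n x y = wt n n x y * of_real (ratio \<alpha> n x y)"

lemma dipole_measurable[measurable]:
  "(\<lambda>p. dipole \<alpha> n (fst p) (snd p)) \<in> borel_measurable (configs n n)"
  unfolding dipole_def by measurable

lemma dipole_bound:
  obtains B where "B > 0" "\<And>\<alpha> x y. distinct_points n n x y \<Longrightarrow> 0 \<le> \<alpha> \<Longrightarrow> \<alpha> \<le> real DIM('a) \<Longrightarrow> cmod (dipole \<alpha> n x y) \<le> B"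
proof -
  obtain c where c: "c \<ge> 0" and bd:
    "\<And>x y \<alpha>. (\<And>i. i < n \<Longrightarrow> x i \<in> K) \<Longrightarrow> (\<And>j. j < n \<Longrightarrow> y j \<in> K) \<Longrightarrow> distinct_points n n x y \<Longrightarrow> 0 \<le> \<alpha> \<Longrightarrow>
      exp (- \<alpha> * coulomb_energy C x y {..<n} {..<n}) \<le> exp (\<alpha> * c) * riesz_sum \<alpha> n n x y"
    using weight_bound[OF order_refl] by blast
  show thesis
  proof (rule that[of "F ^ n * F ^ n * exp (real DIM('a) * c)"])
    show "0 < F ^ n * F ^ n * exp (real DIM('a) * c)" using F(1) by simp
    fix \<alpha> :: real and x y :: "nat \<Rightarrow> 'a"
    assume dp: "distinct_points n n x y" and \<alpha>: "0 \<le> \<alpha>" "\<alpha> \<le> real DIM('a)"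
    show "cmod (dipole \<alpha> n x y) \<le> F ^ n * F ^ n * exp (real DIM('a) * c)"
    proof (cases "wt n n x y = 0")
      case True then show ?thesis using F(1) unfolding dipole_def by simp
    next
      case False
      have "exp (- \<alpha> * coulomb_energy C x y {..<n} {..<n}) \<le> exp (\<alpha> * c) * riesz_sum \<alpha> n n x y"
        using wt_support[OF False] dp \<alpha> by (intro bd) auto
      then have "ratio \<alpha> n x y \<le> exp (\<alpha> * c)"
        unfolding ratio_def using riesz_sum_nonneg[of \<alpha> n n x y] by (simp add: divide_le_eq)
      also have "\<dots> \<le> exp (real DIM('a) * c)" using \<alpha> c by (simp add: mult_right_mono)
      finally have "\<bar>ratio \<alpha> n x y\<bar> \<le> exp (real DIM('a) * c)"
        unfolding ratio_def using riesz_sum_nonneg[of \<alpha> n n x y] by simp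
      then show ?thesis
        unfolding dipole_def norm_mult norm_of_real using wt_bound[of n n x y] F(1) by (intro mult_mono) auto
    qed
  qed
qed

text \<open>The negative charge \<open>j\<close> is placed at polar coordinates \<open>\<omega> j\<close> around its partner \<open>x (\<sigma> j)\<close>.\<close>

definition merged :: "real \<Rightarrow> (nat \<Rightarrow> nat) \<Rightarrow> nat \<Rightarrow> (nat \<Rightarrow> 'a) \<Rightarrow> (nat \<Rightarrow> real \<times> 'a) \<Rightarrow> nat \<Rightarrow> 'a" where
  "merged t \<sigma> n x \<omega> = (\<lambda>j\<in>{..<n}. polar_point t (x (\<sigma> j)) (\<omega> j))"

abbreviation polars :: "nat \<Rightarrow> (nat \<Rightarrow> real \<times> 'a) measure" where
  "polars n \<equiv> PiM {..<n} (\<lambda>_. polar_measure)"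

lemma merged_distr:
  assumes t: "0 < t" "t < real DIM('a)"
  shows "merged t \<sigma> n x \<in> measurable (polars n) (config n)"
    and "distr (polars n) (config n) (merged t \<sigma> n x) =
      density (config n) (\<lambda>y. ennreal (riesz_const (real DIM('a)) t ^ n * riesz_prod (real DIM('a) - t) \<sigma> n x y))"
proof -
  have m: "polar_point t z \<in> measurable polar_measure lborel" for z :: 'a
    unfolding polar_measure_def by simp
  show "merged t \<sigma> n x \<in> measurable (polars n) (config n)"
    unfolding merged_def
  proof (rule measurable_restrict)
    fix j assume "j \<in> {..<n}"
    then have "(\<lambda>\<omega>. \<omega> j) \<in> measurable (polars n) polar_measure" by (rule measurable_component_singleton)
    from measurable_compose[OF this m[of "x (\<sigma> j)"]]
    show "(\<lambda>\<omega>. polar_point t (x (\<sigma> j)) (\<omega> j)) \<in> measurable (polars n) lborel" .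
  qed
  have r: "riesz_const (real DIM('a)) t \<ge> 0" using riesz_const_pos[OF t] by simp
  have "(\<Prod>j<n. ennreal (riesz_const (real DIM('a)) t * norm (y j - x (\<sigma> j)) powr (t - real DIM('a)))) =
      ennreal (riesz_const (real DIM('a)) t ^ n * riesz_prod (real DIM('a) - t) \<sigma> n x y)" for y
    using r by (subst prod_ennreal) (auto simp: riesz_prod_def prod.distrib)
  then show "distr (polars n) (config n) (merged t \<sigma> n x) =
      density (config n) (\<lambda>y. ennreal (riesz_const (real DIM('a)) t ^ n * riesz_prod (real DIM('a) - t) \<sigma> n x y))"
    using PiM_polar_points[OF finite_lessThan t, of n "\<lambda>j. x (\<sigma> j)"] unfolding merged_def[abs_def] by simp
qed

lemma merged_integral:
  assumes t: "0 < t" "t < real DIM('a)" and \<sigma>: "\<sigma> \<in> matchings n n" and x: "x \<in> space (config n)"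
  shows "(\<integral>\<omega>. dipole (real DIM('a) - t) n x (merged t \<sigma> n x \<omega>) \<partial>polars n) =
    of_real (riesz_const (real DIM('a)) t ^ n) *
      (\<integral>y. dipole (real DIM('a) - t) n x y * of_real (riesz_prod (real DIM('a) - t) \<sigma> n x y) \<partial>config n)"
proof -
  let ?\<alpha> = "real DIM('a) - t"
  let ?c = "riesz_const (real DIM('a)) t"
  have c: "?c > 0" by (rule riesz_const_pos[OF t])
  have dm: "dipole ?\<alpha> n x \<in> borel_measurable (config n)"
    using measurable_compose[OF measurable_Pair1'[OF x] dipole_measurable] by simp
  have rm: "riesz_prod ?\<alpha> \<sigma> n x \<in> borel_measurable (config n)"
    using measurable_compose[OF measurable_Pair1'[OF x] riesz_prod_measurable[OF \<sigma>]] by simp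
  have "(\<integral>\<omega>. dipole ?\<alpha> n x (merged t \<sigma> n x \<omega>) \<partial>polars n) = (\<integral>y. dipole ?\<alpha> n x y \<partial>distr (polars n) (config n) (merged t \<sigma> n x))"
    by (rule integral_distr[OF merged_distr(1)[OF t] dm, symmetric])
  also have "\<dots> = (\<integral>y. (?c ^ n * riesz_prod ?\<alpha> \<sigma> n x y) *\<^sub>R dipole ?\<alpha> n x y \<partial>config n)"
    unfolding merged_distr(2)[OF t]
    by (rule integral_density[OF dm]) (use rm c in \<open>auto simp: riesz_prod_def intro!: AE_I2 mult_nonneg_nonneg prod_nonneg\<close>)
  also have "\<dots> = (\<integral>y. of_real (?c ^ n) * (dipole ?\<alpha> n x y * of_real (riesz_prod ?\<alpha> \<sigma> n x y)) \<partial>config n)"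
    by (intro Bochner_Integration.integral_cong refl) (simp add: scaleR_conv_of_real mult_ac)
  finally show ?thesis by simp
qed

lemma merged_distinct:
  assumes t: "0 < t" "t < real DIM('a)" and \<sigma>: "\<sigma> \<in> matchings n n" and x: "x \<in> space (config n)"
    and ae: "AE y in config n. distinct_points n n x y"
  shows "AE \<omega> in polars n. distinct_points n n x (merged t \<sigma> n x \<omega>)"
proof (rule AE_distrD[OF merged_distr(1)[OF t]])
  have rm: "riesz_prod (real DIM('a) - t) \<sigma> n x \<in> borel_measurable (config n)"
    using measurable_compose[OF measurable_Pair1'[OF x] riesz_prod_measurable[OF \<sigma>]] by simp
  have "AE y in config n. 0 < ennreal (riesz_const (real DIM('a)) t ^ n * riesz_prod (real DIM('a) - t) \<sigma> n x y) \<longrightarrow> distinct_points n n x y"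
    using ae by eventually_elim simp
  then show "AE y in distr (polars n) (config n) (merged t \<sigma> n x). distinct_points n n x y"
    unfolding merged_distr(2)[OF t] using rm by (subst AE_density) auto
qed

lemma AE_polars: "AE \<omega> in polars n. \<forall>j<n. 0 < fst (\<omega> j) \<and> fst (\<omega> j) \<noteq> 1 \<and> snd (\<omega> j) \<in> shell"
proof -
  have "AE \<omega> in polars n. \<forall>j\<in>{..<n}. 0 < fst (\<omega> j) \<and> fst (\<omega> j) \<noteq> 1 \<and> snd (\<omega> j) \<in> shell"
    by (intro AE_finite_allI AE_PiM_component_sigma_finite AE_polar_measure sigma_finite_polar_measure) auto
  then show ?thesis by eventually_elim auto
qed

text \<open>Configurations of polar coordinates whose radial variables all lie in \<open>A\<close>.\<close>

definition slab :: "nat \<Rightarrow> real set \<Rightarrow> (nat \<Rightarrow> real \<times> 'a) set" where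
  "slab n A = Pi\<^sub>E {..<n} (\<lambda>_. A \<times> UNIV)"

lemma slab:
  assumes A: "A \<in> sets borel"
  shows "slab n A \<in> sets (polars n)"
    and "emeasure (polars n) (slab n A) = (emeasure lborel (A \<inter> {0<..}) * ennreal (measure lborel (shell :: 'a set))) ^ n"
proof -
  interpret product_sigma_finite "\<lambda>_::nat. polar_measure :: (real \<times> 'a) measure"
    using sigma_finite_polar_measure by (simp add: product_sigma_finite_def)
  have s: "A \<times> (UNIV :: 'a set) \<in> sets polar_measure" using A unfolding polar_measure_def by (simp add: borel_Times)
  show "slab n A \<in> sets (polars n)" unfolding slab_def using s by (intro sets_PiM_I_finite) auto
  show "emeasure (polars n) (slab n A) = (emeasure lborel (A \<inter> {0<..}) * ennreal (measure lborel (shell :: 'a set))) ^ n"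
    unfolding slab_def using s by (subst emeasure_PiM) (auto simp: emeasure_polar_measure[OF A])
qed

lemma wt_eq_0: "j < n \<Longrightarrow> y j \<notin> K \<Longrightarrow> wt k n x y = 0"
  using wt_support(2)[of k n x y j] by blast

lemma wt_eq_0': "i < k \<Longrightarrow> x i \<notin> K \<Longrightarrow> wt k n x y = 0"
  using wt_support(1)[of k n x y i] by blast

lemma merged_far:
  assumes x: "x (\<sigma> j) \<in> K" and j: "j < n" and b: "snd (\<omega> j) \<in> shell" and s: "fst (\<omega> j) powr (1 / t) > D"
    and D: "\<And>x y. x \<in> K \<Longrightarrow> y \<in> K \<Longrightarrow> norm (y - x) \<le> D"
  shows "merged t \<sigma> n x \<omega> j \<notin> K"
proof
  assume "merged t \<sigma> n x \<omega> j \<in> K"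
  then have "norm (merged t \<sigma> n x \<omega> j - x (\<sigma> j)) \<le> D" by (rule D[OF x])
  then have 1: "fst (\<omega> j) powr (1 / t) * norm (snd (\<omega> j)) \<le> D"
    using j unfolding merged_def polar_point_def by simp
  have "fst (\<omega> j) powr (1 / t) * 1 \<le> fst (\<omega> j) powr (1 / t) * norm (snd (\<omega> j))"
    using b unfolding shell_def by (intro mult_left_mono) auto
  then show False using 1 s by simp
qed

lemma wt_tendsto:
  assumes \<sigma>: "\<sigma> \<in> matchings n n" and y: "\<And>j. j < n \<Longrightarrow> (\<lambda>m. y m j) \<longlonglongrightarrow> x (\<sigma> j)"
  shows "(\<lambda>m. wt n n x (y m)) \<longlonglongrightarrow> of_real (\<Prod>i<n. (cmod (f (x i)))\<^sup>2)"
proof -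
  have fc: "isCont f z" for z
    using smooth_continuous[OF test_smooth[OF f], of UNIV] continuous_on_eq_continuous_at[OF open_UNIV] by blast
  have "(\<lambda>m. wt n n x (y m)) \<longlonglongrightarrow> (\<Prod>i<n. f (x i)) * (\<Prod>j<n. cnj (f (x (\<sigma> j))))"
    unfolding wt_def
    by (intro tendsto_mult tendsto_const tendsto_prod tendsto_cnj isCont_tendsto_compose[OF fc] y) auto
  also have "(\<Prod>j<n. cnj (f (x (\<sigma> j)))) = (\<Prod>i<n. cnj (f (x i)))"
    by (rule prod.reindex_bij_betw[OF matchings_bij[OF \<sigma>]])
  also have "(\<Prod>i<n. f (x i)) * (\<Prod>i<n. cnj (f (x i))) = of_real (\<Prod>i<n. (cmod (f (x i)))\<^sup>2)"
    unfolding prod.distrib[symmetric] of_real_prod by (intro prod.cong refl) (simp only: complex_norm_square)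
  finally show ?thesis .
qed

text \<open>If all radial variables are less than one, all negative charges collapse onto their partners. If one
  of them exceeds one, the corresponding charge leaves the support of \<open>f\<close>.\<close>

lemma dipole_pointwise_limit:
  assumes t: "\<And>m. 0 < t m" "t \<longlonglongrightarrow> 0" and \<sigma>: "\<sigma> \<in> matchings n n"
    and xK: "\<And>i. i < n \<Longrightarrow> x i \<in> K" and inj: "inj_on x {..<n}"
    and \<omega>: "\<omega> \<in> space (polars n)" "\<And>j. j < n \<Longrightarrow> 0 < fst (\<omega> j) \<and> fst (\<omega> j) \<noteq> 1 \<and> snd (\<omega> j) \<in> shell"
  shows "(\<lambda>m. dipole (real DIM('a) - t m) n x (merged (t m) \<sigma> n x \<omega>))
    \<longlonglongrightarrow> of_real (\<Prod>i<n. \<rho> (x i)) * indicator (slab n {..<1}) \<omega>"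
proof (cases "\<forall>j<n. fst (\<omega> j) < 1")
  case True
  let ?y = "\<lambda>m. merged (t m) \<sigma> n x \<omega>"
  have \<sigma>n: "\<sigma> j < n" if "j < n" for j using \<sigma> that by (auto simp: matchings_def PiE_iff)
  have y: "(\<lambda>m. ?y m j) \<longlonglongrightarrow> x (\<sigma> j)" if j: "j < n" for j
  proof -
    have "(\<lambda>m. fst (\<omega> j) powr (1 / t m)) \<longlonglongrightarrow> 0"
      using \<omega>(2)[OF j] True j by (intro powr_reciprocal_tendsto_0 t) auto
    then have "(\<lambda>m. x (\<sigma> j) + (fst (\<omega> j) powr (1 / t m)) *\<^sub>R snd (\<omega> j)) \<longlonglongrightarrow> x (\<sigma> j) + 0 *\<^sub>R snd (\<omega> j)"
      by (intro tendsto_intros)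
    then show ?thesis using j unfolding merged_def polar_point_def by simp
  qed
  have ne: "?y m j \<noteq> x (\<sigma> j)" if j: "j < n" for m j
    using \<omega>(2)[OF j] j unfolding merged_def polar_point_def shell_def by auto
  have \<alpha>: "(\<lambda>m. real DIM('a) - t m) \<longlonglongrightarrow> real DIM('a)"
    using tendsto_diff[OF tendsto_const t(2), of "real DIM('a)"] by simp
  have "(\<lambda>m. wt n n x (?y m) * of_real (ratio (real DIM('a) - t m) n x (?y m)))
      \<longlonglongrightarrow> of_real (\<Prod>i<n. (cmod (f (x i)))\<^sup>2) * of_real (exp (real DIM('a) * (\<Sum>i<n. g (x i) (x i))))"
    using xK K(2)
    by (intro tendsto_mult wt_tendsto[OF \<sigma>] y tendsto_of_real ratio_tendsto[OF \<sigma> _ inj] ne \<alpha>) auto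
  also have "of_real (\<Prod>i<n. (cmod (f (x i)))\<^sup>2) * of_real (exp (real DIM('a) * (\<Sum>i<n. g (x i) (x i)))) =
      complex_of_real (\<Prod>i<n. \<rho> (x i))"
    unfolding of_real_mult[symmetric] \<rho>_def prod.distrib sum_distrib_left exp_sum[OF finite_lessThan] ..
  moreover have "\<omega> \<in> slab n {..<1}"
    using True \<omega>(1) unfolding slab_def by (auto simp: space_PiM PiE_iff mem_Times_iff)
  ultimately show ?thesis unfolding dipole_def by simp
next
  case False
  then obtain j where j: "j < n" "fst (\<omega> j) > 1" using \<omega>(2) by (metis linorder_neqE_linordered_idom)
  obtain D where D: "D \<ge> 1" "\<And>x y. x \<in> K \<Longrightarrow> y \<in> K \<Longrightarrow> norm (y - x) \<le> D" using K_diameter by blast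
  have "x (\<sigma> j) \<in> K" using xK \<sigma> j(1) by (auto simp: matchings_def PiE_iff)
  have "\<forall>\<^sub>F m in sequentially. fst (\<omega> j) powr (1 / t m) > D"
    using powr_reciprocal_at_top[OF j(2) t] unfolding filterlim_at_top_dense by blast
  then have "\<forall>\<^sub>F m in sequentially. 0 = dipole (real DIM('a) - t m) n x (merged (t m) \<sigma> n x \<omega>)"
  proof eventually_elim
    case (elim m)
    have "merged (t m) \<sigma> n x \<omega> j \<notin> K"
      by (rule merged_far[where x=x and \<sigma>=\<sigma> and j=j and \<omega>=\<omega> and t="t m" and D=D])
         (use \<open>x (\<sigma> j) \<in> K\<close> \<omega>(2)[OF j(1)] j(1) elim D(2) in auto)
    then show ?case using wt_eq_0[OF j(1)] unfolding dipole_def by simp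
  qed
  then have "(\<lambda>m. dipole (real DIM('a) - t m) n x (merged (t m) \<sigma> n x \<omega>)) \<longlonglongrightarrow> 0"
    by (rule Lim_transform_eventually[OF tendsto_const])
  moreover have "\<omega> \<notin> slab n {..<1}" using j unfolding slab_def by (force simp: PiE_iff mem_Times_iff)
  ultimately show ?thesis by simp
qed

lemma AE_inner_distinct:
  "AE x in (config n :: (nat \<Rightarrow> 'a) measure). inj_on x {..<n} \<and> (AE y in config n. distinct_points n n x y)"
proof -
  interpret L: pair_sigma_finite "config n :: (nat \<Rightarrow> 'a) measure" "config n :: (nat \<Rightarrow> 'a) measure"
    by (rule pair_sigma_finite_configs)
  have "AE x in (config n :: (nat \<Rightarrow> 'a) measure). AE y in config n. distinct_points n n x y"
    using L.AE_pair[OF AE_distinct_points[of n n]] by simp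
  moreover have "AE x in (config n :: (nat \<Rightarrow> 'a) measure). \<forall>i\<in>{..<n}. \<forall>i'\<in>{..<n} - {i}. x i \<noteq> x i'"
    by (intro AE_finite_allI) (auto intro: AE_config_distinct)
  ultimately show ?thesis by eventually_elim (auto simp: inj_on_def)
qed

text \<open>A radial variable \<open>s > D \<ge> 1\<close> satisfies \<open>s powr (1 / t) > D\<close> for all \<open>t \<le> 1\<close>, which moves the charge
  further away than the diameter of \<open>K\<close>. This confines the integrands to a fixed set of finite measure.\<close>

lemma dipole_outside_slab:
  assumes t: "0 < t" "t \<le> 1" and \<sigma>: "\<sigma> \<in> matchings n n" and xK: "\<And>i. i < n \<Longrightarrow> x i \<in> K"
    and \<omega>: "\<omega> \<in> space (polars n)" "\<And>j. j < n \<Longrightarrow> snd (\<omega> j) \<in> shell" "\<omega> \<notin> slab n {..D}"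
    and D: "D \<ge> 1" "\<And>x y. x \<in> K \<Longrightarrow> y \<in> K \<Longrightarrow> norm (y - x) \<le> D"
  shows "dipole \<alpha> n x (merged t \<sigma> n x \<omega>) = 0"
proof -
  obtain j where j: "j < n" "fst (\<omega> j) > D"
    using \<omega>(1,3) unfolding slab_def by (auto simp: space_PiM PiE_iff mem_Times_iff not_le)
  have "fst (\<omega> j) powr 1 \<le> fst (\<omega> j) powr (1 / t)" using t j D(1) by (intro powr_mono) auto
  then have "fst (\<omega> j) powr (1 / t) > D" using j D(1) by simp
  then have "merged t \<sigma> n x \<omega> j \<notin> K"
    by (intro merged_far[where x=x and \<sigma>=\<sigma> and j=j and \<omega>=\<omega> and t=t and D=D])
       (use xK \<sigma> j(1) \<omega>(2)[OF j(1)] D(2) in \<open>auto simp: matchings_def PiE_iff\<close>)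
  then show ?thesis using wt_eq_0[OF j(1)] unfolding dipole_def by simp
qed

text \<open>The inner integral over the negative charges is transported to polar coordinates, where the
  integrand is bounded and supported in a fixed slab of finite measure. Dominated convergence applies first to
  the inner and then to the outer integral.\<close>

lemma dipole_tendsto:
  assumes t: "\<And>m. 0 < t m" "\<And>m. t m < real DIM('a)" "\<And>m. t m \<le> 1" "t \<longlonglongrightarrow> 0" and \<sigma>: "\<sigma> \<in> matchings n n"
  shows "integrable (configs n n) (\<lambda>p. dipole (real DIM('a) - t m) n (fst p) (snd p) *
      of_real (riesz_prod (real DIM('a) - t m) \<sigma> n (fst p) (snd p)))" (is "?int m")
    and "(\<lambda>m. of_real (riesz_const (real DIM('a)) (t m) ^ n) *
      (\<integral>p. dipole (real DIM('a) - t m) n (fst p) (snd p) *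
        of_real (riesz_prod (real DIM('a) - t m) \<sigma> n (fst p) (snd p)) \<partial>configs n n))
      \<longlonglongrightarrow> of_real ((measure lborel (shell :: 'a set) * (\<integral>x. \<rho> x \<partial>lborel)) ^ n)" (is ?lim)
proof -
  interpret PS: product_sigma_finite "\<lambda>_::nat. lborel :: 'a measure" by (rule product_sigma_finite_lborel)
  interpret L: pair_sigma_finite "config n :: (nat \<Rightarrow> 'a) measure" "config n :: (nat \<Rightarrow> 'a) measure"
    by (rule pair_sigma_finite_configs)
  let ?\<alpha> = "\<lambda>m. real DIM('a) - t m"
  let ?c = "\<lambda>m. riesz_const (real DIM('a)) (t m)"
  let ?vol = "measure lborel (shell :: 'a set)"
  obtain D where D: "D \<ge> 1" "\<And>x y. x \<in> K \<Longrightarrow> y \<in> K \<Longrightarrow> norm (y - x) \<le> D" using K_diameter by blast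
  have D0: "D > 0" using D(1) by simp
  obtain B where B: "B > 0" "\<And>\<alpha> x y. distinct_points n n x y \<Longrightarrow> 0 \<le> \<alpha> \<Longrightarrow> \<alpha> \<le> real DIM('a) \<Longrightarrow> cmod (dipole \<alpha> n x y) \<le> B"
    using dipole_bound by blast
  have \<alpha>: "0 \<le> ?\<alpha> m" "?\<alpha> m \<le> real DIM('a)" for m using t(1)[of m] t(2)[of m] by auto
  note [measurable] = riesz_prod_measurable[OF \<sigma>]
  have int: "?int m" for m
  proof (rule Bochner_Integration.integrable_bound)
    show "integrable (configs n n) (\<lambda>p. B * (indicator (box K n n) p * riesz_sum (?\<alpha> m) n n (fst p) (snd p)))"
      by (rule integrable_mult_right[OF riesz_sum_integrable(1)[OF K(1) D0 D(2) t(1,2)]])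
    show "(\<lambda>p. dipole (?\<alpha> m) n (fst p) (snd p) * complex_of_real (riesz_prod (?\<alpha> m) \<sigma> n (fst p) (snd p))) \<in> borel_measurable (configs n n)"
      by measurable
    show "AE p in configs n n. norm (dipole (?\<alpha> m) n (fst p) (snd p) * complex_of_real (riesz_prod (?\<alpha> m) \<sigma> n (fst p) (snd p)))
        \<le> norm (B * (indicator (box K n n) p * riesz_sum (?\<alpha> m) n n (fst p) (snd p)))"
      using AE_distinct_points AE_space
    proof eventually_elim
      case (elim p)
      show ?case
      proof (cases "wt n n (fst p) (snd p) = 0")
        case True then show ?thesis unfolding dipole_def by simp
      next
        case False
        have r0: "riesz_prod (?\<alpha> m) \<tau> n (fst p) (snd p) \<ge> 0" for \<tau>
          unfolding riesz_prod_def by (intro prod_nonneg) auto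
        have "riesz_prod (?\<alpha> m) \<sigma> n (fst p) (snd p) \<le> riesz_sum (?\<alpha> m) n n (fst p) (snd p)"
          unfolding riesz_sum_eq by (intro member_le_sum[OF \<sigma>] r0 finite_matchings)
        then have "cmod (dipole (?\<alpha> m) n (fst p) (snd p)) * riesz_prod (?\<alpha> m) \<sigma> n (fst p) (snd p) \<le> B * riesz_sum (?\<alpha> m) n n (fst p) (snd p)"
          using B(2)[OF elim(1) \<alpha>] r0 B(1) by (intro mult_mono) auto
        moreover have "p \<in> box K n n"
          using not_in_box[OF elim(2), of K] wt_support[OF False] by blast
        ultimately show ?thesis using r0 B(1) riesz_sum_nonneg[of "?\<alpha> m" n n "fst p" "snd p"] by (simp add: norm_mult)
      qed
    qed
  qed
  show "?int m" by (rule int)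
  let ?y = "\<lambda>m x. \<integral>y. dipole (?\<alpha> m) n x y * of_real (riesz_prod (?\<alpha> m) \<sigma> n x y) \<partial>config n"
  let ?V = "\<lambda>m x. of_real (?c m ^ n) * ?y m x"
  have V: "?V m x = (\<integral>\<omega>. dipole (?\<alpha> m) n x (merged (t m) \<sigma> n x \<omega>) \<partial>polars n)" if "x \<in> space (config n)" for m x
    by (rule merged_integral[OF t(1,2) \<sigma> that, symmetric])
  have meas_slab: "measure (polars n) (slab n {..<1}) = ?vol ^ n" "emeasure (polars n) (slab n {..<1}) < \<infinity>"
    "measure (polars n) (slab n {..D}) = (D * ?vol) ^ n" "emeasure (polars n) (slab n {..D}) < \<infinity>"
  proof -
    have 1: "emeasure (polars n) (slab n {..<1}) = ennreal (?vol ^ n)"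
    proof -
      have "{..<1} \<inter> {0<..} = {0<..<1::real}" by auto
      then show ?thesis by (subst slab(2)) (auto simp: ennreal_power)
    qed
    have 2: "emeasure (polars n) (slab n {..D}) = ennreal ((D * ?vol) ^ n)"
    proof -
      have "{..D} \<inter> {0<..} = {0<..D}" by auto
      then show ?thesis using D0 by (subst slab(2)) (auto simp: ennreal_power ennreal_mult[symmetric])
    qed
    show "measure (polars n) (slab n {..<1}) = ?vol ^ n" "emeasure (polars n) (slab n {..<1}) < \<infinity>"
      "measure (polars n) (slab n {..D}) = (D * ?vol) ^ n" "emeasure (polars n) (slab n {..D}) < \<infinity>"
      unfolding measure_def 1 2 using D0 by auto
  qed
  have slabs[measurable]: "slab n {..<1} \<in> sets (polars n)" "slab n {..D} \<in> sets (polars n)"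
    by (intro slab(1); simp)+
  have dom: "AE \<omega> in polars n. norm (dipole (?\<alpha> m) n x (merged (t m) \<sigma> n x \<omega>)) \<le> B * indicator (slab n {..D}) \<omega>"
    if x: "x \<in> space (config n)" "AE y in config n. distinct_points n n x y" "\<And>i. i < n \<Longrightarrow> x i \<in> K" for m x
    using merged_distinct[OF t(1,2) \<sigma> x(1,2), of m] AE_polars[of n] AE_space
  proof eventually_elim
    case (elim \<omega>)
    show ?case
    proof (cases "\<omega> \<in> slab n {..D}")
      case True then show ?thesis using B(2)[OF elim(1) \<alpha>] by simp
    next
      case False
      have "dipole (?\<alpha> m) n x (merged (t m) \<sigma> n x \<omega>) = 0"
        using elim(2) by (intro dipole_outside_slab[OF t(1,3) \<sigma> x(3) elim(3) _ False D]) auto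
      then show ?thesis using B(1) by simp
    qed
  qed
  have iw: "integrable (polars n) (\<lambda>\<omega>. B * indicator (slab n {..D}) \<omega>)"
    using meas_slab(4) by (intro integrable_mult_right integrable_real_indicator) auto
  have outside: "?V m x = 0" if out: "x \<notin> Pi\<^sub>E {..<n} (\<lambda>_. K)" "x \<in> space (config n)" for m x
  proof -
    obtain i where "i < n" "x i \<notin> K" using not_in_PiE[OF out(2,1)] by blast
    then have "dipole (?\<alpha> m) n x y = 0" for y using wt_eq_0'[of i n x n y] unfolding dipole_def by simp
    then show ?thesis by simp
  qed
  let ?L = "\<lambda>x. complex_of_real (\<Prod>i<n. \<rho> (x i)) * of_real (?vol ^ n)"
  have "(\<lambda>m. \<integral>x. ?V m x \<partial>config n) \<longlonglongrightarrow> (\<integral>x. ?L x \<partial>config n)"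
  proof (rule integral_dominated_convergence[where w="\<lambda>x. B * (D * ?vol) ^ n * indicator (Pi\<^sub>E {..<n} (\<lambda>_. K)) x"])
    have [measurable]: "\<rho> \<in> borel_measurable borel" using rho_integrable by simp
    show "?L \<in> borel_measurable (config n)"
      by (intro borel_measurable_times measurable_compose[OF _ borel_measurable_of_real] borel_measurable_prod borel_measurable_const
          measurable_compose[OF measurable_component_singleton]) auto
    show "?V m \<in> borel_measurable (config n)" for m
    proof (intro borel_measurable_times borel_measurable_const sigma_finite_measure.borel_measurable_lebesgue_integral[OF sigma_finite_config])
      show "(\<lambda>(x, y). dipole (?\<alpha> m) n x y * complex_of_real (riesz_prod (?\<alpha> m) \<sigma> n x y)) \<in> borel_measurable (configs n n)"
        using int[of m] unfolding case_prod_beta by (rule borel_measurable_integrable)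
    qed
    have KE: "Pi\<^sub>E {..<n} (\<lambda>_. K) \<in> sets (config n)" using K(1) borel_compact by (intro sets_PiM_I_finite) auto
    have "emeasure (config n) (Pi\<^sub>E {..<n} (\<lambda>_. K)) < \<infinity>"
      using K(1) borel_compact emeasure_bounded_finite[OF compact_imp_bounded[OF K(1)]]
      by (subst PS.emeasure_PiM) (auto simp: power_less_top_ennreal)
    then show "integrable (config n) (\<lambda>x. B * (D * ?vol) ^ n * indicator (Pi\<^sub>E {..<n} (\<lambda>_. K)) x)"
      using KE by (intro integrable_mult_right integrable_real_indicator) auto
    show "AE x in config n. norm (?V m x) \<le> B * (D * ?vol) ^ n * indicator (Pi\<^sub>E {..<n} (\<lambda>_. K)) x" for m
      using AE_inner_distinct AE_space
    proof eventually_elim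
      case (elim x)
      show ?case
      proof (cases "x \<in> Pi\<^sub>E {..<n} (\<lambda>_. K)")
        case True
        then have xK: "\<And>i. i < n \<Longrightarrow> x i \<in> K" by auto
        have "norm (?V m x) \<le> (\<integral>\<omega>. B * indicator (slab n {..D}) \<omega> \<partial>polars n)"
          unfolding V[OF elim(2)] using elim xK by (intro integral_norm_bound_integral_AE iw dom) auto
        also have "\<dots> = B * (D * ?vol) ^ n" using meas_slab by simp
        finally show ?thesis using True by simp
      next
        case False
        then show ?thesis using outside[OF False elim(2)] by simp
      qed
    qed
    show "AE x in config n. (\<lambda>m. ?V m x) \<longlonglongrightarrow> ?L x"
      using AE_inner_distinct AE_space
    proof eventually_elim
      case (elim x)
      show ?case
      proof (cases "x \<in> Pi\<^sub>E {..<n} (\<lambda>_. K)")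
        case True
        then have xK: "\<And>i. i < n \<Longrightarrow> x i \<in> K" by auto
        have "(\<lambda>m. \<integral>\<omega>. dipole (?\<alpha> m) n x (merged (t m) \<sigma> n x \<omega>) \<partial>polars n)
            \<longlonglongrightarrow> (\<integral>\<omega>. complex_of_real (\<Prod>i<n. \<rho> (x i)) * indicator (slab n {..<1}) \<omega> \<partial>polars n)"
        proof (rule integral_dominated_convergence[OF _ _ iw])
          have dm: "dipole (?\<alpha> m) n x \<in> borel_measurable (config n)" for m
            using measurable_compose[OF measurable_Pair1'[OF elim(2)] dipole_measurable] by simp
          show "(\<lambda>\<omega>. dipole (?\<alpha> m) n x (merged (t m) \<sigma> n x \<omega>)) \<in> borel_measurable (polars n)" for m
            by (rule measurable_compose[OF merged_distr(1)[OF t(1,2)] dm])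
          show "(\<lambda>\<omega>. complex_of_real (\<Prod>i<n. \<rho> (x i)) * indicator (slab n {..<1}) \<omega>) \<in> borel_measurable (polars n)"
            by measurable
          show "AE \<omega> in polars n. (\<lambda>m. dipole (?\<alpha> m) n x (merged (t m) \<sigma> n x \<omega>))
              \<longlonglongrightarrow> complex_of_real (\<Prod>i<n. \<rho> (x i)) * indicator (slab n {..<1}) \<omega>"
            using AE_polars[of n] AE_space
            by eventually_elim (use elim(1) in \<open>intro dipole_pointwise_limit t(1,4) \<sigma> xK; auto\<close>)
          show "AE \<omega> in polars n. norm (dipole (?\<alpha> m) n x (merged (t m) \<sigma> n x \<omega>)) \<le> B * indicator (slab n {..D}) \<omega>" for m
            using elim xK by (intro dom) auto
        qed
        also have "(\<integral>\<omega>. complex_of_real (\<Prod>i<n. \<rho> (x i)) * indicator (slab n {..<1}) \<omega> \<partial>polars n) = ?L x"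
        proof -
          have "(\<integral>\<omega>. indicator (slab n {..<1}) \<omega> \<partial>polars n) = complex_of_real (\<integral>\<omega>. indicator (slab n {..<1}) \<omega> \<partial>polars n)"
            unfolding integral_complex_of_real[symmetric] by (intro Bochner_Integration.integral_cong) (auto simp: indicator_def)
          then show ?thesis using meas_slab by simp
        qed
        finally show ?thesis unfolding V[OF elim(2)] .
      next
        case False
        then obtain i where "i < n" "x i \<notin> K" using not_in_PiE[OF elim(2) False] by blast
        then have z: "(\<Prod>i<n. \<rho> (x i)) = 0" using f_supp by (intro prod_zero) (auto simp: \<rho>_def)
        have "?L x = 0" unfolding z by simp
        moreover have "?V m x = 0" for m by (rule outside[OF False elim(2)])
        ultimately show ?thesis by (simp only: tendsto_const)
      qed
    qed
  qed
  moreover have "(\<integral>x. ?V m x \<partial>config n) = of_real (?c m ^ n) *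
      (\<integral>p. dipole (?\<alpha> m) n (fst p) (snd p) * of_real (riesz_prod (?\<alpha> m) \<sigma> n (fst p) (snd p)) \<partial>configs n n)" for m
    using L.integral_fst'[OF int[of m]] by simp
  moreover have "(\<integral>x. ?L x \<partial>config n) = of_real ((?vol * (\<integral>x. \<rho> x \<partial>lborel)) ^ n)"
  proof -
    have "(\<integral>x. (\<Prod>i<n. \<rho> (x i)) \<partial>config n) = (\<integral>x. \<rho> x \<partial>lborel) ^ n"
      by (subst PS.product_integral_prod) (auto intro: rho_integrable)
    then have "(\<integral>x. complex_of_real (\<Prod>i<n. \<rho> (x i)) \<partial>config n) = of_real ((\<integral>x. \<rho> x \<partial>lborel) ^ n)"
      unfolding integral_complex_of_real by simp
    then show ?thesis by (simp add: power_mult_distrib mult.commute)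
  qed
  ultimately show ?lim by (simp only:)
qed

end

section \<open>The limits of the scaled moments\<close>

lemma riesz_const_asymptotics:
  assumes t: "\<And>m. 0 < t m" "\<And>m. t m < d" "t \<longlonglongrightarrow> 0" and d: "d > 0"
  shows "(\<lambda>m. t m / riesz_const d (t m)) \<longlonglongrightarrow> d / (2 powr d - 1)"
proof -
  have ne: "2 powr d - 1 \<noteq> 0" using powr_less_mono[of 0 d 2] d by simp
  have "(\<lambda>m. (d - t m) / (2 powr (d - t m) - 1)) \<longlonglongrightarrow> (d - 0) / (2 powr (d - 0) - 1)"
    using ne by (intro tendsto_intros t(3)) auto
  moreover have "t m / riesz_const d (t m) = (d - t m) / (2 powr (d - t m) - 1)" for m
    using t(1)[of m] unfolding riesz_const_def by simp
  ultimately show ?thesis by simp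
qed

lemma sphere_measure_unit_sphere:
  "sphere_measure (sphere (0::'a::euclidean_space) 1) = real DIM('a) * unit_ball_vol (real DIM('a))"
proof -
  have "{r *\<^sub>R x |r x. 0 < r \<and> r \<le> 1 \<and> x \<in> sphere (0::'a) 1} = cball 0 1 - {0}"
  proof (intro equalityI subsetI)
    fix z :: 'a assume "z \<in> cball 0 1 - {0}"
    then show "z \<in> {r *\<^sub>R x |r x. 0 < r \<and> r \<le> 1 \<and> x \<in> sphere (0::'a) 1}"
      by (intro CollectI exI[of _ "norm z"] exI[of _ "z /\<^sub>R norm z"]) auto
  qed auto
  moreover have "measure lborel (cball (0::'a) 1 - {0}) = measure lborel (cball (0::'a) 1)"
  proof -
    have "measure lborel (cball (0::'a) 1 - {0}) = measure lborel (cball (0::'a) 1) - measure lborel {0::'a}"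
      using emeasure_bounded_finite[of "cball (0::'a) 1"] by (intro measure_Diff) auto
    then show ?thesis by simp
  qed
  ultimately show ?thesis unfolding sphere_measure_def by (simp add: content_cball)
qed

lemma measure_shell:
  "measure lborel (shell :: 'a::euclidean_space set) = (2 ^ DIM('a) - 1) * unit_ball_vol (real DIM('a))"
proof -
  have eq: "(shell :: 'a set) = cball 0 2 - ball 0 1" unfolding shell_def by auto
  have "measure lborel (cball (0::'a) 2 - ball 0 1) = measure lborel (cball (0::'a) 2) - measure lborel (ball (0::'a) 1)"
    using emeasure_bounded_finite[of "cball (0::'a) 2"] by (intro measure_Diff) auto
  then show ?thesis unfolding eq by (simp add: content_cball content_ball algebra_simps)
qed

context log_field_test
begin

text \<open>The Boltzmann weight is \<open>ratio\<close> times the sum over matchings.\<close>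

lemma gas_eq_dipoles:
  assumes t: "0 < t" "t < real DIM('a)" "t \<le> 1"
  shows "gas (real DIM('a) - t) C n n = (\<Sum>\<sigma>\<in>matchings n n. \<integral>p. dipole (real DIM('a) - t) n (fst p) (snd p) *
        of_real (riesz_prod (real DIM('a) - t) \<sigma> n (fst p) (snd p)) \<partial>configs n n)"
proof -
  let ?\<alpha> = "real DIM('a) - t"
  define s where "s m = t / real (Suc m)" for m
  have s: "0 < s m" "s m \<le> t" for m using t(1) divide_left_mono[of 1 "1 + real m" t] by (auto simp: s_def)
  have "(\<lambda>m. t * (1 / real (Suc m))) \<longlonglongrightarrow> t * 0" by (intro tendsto_intros LIMSEQ_Suc[OF lim_1_over_n])
  then have s0: "s \<longlonglongrightarrow> 0" unfolding s_def by simp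
  have int: "integrable (configs n n) (\<lambda>p. dipole ?\<alpha> n (fst p) (snd p) * of_real (riesz_prod ?\<alpha> \<sigma> n (fst p) (snd p)))"
    if "\<sigma> \<in> matchings n n" for \<sigma>
    using dipole_tendsto(1)[of s \<sigma> n 0] s s0 t that
    by (simp add: s_def) (meson order_le_less_trans order_trans)
  have "gas ?\<alpha> C n n = (\<integral>p. (\<Sum>\<sigma>\<in>matchings n n. dipole ?\<alpha> n (fst p) (snd p) * of_real (riesz_prod ?\<alpha> \<sigma> n (fst p) (snd p))) \<partial>configs n n)"
    unfolding gas_def
  proof (rule integral_cong_AE)
    show "(\<lambda>p. wt n n (fst p) (snd p) * complex_of_real (exp (- ?\<alpha> * coulomb_energy C (fst p) (snd p) {..<n} {..<n}))) \<in> borel_measurable (configs n n)"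
      by measurable
    show "(\<lambda>p. \<Sum>\<sigma>\<in>matchings n n. dipole ?\<alpha> n (fst p) (snd p) * of_real (riesz_prod ?\<alpha> \<sigma> n (fst p) (snd p))) \<in> borel_measurable (configs n n)"
      using int by (intro borel_measurable_sum borel_measurable_integrable)
    show "AE p in configs n n. wt n n (fst p) (snd p) * complex_of_real (exp (- ?\<alpha> * coulomb_energy C (fst p) (snd p) {..<n} {..<n})) =
        (\<Sum>\<sigma>\<in>matchings n n. dipole ?\<alpha> n (fst p) (snd p) * of_real (riesz_prod ?\<alpha> \<sigma> n (fst p) (snd p)))"
      using AE_distinct_points[of n n]
    proof eventually_elim
      case (elim p)
      have "matchings n n \<noteq> {}" using card_matchings[of n] by force
      then have "riesz_sum ?\<alpha> n n (fst p) (snd p) > 0"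
        unfolding riesz_sum_eq by (intro sum_pos finite_matchings riesz_prod_pos[OF elim])
      then have "exp (- ?\<alpha> * coulomb_energy C (fst p) (snd p) {..<n} {..<n}) = ratio ?\<alpha> n (fst p) (snd p) * riesz_sum ?\<alpha> n n (fst p) (snd p)"
        unfolding ratio_def by simp
      then show ?case
        unfolding dipole_def riesz_sum_eq sum_distrib_left[symmetric] of_real_sum[symmetric] mult.assoc of_real_mult[symmetric] by simp
    qed
  qed
  then show ?thesis using int by (simp add: Bochner_Integration.integral_sum)
qed

lemma gas_diagonal_limit:
  assumes t: "\<And>m. 0 < t m" "\<And>m. t m < real DIM('a)" "\<And>m. t m \<le> 1" "t \<longlonglongrightarrow> 0"
  shows "(\<lambda>m. of_real (riesz_const (real DIM('a)) (t m) ^ n) * gas (real DIM('a) - t m) C n n)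
    \<longlonglongrightarrow> of_real (fact n * (measure lborel (shell :: 'a set) * (\<integral>x. \<rho> x \<partial>lborel)) ^ n)"
proof -
  have "(\<lambda>m. \<Sum>\<sigma>\<in>matchings n n. of_real (riesz_const (real DIM('a)) (t m) ^ n) *
      (\<integral>p. dipole (real DIM('a) - t m) n (fst p) (snd p) *
        of_real (riesz_prod (real DIM('a) - t m) \<sigma> n (fst p) (snd p)) \<partial>configs n n))
     \<longlonglongrightarrow> (\<Sum>\<sigma>\<in>matchings n n. of_real ((measure lborel (shell :: 'a set) * (\<integral>x. \<rho> x \<partial>lborel)) ^ n))"
    by (intro tendsto_sum dipole_tendsto(2) t)
  then show ?thesis
    unfolding gas_eq_dipoles[OF t(1,2,3)] sum_distrib_left by (simp add: card_matchings)
qed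

text \<open>The constants fit because \<open>d\<close> times the volume of the shell is \<open>(2\<^sup>d - 1) |S\<^sup>d\<^sup>-\<^sup>1|\<close>, while
  \<open>t / riesz_const d t\<close> tends to \<open>d / (2\<^sup>d - 1)\<close>. If \<open>l < k\<close>, the scaling exceeds the bound
  \<open>gas_bound\<close> by the factor \<open>t powr ((k - l) / 2)\<close>.\<close>

lemma scaled_gas_limit:
  assumes t: "\<And>m. 0 < t m" "\<And>m. t m < real DIM('a)" "\<And>m. t m \<le> 1" "t \<longlonglongrightarrow> 0" and lk: "l \<le> k"
  shows "(\<lambda>m. of_real (sqrt (t m / sphere_measure (sphere (0::'a) 1)) ^ (k + l)) * gas (real DIM('a) - t m) C k l)
    \<longlonglongrightarrow> (if k = l then of_real (fact k * (\<integral>x. \<rho> x \<partial>lborel) ^ k) else 0)"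
proof -
  let ?d = "real DIM('a)" and ?S = "\<integral>x. \<rho> x \<partial>lborel" and ?V = "measure lborel (shell :: 'a set)"
  let ?s = "sphere_measure (sphere (0::'a) 1)"
  let ?c = "\<lambda>m. riesz_const ?d (t m)"
  have d: "?d > 0" by simp
  have p2: "(2::real) ^ DIM('a) - 1 > 0" using one_less_power[of "2::real" "DIM('a)"] by simp
  then have ne1: "(2::real) ^ DIM('a) \<noteq> 1" by linarith
  have s: "?s > 0" unfolding sphere_measure_unit_sphere by simp
  have c: "?c m > 0" for m by (rule riesz_const_pos[OF t(1,2)])
  have ta: "(\<lambda>m. t m / ?c m / ?s) \<longlonglongrightarrow> ?d / (2 ^ DIM('a) - 1) / ?s"
    by (rule tendsto_divide[OF _ tendsto_const])
      (use riesz_const_asymptotics[OF t(1,2,4) d] s in \<open>simp_all add: powr_realpow\<close>)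
  have V: "?d / (2 ^ DIM('a) - 1) / ?s * ?V = 1"
    unfolding sphere_measure_unit_sphere measure_shell using ne1 by (simp add: field_simps less_imp_neq[OF unit_ball_vol_pos, symmetric])
  have sq: "sqrt (t m / ?s) ^ 2 = t m / ?c m / ?s * ?c m" for m
    using t(1)[of m] s c[of m] by simp
  show ?thesis
  proof (cases "k = l")
    case True
    have "(\<lambda>m. of_real ((t m / ?c m / ?s) ^ k) * (of_real (?c m ^ k) * gas (?d - t m) C k k))
      \<longlonglongrightarrow> of_real ((?d / (2 ^ DIM('a) - 1) / ?s) ^ k) * of_real (fact k * (?V * ?S) ^ k)"
      by (intro tendsto_mult tendsto_of_real tendsto_power ta gas_diagonal_limit t)
    also have "complex_of_real ((?d / (2 ^ DIM('a) - 1) / ?s) ^ k) * of_real (fact k * (?V * ?S) ^ k) =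
        of_real (fact k * (?d / (2 ^ DIM('a) - 1) / ?s * ?V) ^ k * ?S ^ k)"
      unfolding power_mult_distrib of_real_mult by (simp only: ac_simps)
    also have "(\<lambda>m. of_real ((t m / ?c m / ?s) ^ k) * (of_real (?c m ^ k) * gas (?d - t m) C k k)) =
      (\<lambda>m. of_real (sqrt (t m / ?s) ^ (k + k)) * gas (?d - t m) C k k)"
    proof
      fix m
      have "sqrt (t m / ?s) ^ (k + k) = (t m / ?c m / ?s) ^ k * ?c m ^ k"
        unfolding mult_2[symmetric] power_mult sq power_mult_distrib ..
      then show "of_real ((t m / ?c m / ?s) ^ k) * (of_real (?c m ^ k) * gas (?d - t m) C k k) =
          of_real (sqrt (t m / ?s) ^ (k + k)) * gas (?d - t m) C k k"
        by (simp only: of_real_mult mult.assoc)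
    qed
    finally show ?thesis unfolding V using True by simp
  next
    case False
    with lk have lk': "0 < k - l" by simp
    obtain B where B: "\<And>t. 0 < t \<Longrightarrow> t < ?d \<Longrightarrow> t \<le> 1 \<Longrightarrow> cmod (gas (?d - t) C k l) \<le> B * (1 / riesz_const ?d t) ^ l"
      using gas_bound[OF lk] by blast
    let ?a = "\<lambda>m. sqrt (t m / ?s)"
    have "(\<lambda>m. sqrt (t m / ?s)) \<longlonglongrightarrow> sqrt (0 / ?s)" using s by (intro tendsto_intros t(4)) auto
    then have "(\<lambda>m. B * ?a m ^ (k - l) * (t m / ?c m / ?s) ^ l) \<longlonglongrightarrow> B * (sqrt (0 / ?s)) ^ (k - l) * (?d / (2 ^ DIM('a) - 1) / ?s) ^ l"
      by (intro tendsto_mult tendsto_const tendsto_power ta)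
    then have z: "(\<lambda>m. B * ?a m ^ (k - l) * (t m / ?c m / ?s) ^ l) \<longlonglongrightarrow> 0" using lk' by (simp add: power_0_left)
    have "(\<lambda>m. of_real (?a m ^ (k + l)) * gas (?d - t m) C k l) \<longlonglongrightarrow> 0"
    proof (rule Lim_null_comparison[OF _ z], rule always_eventually, rule allI)
      fix m
      have a0: "?a m \<ge> 0" using t(1)[of m] s by simp
      have "k + l = (k - l) + 2 * l" using lk by simp
      then have "?a m ^ (k + l) = ?a m ^ (k - l) * (t m / ?c m / ?s * ?c m) ^ l"
        by (simp only: power_add power_mult sq)
      then have e: "?a m ^ (k + l) * (B * (1 / ?c m) ^ l) = B * ?a m ^ (k - l) * (t m / ?c m / ?s) ^ l"
        using c[of m] by (simp add: power_mult_distrib power_divide mult_ac)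
      have "norm (of_real (?a m ^ (k + l)) * gas (?d - t m) C k l) = ?a m ^ (k + l) * cmod (gas (?d - t m) C k l)"
        using a0 by (simp add: norm_mult norm_power)
      also have "\<dots> \<le> ?a m ^ (k + l) * (B * (1 / ?c m) ^ l)"
        using a0 by (intro mult_left_mono B t) auto
      finally show "norm (of_real (?a m ^ (k + l)) * gas (?d - t m) C k l) \<le> B * ?a m ^ (k - l) * (t m / ?c m / ?s) ^ l"
        unfolding e .
    qed
    then show ?thesis using False by simp
  qed
qed

end

section \<open>Convergence in law from moments\<close>

text \<open>Stop the exponential series before an even power: the remainder is at most the next even moment divided by
  a factorial. Its limit is a term of the exponential series of \<open>q\<close>, which is small
  for a late cutoff, while for a fixed cutoff only finitely many moments have to converge.\<close>

lemma gaussian_moments_imp_char: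
  fixes T :: "nat \<Rightarrow> 'w \<Rightarrow> real"
  assumes M: "prob_space M" and T[measurable]: "\<And>m. T m \<in> borel_measurable M"
    and bd: "\<And>m. \<exists>B. \<forall>\<omega>\<in>space M. \<bar>T m \<omega>\<bar> \<le> B"
    and mom: "\<And>n. (\<lambda>m. \<integral>\<omega>. T m \<omega> ^ n \<partial>M) \<longlonglongrightarrow> (if even n then fact n / fact (n div 2) * q ^ (n div 2) else 0)"
  shows "(\<lambda>m. \<integral>\<omega>. cis (T m \<omega>) \<partial>M) \<longlonglongrightarrow> of_real (exp (- q))"
proof (rule LIMSEQ_I)
  interpret prob_space M by fact
  fix e :: real assume e: "e > 0"
  define \<tau> where "\<tau> n = (if even n then fact n / fact (n div 2) * q ^ (n div 2) else 0)" for n :: nat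
  have int: "integrable M (\<lambda>\<omega>. T m \<omega> ^ n)" for m n
  proof -
    obtain B where B: "\<forall>\<omega>\<in>space M. \<bar>T m \<omega>\<bar> \<le> B" using bd by blast
    show ?thesis by (rule integrable_const_bound[where B="B ^ n"]) (use B in \<open>auto simp: power_abs intro!: power_mono\<close>)
  qed
  have taylor: "cmod ((\<integral>\<omega>. cis (T m \<omega>) \<partial>M) - (\<Sum>n<2 * p. \<i> ^ n * of_real ((\<integral>\<omega>. T m \<omega> ^ n \<partial>M) / fact n)))
      \<le> (\<integral>\<omega>. T m \<omega> ^ (2 * p) \<partial>M) / fact (2 * p)" if p: "p \<ge> 1" for m p
  proof -
    have "2 * p = Suc (2 * p - 1)" using p by simp
    then have r: "{..<2 * p} = {..2 * p - 1}" "Suc (2 * p - 1) = 2 * p" using lessThan_Suc_atMost[of "2 * p - 1"] by simp_all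
    have icis: "integrable M (\<lambda>\<omega>. cis (T m \<omega>))" by (rule integrable_const_bound[where B=1]) auto
    have isum: "integrable M (\<lambda>\<omega>. \<i> ^ n * complex_of_real (T m \<omega> ^ n / fact n))" for n
      by (intro integrable_mult_right integrable_of_real integrable_divide_zero int impI)
    have "(\<integral>\<omega>. cis (T m \<omega>) \<partial>M) - (\<Sum>n<2 * p. \<i> ^ n * of_real ((\<integral>\<omega>. T m \<omega> ^ n \<partial>M) / fact n)) =
        (\<integral>\<omega>. cis (T m \<omega>) - (\<Sum>n<2 * p. \<i> ^ n * of_real (T m \<omega> ^ n / fact n)) \<partial>M)"
      using icis isum by (simp add: Bochner_Integration.integral_diff Bochner_Integration.integral_sum del: of_real_power of_real_divide)
    then have "cmod ((\<integral>\<omega>. cis (T m \<omega>) \<partial>M) - (\<Sum>n<2 * p. \<i> ^ n * of_real ((\<integral>\<omega>. T m \<omega> ^ n \<partial>M) / fact n))) \<le>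
        (\<integral>\<omega>. cmod (cis (T m \<omega>) - (\<Sum>n<2 * p. \<i> ^ n * of_real (T m \<omega> ^ n / fact n))) \<partial>M)"
      using integral_norm_bound by simp
    also have "\<dots> \<le> (\<integral>\<omega>. T m \<omega> ^ (2 * p) / fact (2 * p) \<partial>M)"
    proof (intro integral_mono integrable_norm Bochner_Integration.integrable_diff icis Bochner_Integration.integrable_sum isum integrable_divide_zero int impI)
      fix \<omega>
      have "cmod (cis (T m \<omega>) - (\<Sum>n<2 * p. \<i> ^ n * of_real (T m \<omega> ^ n / fact n))) =
          cmod (iexp (T m \<omega>) - (\<Sum>n\<le>2 * p - 1. (\<i> * T m \<omega>) ^ n / fact n))"
        unfolding r cis_conv_exp by (simp add: power_mult_distrib)
      also have "\<dots> \<le> \<bar>T m \<omega>\<bar> ^ (2 * p) / fact (2 * p)" using iexp_approx1[of "T m \<omega>" "2 * p - 1"] unfolding r .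
      finally show "cmod (cis (T m \<omega>) - (\<Sum>n<2 * p. \<i> ^ n * of_real (T m \<omega> ^ n / fact n))) \<le> T m \<omega> ^ (2 * p) / fact (2 * p)"
        by (simp add: power_even_abs)
    qed
    finally show ?thesis by simp
  qed
  have lsum: "(\<Sum>n<2 * p. \<i> ^ n * complex_of_real (\<tau> n / fact n)) = of_real (\<Sum>j<p. (- q) ^ j / fact j)" for p
  proof (induction p)
    case (Suc p)
    have "\<i> ^ (2 * p) * complex_of_real (\<tau> (2 * p) / fact (2 * p)) = of_real ((- q) ^ p / fact p)"
      unfolding power_mult \<tau>_def by (simp add: power_minus[of q])
    moreover have "\<tau> (Suc (2 * p)) = 0" by (simp add: \<tau>_def)
    ultimately show ?case using Suc by simp
  qed simp
  have ser: "(\<lambda>p. \<Sum>j<p. x ^ j / fact j) \<longlonglongrightarrow> exp x" for x :: real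
    using exp_converges[of x] unfolding sums_def by (simp add: divide_inverse mult.commute scaleR_conv_of_real)
  have "(\<lambda>p. q ^ p / fact p) \<longlonglongrightarrow> 0"
    using summable_LIMSEQ_zero[OF summable_exp[of q]] by (simp add: divide_inverse mult.commute)
  then have "\<forall>\<^sub>F p in sequentially. \<bar>q ^ p / fact p\<bar> < e / 4"
    using e by (auto dest!: tendstoD[where e="e/4"] simp: dist_real_def)
  moreover have "\<forall>\<^sub>F p in sequentially. \<bar>(\<Sum>j<p. (- q) ^ j / fact j) - exp (- q)\<bar> < e / 4"
    using tendstoD[OF ser, of "e / 4" "- q"] e by (simp add: dist_real_def)
  ultimately have "\<forall>\<^sub>F p in sequentially. p \<ge> 1 \<and> \<bar>q ^ p / fact p\<bar> < e / 4 \<and> \<bar>(\<Sum>j<p. (- q) ^ j / fact j) - exp (- q)\<bar> < e / 4"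
    using eventually_ge_at_top[of 1] by eventually_elim simp
  then obtain p where p: "p \<ge> 1" "\<bar>q ^ p / fact p\<bar> < e / 4" "\<bar>(\<Sum>j<p. (- q) ^ j / fact j) - exp (- q)\<bar> < e / 4"
    using eventually_happens by fastforce
  let ?S = "\<lambda>m. \<Sum>n<2 * p. \<i> ^ n * complex_of_real ((\<integral>\<omega>. T m \<omega> ^ n \<partial>M) / fact n)"
  have "?S \<longlonglongrightarrow> (\<Sum>n<2 * p. \<i> ^ n * complex_of_real (\<tau> n / fact n))"
    unfolding \<tau>_def by (intro tendsto_sum tendsto_mult tendsto_const tendsto_of_real tendsto_divide mom) simp
  then have s: "\<forall>\<^sub>F m in sequentially. cmod (?S m - of_real (\<Sum>j<p. (- q) ^ j / fact j)) < e / 4"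
    unfolding lsum using e by (auto dest!: tendstoD[where e="e/4"] simp: dist_norm)
  have "(\<lambda>m. (\<integral>\<omega>. T m \<omega> ^ (2 * p) \<partial>M) / fact (2 * p)) \<longlonglongrightarrow> \<tau> (2 * p) / fact (2 * p)"
    unfolding \<tau>_def by (intro tendsto_divide tendsto_const mom) simp
  then have "(\<lambda>m. (\<integral>\<omega>. T m \<omega> ^ (2 * p) \<partial>M) / fact (2 * p)) \<longlonglongrightarrow> q ^ p / fact p" by (simp add: \<tau>_def)
  then have "\<forall>\<^sub>F m in sequentially. \<bar>(\<integral>\<omega>. T m \<omega> ^ (2 * p) \<partial>M) / fact (2 * p) - q ^ p / fact p\<bar> < e / 4"
    using e by (auto dest!: tendstoD[where e="e/4"] simp: dist_real_def)
  with s have "\<forall>\<^sub>F m in sequentially. cmod ((\<integral>\<omega>. cis (T m \<omega>) \<partial>M) - of_real (exp (- q))) < e"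
  proof eventually_elim
    case (elim m)
    let ?x = "\<integral>\<omega>. cis (T m \<omega>) \<partial>M" and ?z = "\<Sum>j<p. (- q) ^ j / fact j"
    have "cmod (?x - ?S m) \<le> (\<integral>\<omega>. T m \<omega> ^ (2 * p) \<partial>M) / fact (2 * p)" by (rule taylor[OF p(1)])
    also have "\<dots> < e / 2" using elim(2) p(2) by linarith
    finally have 1: "cmod (?x - ?S m) < e / 2" .
    have 2: "cmod (of_real ?z - of_real (exp (- q))) < e / 4"
      using p(3) unfolding of_real_diff[symmetric] norm_of_real .
    have "cmod ((?x - ?S m) + (?S m - of_real ?z) + (of_real ?z - of_real (exp (- q))))
        \<le> cmod (?x - ?S m) + cmod (?S m - of_real ?z) + cmod (of_real ?z - of_real (exp (- q)))"
      by (rule order_trans[OF norm_triangle_ineq add_right_mono[OF norm_triangle_ineq]])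
    moreover have "(?x - ?S m) + (?S m - of_real ?z) + (of_real ?z - of_real (exp (- q))) = ?x - of_real (exp (- q))" by simp
    ultimately have "cmod (?x - of_real (exp (- q))) \<le> cmod (?x - ?S m) + cmod (?S m - of_real ?z) + cmod (of_real ?z - of_real (exp (- q)))"
      by (simp only:)
    then show ?case using 1 2 elim(1) by linarith
  qed
  then show "\<exists>no. \<forall>n\<ge>no. cmod ((\<integral>\<omega>. cis (T n \<omega>) \<partial>M) - of_real (exp (- q))) < e"
    unfolding eventually_sequentially .
qed

text \<open>Write \<open>w \<bullet> a = (cnj a * w + a * cnj w) / 2\<close> and expand; in the limit only the middle binomial term
  survives.\<close>

lemma circular_moments_imp_marginal_moments:
  fixes W :: "nat \<Rightarrow> 'w \<Rightarrow> complex"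
  assumes M: "prob_space M" and W[measurable]: "\<And>m. W m \<in> borel_measurable M"
    and bd: "\<And>m. \<exists>B. \<forall>\<omega>\<in>space M. cmod (W m \<omega>) \<le> B"
    and mom: "\<And>k l. (\<lambda>m. \<integral>\<omega>. W m \<omega> ^ k * cnj (W m \<omega>) ^ l \<partial>M) \<longlonglongrightarrow> (if k = l then of_real (fact k * v ^ k) else 0)"
  shows "(\<lambda>m. \<integral>\<omega>. (W m \<omega> \<bullet> a) ^ n \<partial>M) \<longlonglongrightarrow>
    (if even n then fact n / fact (n div 2) * ((cmod a)\<^sup>2 * v / 4) ^ (n div 2) else 0)"
proof -
  interpret prob_space M by fact
  have int: "integrable M (\<lambda>\<omega>. W m \<omega> ^ k * cnj (W m \<omega>) ^ l)" for m k l
  proof -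
    obtain B where B: "\<forall>\<omega>\<in>space M. cmod (W m \<omega>) \<le> B" using bd by blast
    have "norm (W m \<omega> ^ k * cnj (W m \<omega>) ^ l) \<le> B ^ (k + l)" if "\<omega> \<in> space M" for \<omega>
      using B that by (simp add: norm_mult norm_power power_add[symmetric] power_mono)
    moreover have "(\<lambda>\<omega>. W m \<omega> ^ k * cnj (W m \<omega>) ^ l) \<in> borel_measurable M"
      by (rule measurable_compose[OF W], rule borel_measurable_continuous_onI) (intro continuous_intros)
    ultimately show ?thesis by (intro integrable_const_bound[where B="B ^ (k + l)"] AE_I2)
  qed
  let ?c = "\<lambda>k. of_nat (n choose k) * (cnj a / 2) ^ k * (a / 2) ^ (n - k)"
  have binom: "complex_of_real ((w \<bullet> a) ^ n) = (\<Sum>k\<le>n. ?c k * (w ^ k * cnj w ^ (n - k)))" for w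
  proof -
    have "complex_of_real (w \<bullet> a) = (cnj a / 2) * w + (a / 2) * cnj w"
      by (simp add: complex_eq_iff inner_complex_def field_simps)
    then have "complex_of_real ((w \<bullet> a) ^ n) = ((cnj a / 2) * w + (a / 2) * cnj w) ^ n" by simp
    also have "\<dots> = (\<Sum>k\<le>n. ?c k * (w ^ k * cnj w ^ (n - k)))"
      unfolding binomial_ring by (intro sum.cong refl) (simp add: power_mult_distrib power_divide mult_ac)
    finally show ?thesis .
  qed
  have "(\<lambda>m. \<Sum>k\<le>n. ?c k * (\<integral>\<omega>. W m \<omega> ^ k * cnj (W m \<omega>) ^ (n - k) \<partial>M)) \<longlonglongrightarrow>
      (\<Sum>k\<le>n. ?c k * (if k = n - k then of_real (fact k * v ^ k) else 0))"
    by (intro tendsto_sum tendsto_mult tendsto_const mom)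
  also have "(\<lambda>m. \<Sum>k\<le>n. ?c k * (\<integral>\<omega>. W m \<omega> ^ k * cnj (W m \<omega>) ^ (n - k) \<partial>M)) =
      (\<lambda>m. complex_of_real (\<integral>\<omega>. (W m \<omega> \<bullet> a) ^ n \<partial>M))"
  proof
    fix m
    have "(\<Sum>k\<le>n. ?c k * (\<integral>\<omega>. W m \<omega> ^ k * cnj (W m \<omega>) ^ (n - k) \<partial>M)) = (\<integral>\<omega>. (\<Sum>k\<le>n. ?c k * (W m \<omega> ^ k * cnj (W m \<omega>) ^ (n - k))) \<partial>M)"
      by (subst Bochner_Integration.integral_sum) (auto intro!: integrable_mult_right int)
    then show "(\<Sum>k\<le>n. ?c k * (\<integral>\<omega>. W m \<omega> ^ k * cnj (W m \<omega>) ^ (n - k) \<partial>M)) = complex_of_real (\<integral>\<omega>. (W m \<omega> \<bullet> a) ^ n \<partial>M)"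
      unfolding binom[symmetric] integral_complex_of_real .
  qed
  also have "(\<Sum>k\<le>n. ?c k * (if k = n - k then of_real (fact k * v ^ k) else 0)) =
      complex_of_real (if even n then fact n / fact (n div 2) * ((cmod a)\<^sup>2 * v / 4) ^ (n div 2) else 0)"
  proof (cases "even n")
    case True
    then obtain p where p: "n = 2 * p" by blast
    have "(\<Sum>k\<le>n. ?c k * (if k = n - k then of_real (fact k * v ^ k) else 0)) =
        (\<Sum>k\<le>n. if k = p then ?c p * of_real (fact p * v ^ p) else 0)"
      by (intro sum.cong refl) (auto simp: p)
    also have "\<dots> = ?c p * of_real (fact p * v ^ p)" by (simp add: p)
    also have "\<dots> = of_real (real (2 * p choose p) * fact p) * (((cnj a / 2) * (a / 2)) ^ p * of_real (v ^ p))"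
      unfolding p power_mult_distrib by simp
    also have "real (2 * p choose p) * fact p = fact (2 * p) / fact p"
      by (subst binomial_fact) auto
    also have "(cnj a / 2) * (a / 2) = of_real ((cmod a)\<^sup>2 / 4)"
      by (simp add: complex_norm_square mult.commute del: of_real_power)
    finally show ?thesis by (simp add: p power_mult_distrib power_divide)
  next
    case False
    then have "k \<noteq> n - k" if "k \<le> n" for k using that by presburger
    then show ?thesis using False by simp
  qed
  finally show ?thesis by (simp only: tendsto_of_real_iff)
qed

lemma white_noise_char:
  fixes Z :: "'z \<Rightarrow> complex"
  assumes N: "prob_space N" and G: "\<And>a b. centered_gaussian N (\<lambda>\<omega>. a * Re (Z \<omega>) + b * Im (Z \<omega>))"
    and Z0: "(\<integral>\<omega>. (Z \<omega>)\<^sup>2 \<partial>N) = 0" and Zv: "(\<integral>\<omega>. (cmod (Z \<omega>))\<^sup>2 \<partial>N) = v"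
  shows "Z \<in> borel_measurable N"
    and "integrable N (\<lambda>\<omega>. (cmod (Z \<omega>))\<^sup>2)"
    and "(\<integral>\<omega>. cis (Z \<omega> \<bullet> a) \<partial>N) = of_real (exp (- ((cmod a)\<^sup>2 * v / 4)))"
proof -
  interpret prob_space N by fact
  let ?X = "\<lambda>\<omega>. Re (Z \<omega>)" and ?Y = "\<lambda>\<omega>. Im (Z \<omega>)"
  have "?X \<in> borel_measurable N" "?Y \<in> borel_measurable N"
    using G[of 1 0] G[of 0 1] unfolding centered_gaussian_def by simp_all
  then show Zm: "Z \<in> borel_measurable N" by (simp add: borel_measurable_complex_iff)
  have iX: "integrable N (\<lambda>\<omega>. (?X \<omega>)\<^sup>2)" using centered_gaussian_char(1)[OF N G[of 1 0]] by simp
  have iY: "integrable N (\<lambda>\<omega>. (?Y \<omega>)\<^sup>2)" using centered_gaussian_char(1)[OF N G[of 0 1]] by simp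
  have "integrable N (\<lambda>\<omega>. ((?X \<omega> + ?Y \<omega>)\<^sup>2 - (?X \<omega>)\<^sup>2 - (?Y \<omega>)\<^sup>2) / 2)"
    using centered_gaussian_char(1)[OF N G[of 1 1]] iX iY by simp
  then have iXY: "integrable N (\<lambda>\<omega>. ?X \<omega> * ?Y \<omega>)" by (simp add: power2_sum)
  show "integrable N (\<lambda>\<omega>. (cmod (Z \<omega>))\<^sup>2)" unfolding cmod_power2 by (intro Bochner_Integration.integrable_add iX iY)
  have v: "(\<integral>\<omega>. (?X \<omega>)\<^sup>2 \<partial>N) + (\<integral>\<omega>. (?Y \<omega>)\<^sup>2 \<partial>N) = v"
    using Zv iX iY unfolding cmod_power2 by simp
  have sq: "(Z \<omega>)\<^sup>2 = of_real ((?X \<omega>)\<^sup>2 - (?Y \<omega>)\<^sup>2) + \<i> * of_real (2 * (?X \<omega> * ?Y \<omega>))" for \<omega>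
    by (simp add: complex_eq_iff power2_eq_square)
  have "(\<integral>\<omega>. (Z \<omega>)\<^sup>2 \<partial>N) = of_real (\<integral>\<omega>. (?X \<omega>)\<^sup>2 - (?Y \<omega>)\<^sup>2 \<partial>N) + \<i> * of_real (\<integral>\<omega>. 2 * (?X \<omega> * ?Y \<omega>) \<partial>N)"
    unfolding sq using iX iY iXY
    by (subst Bochner_Integration.integral_add) (auto intro!: integrable_mult_right integrable_of_real simp: integral_complex_of_real simp del: of_real_mult of_real_diff)
  then have "(\<integral>\<omega>. (?X \<omega>)\<^sup>2 - (?Y \<omega>)\<^sup>2 \<partial>N) = 0 \<and> (\<integral>\<omega>. 2 * (?X \<omega> * ?Y \<omega>) \<partial>N) = 0"
    unfolding Z0 by (simp add: complex_eq_iff)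
  then have xy: "(\<integral>\<omega>. (?X \<omega>)\<^sup>2 \<partial>N) = (\<integral>\<omega>. (?Y \<omega>)\<^sup>2 \<partial>N)" "(\<integral>\<omega>. ?X \<omega> * ?Y \<omega> \<partial>N) = 0"
    using iX iY iXY by simp_all
  have in_eq: "Z \<omega> \<bullet> a = Re a * ?X \<omega> + Im a * ?Y \<omega>" for \<omega> by (simp add: inner_complex_def mult.commute)
  have ex: "(Re a * ?X \<omega> + Im a * ?Y \<omega>)\<^sup>2 = (Re a)\<^sup>2 * (?X \<omega>)\<^sup>2 + (Im a)\<^sup>2 * (?Y \<omega>)\<^sup>2 + (2 * Re a * Im a) * (?X \<omega> * ?Y \<omega>)" for \<omega>
    by (simp add: power2_sum power_mult_distrib)
  have "(\<integral>\<omega>. (Re a * ?X \<omega> + Im a * ?Y \<omega>)\<^sup>2 \<partial>N) = (Re a)\<^sup>2 * (\<integral>\<omega>. (?X \<omega>)\<^sup>2 \<partial>N) + (Im a)\<^sup>2 * (\<integral>\<omega>. (?Y \<omega>)\<^sup>2 \<partial>N)"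
    unfolding ex using iX iY iXY xy(2) by simp
  also have "\<dots> = (cmod a)\<^sup>2 * v / 2" unfolding cmod_power2 v[symmetric] xy(1) by (simp add: algebra_simps)
  finally have E: "(\<integral>\<omega>. (Re a * ?X \<omega> + Im a * ?Y \<omega>)\<^sup>2 \<partial>N) = (cmod a)\<^sup>2 * v / 2" .
  show "(\<integral>\<omega>. cis (Z \<omega> \<bullet> a) \<partial>N) = of_real (exp (- ((cmod a)\<^sup>2 * v / 4)))"
    unfolding in_eq centered_gaussian_char(2)[OF N G] E by simp
qed

lemma lipschitz_expectation_transfer:
  fixes H :: "complex \<Rightarrow> 'b::{banach, second_countable_topology}"
  assumes M: "prob_space M" and [measurable]: "\<And>m. W m \<in> borel_measurable M" "\<And>m. Y m \<in> borel_measurable M"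
    and H: "\<And>y. norm (H y) \<le> b" "\<And>x y. norm (H x - H y) \<le> L * norm (x - y)" "L \<ge> 0"
    and conv: "(\<lambda>m. \<integral>\<omega>. min 1 (cmod (W m \<omega> - Y m \<omega>)) \<partial>M) \<longlonglongrightarrow> 0"
  shows "(\<lambda>m. (\<integral>\<omega>. H (W m \<omega>) \<partial>M) - (\<integral>\<omega>. H (Y m \<omega>) \<partial>M)) \<longlonglongrightarrow> 0"
proof -
  interpret prob_space M by fact
  have b: "b \<ge> 0" using order_trans[OF norm_ge_zero H(1)[of 0]] .
  have "continuous_on UNIV H"
    by (rule lipschitz_on_continuous_on[of L]) (use H in \<open>auto simp: lipschitz_on_def dist_norm\<close>)
  then have Hm: "H \<in> borel_measurable borel" by (rule borel_measurable_continuous_onI)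
  have m[measurable]: "(\<lambda>\<omega>. H (W m \<omega>)) \<in> borel_measurable M" "(\<lambda>\<omega>. H (Y m \<omega>)) \<in> borel_measurable M" for m
    by (rule measurable_compose[OF _ Hm], measurable)+
  have i: "integrable M (\<lambda>\<omega>. H (W m \<omega>))" "integrable M (\<lambda>\<omega>. H (Y m \<omega>))" for m
    using H(1) by (auto intro!: integrable_const_bound[where B=b])
  have bd: "norm (H x - H y) \<le> (L + 2 * b) * min 1 (cmod (x - y))" for x y
  proof (cases "cmod (x - y) \<le> 1")
    case True
    have "norm (H x - H y) \<le> L * cmod (x - y)" by (rule H(2))
    also have "\<dots> \<le> (L + 2 * b) * cmod (x - y)" using b by (intro mult_right_mono) auto
    finally show ?thesis using True by simp
  next
    case False
    have "norm (H x - H y) \<le> b + b" using norm_triangle_ineq4[of "H x" "H y"] H(1)[of x] H(1)[of y] by linarith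
    then show ?thesis using False H(3) by simp
  qed
  have "norm ((\<integral>\<omega>. H (W m \<omega>) \<partial>M) - (\<integral>\<omega>. H (Y m \<omega>) \<partial>M)) \<le> (L + 2 * b) * (\<integral>\<omega>. min 1 (cmod (W m \<omega> - Y m \<omega>)) \<partial>M)" for m
  proof -
    have "norm ((\<integral>\<omega>. H (W m \<omega>) \<partial>M) - (\<integral>\<omega>. H (Y m \<omega>) \<partial>M)) = norm (\<integral>\<omega>. H (W m \<omega>) - H (Y m \<omega>) \<partial>M)" using i by simp
    also have "\<dots> \<le> (\<integral>\<omega>. norm (H (W m \<omega>) - H (Y m \<omega>)) \<partial>M)" by (rule integral_norm_bound)
    also have "\<dots> \<le> (\<integral>\<omega>. (L + 2 * b) * min 1 (cmod (W m \<omega> - Y m \<omega>)) \<partial>M)"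
      by (intro integral_mono integrable_norm Bochner_Integration.integrable_diff i integrable_mult_right
          integrable_const_bound[where B=1] bd) auto
    finally show ?thesis by simp
  qed
  note bound = this
  show ?thesis
  proof (rule Lim_null_comparison)
    show "\<forall>\<^sub>F m in sequentially. norm ((\<integral>\<omega>. H (W m \<omega>) \<partial>M) - (\<integral>\<omega>. H (Y m \<omega>) \<partial>M))
        \<le> (L + 2 * b) * (\<integral>\<omega>. min 1 (cmod (W m \<omega> - Y m \<omega>)) \<partial>M)"
      by (intro always_eventually allI bound)
    show "(\<lambda>m. (L + 2 * b) * (\<integral>\<omega>. min 1 (cmod (W m \<omega> - Y m \<omega>)) \<partial>M)) \<longlonglongrightarrow> 0"
      by (rule tendsto_mult_right_zero[OF conv])
  qed
qed

text \<open>Gaussian smoothing is an average of characters, so its expectation depends on the law only through the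
  characteristic function.\<close>

lemma expectation_gauss_smoothing:
  fixes f :: "complex \<Rightarrow> complex"
  assumes M: "prob_space M" and Y[measurable]: "Y \<in> borel_measurable M" and f: "integrable lborel f" and h: "h > 0"
  shows "(\<integral>\<omega>. (\<integral>v. gauss v *\<^sub>R f (Y \<omega> + h *\<^sub>R v) \<partial>lborel) \<partial>M) =
    of_real ((1 / (sqrt (2 * pi) * h)) ^ DIM(complex)) *
    (\<integral>w. of_real (gauss w) * (\<integral>x. f x * cis ((x \<bullet> w) / h) \<partial>lborel) * (\<integral>\<omega>. cis (Y \<omega> \<bullet> (- w /\<^sub>R h)) \<partial>M) \<partial>lborel)"
proof -
  interpret prob_space M by fact
  interpret P: pair_sigma_finite M "lborel :: complex measure" ..
  define I where "I = (\<integral>x. cmod (f x) \<partial>lborel)"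
  have [measurable]: "f \<in> borel_measurable borel" using f by simp
  define \<Phi> where "\<Phi> w = (\<integral>x. f x * cis ((x \<bullet> w) / h) \<partial>lborel)" for w
  have [measurable]: "\<Phi> \<in> borel_measurable borel" unfolding \<Phi>_def[abs_def] by measurable
  have \<Phi>: "cmod (\<Phi> w) \<le> I" for w
    using integral_norm_bound[of lborel "\<lambda>x. f x * cis ((x \<bullet> w) / h)"] unfolding \<Phi>_def I_def by (simp add: norm_mult)
  have I: "I \<ge> 0" unfolding I_def by simp
  let ?F = "\<lambda>\<omega> w. of_real (gauss w) * cis (- (Y \<omega> \<bullet> w) / h) * \<Phi> w"
  have bd: "norm (?F \<omega> w) \<le> I * gauss w" for \<omega> w
    using mult_right_mono[OF \<Phi>[of w] gauss_nonneg[of w]] by (simp add: norm_mult gauss_nonneg mult.commute)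
  have ig: "integrable lborel (\<lambda>w::complex. I * gauss w)" by (intro integrable_mult_right gauss_integrable)
  have i1: "integrable lborel (?F \<omega>)" for \<omega>
    by (rule Bochner_Integration.integrable_bound[OF ig]) (use bd I in \<open>auto simp: gauss_nonneg\<close>)
  have int: "integrable (M \<Otimes>\<^sub>M lborel) (\<lambda>(\<omega>, w). ?F \<omega> w)"
  proof (rule P.Fubini_integrable)
    show "(\<lambda>(\<omega>, w). ?F \<omega> w) \<in> borel_measurable (M \<Otimes>\<^sub>M lborel)" by measurable
    show "AE \<omega> in M. integrable lborel (\<lambda>w. case (\<omega>, w) of (\<omega>, w) \<Rightarrow> ?F \<omega> w)" using i1 by simp
    have le: "(\<integral>w. norm (?F \<omega> w) \<partial>lborel) \<le> I" for \<omega>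
    proof -
      have "(\<integral>w. norm (?F \<omega> w) \<partial>lborel) \<le> integral\<^sup>L lborel (\<lambda>w::complex. I * gauss w)"
        by (intro integral_mono integrable_norm i1 ig bd)
      then show ?thesis by (simp add: gauss_integral)
    qed
    show "integrable M (\<lambda>\<omega>. \<integral>w. norm (case (\<omega>, w) of (\<omega>, w) \<Rightarrow> ?F \<omega> w) \<partial>lborel)"
      unfolding prod.case by (rule integrable_const_bound[where B=I]) (use le in auto)
  qed
  have "(\<integral>\<omega>. (\<integral>v. gauss v *\<^sub>R f (Y \<omega> + h *\<^sub>R v) \<partial>lborel) \<partial>M) =
     of_real ((1 / (sqrt (2 * pi) * h)) ^ DIM(complex)) * (\<integral>\<omega>. (\<integral>w. ?F \<omega> w \<partial>lborel) \<partial>M)"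
    unfolding gauss_smoothing_fourier[OF f h] \<Phi>_def[symmetric] by simp
  also have "(\<integral>\<omega>. (\<integral>w. ?F \<omega> w \<partial>lborel) \<partial>M) = (\<integral>w. (\<integral>\<omega>. ?F \<omega> w \<partial>M) \<partial>lborel)"
    using P.Fubini_integral[OF int] by simp
  also have "\<dots> = (\<integral>w. of_real (gauss w) * \<Phi> w * (\<integral>\<omega>. cis (Y \<omega> \<bullet> (- w /\<^sub>R h)) \<partial>M) \<partial>lborel)"
  proof (intro Bochner_Integration.integral_cong refl)
    fix w
    have "(\<integral>\<omega>. ?F \<omega> w \<partial>M) = (\<integral>\<omega>. (of_real (gauss w) * \<Phi> w) * cis (Y \<omega> \<bullet> (- w /\<^sub>R h)) \<partial>M)"
      by (intro Bochner_Integration.integral_cong refl) (simp add: divide_inverse mult_ac)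
    then show "(\<integral>\<omega>. ?F \<omega> w \<partial>M) = of_real (gauss w) * \<Phi> w * (\<integral>\<omega>. cis (Y \<omega> \<bullet> (- w /\<^sub>R h)) \<partial>M)"
      by simp
  qed
  finally show ?thesis unfolding \<Phi>_def .
qed

lemma expectation_gauss_smoothing_tendsto:
  fixes f :: "complex \<Rightarrow> complex" and Y :: "nat \<Rightarrow> 'w \<Rightarrow> complex" and Z :: "'z \<Rightarrow> complex"
  assumes M: "prob_space M" and N: "prob_space N"
    and Y: "\<And>m. Y m \<in> borel_measurable M" and Z: "Z \<in> borel_measurable N"
    and cf: "\<And>a. (\<lambda>m. \<integral>\<omega>. cis (Y m \<omega> \<bullet> a) \<partial>M) \<longlonglongrightarrow> (\<integral>\<omega>. cis (Z \<omega> \<bullet> a) \<partial>N)"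
    and f: "integrable lborel f" and h: "h > 0"
  shows "(\<lambda>m. \<integral>\<omega>. (\<integral>v. gauss v *\<^sub>R f (Y m \<omega> + h *\<^sub>R v) \<partial>lborel) \<partial>M)
    \<longlonglongrightarrow> (\<integral>\<omega>. (\<integral>v. gauss v *\<^sub>R f (Z \<omega> + h *\<^sub>R v) \<partial>lborel) \<partial>N)"
  unfolding expectation_gauss_smoothing[OF M Y f h] expectation_gauss_smoothing[OF N Z f h]
proof (intro tendsto_mult tendsto_const)
  interpret M: prob_space M by fact
  interpret N: prob_space N by fact
  note [measurable] = Y Z
  define I where "I = (\<integral>x. cmod (f x) \<partial>lborel)"
  have [measurable]: "f \<in> borel_measurable borel" using f by simp
  define \<Phi> where "\<Phi> w = (\<integral>x. f x * cis ((x \<bullet> w) / h) \<partial>lborel)" for w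
  have [measurable]: "\<Phi> \<in> borel_measurable borel" unfolding \<Phi>_def[abs_def] by measurable
  have \<Phi>: "cmod (\<Phi> w) \<le> I" for w
    using integral_norm_bound[of lborel "\<lambda>x. f x * cis ((x \<bullet> w) / h)"] unfolding \<Phi>_def I_def by (simp add: norm_mult)
  have I: "I \<ge> 0" unfolding I_def by simp
  have c1: "cmod (\<integral>\<omega>. cis (Y m \<omega> \<bullet> a) \<partial>M) \<le> 1" for m a
    using integral_norm_bound[of M "\<lambda>\<omega>. cis (Y m \<omega> \<bullet> a)"] M.prob_space by simp
  show "(\<lambda>m. \<integral>w. of_real (gauss w) * (\<integral>x. f x * cis ((x \<bullet> w) / h) \<partial>lborel) * (\<integral>\<omega>. cis (Y m \<omega> \<bullet> (- w /\<^sub>R h)) \<partial>M) \<partial>lborel)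
    \<longlonglongrightarrow> (\<integral>w. of_real (gauss w) * (\<integral>x. f x * cis ((x \<bullet> w) / h) \<partial>lborel) * (\<integral>\<omega>. cis (Z \<omega> \<bullet> (- w /\<^sub>R h)) \<partial>N) \<partial>lborel)"
    unfolding \<Phi>_def[symmetric]
  proof (rule integral_dominated_convergence)
    show "(\<lambda>w. of_real (gauss w) * \<Phi> w * (\<integral>\<omega>. cis (Z \<omega> \<bullet> (- w /\<^sub>R h)) \<partial>N)) \<in> borel_measurable lborel" by measurable
    show "(\<lambda>w. of_real (gauss w) * \<Phi> w * (\<integral>\<omega>. cis (Y m \<omega> \<bullet> (- w /\<^sub>R h)) \<partial>M)) \<in> borel_measurable lborel" for m by measurable
    show "integrable lborel (\<lambda>w::complex. I * gauss w)" by (intro integrable_mult_right gauss_integrable)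
    show "AE w in lborel. (\<lambda>m. of_real (gauss w) * \<Phi> w * (\<integral>\<omega>. cis (Y m \<omega> \<bullet> (- w /\<^sub>R h)) \<partial>M))
        \<longlonglongrightarrow> of_real (gauss w) * \<Phi> w * (\<integral>\<omega>. cis (Z \<omega> \<bullet> (- w /\<^sub>R h)) \<partial>N)"
      by (intro AE_I2 tendsto_mult tendsto_const cf)
    have "cmod (of_real (gauss w) * \<Phi> w * (\<integral>\<omega>. cis (Y m \<omega> \<bullet> (- w /\<^sub>R h)) \<partial>M)) \<le> gauss w * I * 1" for m w
      unfolding norm_mult by (intro mult_mono \<Phi> c1) (auto simp: gauss_nonneg I)
    then show "AE w in lborel. cmod (of_real (gauss w) * \<Phi> w * (\<integral>\<omega>. cis (Y m \<omega> \<bullet> (- w /\<^sub>R h)) \<partial>M)) \<le> I * gauss w" for m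
      by (simp add: mult.commute)
  qed
qed

text \<open>Increments shorter than \<open>d\<close> are controlled by uniform continuity; the contribution of the longer ones
  is the smoothing of \<open>min 1 (|u| / d)\<close> at the origin, which tends to zero.\<close>

lemma gauss_smoothing_uniform:
  fixes f :: "complex \<Rightarrow> complex"
  assumes c: "continuous_on UNIV f" and R: "\<And>y. norm y > R \<Longrightarrow> f y = 0" and e: "e > 0"
  obtains h where "h > 0" "\<And>y. cmod ((\<integral>v. gauss v *\<^sub>R f (y + h *\<^sub>R v) \<partial>lborel) - f y) \<le> e"
proof -
  have fm[measurable]: "f \<in> borel_measurable borel" using c by (rule borel_measurable_continuous_onI)
  have "compact (f ` cball 0 R)" by (intro compact_continuous_image continuous_on_subset[OF c] compact_cball) simp
  then obtain B0 where B0: "\<And>y. y \<in> cball 0 R \<Longrightarrow> cmod (f y) \<le> B0"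
    using compact_imp_bounded bounded_iff by (metis imageI)
  define B where "B = max B0 0"
  have B: "cmod (f y) \<le> B" "B \<ge> 0" for y
  proof -
    show "cmod (f y) \<le> B"
    proof (cases "norm y > R")
      case True then show ?thesis by (simp add: R B_def)
    next
      case False then have "cmod (f y) \<le> B0" by (intro B0) simp
      then show ?thesis by (simp add: B_def)
    qed
  qed (simp add: B_def)
  have "uniformly_continuous_on (cball 0 (R + 1)) f"
    by (intro compact_uniformly_continuous continuous_on_subset[OF c] compact_cball) simp
  then obtain d0 where d0: "d0 > 0" and uc0: "\<And>x y. x \<in> cball 0 (R + 1) \<Longrightarrow> y \<in> cball 0 (R + 1) \<Longrightarrow> dist y x < d0 \<Longrightarrow> dist (f y) (f x) < e / 2"
    unfolding uniformly_continuous_on_def using e by (metis half_gt_zero)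
  define d where "d = min d0 1"
  have d: "d > 0" using d0 by (simp add: d_def)
  have uc: "cmod (f (y + u) - f y) \<le> e / 2" if u: "norm u < d" for y u
  proof (cases "norm y \<le> R + 1 \<and> norm (y + u) \<le> R + 1")
    case True
    then have "y \<in> cball 0 (R + 1)" "y + u \<in> cball 0 (R + 1)" unfolding mem_cball_0 by blast+
    moreover have "dist (y + u) y < d0" using u by (simp add: dist_norm d_def)
    ultimately have "dist (f (y + u)) (f y) < e / 2" by (rule uc0)
    then show ?thesis by (simp add: dist_norm)
  next
    case False
    then have "norm y > R" "norm (y + u) > R"
      using u norm_triangle_ineq[of y u] norm_triangle_ineq4[of "y + u" u] by (auto simp: d_def)
    then show ?thesis using R e by simp
  qed
  have est: "cmod (f (y + u) - f y) \<le> e / 2 + 2 * B * min 1 (norm u / d)" for y u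
  proof (cases "norm u < d")
    case True
    moreover have "0 \<le> 2 * B * min 1 (norm u / d)" using B(2) d by simp
    ultimately show ?thesis using uc[of u y] by linarith
  next
    case False
    then have "min 1 (norm u / d) = 1" using d by (simp add: min_def field_simps)
    then show ?thesis using norm_triangle_ineq4[of "f (y + u)" "f y"] B(1)[of y] B(1)[of "y + u"] e by simp
  qed
  let ?m = "\<lambda>u::complex. min 1 (norm u / d)"
  have "(\<lambda>n. \<integral>v. gauss v *\<^sub>R ?m (0 + (1 / real (Suc n)) *\<^sub>R v) \<partial>lborel) \<longlonglongrightarrow> ?m 0"
  proof (rule gauss_mollification[where B=1])
    show "continuous_on UNIV ?m" using d by (intro continuous_intros) auto
    show "norm (?m u) \<le> 1" for u using d by simp
    show "(\<lambda>n. 1 / real (Suc n)) \<longlonglongrightarrow> 0" by (rule LIMSEQ_Suc[OF lim_1_over_n])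
  qed
  then have "\<forall>\<^sub>F n in sequentially. \<bar>\<integral>v. gauss v *\<^sub>R ?m (0 + (1 / real (Suc n)) *\<^sub>R v) \<partial>lborel\<bar> < e / (4 * B + 1)"
    using e B(2) by (auto dest!: tendstoD[where e="e / (4 * B + 1)"] simp: dist_real_def)
  then obtain n where n: "\<bar>\<integral>v. gauss v *\<^sub>R ?m (0 + (1 / real (Suc n)) *\<^sub>R v) \<partial>lborel\<bar> < e / (4 * B + 1)"
    using eventually_happens by fastforce
  define h where "h = 1 / real (Suc n)"
  have h: "h > 0" by (simp add: h_def)
  have n': "(\<integral>v. gauss v * ?m (h *\<^sub>R v) \<partial>lborel) < e / (4 * B + 1)" using n unfolding h_def by (simp del: norm_scaleR)
  show thesis
  proof (rule that[OF h])
    fix y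
    have im: "integrable lborel (\<lambda>v. gauss v * ?m (h *\<^sub>R v))"
      by (rule Bochner_Integration.integrable_bound[OF gauss_integrable]) (use d in \<open>auto simp: gauss_nonneg abs_mult mult_left_le\<close>)
    have i1: "integrable lborel (\<lambda>v. gauss v *\<^sub>R f (y + h *\<^sub>R v))"
      by (rule Bochner_Integration.integrable_bound[where f="\<lambda>v. B * gauss v"])
        (use mult_left_mono[OF B(1) gauss_nonneg] B(2) in \<open>auto simp: gauss_nonneg gauss_integrable mult.commute[of B]\<close>)
    have i2: "integrable lborel (\<lambda>v. gauss v *\<^sub>R f y)" by (intro integrable_scaleR_left gauss_integrable)
    have "(\<integral>v. gauss v *\<^sub>R f (y + h *\<^sub>R v) \<partial>lborel) - f y = (\<integral>v. gauss v *\<^sub>R (f (y + h *\<^sub>R v) - f y) \<partial>lborel)"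
      unfolding scaleR_diff_right using i1 i2 by (simp add: gauss_integral gauss_integrable)
    then have "cmod ((\<integral>v. gauss v *\<^sub>R f (y + h *\<^sub>R v) \<partial>lborel) - f y) \<le> (\<integral>v. norm (gauss v *\<^sub>R (f (y + h *\<^sub>R v) - f y)) \<partial>lborel)"
      by (simp only: integral_norm_bound)
    also have "\<dots> \<le> (\<integral>v. e / 2 * gauss v + 2 * B * (gauss v * ?m (h *\<^sub>R v)) \<partial>lborel)"
    proof (intro integral_mono integrable_norm Bochner_Integration.integrable_add integrable_mult_right im gauss_integrable)
      show "integrable lborel (\<lambda>v. gauss v *\<^sub>R (f (y + h *\<^sub>R v) - f y))"
        unfolding scaleR_diff_right using i1 i2 by (rule Bochner_Integration.integrable_diff)
      fix v
      have "norm (gauss v *\<^sub>R (f (y + h *\<^sub>R v) - f y)) \<le> gauss v * (e / 2 + 2 * B * ?m (h *\<^sub>R v))"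
        using est[of y "h *\<^sub>R v"] by (simp add: gauss_nonneg mult_left_mono)
      then show "norm (gauss v *\<^sub>R (f (y + h *\<^sub>R v) - f y)) \<le> e / 2 * gauss v + 2 * B * (gauss v * ?m (h *\<^sub>R v))"
        by (simp only: distrib_left mult_ac)
    qed
    also have "\<dots> = e / 2 + 2 * B * (\<integral>v. gauss v * ?m (h *\<^sub>R v) \<partial>lborel)"
      using im by (simp add: gauss_integral gauss_integrable del: norm_scaleR)
    also have "\<dots> \<le> e / 2 + 2 * B * (e / (4 * B + 1))" using n' B(2) by (intro add_left_mono mult_left_mono) auto
    also have "\<dots> \<le> e"
    proof -
      have "4 * B * e \<le> e * (4 * B + 1)" using e by (simp add: algebra_simps)
      then have "4 * B * e / (4 * B + 1) \<le> e" using B(2) by (subst pos_divide_le_eq) auto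
      then show ?thesis by simp
    qed
    finally show "cmod ((\<integral>v. gauss v *\<^sub>R f (y + h *\<^sub>R v) \<partial>lborel) - f y) \<le> e" .
  qed
qed

text \<open>Cut \<open>G\<close> off outside a large ball, which costs little by tightness, and smooth the result, which costs little by
  uniform continuity. The expectations of the smoothed function converge because the
  characteristic functions do.\<close>

lemma char_tight_imp_weak_convergence:
  fixes Y :: "nat \<Rightarrow> 'w \<Rightarrow> complex" and Z :: "'z \<Rightarrow> complex" and G :: "complex \<Rightarrow> real"
  assumes M: "prob_space M" and N: "prob_space N"
    and Y[measurable]: "\<And>m. Y m \<in> borel_measurable M" and Z[measurable]: "Z \<in> borel_measurable N"
    and cf: "\<And>a. (\<lambda>m. \<integral>\<omega>. cis (Y m \<omega> \<bullet> a) \<partial>M) \<longlonglongrightarrow> (\<integral>\<omega>. cis (Z \<omega> \<bullet> a) \<partial>N)"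
    and tight: "\<And>e. e > 0 \<Longrightarrow> \<exists>R>0. (\<forall>\<^sub>F m in sequentially. (\<integral>\<omega>. min 1 (cmod (Y m \<omega>) / R) \<partial>M) \<le> e) \<and>
      (\<integral>\<omega>. min 1 (cmod (Z \<omega>) / R) \<partial>N) \<le> e"
    and G: "continuous_on UNIV G" "bounded (range G)"
  shows "(\<lambda>m. \<integral>\<omega>. G (Y m \<omega>) \<partial>M) \<longlonglongrightarrow> (\<integral>\<omega>. G (Z \<omega>) \<partial>N)"
proof (rule LIMSEQ_I)
  interpret M: prob_space M by fact
  interpret N: prob_space N by fact
  fix e :: real assume e: "e > 0"
  obtain B where B: "B > 0" "\<And>y. \<bar>G y\<bar> \<le> B"
    using G(2) unfolding bounded_pos by (metis rangeI real_norm_def)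
  obtain R where R: "R > 0" and tY: "\<forall>\<^sub>F m in sequentially. (\<integral>\<omega>. min 1 (cmod (Y m \<omega>) / R) \<partial>M) \<le> e / (8 * B)"
    and tZ: "(\<integral>\<omega>. min 1 (cmod (Z \<omega>) / R) \<partial>N) \<le> e / (8 * B)"
    using tight[of "e / (8 * B)"] e B(1) by auto
  define f where "f y = complex_of_real (G y * (1 - min 1 (cmod y / R)))" for y
  have fc: "continuous_on UNIV f" unfolding f_def[abs_def] using R by (intro continuous_intros G(1)) auto
  have f0: "f y = 0" if "norm y > R" for y using that R by (simp add: f_def)
  have fm[measurable]: "f \<in> borel_measurable borel" using fc by (rule borel_measurable_continuous_onI)
  have Gm[measurable]: "G \<in> borel_measurable borel" using G(1) by (rule borel_measurable_continuous_onI)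
  have "integrable lborel (\<lambda>y. indicator (cball 0 R) y *\<^sub>R f y)"
    by (intro borel_integrable_compact compact_cball continuous_on_subset[OF fc]) simp
  also have "(\<lambda>y. indicator (cball 0 R) y *\<^sub>R f y) = f"
    using f0 by (auto simp: indicator_def fun_eq_iff not_le)
  finally have fi: "integrable lborel f" .
  have ef: "cmod (complex_of_real (G y) - f y) \<le> B * min 1 (cmod y / R)" for y
  proof -
    have "complex_of_real (G y) - f y = of_real (G y * min 1 (cmod y / R))" by (simp add: f_def algebra_simps)
    then have "cmod (complex_of_real (G y) - f y) = \<bar>G y\<bar> * min 1 (cmod y / R)"
      using R by (simp only: norm_of_real abs_mult) simp
    then show ?thesis using B(2)[of y] R by (simp add: mult_right_mono)
  qed
  obtain h where h: "h > 0" and hs: "\<And>y. cmod ((\<integral>v. gauss v *\<^sub>R f (y + h *\<^sub>R v) \<partial>lborel) - f y) \<le> e / 8"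
    using gauss_smoothing_uniform[where f=f and R=R and e="e / 8", OF fc f0] e by auto
  define fh where "fh y = (\<integral>v. gauss v *\<^sub>R f (y + h *\<^sub>R v) \<partial>lborel)" for y
  have [measurable]: "fh \<in> borel_measurable borel" unfolding fh_def[abs_def] by measurable
  have approx: "cmod (complex_of_real (G y) - fh y) \<le> B * min 1 (cmod y / R) + e / 8" for y
    using norm_triangle_ineq4[of "complex_of_real (G y) - f y" "fh y - f y"] ef[of y] hs[of y] unfolding fh_def by simp
  have comp: "cmod (complex_of_real (\<integral>\<omega>. G (V \<omega>) \<partial>P) - (\<integral>\<omega>. fh (V \<omega>) \<partial>P)) \<le> e / 4"
    if P: "prob_space P" and V[measurable]: "V \<in> borel_measurable P" and t: "(\<integral>\<omega>. min 1 (cmod (V \<omega>) / R) \<partial>P) \<le> e / (8 * B)"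
    for P :: "'x measure" and V :: "'x \<Rightarrow> complex"
  proof -
    interpret P: prob_space P by fact
    have i1: "integrable P (\<lambda>\<omega>. complex_of_real (G (V \<omega>)))"
      using B by (intro P.integrable_const_bound[where B=B]) auto
    have i3: "integrable P (\<lambda>\<omega>. min 1 (cmod (V \<omega>) / R))"
      using R by (intro P.integrable_const_bound[where B=1]) auto
    have i2: "integrable P (\<lambda>\<omega>. fh (V \<omega>))"
    proof (rule P.integrable_const_bound[where B="2 * B + e / 8"])
      have "cmod (fh y) \<le> 2 * B + e / 8" for y
      proof -
        have "cmod (fh y) \<le> cmod (complex_of_real (G y)) + cmod (complex_of_real (G y) - fh y)"
          using norm_triangle_ineq4[of "complex_of_real (G y)" "complex_of_real (G y) - fh y"] by simp
        also have "\<dots> \<le> B + (B * min 1 (cmod y / R) + e / 8)" using B(2)[of y] approx[of y] by (intro add_mono) simp_all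
        also have "B * min 1 (cmod y / R) \<le> B * 1" using B(1) by (intro mult_left_mono) auto
        finally show ?thesis by simp
      qed
      then show "AE \<omega> in P. cmod (fh (V \<omega>)) \<le> 2 * B + e / 8" by simp
    qed measurable
    have "complex_of_real (\<integral>\<omega>. G (V \<omega>) \<partial>P) - (\<integral>\<omega>. fh (V \<omega>) \<partial>P) = (\<integral>\<omega>. complex_of_real (G (V \<omega>)) - fh (V \<omega>) \<partial>P)"
      using i1 i2 by (simp add: integral_complex_of_real)
    then have "cmod (complex_of_real (\<integral>\<omega>. G (V \<omega>) \<partial>P) - (\<integral>\<omega>. fh (V \<omega>) \<partial>P)) \<le> (\<integral>\<omega>. cmod (complex_of_real (G (V \<omega>)) - fh (V \<omega>)) \<partial>P)"
      by (simp only: integral_norm_bound)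
    also have "\<dots> \<le> (\<integral>\<omega>. B * min 1 (cmod (V \<omega>) / R) + e / 8 \<partial>P)"
      using i1 i2 i3 approx by (intro integral_mono integrable_norm Bochner_Integration.integrable_diff Bochner_Integration.integrable_add integrable_mult_right) auto
    also have "\<dots> = B * (\<integral>\<omega>. min 1 (cmod (V \<omega>) / R) \<partial>P) + e / 8"
      using i3 P.prob_space by simp
    also have "\<dots> \<le> B * (e / (8 * B)) + e / 8" using t B(1) by (intro add_right_mono mult_left_mono) auto
    also have "\<dots> = e / 4" using B(1) by simp
    finally show ?thesis .
  qed
  have "(\<lambda>m. \<integral>\<omega>. fh (Y m \<omega>) \<partial>M) \<longlonglongrightarrow> (\<integral>\<omega>. fh (Z \<omega>) \<partial>N)"
    unfolding fh_def by (rule expectation_gauss_smoothing_tendsto[OF M N Y Z cf fi h])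
  then have "\<forall>\<^sub>F m in sequentially. cmod ((\<integral>\<omega>. fh (Y m \<omega>) \<partial>M) - (\<integral>\<omega>. fh (Z \<omega>) \<partial>N)) < e / 4"
    using e by (auto dest!: tendstoD[where e="e/4"] simp: dist_norm)
  with tY have "\<forall>\<^sub>F m in sequentially. norm ((\<integral>\<omega>. G (Y m \<omega>) \<partial>M) - (\<integral>\<omega>. G (Z \<omega>) \<partial>N)) < e"
  proof eventually_elim
    case (elim m)
    let ?a = "complex_of_real (\<integral>\<omega>. G (Y m \<omega>) \<partial>M)" and ?b = "\<integral>\<omega>. fh (Y m \<omega>) \<partial>M"
      and ?c = "\<integral>\<omega>. fh (Z \<omega>) \<partial>N" and ?d = "complex_of_real (\<integral>\<omega>. G (Z \<omega>) \<partial>N)"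
    have 1: "cmod (?a - ?b) \<le> e / 4" by (rule comp[OF M Y elim(1)])
    have 2: "cmod (?d - ?c) \<le> e / 4" by (rule comp[OF N Z tZ])
    have "cmod ((?a - ?b) + (?b - ?c) - (?d - ?c)) \<le> cmod (?a - ?b) + cmod (?b - ?c) + cmod (?d - ?c)"
      by (rule order_trans[OF norm_triangle_ineq4 add_right_mono[OF norm_triangle_ineq]])
    moreover have "(?a - ?b) + (?b - ?c) - (?d - ?c) = of_real ((\<integral>\<omega>. G (Y m \<omega>) \<partial>M) - (\<integral>\<omega>. G (Z \<omega>) \<partial>N))" by simp
    ultimately have "norm ((\<integral>\<omega>. G (Y m \<omega>) \<partial>M) - (\<integral>\<omega>. G (Z \<omega>) \<partial>N)) \<le> cmod (?a - ?b) + cmod (?b - ?c) + cmod (?d - ?c)"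
      by (simp only: norm_of_real real_norm_def)
    then show ?case using 1 2 elim(2) e by linarith
  qed
  then show "\<exists>no. \<forall>n\<ge>no. norm ((\<integral>\<omega>. G (Y n \<omega>) \<partial>M) - (\<integral>\<omega>. G (Z \<omega>) \<partial>N)) < e"
    unfolding eventually_sequentially .
qed

text \<open>The moments belong to bounded approximants \<open>W\<close>, not to the variables \<open>Y\<close> themselves. Convergence in
  probability to zero of the difference transfers bounded Lipschitz functionals, and both the characters and the
  truncated norms used for tightness are such functionals.\<close>

lemma circular_moments_imp_weak_convergence:
  fixes W Y :: "nat \<Rightarrow> 'w \<Rightarrow> complex" and Z :: "'z \<Rightarrow> complex" and G :: "complex \<Rightarrow> real"
  assumes M: "prob_space M" and N: "prob_space N"
    and W[measurable]: "\<And>m. W m \<in> borel_measurable M" and Y[measurable]: "\<And>m. Y m \<in> borel_measurable M"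
    and bd: "\<And>m. \<exists>B. \<forall>\<omega>\<in>space M. cmod (W m \<omega>) \<le> B"
    and mom: "\<And>k l. (\<lambda>m. \<integral>\<omega>. W m \<omega> ^ k * cnj (W m \<omega>) ^ l \<partial>M) \<longlonglongrightarrow> (if k = l then of_real (fact k * v ^ k) else 0)"
    and close: "(\<lambda>m. \<integral>\<omega>. min 1 (cmod (W m \<omega> - Y m \<omega>)) \<partial>M) \<longlonglongrightarrow> 0"
    and v: "v \<ge> 0"
    and Zg: "\<And>a b. centered_gaussian N (\<lambda>\<omega>. a * Re (Z \<omega>) + b * Im (Z \<omega>))"
    and Z0: "(\<integral>\<omega>. (Z \<omega>)\<^sup>2 \<partial>N) = 0" and Zv: "(\<integral>\<omega>. (cmod (Z \<omega>))\<^sup>2 \<partial>N) = v"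
    and G: "continuous_on UNIV G" "bounded (range G)"
  shows "(\<lambda>m. \<integral>\<omega>. G (Y m \<omega>) \<partial>M) \<longlonglongrightarrow> (\<integral>\<omega>. G (Z \<omega>) \<partial>N)"
proof (rule char_tight_imp_weak_convergence[OF M N Y white_noise_char(1)[OF N Zg Z0 Zv] _ _ G])
  interpret M: prob_space M by fact
  interpret N: prob_space N by fact
  note [measurable] = white_noise_char(1)[OF N Zg Z0 Zv]
  fix a :: complex
  have "(\<lambda>m. \<integral>\<omega>. cis (W m \<omega> \<bullet> a) \<partial>M) \<longlonglongrightarrow> of_real (exp (- ((cmod a)\<^sup>2 * v / 4)))"
  proof (rule gaussian_moments_imp_char[OF M])
    show "\<exists>B. \<forall>\<omega>\<in>space M. \<bar>W m \<omega> \<bullet> a\<bar> \<le> B" for m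
    proof -
      obtain B where "\<forall>\<omega>\<in>space M. cmod (W m \<omega>) \<le> B" using bd by blast
      then have "\<bar>W m \<omega> \<bullet> a\<bar> \<le> B * cmod a" if "\<omega> \<in> space M" for \<omega>
        using Cauchy_Schwarz_ineq2[of "W m \<omega>" a] mult_right_mono[of "cmod (W m \<omega>)" B "cmod a"] that by fastforce
      then show ?thesis by blast
    qed
    show "(\<lambda>m. \<integral>\<omega>. (W m \<omega> \<bullet> a) ^ n \<partial>M) \<longlonglongrightarrow>
      (if even n then fact n / fact (n div 2) * ((cmod a)\<^sup>2 * v / 4) ^ (n div 2) else 0)" for n
      by (rule circular_moments_imp_marginal_moments[OF M W bd mom])
  qed measurable
  moreover have "(\<lambda>m. (\<integral>\<omega>. cis (W m \<omega> \<bullet> a) \<partial>M) - (\<integral>\<omega>. cis (Y m \<omega> \<bullet> a) \<partial>M)) \<longlonglongrightarrow> 0"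
  proof (rule lipschitz_expectation_transfer[OF M W Y _ _ _ close])
    show "norm (cis (y \<bullet> a)) \<le> 1" for y by simp
    fix x y :: complex
    have "norm (cis (x \<bullet> a) - cis (y \<bullet> a)) \<le> \<bar>x \<bullet> a - y \<bullet> a\<bar>"
    proof -
      have "cis (x \<bullet> a) - cis (y \<bullet> a) = cis (y \<bullet> a) * (cis (x \<bullet> a - y \<bullet> a) - 1)"
        by (simp add: right_diff_distrib cis_mult)
      then have "norm (cis (x \<bullet> a) - cis (y \<bullet> a)) = norm (cis (x \<bullet> a - y \<bullet> a) - 1)"
        by (simp add: norm_mult)
      also have "\<dots> \<le> \<bar>x \<bullet> a - y \<bullet> a\<bar>" using iexp_approx1[of "x \<bullet> a - y \<bullet> a" 0] by (simp add: cis_conv_exp)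
      finally show ?thesis .
    qed
    also have "\<dots> \<le> cmod (x - y) * cmod a" unfolding inner_diff_left[symmetric] by (rule Cauchy_Schwarz_ineq2)
    finally show "norm (cis (x \<bullet> a) - cis (y \<bullet> a)) \<le> cmod a * cmod (x - y)" by (simp add: mult.commute)
  qed simp
  ultimately have "(\<lambda>m. (\<integral>\<omega>. cis (W m \<omega> \<bullet> a) \<partial>M) - ((\<integral>\<omega>. cis (W m \<omega> \<bullet> a) \<partial>M) - (\<integral>\<omega>. cis (Y m \<omega> \<bullet> a) \<partial>M)))
      \<longlonglongrightarrow> of_real (exp (- ((cmod a)\<^sup>2 * v / 4))) - 0" by (rule tendsto_diff)
  then show "(\<lambda>m. \<integral>\<omega>. cis (Y m \<omega> \<bullet> a) \<partial>M) \<longlonglongrightarrow> (\<integral>\<omega>. cis (Z \<omega> \<bullet> a) \<partial>N)"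
    unfolding white_noise_char(3)[OF N Zg Z0 Zv] by simp
next
  interpret M: prob_space M by fact
  interpret N: prob_space N by fact
  note Zm[measurable] = white_noise_char(1)[OF N Zg Z0 Zv]
  fix e :: real assume e: "e > 0"
  \<comment> \<open>The second moment is eventually below \<open>1 + v\<close>, so the tail of \<open>W\<close> is at most \<open>(2 + v) / R\<close>, and
    \<open>e / (3 + v)\<close> is left for the difference of \<open>W\<close> and \<open>Y\<close>.\<close>
  define R where "R = (3 + v) / e"
  have R: "R > 0" using e v by (simp add: R_def)
  have Re: "(2 + v) / R + e / (3 + v) = e" 
  proof -
    have "(2 + v) / R + e / (3 + v) = ((3 + v) * e) / (3 + v)"
      unfolding R_def by (simp add: add_divide_distrib[symmetric] algebra_simps)
    then show ?thesis using v by simp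
  qed
  have le: "min 1 (cmod y / R) \<le> (1 + (cmod y)\<^sup>2) / R" for y
  proof -
    have "0 \<le> (cmod y - 1)\<^sup>2" by simp
    then have "2 * cmod y \<le> 1 + (cmod y)\<^sup>2" unfolding power2_diff by simp
    then have "cmod y \<le> 1 + (cmod y)\<^sup>2" using norm_ge_zero[of y] by linarith
    then have "cmod y / R \<le> (1 + (cmod y)\<^sup>2) / R" using R by (intro divide_right_mono) auto
    then show ?thesis by simp
  qed
  have Ztail: "(\<integral>\<omega>. min 1 (cmod (Z \<omega>) / R) \<partial>N) \<le> e"
  proof -
    have "(\<integral>\<omega>. min 1 (cmod (Z \<omega>) / R) \<partial>N) \<le> (\<integral>\<omega>. (1 + (cmod (Z \<omega>))\<^sup>2) / R \<partial>N)"
    proof (rule integral_mono[OF _ _ le])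
      show "integrable N (\<lambda>\<omega>. min 1 (cmod (Z \<omega>) / R))" using R by (intro N.integrable_const_bound[where B=1]) auto
    qed (use white_noise_char(2)[OF N Zg Z0 Zv] in simp)
    also have "\<dots> = (1 + v) / R" using white_noise_char(2)[OF N Zg Z0 Zv] Zv N.prob_space by simp
    also have "\<dots> \<le> (2 + v) / R" using R by (intro divide_right_mono) auto
    also have "\<dots> \<le> e"
    proof -
      have "0 \<le> e / (3 + v)" using e v by simp
      then show ?thesis using Re by linarith
    qed
    finally show ?thesis .
  qed
  have W2: "(\<lambda>m. \<integral>\<omega>. (cmod (W m \<omega>))\<^sup>2 \<partial>M) \<longlonglongrightarrow> v"
  proof -
    have "(\<integral>\<omega>. W m \<omega> ^ 1 * cnj (W m \<omega>) ^ 1 \<partial>M) = complex_of_real (\<integral>\<omega>. (cmod (W m \<omega>))\<^sup>2 \<partial>M)" for m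
      unfolding integral_complex_of_real[symmetric] by (simp only: complex_norm_square power_one_right)
    then show ?thesis using mom[of 1 1] by (simp add: tendsto_of_real_iff)
  qed
  have "(\<lambda>m. (\<integral>\<omega>. min 1 (cmod (W m \<omega>) / R) \<partial>M) - (\<integral>\<omega>. min 1 (cmod (Y m \<omega>) / R) \<partial>M)) \<longlonglongrightarrow> 0"
  proof (rule lipschitz_expectation_transfer[OF M W Y _ _ _ close])
    show "norm (min 1 (cmod y / R)) \<le> 1" for y using R by simp
    fix x y :: complex
    have "\<bar>min 1 (cmod x / R) - min 1 (cmod y / R)\<bar> \<le> \<bar>cmod x / R - cmod y / R\<bar>" by linarith
    also have "\<dots> = \<bar>cmod x - cmod y\<bar> / R" using R unfolding diff_divide_distrib[symmetric] by simp
    also have "\<dots> \<le> cmod (x - y) / R" using R norm_triangle_ineq3 by (intro divide_right_mono) auto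
    finally show "norm (min 1 (cmod x / R) - min 1 (cmod y / R)) \<le> 1 / R * cmod (x - y)" by simp
  qed (use R in simp)
  then have d: "\<forall>\<^sub>F m in sequentially. \<bar>(\<integral>\<omega>. min 1 (cmod (W m \<omega>) / R) \<partial>M) - (\<integral>\<omega>. min 1 (cmod (Y m \<omega>) / R) \<partial>M)\<bar> < e / (3 + v)"
    using e v by (auto dest!: tendstoD[where e="e / (3 + v)"] simp: dist_real_def)
  have "\<forall>\<^sub>F m in sequentially. (\<integral>\<omega>. (cmod (W m \<omega>))\<^sup>2 \<partial>M) < 1 + v"
    by (rule order_tendstoD(2)[OF W2]) simp
  with d have "\<forall>\<^sub>F m in sequentially. (\<integral>\<omega>. min 1 (cmod (Y m \<omega>) / R) \<partial>M) \<le> e"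
  proof eventually_elim
    case (elim m)
    obtain B where B: "\<forall>\<omega>\<in>space M. cmod (W m \<omega>) \<le> B" using bd by blast
    have i: "integrable M (\<lambda>\<omega>. (cmod (W m \<omega>))\<^sup>2)"
      by (rule M.integrable_const_bound[where B="B\<^sup>2"]) (use B in \<open>auto intro!: power_mono\<close>)
    have "(\<integral>\<omega>. min 1 (cmod (W m \<omega>) / R) \<partial>M) \<le> (\<integral>\<omega>. (1 + (cmod (W m \<omega>))\<^sup>2) / R \<partial>M)"
    proof (rule integral_mono[OF _ _ le])
      show "integrable M (\<lambda>\<omega>. min 1 (cmod (W m \<omega>) / R))" using R by (intro M.integrable_const_bound[where B=1]) auto
    qed (use i in simp)
    also have "\<dots> = (1 + (\<integral>\<omega>. (cmod (W m \<omega>))\<^sup>2 \<partial>M)) / R" using i M.prob_space by simp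
    also have "\<dots> \<le> (2 + v) / R" using R elim(2) by (intro divide_right_mono) auto
    finally show ?case using elim(1) Re by linarith
  qed
  with R Ztail show "\<exists>R>0. (\<forall>\<^sub>F m in sequentially. (\<integral>\<omega>. min 1 (cmod (Y m \<omega>) / R) \<partial>M) \<le> e) \<and>
      (\<integral>\<omega>. min 1 (cmod (Z \<omega>) / R) \<partial>N) \<le> e" by blast
qed

text \<open>For every \<open>m\<close> choose \<open>j\<close> so large that the finitely many moments of order at most \<open>m\<close> and the
  distance to \<open>Y m\<close> are within \<open>1 / (m + 1)\<close> of their limits. The moments with \<open>k < l\<close> are conjugate
  to those with \<open>l < k\<close>.\<close>

lemma diagonal_approximants:
  fixes A :: "nat \<Rightarrow> nat \<Rightarrow> 'w \<Rightarrow> complex"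
  assumes mom: "\<And>m k l. l \<le> k \<Longrightarrow> (\<lambda>j. \<integral>\<omega>. A m j \<omega> ^ k * cnj (A m j \<omega>) ^ l \<partial>M) \<longlonglongrightarrow> \<gamma> m k l"
    and lim: "\<And>k l. l \<le> k \<Longrightarrow> (\<lambda>m. \<gamma> m k l) \<longlonglongrightarrow> (if k = l then of_real (c k) else 0)"
    and close: "\<And>m. (\<lambda>j. \<integral>\<omega>. min 1 (cmod (A m j \<omega> - Y m \<omega>)) \<partial>M) \<longlonglongrightarrow> 0"
  shows "\<exists>j. (\<forall>k l. (\<lambda>m. \<integral>\<omega>. A m (j m) \<omega> ^ k * cnj (A m (j m) \<omega>) ^ l \<partial>M) \<longlonglongrightarrow> (if k = l then of_real (c k) else 0)) \<and>
    (\<lambda>m. \<integral>\<omega>. min 1 (cmod (A m (j m) \<omega> - Y m \<omega>)) \<partial>M) \<longlonglongrightarrow> 0"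
proof -
  let ?E = "\<lambda>m j k l. \<integral>\<omega>. A m j \<omega> ^ k * cnj (A m j \<omega>) ^ l \<partial>M"
  let ?D = "\<lambda>m j. \<integral>\<omega>. min 1 (cmod (A m j \<omega> - Y m \<omega>)) \<partial>M"
  have "\<exists>j. (\<forall>k\<in>{..m}. \<forall>l\<in>{..k}. cmod (?E m j k l - \<gamma> m k l) < 1 / real (Suc m)) \<and> \<bar>?D m j\<bar> < 1 / real (Suc m)" for m
  proof -
    have "\<forall>\<^sub>F j in sequentially. \<forall>k\<in>{..m}. \<forall>l\<in>{..k}. cmod (?E m j k l - \<gamma> m k l) < 1 / real (Suc m)"
    proof (intro eventually_ball_finite finite_atMost ballI)
      fix k l :: nat assume "l \<in> {..k}"
      then have "l \<le> k" by simp
      show "\<forall>\<^sub>F j in sequentially. cmod (?E m j k l - \<gamma> m k l) < 1 / real (Suc m)"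
        unfolding dist_norm[symmetric] by (rule tendstoD[OF mom[OF \<open>l \<le> k\<close>]]) simp
    qed
    moreover have "\<forall>\<^sub>F j in sequentially. dist (?D m j) 0 < 1 / real (Suc m)" by (rule tendstoD[OF close]) simp
    ultimately have "\<forall>\<^sub>F j in sequentially. (\<forall>k\<in>{..m}. \<forall>l\<in>{..k}. cmod (?E m j k l - \<gamma> m k l) < 1 / real (Suc m)) \<and> \<bar>?D m j\<bar> < 1 / real (Suc m)"
      by eventually_elim (simp only: dist_real_def diff_zero simp_thms)
    then show ?thesis by (rule eventually_happens'[OF sequentially_bot])
  qed
  note ex = this
  define j where "j m = (SOME j. (\<forall>k\<in>{..m}. \<forall>l\<in>{..k}. cmod (?E m j k l - \<gamma> m k l) < 1 / real (Suc m)) \<and> \<bar>?D m j\<bar> < 1 / real (Suc m))" for m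
  have jm: "(\<forall>k\<in>{..m}. \<forall>l\<in>{..k}. cmod (?E m (j m) k l - \<gamma> m k l) < 1 / real (Suc m)) \<and> \<bar>?D m (j m)\<bar> < 1 / real (Suc m)" for m
    unfolding j_def by (rule someI_ex[OF ex])
  have j: "cmod (?E m (j m) k l - \<gamma> m k l) < 1 / real (Suc m)" if "k \<le> m" "l \<le> k" for m k l
    using jm[of m] that unfolding Ball_def atMost_iff by blast
  have j2: "\<bar>?D m (j m)\<bar> < 1 / real (Suc m)" for m
    using jm[of m] by blast
  have inv: "(\<lambda>m. 1 / real (Suc m)) \<longlonglongrightarrow> 0" by (rule LIMSEQ_Suc[OF lim_1_over_n])
  have lk: "(\<lambda>m. ?E m (j m) k l) \<longlonglongrightarrow> (if k = l then of_real (c k) else 0)" if "l \<le> k" for k l :: nat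
  proof -
    have "(\<lambda>m. ?E m (j m) k l - \<gamma> m k l) \<longlonglongrightarrow> 0"
    proof (rule Lim_null_comparison[OF _ inv])
      show "\<forall>\<^sub>F m in sequentially. cmod (?E m (j m) k l - \<gamma> m k l) \<le> 1 / real (Suc m)"
        using eventually_ge_at_top[of k] by eventually_elim (rule less_imp_le[OF j[OF _ that]])
    qed
    from tendsto_add[OF this lim[OF that]] show ?thesis by (simp del: of_real_0)
  qed
  show ?thesis
  proof (intro exI[of _ j] conjI allI)
    show "(\<lambda>m. ?E m (j m) k l) \<longlonglongrightarrow> (if k = l then of_real (c k) else 0)" for k l
    proof (cases "l \<le> k")
      case True then show ?thesis by (rule lk)
    next
      case False
      have "?E m (j m) k l = cnj (?E m (j m) l k)" for m
        unfolding Bochner_Integration.integral_cnj[symmetric] by (intro Bochner_Integration.integral_cong refl) (simp add: mult.commute)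
      moreover have "(\<lambda>m. cnj (?E m (j m) l k)) \<longlonglongrightarrow> cnj (if l = k then of_real (c l) else 0)"
        by (intro tendsto_cnj lk) (use False in simp)
      ultimately show ?thesis using False by simp
    qed
    show "(\<lambda>m. ?D m (j m)) \<longlonglongrightarrow> 0"
      by (rule Lim_null_comparison[OF _ inv], rule always_eventually, rule allI)
        (simp only: real_norm_def less_imp_le[OF j2])
  qed
qed

section \<open>Convergence of imaginary chaos to white noise\<close>

lemma sobolev_conv_in_prob_pairing:
  fixes f :: "'a::euclidean_space \<Rightarrow> complex" and u :: "nat \<Rightarrow> 'w \<Rightarrow> 'a distr"
  assumes M: "prob_space M" and conv: "sobolev_conv_in_prob M s u v" and f: "test_function UNIV f"
  shows "(\<lambda>\<omega>. u n \<omega> f) \<in> borel_measurable M" and "(\<lambda>\<omega>. v \<omega> f) \<in> borel_measurable M"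
    and "(\<lambda>n. \<integral>\<omega>. min 1 (cmod (a * u n \<omega> f - a * v \<omega> f)) \<partial>M) \<longlonglongrightarrow> 0"
proof -
  interpret prob_space M by fact
  have um: "u n \<in> measurable M (sobolev_borel s)" and vm: "v \<in> measurable M (sobolev_borel s)"
    and Sm[measurable]: "(\<lambda>\<omega>. sobolev_norm s (distr_diff (u n \<omega>) (v \<omega>))) \<in> borel_measurable M"
    and prob0: "e > 0 \<Longrightarrow> (\<lambda>n. measure M {\<omega>\<in>space M. sobolev_norm s (distr_diff (u n \<omega>) (v \<omega>)) > e}) \<longlonglongrightarrow> 0" for n e
    using conv unfolding sobolev_conv_in_prob_def by blast+
  show u[measurable]: "(\<lambda>\<omega>. u n \<omega> f) \<in> borel_measurable M" for n
    by (rule measurable_compose[OF um sobolev_pairing_measurable[OF f]])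
  show v[measurable]: "(\<lambda>\<omega>. v \<omega> f) \<in> borel_measurable M"
    by (rule measurable_compose[OF vm sobolev_pairing_measurable[OF f]])
  obtain c where c: "c > 0" and bd: "\<And>u v. u \<in> sobolev s \<Longrightarrow> v \<in> sobolev s \<Longrightarrow>
      cmod (u f - v f) \<le> c * sobolev_norm s (distr_diff u v)"
    using sobolev_norm_controls_pairing[OF f] by blast
  define c' where "c' = cmod a * c + 1"
  have c': "c' > 0" using c by (simp add: c'_def add_nonneg_pos)
  define S where "S n \<omega> = sobolev_norm s (distr_diff (u n \<omega>) (v \<omega>))" for n \<omega>
  have [measurable]: "S n \<in> borel_measurable M" for n unfolding S_def[abs_def] by measurable
  have D: "cmod (a * u n \<omega> f - a * v \<omega> f) \<le> c' * S n \<omega>" if "\<omega> \<in> space M" for n \<omega>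
  proof -
    have "u n \<omega> \<in> sobolev s" "v \<omega> \<in> sobolev s"
      using measurable_space[OF um that] measurable_space[OF vm that] unfolding space_sobolev_borel .
    then have 1: "cmod (u n \<omega> f - v \<omega> f) \<le> c * S n \<omega>" unfolding S_def by (rule bd)
    then have "0 \<le> c * S n \<omega>" using norm_ge_zero order_trans by blast
    then have S0: "S n \<omega> \<ge> 0" using c by (simp add: zero_le_mult_iff)
    have "cmod (a * u n \<omega> f - a * v \<omega> f) = cmod a * cmod (u n \<omega> f - v \<omega> f)"
      unfolding right_diff_distrib[symmetric] norm_mult ..
    also have "\<dots> \<le> cmod a * (c * S n \<omega>)" using 1 by (intro mult_left_mono) auto
    also have "\<dots> \<le> c' * S n \<omega>" using S0 by (simp add: c'_def distrib_right)
    finally show ?thesis .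
  qed
  show "(\<lambda>n. \<integral>\<omega>. min 1 (cmod (a * u n \<omega> f - a * v \<omega> f)) \<partial>M) \<longlonglongrightarrow> 0"
  proof (rule LIMSEQ_I)
    fix e :: real assume e: "e > 0"
    let ?e = "e / (2 * c')"
    have e': "?e > 0" using e c' by simp
    let ?P = "\<lambda>n. {\<omega>\<in>space M. S n \<omega> > ?e}"
    have "(\<lambda>n. measure M (?P n)) \<longlonglongrightarrow> 0" unfolding S_def by (rule prob0[OF e'])
    then have "\<forall>\<^sub>F n in sequentially. measure M (?P n) < e / 2" by (rule order_tendstoD) (use e in simp)
    then have "\<forall>\<^sub>F n in sequentially. norm ((\<integral>\<omega>. min 1 (cmod (a * u n \<omega> f - a * v \<omega> f)) \<partial>M) - 0) < e"
    proof eventually_elim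
      case (elim n)
      have P: "?P n \<in> sets M" by measurable
      have iP0: "integrable M (indicator (?P n) :: _ \<Rightarrow> real)"
        using P by (intro integrable_real_indicator) (auto simp: less_top[symmetric])
      then have iP: "integrable M (\<lambda>\<omega>. e / 2 + indicator (?P n) \<omega> :: real)"
        by (intro Bochner_Integration.integrable_add) auto
      have "(\<integral>\<omega>. min 1 (cmod (a * u n \<omega> f - a * v \<omega> f)) \<partial>M) \<le> (\<integral>\<omega>. e / 2 + indicator (?P n) \<omega> \<partial>M)"
      proof (rule integral_mono[OF _ iP])
        show "integrable M (\<lambda>\<omega>. min 1 (cmod (a * u n \<omega> f - a * v \<omega> f)))"
          by (rule integrable_const_bound[where B=1]) auto
        fix \<omega> assume \<omega>: "\<omega> \<in> space M"
        show "min 1 (cmod (a * u n \<omega> f - a * v \<omega> f)) \<le> e / 2 + indicator (?P n) \<omega>"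
        proof (cases "S n \<omega> > ?e")
          case True
          then show ?thesis using \<omega> e by simp
        next
          case False
          then have "c' * S n \<omega> \<le> c' * ?e" using c' by (intro mult_left_mono) auto
          also have "c' * ?e = e / 2" using c' by simp
          finally show ?thesis using D[OF \<omega>, of n] False by simp
        qed
      qed
      also have "\<dots> = e / 2 + measure M (?P n)"
        using P iP0 by (subst Bochner_Integration.integral_add) (auto simp: prob_space)
      also have "\<dots> < e" using elim by simp
      finally have "(\<integral>\<omega>. min 1 (cmod (a * u n \<omega> f - a * v \<omega> f)) \<partial>M) < e" .
      moreover have "0 \<le> (\<integral>\<omega>. min 1 (cmod (a * u n \<omega> f - a * v \<omega> f)) \<partial>M)" by (intro integral_nonneg_AE) auto
      ultimately show ?case by simp
    qed
    then show "\<exists>no. \<forall>n\<ge>no. norm ((\<integral>\<omega>. min 1 (cmod (a * u n \<omega> f - a * v \<omega> f)) \<partial>M) - 0) < e"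
      unfolding eventually_sequentially .
  qed
qed

theorem theorem3p20:
  fixes U :: "'a::euclidean_space set"
    and g :: "'a \<Rightarrow> 'a \<Rightarrow> real"
    and M :: "'w measure" and X :: "'w \<Rightarrow> 'a distr"
    and \<eta> :: "'a \<Rightarrow> real" and \<mu> :: "real \<Rightarrow> 'w \<Rightarrow> 'a distr"
    and f :: "'a \<Rightarrow> complex"
    and N :: "'z measure" and Z :: "'z \<Rightarrow> complex"
  assumes "open U" "connected U" "U \<noteq> {}" "bounded U" "simply_connected U"
    and "set_integrable lborel (U \<times> U) (\<lambda>(x, y). g x y)"
    and "continuous_on (U \<times> U) (\<lambda>(x, y). g x y)"
    and "bdd_above ((\<lambda>(x, y). g x y) ` (U \<times> U))"
    and "covariance_kernel (log_kernel U g)"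
    and "prob_space M" and "log_correlated_field M (log_kernel U g) X"
    and "mollifier \<eta>"
    and "\<And>\<beta>. 0 < \<beta> \<Longrightarrow> \<beta> < sqrt (real DIM('a)) \<Longrightarrow> imaginary_chaos M U X \<eta> \<beta> (\<mu> \<beta>)"
    and "test_function U f"
    and "prob_space N"
    and "white_noise_integral N U (\<lambda>x. f x * of_real (exp (real DIM('a) / 2 * g x x))) Z"
  shows "converges_in_law (at_left (sqrt (real DIM('a)))) M
           (\<lambda>\<beta> \<omega>. of_real (sqrt ((real DIM('a) - \<beta>\<^sup>2) / sphere_measure (sphere (0::'a) 1))) * \<mu> \<beta> \<omega> f)
           N Z"
proof -
  have ft: "test_function UNIV f" using \<open>test_function U f\<close> by (rule test_function_UNIV)
  have K: "compact (support f)" "support f \<subseteq> U" using \<open>test_function U f\<close> unfolding test_function_def by blast+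
  have off: "f x = 0" if "x \<notin> support f" for x
    using that closure_subset[of "{x. f x \<noteq> 0}"] unfolding support_def by blast
  interpret L: log_field_test U g M X \<eta> "support f" f
    by (intro log_field_test.intro log_field.intro log_field_test_axioms.intro) (fact assms K ft off)+
  let ?d = "real DIM('a)"
  let ?s = "sphere_measure (sphere (0::'a) 1)"
  let ?a = "\<lambda>\<beta>. complex_of_real (sqrt ((?d - \<beta>\<^sup>2) / ?s))"
  let ?v = "\<integral>x. L.\<rho> x \<partial>lborel"
  have d1: "?d \<ge> 1" using DIM_positive[where 'a='a] by linarith
  obtain \<epsilon>0 where e0: "\<epsilon>0 > 0"
    and bounded_approx: "\<And>\<epsilon> \<beta>. 0 < \<epsilon> \<Longrightarrow> \<epsilon> \<le> \<epsilon>0 \<Longrightarrow>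
      \<exists>B. \<forall>\<omega>\<in>space M. cmod (distr_of_fun (approx_chaos M U X \<eta> \<beta> \<epsilon> \<omega>) f) \<le> B"
    and moments: "\<And>\<epsilon> \<beta> k l. 0 < \<epsilon> \<Longrightarrow> \<epsilon> \<le> \<epsilon>0 \<Longrightarrow>
      (\<integral>\<omega>. distr_of_fun (approx_chaos M U X \<eta> \<beta> \<epsilon> \<omega>) f ^ k * cnj (distr_of_fun (approx_chaos M U X \<eta> \<beta> \<epsilon> \<omega>) f) ^ l \<partial>M) =
      L.gas (\<beta>\<^sup>2) (L.cov \<epsilon>) k l"
    using L.approx_moment by blast
  \<comment> \<open>Any admissible sequence would do: the limit in probability is the same for all of them.\<close>
  define \<delta> where "\<delta> n = \<epsilon>0 * (1 / real (Suc n))" for n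
  have dpos: "\<delta> n > 0" and dle: "\<delta> n \<le> \<epsilon>0" for n using e0 unfolding \<delta>_def by (simp_all add: field_simps)
  have ddec: "decseq \<delta>" using e0 by (intro decseq_SucI) (simp add: \<delta>_def frac_le)
  have "\<delta> \<longlonglongrightarrow> \<epsilon>0 * 0" unfolding \<delta>_def by (intro tendsto_intros LIMSEQ_Suc[OF lim_1_over_n])
  then have dlim: "\<delta> \<longlonglongrightarrow> 0" by simp
  let ?A = "\<lambda>\<beta> n \<omega>. distr_of_fun (approx_chaos M U X \<eta> \<beta> (\<delta> n) \<omega>)"
  \<comment> \<open>Some exponent below \<open>- d / 2\<close>; the pairing does not depend on it.\<close>
  have conv: "sobolev_conv_in_prob M (- ?d) (?A \<beta>) (\<mu> \<beta>)" if "0 < \<beta>" "\<beta> < sqrt ?d" for \<beta>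
  proof -
    have "- ?d < - ?d / 2" using d1 by simp
    then show ?thesis using assms(13)[OF that] ddec dpos dlim unfolding imaginary_chaos_def by blast
  qed
  note pairing = sobolev_conv_in_prob_pairing[OF \<open>prob_space M\<close> conv ft]
  have Zg: "\<And>a b. centered_gaussian N (\<lambda>\<omega>. a * Re (Z \<omega>) + b * Im (Z \<omega>))" and Z0: "(\<integral>\<omega>. (Z \<omega>)\<^sup>2 \<partial>N) = 0"
    and Zv: "(\<integral>\<omega>. (cmod (Z \<omega>))\<^sup>2 \<partial>N) = set_lebesgue_integral lborel U (\<lambda>x. (cmod (f x * of_real (exp (?d / 2 * g x x))))\<^sup>2)"
    using assms(16) unfolding white_noise_integral_def by blast+
  have "set_lebesgue_integral lborel U (\<lambda>x. (cmod (f x * of_real (exp (?d / 2 * g x x))))\<^sup>2) = ?v"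
    unfolding set_lebesgue_integral_def
  proof (intro Bochner_Integration.integral_cong refl)
    fix x
    have "(exp (?d / 2 * g x x))\<^sup>2 = exp (?d * g x x)" by (simp add: power2_eq_square exp_add[symmetric])
    then have "(cmod (f x * of_real (exp (?d / 2 * g x x))))\<^sup>2 = L.\<rho> x"
      by (simp add: L.\<rho>_def norm_mult power_mult_distrib)
    moreover have "L.\<rho> x = 0" if "x \<notin> U" using off[of x] K(2) that by (auto simp: L.\<rho>_def)
    ultimately show "indicator U x *\<^sub>R (cmod (f x * of_real (exp (?d / 2 * g x x))))\<^sup>2 = L.\<rho> x"
      by (cases "x \<in> U") auto
  qed
  with Zv have Zv': "(\<integral>\<omega>. (cmod (Z \<omega>))\<^sup>2 \<partial>N) = ?v" by simp
  show ?thesis unfolding converges_in_law_def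
  proof (intro conjI allI impI)
    show "\<forall>\<^sub>F \<beta> in at_left (sqrt ?d). (\<lambda>\<omega>. ?a \<beta> * \<mu> \<beta> \<omega> f) \<in> borel_measurable M"
    proof (rule eventually_at_leftI[of 0])
      fix \<beta> assume "\<beta> \<in> {0<..<sqrt ?d}"
      then show "(\<lambda>\<omega>. ?a \<beta> * \<mu> \<beta> \<omega> f) \<in> borel_measurable M"
        by (intro borel_measurable_times borel_measurable_const pairing(2)) auto
    qed simp
    show "Z \<in> borel_measurable N" by (rule white_noise_char(1)[OF \<open>prob_space N\<close> Zg Z0 Zv])
    fix G :: "complex \<Rightarrow> real" assume G: "continuous_on UNIV G" "bounded (range G)"
    show "((\<lambda>\<beta>. \<integral>\<omega>. G (?a \<beta> * \<mu> \<beta> \<omega> f) \<partial>M) \<longlongrightarrow> (\<integral>\<omega>. G (Z \<omega>) \<partial>N)) (at_left (sqrt ?d))"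
    \<comment> \<open>The lower bound for \<open>\<beta>\<close> ensures \<open>d - \<beta>\<^sup>2 \<le> 1\<close>.\<close>
    proof (rule tendsto_at_left_sequentially[of "sqrt (?d - 1)"])
      show "sqrt (?d - 1) < sqrt ?d" by simp
      fix S assume S: "\<And>n. S n < sqrt ?d" "\<And>n. sqrt (?d - 1) < S n" "S \<longlonglongrightarrow> sqrt ?d"
      define t where "t m = ?d - (S m)\<^sup>2" for m
      have S0: "0 < S m" for m using le_less_trans[OF real_sqrt_ge_zero S(2)[of m]] d1 by simp
      have S2: "(S m)\<^sup>2 = ?d - t m" for m by (simp add: t_def)
      have t: "0 < t m" "t m < ?d" "t m \<le> 1" for m
      proof -
        have "(S m)\<^sup>2 < (sqrt ?d)\<^sup>2" using S(1)[of m] S0[of m] by (intro power_strict_mono) auto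
        then show "0 < t m" by (simp add: t_def)
        show "t m < ?d" using S0[of m] by (simp add: t_def)
        have "(sqrt (?d - 1))\<^sup>2 \<le> (S m)\<^sup>2" using S(2)[of m] d1 by (intro power_mono) auto
        then show "t m \<le> 1" using d1 by (simp add: t_def)
      qed
      have "t \<longlonglongrightarrow> ?d - (sqrt ?d)\<^sup>2" unfolding t_def by (intro tendsto_intros S(3))
      then have tlim: "t \<longlonglongrightarrow> 0" by simp
      have pm: "(\<lambda>\<omega>. ?A (S m) j \<omega> f) \<in> borel_measurable M" "(\<lambda>\<omega>. \<mu> (S m) \<omega> f) \<in> borel_measurable M" for m j
        by (rule pairing(1)[OF S0 S(1)], rule pairing(2)[OF S0 S(1)])
      have "\<exists>j. (\<forall>k l. (\<lambda>m. \<integral>\<omega>. (?a (S m) * ?A (S m) (j m) \<omega> f) ^ k * cnj (?a (S m) * ?A (S m) (j m) \<omega> f) ^ l \<partial>M)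
          \<longlonglongrightarrow> (if k = l then of_real (fact k * ?v ^ k) else 0)) \<and>
        (\<lambda>m. \<integral>\<omega>. min 1 (cmod (?a (S m) * ?A (S m) (j m) \<omega> f - ?a (S m) * \<mu> (S m) \<omega> f)) \<partial>M) \<longlonglongrightarrow> 0"
      proof (rule diagonal_approximants[where A="\<lambda>m j \<omega>. ?a (S m) * ?A (S m) j \<omega> f" and Y="\<lambda>m \<omega>. ?a (S m) * \<mu> (S m) \<omega> f"
            and M=M and c="\<lambda>k. fact k * ?v ^ k"
            and \<gamma>="\<lambda>m k l. of_real (sqrt (t m / ?s) ^ (k + l)) * L.gas (?d - t m) L.C k l"])
        fix m k l :: nat assume lk: "l \<le> k"
        have "(\<integral>\<omega>. (?a (S m) * ?A (S m) j \<omega> f) ^ k * cnj (?a (S m) * ?A (S m) j \<omega> f) ^ l \<partial>M) =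
            of_real (sqrt (t m / ?s) ^ (k + l)) * L.gas (?d - t m) (L.cov (\<delta> j)) k l" for j
        proof -
          have "(\<integral>\<omega>. (?a (S m) * ?A (S m) j \<omega> f) ^ k * cnj (?a (S m) * ?A (S m) j \<omega> f) ^ l \<partial>M) =
              (\<integral>\<omega>. of_real (sqrt (t m / ?s) ^ (k + l)) * (?A (S m) j \<omega> f ^ k * cnj (?A (S m) j \<omega> f) ^ l) \<partial>M)"
            by (intro Bochner_Integration.integral_cong refl) (simp add: power_mult_distrib power_add t_def)
          also have "\<dots> = of_real (sqrt (t m / ?s) ^ (k + l)) * (\<integral>\<omega>. ?A (S m) j \<omega> f ^ k * cnj (?A (S m) j \<omega> f) ^ l \<partial>M)"
            by (rule integral_mult_right_zero)
          finally show ?thesis unfolding moments[OF dpos dle] S2 .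
        qed
        then show "(\<lambda>j. \<integral>\<omega>. (?a (S m) * ?A (S m) j \<omega> f) ^ k * cnj (?a (S m) * ?A (S m) j \<omega> f) ^ l \<partial>M)
            \<longlonglongrightarrow> of_real (sqrt (t m / ?s) ^ (k + l)) * L.gas (?d - t m) L.C k l"
          by (simp only:) (intro tendsto_mult tendsto_const L.gas_tendsto[OF lk t(1,2) dpos dlim])
      next
        fix k l :: nat assume lk: "l \<le> k"
        show "(\<lambda>m. of_real (sqrt (t m / ?s) ^ (k + l)) * L.gas (?d - t m) L.C k l)
            \<longlonglongrightarrow> (if k = l then of_real (fact k * ?v ^ k) else 0)"
          by (rule L.scaled_gas_limit[OF t tlim lk])
      next
        show "(\<lambda>j. \<integral>\<omega>. min 1 (cmod (?a (S m) * ?A (S m) j \<omega> f - ?a (S m) * \<mu> (S m) \<omega> f)) \<partial>M) \<longlonglongrightarrow> 0" for m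
          by (rule pairing(3)[OF S0 S(1)])
      qed
      then obtain j where j: "(\<forall>k l. (\<lambda>m. \<integral>\<omega>. (?a (S m) * ?A (S m) (j m) \<omega> f) ^ k * cnj (?a (S m) * ?A (S m) (j m) \<omega> f) ^ l \<partial>M)
          \<longlonglongrightarrow> (if k = l then of_real (fact k * ?v ^ k) else 0)) \<and>
        (\<lambda>m. \<integral>\<omega>. min 1 (cmod (?a (S m) * ?A (S m) (j m) \<omega> f - ?a (S m) * \<mu> (S m) \<omega> f)) \<partial>M) \<longlonglongrightarrow> 0"
        by (rule exE)
      show "(\<lambda>m. \<integral>\<omega>. G (?a (S m) * \<mu> (S m) \<omega> f) \<partial>M) \<longlonglongrightarrow> (\<integral>\<omega>. G (Z \<omega>) \<partial>N)"
      proof (rule circular_moments_imp_weak_convergence[OF \<open>prob_space M\<close> \<open>prob_space N\<close> _ _ _ j[THEN conjunct1, rule_format] j[THEN conjunct2] _ Zg Z0 Zv' G])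
        show "(\<lambda>\<omega>. ?a (S m) * ?A (S m) (j m) \<omega> f) \<in> borel_measurable M" "(\<lambda>\<omega>. ?a (S m) * \<mu> (S m) \<omega> f) \<in> borel_measurable M" for m
          by (intro borel_measurable_times borel_measurable_const pm)+
        show "\<exists>B. \<forall>\<omega>\<in>space M. cmod (?a (S m) * ?A (S m) (j m) \<omega> f) \<le> B" for m
        proof -
          obtain B where "\<forall>\<omega>\<in>space M. cmod (?A (S m) (j m) \<omega> f) \<le> B" using bounded_approx[OF dpos dle] by blast
          then have "\<forall>\<omega>\<in>space M. cmod (?a (S m) * ?A (S m) (j m) \<omega> f) \<le> cmod (?a (S m)) * B"
            unfolding norm_mult by (intro ballI mult_left_mono) auto
          then show ?thesis by blast
        qed
        show "0 \<le> ?v" by (intro integral_nonneg_AE) (simp add: L.\<rho>_def)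
      qed
    qed
  qed
qed

end
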